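(* Let $S$ be a finite set. Then for every $\lambda\in FL(S)^S$ and every $\omega\in CW(S)$, $$E_l(\lambda;\omega)=E_f(\Gamma(\lambda);\omega)\qquad\text{and}\qquad E_f(\lambda;\omega)=E_l(\Lambda(\lambda);\omega)$$ in $\mathcal A^w_{\exp}(S)$.
   Context: **Free Lie algebras and cyclic words.** Everything is over $\mathbb Q$. $FL(S)$ is the degree-completed free Lie algebra on a finite set $S$ of degree 1 generators; $CW(S)$ is the degree-completed vector space spanned by non-empty cyclic words in the alphabet $S$; $FL(S)^S$ is the set of functions $\lambda=(\lambda_a)_{a\in S}$, $\lambda_a\in FL(S)$, with componentwise ("ordinary") bracket $[\cdot,\cdot]$. For $\lambda\in FL(S)^S$, $\partial_\lambda$ is the derivation of $FL(S)$ with $\partial_\lambda(a)=[a,\lambda_a]$ for all $a\in S$; it also acts componentwise on $FL(S)^S$. The tangential bracket on $FL(S)^S$ is the Lie bracket $[\lambda_1,\lambda_2]_{tb}=[\lambda_1,\lambda_2]+\partial_{\lambda_1}\lambda_2-\partial_{\lambda_2}\lambda_1$; $\mathrm{ad}$ and $\mathrm{ad}_{tb}$ are the adjoint actions on $FL(S)^S$ for $[\cdot,\cdot]$ and $[\cdot,\cdot]_{tb}$. **The maps $\Gamma,\Lambda$.** With $t$ a scalar formal variable, $\Gamma_t(\lambda)$ and $\Lambda_t(\lambda)$ in $FL(S)^S$ (depending on $t$) are the unique solutions of $$\Gamma_0(\lambda)=0,\quad \frac{d\Gamma_t(\lambda)}{dt}=\frac{\mathrm{ad}\,\Gamma_t(\lambda)}{e^{\mathrm{ad}\,\Gamma_t(\lambda)}-1}\left(e^{-t\partial_\lambda}(\lambda)\right),\qquad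 \Lambda_0(\lambda)=0,\quad \frac{d\Lambda_t(\lambda)}{dt}=\frac{\mathrm{ad}_{tb}\Lambda_t(\lambda)}{e^{\mathrm{ad}_{tb}\Lambda_t(\lambda)}-1}\left(e^{\partial_{\Lambda_t(\lambda)}}(\lambda)\right).$$ Set $\Gamma(\lambda)=\Gamma_1(\lambda)$, $\Lambda(\lambda)=\Lambda_1(\lambda)$. **The space $\mathcal A^w(S)$.** An arrow diagram on $S$ consists of vertical upward-oriented strands labelled by $S$ (the skeleton) and a finite directed graph whose univalent vertices (ends) are attached at distinct points of the strands (a source end is a "tail", a sink end is a "head"), whose other vertices are trivalent with two incoming edges and one outgoing edge and with an ordering (left, right) of the incoming edges, and each of whose connected components has at least one end on the skeleton. Its degree is half the total number of vertices (ends and trivalent). A trivalent vertex with left input $p$ and right input $q$ is thought of as outputting the bracket $[p,q]$. $\mathcal A^w(S)$ is the degree completion of the span of arrow diagrams modulo: (AS) exchanging the two inputs of a trivalent vertex negates the diagram; (IHX) the Jacobi identity $[[p,q],r]+[[q,r],p]+[[r,p],q]=0$ applied locally; (STU$_1$) if the heads of edges $p,q$ are adjacent on a strand, ($p$ below $q$) $-$ ($q$ below $p$) $=$ the diagram with a single head there, on the edge output by a new vertex $[p,q]$; (STU$_2$) if the head of an edge $p$ and the tail of an edge $e$ are adjacent on a strand, (head below tail) $-$ (tail below head) $=$ the diagram with a single tail there, feeding as the left input of a new vertex whose right input is $p$ and whose output continues along $e$; (TC) adjacent tails on a strand may be exchanged. The product $D_1\ast D_2$ stacks $D_2$ on top of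 $D_1$. The co-product $\Box(D)$ is the sum over all ways of distributing the connected components of $D$ minus its skeleton between a left and a right co-factor; $\mathcal A^w_{\exp}(S)$ is the set of group-like elements, $\Box(Z)=Z\otimes Z$. **Trees, wheels, and the two presentations.** $l\colon FL(S)^S\to\mathcal A^w(S)$ sends $\lambda$ to the sum over $a\in S$ of planting $\lambda_a$, written as a combination of bracket trees (the bracket $[p,q]$ being a vertex with left input $p$ and right input $q$), with its root as a head on strand $a$ and its leaves as tails on the strands matching their labels, so that the head is below all tails. $\iota\colon CW(S)\to\mathcal A^w(S)$ sends the cyclic word $a_1a_2\cdots a_k$ to $(-1)$ times the wheel obtained by closing up $z\mapsto[a_1,[a_2,\ldots,[a_k,z]\ldots]]$ into a directed cycle, the legs being tails on strands $a_1,\ldots,a_k$. Every element of $\mathcal A^w(S)$ is a combination of sorted diagrams, in which on each strand all heads are below all tails, and this sorted form is unique modulo STU$_1$, TC, AS and IHX. The product $\#$ on $\mathcal A^w(S)$ is defined bilinearly on sorted diagrams: on every strand of $D_1\#D_2$ one finds, from bottom to top, the heads of $D_1$, the heads of $D_2$, the tails of $D_1$, the tails of $D_2$. Finally $$E_l(\lambda;\omega)=\exp_\ast(l\lambda)\ast\exp_\ast(\iota\omega),\qquad E_f(\lambda;\omega)=\exp_\#(l\lambda+\iota\omega),$$ both maps $FL(S)^S\times CW(S)\to\mathcal A^w_{\exp}(S)$. *)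

theory Defs
  imports
    "HOL-Library.FuncSet"
    "HOL-Library.Function_Algebras"
    "HOL-Library.Groups_Big_Fun"
    "HOL-Library.Multiset"
    "HOL-Computational_Algebra.Polynomial"
    "HOL-Computational_Algebra.Formal_Power_Series"
begin

section \<open>Degree completions of quotients of free modules\<close>

text \<open>
  All spaces below are degree completions of quotients of a free module on a set \<open>B\<close> graded by
  \<open>d\<close>, modulo the span of a set \<open>R\<close> of homogeneous relations.  A formal series is its coefficient
  function \<open>x\<close>, with finitely many non-zero coefficients in each degree; it vanishes in the
  completed quotient iff each of its homogeneous parts lies in the span of \<open>R\<close>.  Elements of the
  quotient are the classes (sets of series).
\<close>

definition fscale :: "'r::comm_ring_1 \<Rightarrow> ('b \<Rightarrow> 'r) \<Rightarrow> 'b \<Rightarrow> 'r" where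
  "fscale c x = (\<lambda>b. c * x b)"

global_interpretation fmod: module fscale
  by unfold_locales (auto simp: fscale_def fun_eq_iff algebra_simps)

definition series :: "'b set \<Rightarrow> ('b \<Rightarrow> nat) \<Rightarrow> ('b \<Rightarrow> 'r::comm_ring_1) set" where
  "series B d = {x. (\<forall>b. x b \<noteq> 0 \<longrightarrow> b \<in> B) \<and> (\<forall>n. finite {b. d b = n \<and> x b \<noteq> 0})}"

definition null_series ::
    "'b set \<Rightarrow> ('b \<Rightarrow> nat) \<Rightarrow> ('b \<Rightarrow> 'r::comm_ring_1) set \<Rightarrow> ('b \<Rightarrow> 'r) set" where
  "null_series B d R =
     {x \<in> series B d. \<forall>n. (\<lambda>b. if d b = n then x b else 0) \<in> fmod.span R}"

definition qclass ::
    "'b set \<Rightarrow> ('b \<Rightarrow> nat) \<Rightarrow> ('b \<Rightarrow> 'r::comm_ring_1) set \<Rightarrow> ('b \<Rightarrow> 'r) \<Rightarrow> ('b \<Rightarrow> 'r) set" where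
  "qclass B d R x = {y \<in> series B d. (\<lambda>b. x b - y b) \<in> null_series B d R}"

definition rep :: "'x set \<Rightarrow> 'x" where
  "rep X = (SOME x. x \<in> X)"

definition delta :: "'b \<Rightarrow> 'b \<Rightarrow> 'r::comm_ring_1" where
  "delta b = (\<lambda>c. if c = b then 1 else 0)"

text \<open>
  Linear extension of a map given on basis elements, and bilinear extension of a binary operation on
  basis elements.  For the graded maps used here, each coefficient is a finite sum.
\<close>

definition lin :: "('b \<Rightarrow> 'c \<Rightarrow> 'r::comm_ring_1) \<Rightarrow> ('b \<Rightarrow> 'r) \<Rightarrow> 'c \<Rightarrow> 'r" where
  "lin f x = (\<lambda>c. Sum_any (\<lambda>b. x b * f b c))"

definition bilin ::
    "('b \<Rightarrow> 'c \<Rightarrow> 'e) \<Rightarrow> ('b \<Rightarrow> 'r::comm_ring_1) \<Rightarrow> ('c \<Rightarrow> 'r) \<Rightarrow> 'e \<Rightarrow> 'r" where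
  "bilin m x y = lin (\<lambda>(b, c). delta (m b c)) (\<lambda>(b, c). x b * y c)"


section \<open>The free Lie algebra\<close>

datatype 'a lie_tree = Leaf 'a | Br "'a lie_tree" "'a lie_tree"

fun leaves :: "'a lie_tree \<Rightarrow> nat" where
  "leaves (Leaf a) = 1"
| "leaves (Br p q) = leaves p + leaves q"

definition trees :: "'a set \<Rightarrow> 'a lie_tree set" where
  "trees S = {p. set_lie_tree p \<subseteq> S}"

text \<open>
  The ideal of relations of the free Lie algebra inside the free non-associative algebra.  The
  coefficient rings used are \<open>rat\<close> and \<open>rat poly\<close>, where 2 is invertible, so the polarised relation
  \<open>[p,q] + [q,p] = 0\<close> on basis trees imposes \<open>[x,x] = 0\<close> for all \<open>x\<close>.
\<close>

inductive_set lie_rels :: "'a set \<Rightarrow> ('a lie_tree \<Rightarrow> 'r::comm_ring_1) set" for S :: "'a set" where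
  anti: "p \<in> trees S \<Longrightarrow> q \<in> trees S \<Longrightarrow>
    (\<lambda>u. delta (Br p q) u + delta (Br q p) u) \<in> lie_rels S"
| jacobi: "p \<in> trees S \<Longrightarrow> q \<in> trees S \<Longrightarrow> r \<in> trees S \<Longrightarrow>
    (\<lambda>u. delta (Br (Br p q) r) u + delta (Br (Br q r) p) u + delta (Br (Br r p) q) u)
      \<in> lie_rels S"
| left: "x \<in> lie_rels S \<Longrightarrow> p \<in> trees S \<Longrightarrow> bilin Br (delta p) x \<in> lie_rels S"
| right: "x \<in> lie_rels S \<Longrightarrow> p \<in> trees S \<Longrightarrow> bilin Br x (delta p) \<in> lie_rels S"

text \<open>
  With \<open>'r = rat\<close>, \<open>FL S\<close> is the degree-completed free Lie algebra on \<open>S\<close>.  With \<open>'r = rat poly\<close> it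
  is its version over the polynomials in a formal variable \<open>t\<close>; there each homogeneous component
  of an element depends polynomially on \<open>t\<close>.
\<close>

type_synonym ('a, 'r) fl = "('a lie_tree \<Rightarrow> 'r) set"

definition fl_class :: "'a set \<Rightarrow> ('a lie_tree \<Rightarrow> 'r::comm_ring_1) \<Rightarrow> ('a, 'r) fl" where
  "fl_class S = qclass (trees S) leaves (lie_rels S)"

definition FL :: "'a set \<Rightarrow> ('a, 'r::comm_ring_1) fl set" where
  "FL S = fl_class S ` series (trees S) leaves"

definition fl_bracket ::
    "'a set \<Rightarrow> ('a, 'r::comm_ring_1) fl \<Rightarrow> ('a, 'r) fl \<Rightarrow> ('a, 'r) fl" where
  "fl_bracket S X Y = fl_class S (bilin Br (rep X) (rep Y))"

text \<open>The derivation with \<open>a \<mapsto> [a, u a]\<close>, first on trees, then on \<open>FL S\<close>.\<close>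

fun tree_der :: "('a \<Rightarrow> 'a lie_tree \<Rightarrow> 'r::comm_ring_1) \<Rightarrow> 'a lie_tree \<Rightarrow> 'a lie_tree \<Rightarrow> 'r" where
  "tree_der u (Leaf a) = bilin Br (delta (Leaf a)) (u a)"
| "tree_der u (Br p q) =
     (\<lambda>r. bilin Br (tree_der u p) (delta q) r + bilin Br (delta p) (tree_der u q) r)"

definition fl_der ::
    "'a set \<Rightarrow> ('a \<Rightarrow> ('a, 'r::comm_ring_1) fl) \<Rightarrow> ('a, 'r) fl \<Rightarrow> ('a, 'r) fl" where
  "fl_der S lam X = fl_class S (lin (tree_der (\<lambda>a. rep (lam a))) (rep X))"


section \<open>The space of tuples indexed by \<open>S\<close>\<close>

type_synonym ('a, 'r) fl_tuple = "'a \<Rightarrow> ('a, 'r) fl"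

definition FLS :: "'a set \<Rightarrow> ('a, 'r::comm_ring_1) fl_tuple set" where
  "FLS S = S \<rightarrow>\<^sub>E FL S"

definition fls_zero :: "'a set \<Rightarrow> ('a, 'r::comm_ring_1) fl_tuple" where
  "fls_zero S = (\<lambda>a\<in>S. fl_class S (\<lambda>_. 0))"

definition fls_add ::
    "'a set \<Rightarrow> ('a, 'r::comm_ring_1) fl_tuple \<Rightarrow> ('a, 'r) fl_tuple \<Rightarrow> ('a, 'r) fl_tuple" where
  "fls_add S lam \<mu> = (\<lambda>a\<in>S. fl_class S (\<lambda>p. rep (lam a) p + rep (\<mu> a) p))"

definition fls_scale ::
    "'a set \<Rightarrow> 'r::comm_ring_1 \<Rightarrow> ('a, 'r) fl_tuple \<Rightarrow> ('a, 'r) fl_tuple" where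
  "fls_scale S c lam = (\<lambda>a\<in>S. fl_class S (\<lambda>p. c * rep (lam a) p))"

definition fls_bracket ::
    "'a set \<Rightarrow> ('a, 'r::comm_ring_1) fl_tuple \<Rightarrow> ('a, 'r) fl_tuple \<Rightarrow> ('a, 'r) fl_tuple" where
  "fls_bracket S lam \<mu> = (\<lambda>a\<in>S. fl_bracket S (lam a) (\<mu> a))"

definition fls_der ::
    "'a set \<Rightarrow> ('a, 'r::comm_ring_1) fl_tuple \<Rightarrow> ('a, 'r) fl_tuple \<Rightarrow> ('a, 'r) fl_tuple" where
  "fls_der S lam \<mu> = (\<lambda>a\<in>S. fl_der S lam (\<mu> a))"

definition fls_tb ::
    "'a set \<Rightarrow> ('a, 'r::comm_ring_1) fl_tuple \<Rightarrow> ('a, 'r) fl_tuple \<Rightarrow> ('a, 'r) fl_tuple" where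
  "fls_tb S lam \<mu> =
     fls_add S (fls_add S (fls_bracket S lam \<mu>) (fls_der S lam \<mu>)) (fls_scale S (- 1) (fls_der S \<mu> lam))"


section \<open>The maps \<open>\<Gamma>\<close> and \<open>\<Lambda>\<close>\<close>

definition fls_const :: "'a set \<Rightarrow> ('a, rat) fl_tuple \<Rightarrow> ('a, rat poly) fl_tuple" where
  "fls_const S lam = (\<lambda>a\<in>S. fl_class S (\<lambda>p. [:rep (lam a) p:]))"

definition fls_ddt :: "'a set \<Rightarrow> ('a, rat poly) fl_tuple \<Rightarrow> ('a, rat poly) fl_tuple" where
  "fls_ddt S G = (\<lambda>a\<in>S. fl_class S (\<lambda>p. pderiv (rep (G a) p)))"

definition fls_at :: "'a set \<Rightarrow> rat \<Rightarrow> ('a, rat poly) fl_tuple \<Rightarrow> ('a, rat) fl_tuple" where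
  "fls_at S c G = (\<lambda>a\<in>S. fl_class S (\<lambda>p. poly (rep (G a) p) c))"

text \<open>
  \<open>f(F) \<mu>\<close> for a power series \<open>f\<close> and an operator \<open>F\<close> which raises degrees: as \<open>\<mu>\<close> starts in degree 1,
  \<open>F\<^sup>n \<mu>\<close> starts in degree \<open>n + 1\<close>, so only the terms with \<open>n\<close> below the degree matter.
\<close>

definition op_series ::
    "'a set \<Rightarrow> rat fps \<Rightarrow> (('a, rat poly) fl_tuple \<Rightarrow> ('a, rat poly) fl_tuple) \<Rightarrow>
     ('a, rat poly) fl_tuple \<Rightarrow> ('a, rat poly) fl_tuple" where
  "op_series S f F \<mu> =
     (\<lambda>a\<in>S. fl_class S (\<lambda>p. \<Sum>n\<le>leaves p. [:fps_nth f n:] * rep ((F ^^ n) \<mu> a) p))"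

definition todd_fps :: "rat fps" where
  "todd_fps = fps_X / (fps_exp 1 - 1)"

definition Gamma_t :: "'a set \<Rightarrow> ('a, rat) fl_tuple \<Rightarrow> ('a, rat poly) fl_tuple" where
  "Gamma_t S lam = (THE G. G \<in> FLS S \<and> fls_at S 0 G = fls_zero S \<and>
     fls_ddt S G =
       op_series S todd_fps (fls_bracket S G)
         (op_series S (fps_exp 1) (\<lambda>\<mu>. fls_scale S [:0, - 1:] (fls_der S (fls_const S lam) \<mu>))
           (fls_const S lam)))"

definition Lambda_t :: "'a set \<Rightarrow> ('a, rat) fl_tuple \<Rightarrow> ('a, rat poly) fl_tuple" where
  "Lambda_t S lam = (THE L. L \<in> FLS S \<and> fls_at S 0 L = fls_zero S \<and>
     fls_ddt S L =
       op_series S todd_fps (fls_tb S L)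
         (op_series S (fps_exp 1) (fls_der S L) (fls_const S lam)))"

definition Gamma_map :: "'a set \<Rightarrow> ('a, rat) fl_tuple \<Rightarrow> ('a, rat) fl_tuple" where
  "Gamma_map S lam = fls_at S 1 (Gamma_t S lam)"

definition Lambda_map :: "'a set \<Rightarrow> ('a, rat) fl_tuple \<Rightarrow> ('a, rat) fl_tuple" where
  "Lambda_map S lam = fls_at S 1 (Lambda_t S lam)"


section \<open>Cyclic words\<close>

definition cyclic_words :: "'a set \<Rightarrow> 'a list set set" where
  "cyclic_words S = (\<lambda>w. {rotate n w | n. True}) ` (lists S - {[]})"

text \<open>For finite \<open>S\<close> there are finitely many cyclic words of each length.\<close>

definition CW :: "'a set \<Rightarrow> ('a list set \<Rightarrow> rat) set" where
  "CW S = {\<omega>. \<forall>c. \<omega> c \<noteq> 0 \<longrightarrow> c \<in> cyclic_words S}"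


section \<open>Arrow diagrams\<close>

text \<open>
  Edges are named by natural numbers.  A strand is the list, from bottom to top, of the ends on it,
  an end being given together with its edge.  A trivalent vertex is a triple
  (left input edge, right input edge, output edge).
\<close>

datatype strand_end = is_Head: Head (edge_of: nat) | is_Tail: Tail (edge_of: nat)

datatype 'a diagram =
  Diagram (strand: "'a \<Rightarrow> strand_end list") (vertices: "(nat \<times> nat \<times> nat) multiset")

definition sources :: "'a set \<Rightarrow> 'a diagram \<Rightarrow> nat multiset" where
  "sources S D = (\<Sum>a\<in>S. mset (map edge_of (filter is_Tail (strand D a)))) +
     image_mset (\<lambda>(p, q, r). r) (vertices D)"

definition targets :: "'a set \<Rightarrow> 'a diagram \<Rightarrow> nat multiset" where
  "targets S D = (\<Sum>a\<in>S. mset (map edge_of (filter is_Head (strand D a)))) +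
     (\<Sum>(p, q, r)\<in>#vertices D. {#p, q#})"

definition edges :: "'a set \<Rightarrow> 'a diagram \<Rightarrow> nat set" where
  "edges S D = set_mset (sources S D)"

text \<open>Sets of edges which are unions of connected components of the diagram minus its skeleton.\<close>

definition component_closed :: "'a diagram \<Rightarrow> nat set \<Rightarrow> bool" where
  "component_closed D E \<longleftrightarrow>
     (\<forall>(p, q, r)\<in>#vertices D. (p \<in> E \<longleftrightarrow> r \<in> E) \<and> (q \<in> E \<longleftrightarrow> r \<in> E))"

text \<open>Each edge has exactly one source and one target, and each component touches the skeleton.\<close>

definition diagrams :: "'a set \<Rightarrow> 'a diagram set" where
  "diagrams S = {D. (\<forall>a. a \<notin> S \<longrightarrow> strand D a = []) \<and>
     sources S D = targets S D \<and> (\<forall>e. count (sources S D) e \<le> 1) \<and>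
     (\<forall>E. E \<subseteq> edges S D \<and> E \<noteq> {} \<and> component_closed D E \<longrightarrow>
        (\<exists>a\<in>S. \<exists>x\<in>set (strand D a). edge_of x \<in> E))}"

definition degree_diag :: "'a set \<Rightarrow> 'a diagram \<Rightarrow> nat" where
  "degree_diag S D = ((\<Sum>a\<in>S. length (strand D a)) + size (vertices D)) div 2"

definition rename :: "(nat \<Rightarrow> nat) \<Rightarrow> 'a diagram \<Rightarrow> 'a diagram" where
  "rename f D = Diagram
     (\<lambda>a. map (\<lambda>x. case x of Head e \<Rightarrow> Head (f e) | Tail e \<Rightarrow> Tail (f e)) (strand D a))
     (image_mset (\<lambda>(p, q, r). (f p, f q, f r)) (vertices D))"

text \<open>
  The rule \<open>iso\<close> identifies diagrams which differ only in the names of the edges.  In the other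
  rules \<open>s\<close> and \<open>V\<close> are the strands and vertices away from the place where the relation is applied,
  and the names may coincide wherever the resulting diagrams are well-formed, which covers the cases
  where the participating edges are joined up outside that place.
\<close>

inductive_set aw_rels :: "'a set \<Rightarrow> ('a diagram \<Rightarrow> rat) set" for S :: "'a set" where
  iso: "D \<in> diagrams S \<Longrightarrow> inj_on f (edges S D) \<Longrightarrow>
    (\<lambda>D'. delta D D' - delta (rename f D) D') \<in> aw_rels S"
| AS: "D1 = Diagram s (V + {#(p, q, r)#}) \<Longrightarrow> D2 = Diagram s (V + {#(q, p, r)#}) \<Longrightarrow>
    {D1, D2} \<subseteq> diagrams S \<Longrightarrow>
    (\<lambda>D'. delta D1 D' + delta D2 D') \<in> aw_rels S"
| IHX: "D1 = Diagram s (V + {#(p, q, i), (i, r, e)#}) \<Longrightarrow>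
    D2 = Diagram s (V + {#(q, r, i), (i, p, e)#}) \<Longrightarrow>
    D3 = Diagram s (V + {#(r, p, i), (i, q, e)#}) \<Longrightarrow>
    {D1, D2, D3} \<subseteq> diagrams S \<Longrightarrow>
    (\<lambda>D'. delta D1 D' + delta D2 D' + delta D3 D') \<in> aw_rels S"
| STU1: "a \<in> S \<Longrightarrow>
    D1 = Diagram (s(a := xs @ [Head p, Head q] @ ys)) V \<Longrightarrow>
    D2 = Diagram (s(a := xs @ [Head q, Head p] @ ys)) V \<Longrightarrow>
    D3 = Diagram (s(a := xs @ [Head r] @ ys)) (V + {#(p, q, r)#}) \<Longrightarrow>
    {D1, D2, D3} \<subseteq> diagrams S \<Longrightarrow>
    (\<lambda>D'. delta D1 D' - delta D2 D' - delta D3 D') \<in> aw_rels S"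
| STU2: "a \<in> S \<Longrightarrow>
    D1 = Diagram (s(a := xs @ [Head p, Tail e] @ ys)) V \<Longrightarrow>
    D2 = Diagram (s(a := xs @ [Tail e, Head p] @ ys)) V \<Longrightarrow>
    D3 = Diagram (s(a := xs @ [Tail f] @ ys)) (V + {#(f, p, e)#}) \<Longrightarrow>
    {D1, D2, D3} \<subseteq> diagrams S \<Longrightarrow>
    (\<lambda>D'. delta D1 D' - delta D2 D' - delta D3 D') \<in> aw_rels S"
| TC: "a \<in> S \<Longrightarrow>
    D1 = Diagram (s(a := xs @ [Tail e, Tail f] @ ys)) V \<Longrightarrow>
    D2 = Diagram (s(a := xs @ [Tail f, Tail e] @ ys)) V \<Longrightarrow>
    {D1, D2} \<subseteq> diagrams S \<Longrightarrow>
    (\<lambda>D'. delta D1 D' - delta D2 D') \<in> aw_rels S"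

type_synonym 'a aw = "('a diagram \<Rightarrow> rat) set"

definition aw_class :: "'a set \<Rightarrow> ('a diagram \<Rightarrow> rat) \<Rightarrow> 'a aw" where
  "aw_class S = qclass (diagrams S) (degree_diag S) (aw_rels S)"

definition AW :: "'a set \<Rightarrow> 'a aw set" where
  "AW S = aw_class S ` series (diagrams S) (degree_diag S)"

definition aw_one :: "'a set \<Rightarrow> 'a aw" where
  "aw_one S = aw_class S (delta (Diagram (\<lambda>_. []) {#}))"

definition aw_add :: "'a set \<Rightarrow> 'a aw \<Rightarrow> 'a aw \<Rightarrow> 'a aw" where
  "aw_add S X Y = aw_class S (\<lambda>D. rep X D + rep Y D)"


section \<open>The two products\<close>

text \<open>Edges of the lower and of the upper factor become even and odd, hence disjoint.\<close>

definition stack :: "'a diagram \<Rightarrow> 'a diagram \<Rightarrow> 'a diagram" where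
  "stack D1 D2 =
     (let D1' = rename (\<lambda>e. 2 * e) D1; D2' = rename (\<lambda>e. 2 * e + 1) D2
      in Diagram (\<lambda>a. strand D1' a @ strand D2' a) (vertices D1' + vertices D2'))"

definition aw_star :: "'a set \<Rightarrow> 'a aw \<Rightarrow> 'a aw \<Rightarrow> 'a aw" where
  "aw_star S X Y = aw_class S (bilin stack (rep X) (rep Y))"

definition sorted_diagram :: "'a diagram \<Rightarrow> bool" where
  "sorted_diagram D \<longleftrightarrow>
     (\<forall>a. \<exists>xs ys. strand D a = xs @ ys \<and> list_all is_Head xs \<and> list_all is_Tail ys)"

definition sorted_rep :: "'a aw \<Rightarrow> 'a diagram \<Rightarrow> rat" where
  "sorted_rep X = (SOME x. x \<in> X \<and> (\<forall>D. x D \<noteq> 0 \<longrightarrow> sorted_diagram D))"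

definition merge :: "'a diagram \<Rightarrow> 'a diagram \<Rightarrow> 'a diagram" where
  "merge D1 D2 =
     (let D1' = rename (\<lambda>e. 2 * e) D1; D2' = rename (\<lambda>e. 2 * e + 1) D2
      in Diagram
           (\<lambda>a. filter is_Head (strand D1' a) @ filter is_Head (strand D2' a) @
                filter is_Tail (strand D1' a) @ filter is_Tail (strand D2' a))
           (vertices D1' + vertices D2'))"

definition aw_sharp :: "'a set \<Rightarrow> 'a aw \<Rightarrow> 'a aw \<Rightarrow> 'a aw" where
  "aw_sharp S X Y = aw_class S (bilin merge (sorted_rep X) (sorted_rep Y))"

text \<open>
  The exponential of \<open>X\<close> with respect to a graded product \<open>m\<close>.  It is applied to elements without
  degree 0 part, whose \<open>n\<close>-th power starts in degree \<open>n\<close>, so truncating the sum is harmless.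
\<close>

definition aw_exp :: "'a set \<Rightarrow> ('a aw \<Rightarrow> 'a aw \<Rightarrow> 'a aw) \<Rightarrow> 'a aw \<Rightarrow> 'a aw" where
  "aw_exp S m X =
     aw_class S (\<lambda>D. \<Sum>n\<le>degree_diag S D. rep ((m X ^^ n) (aw_one S)) D / fact n)"


section \<open>The co-product and group-like elements\<close>

definition restrict_diagram :: "'a diagram \<Rightarrow> nat set \<Rightarrow> 'a diagram" where
  "restrict_diagram D E = Diagram (\<lambda>a. filter (\<lambda>x. edge_of x \<in> E) (strand D a))
     (filter_mset (\<lambda>(p, q, r). r \<in> E) (vertices D))"

definition box :: "'a set \<Rightarrow> 'a diagram \<Rightarrow> 'a diagram \<times> 'a diagram \<Rightarrow> rat" where
  "box S D = (\<lambda>P. \<Sum>E | E \<subseteq> edges S D \<and> component_closed D E.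
     delta (restrict_diagram D E, restrict_diagram D (edges S D - E)) P)"

text \<open>
  The completed tensor square of \<open>AW S\<close>, presented as the quotient of the span of pairs of
  diagrams by the relations in either factor.
\<close>

definition aw2_rels :: "'a set \<Rightarrow> ('a diagram \<times> 'a diagram \<Rightarrow> rat) set" where
  "aw2_rels S = {bilin Pair x (delta D) | x D. x \<in> aw_rels S \<and> D \<in> diagrams S} \<union>
     {bilin Pair (delta D) x | x D. x \<in> aw_rels S \<and> D \<in> diagrams S}"

definition aw2_class ::
    "'a set \<Rightarrow> ('a diagram \<times> 'a diagram \<Rightarrow> rat) \<Rightarrow> ('a diagram \<times> 'a diagram \<Rightarrow> rat) set" where
  "aw2_class S = qclass (diagrams S \<times> diagrams S)
     (\<lambda>(D1, D2). degree_diag S D1 + degree_diag S D2) (aw2_rels S)"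

definition aw_coproduct :: "'a set \<Rightarrow> 'a aw \<Rightarrow> ('a diagram \<times> 'a diagram \<Rightarrow> rat) set" where
  "aw_coproduct S X = aw2_class S (lin (box S) (rep X))"

definition aw_tensor :: "'a set \<Rightarrow> 'a aw \<Rightarrow> 'a aw \<Rightarrow> ('a diagram \<times> 'a diagram \<Rightarrow> rat) set" where
  "aw_tensor S X Y = aw2_class S (bilin Pair (rep X) (rep Y))"

definition AW_exp :: "'a set \<Rightarrow> 'a aw set" where
  "AW_exp S = {Z \<in> AW S. aw_coproduct S Z = aw_tensor S Z Z}"


section \<open>Trees and wheels\<close>

text \<open>
  The edges of a planted tree are numbered like a heap: the edge \<open>e\<close> leaving a vertex has the left
  input \<open>2 * e\<close> and the right input \<open>2 * e + 1\<close>.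
\<close>

fun tree_vertices :: "nat \<Rightarrow> 'a lie_tree \<Rightarrow> (nat \<times> nat \<times> nat) multiset" where
  "tree_vertices e (Leaf b) = {#}"
| "tree_vertices e (Br p q) =
     {#(2 * e, 2 * e + 1, e)#} + tree_vertices (2 * e) p + tree_vertices (2 * e + 1) q"

fun tree_tails :: "nat \<Rightarrow> 'a lie_tree \<Rightarrow> ('a \<times> nat) list" where
  "tree_tails e (Leaf b) = [(b, e)]"
| "tree_tails e (Br p q) = tree_tails (2 * e) p @ tree_tails (2 * e + 1) q"

definition plant :: "'a \<Rightarrow> 'a lie_tree \<Rightarrow> 'a diagram" where
  "plant a p = Diagram
     (\<lambda>c. (if c = a then [Head 1] else []) @
          map (\<lambda>(b, e). Tail e) (filter (\<lambda>(b, e). b = c) (tree_tails 1 p)))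
     (tree_vertices 1 p)"

definition l_map :: "'a set \<Rightarrow> ('a, rat) fl_tuple \<Rightarrow> 'a aw" where
  "l_map S lam = aw_class S (\<lambda>D. \<Sum>a\<in>S. lin (\<lambda>p. delta (plant a p)) (rep (lam a)) D)"

text \<open>
  The \<open>i\<close>-th spoke is the edge \<open>i\<close>, and the edge \<open>k + i\<close> of the cycle leaves the \<open>i\<close>-th vertex, whose
  right input is the output of the next vertex.
\<close>

definition wheel :: "'a list \<Rightarrow> 'a diagram" where
  "wheel w = (let k = length w in Diagram
     (\<lambda>c. map Tail (filter (\<lambda>i. w ! i = c) [0..<k]))
     (mset (map (\<lambda>i. (i, k + Suc i mod k, k + i)) [0..<k])))"

definition iota :: "'a set \<Rightarrow> ('a list set \<Rightarrow> rat) \<Rightarrow> 'a aw" where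
  "iota S \<omega> = aw_class S (lin (\<lambda>c D. - delta (wheel (rep c)) D) \<omega>)"

definition E_l :: "'a set \<Rightarrow> ('a, rat) fl_tuple \<Rightarrow> ('a list set \<Rightarrow> rat) \<Rightarrow> 'a aw" where
  "E_l S lam \<omega> =
     aw_star S (aw_exp S (aw_star S) (l_map S lam)) (aw_exp S (aw_star S) (iota S \<omega>))"

definition E_f :: "'a set \<Rightarrow> ('a, rat) fl_tuple \<Rightarrow> ('a list set \<Rightarrow> rat) \<Rightarrow> 'a aw" where
  "E_f S lam \<omega> = aw_exp S (aw_sharp S) (aw_add S (l_map S lam) (iota S \<omega>))"

end

(*
 Classes of arrow diagrams are compared by pairing them with functionals ("weights") which vanish
 in high degree and respect the relations.  Dually to putting the planted trees of a tuple into a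
 diagram, by stacking or by the product on sorted diagrams, a tuple acts on weights by an operator
 which lowers the degree.  Commutators of these operators realise the bracket of tuples (for the
 product on sorted diagrams), the tangential bracket (for stacking) and the derivations (between
 insertion on top and sorted insertion).  The formula for the derivative of an exponential then turns
 the equations defining Gamma and Lambda into the same differential equation in t for the evaluations
 of both exponentials at the empty diagram, and this equation has only one solution, by induction on
 the degree.  Wheels have no heads, so both products with exp(iota omega) are the same.  Group-likeness
 is checked dually on functionals of two diagrams: a tree or a wheel is connected and hence primitive.
*)
theory Submission
 imports Defs "HOL-Combinatorics.Permutations"
begin

section \<open>Pairings with functionals\<close>

text \<open>Elements of the completed quotients are classes of series, and every operation picks
  representatives by a choice operator, so classes are hard to compute with directly. Over a field,
  a vector outside a span is separated from it by a functional; hence pairings with functionals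
  killing the relations determine a class, and they do not see which representative was picked. The
  product on sorted diagrams is the main obstacle: it is defined only through chosen sorted
  representatives. It is controlled because a function on sorted diagrams which respects the
  relations left among them extends to a weight on all diagrams; the normal ordering exists for this
  purpose. The product can then be replaced by an insertion at both ends of the strands
  (\<open>wrap\<close>). At the empty diagram, stacking below, stacking on top and wrapping a sorted
  series give the same value. Changing from one to another there is what brings derivations into the
  differential equations. In each degree the dependence on t is polynomial, so weights take values
  in \<open>rat poly\<close>. They may depend on t themselves, so differentiating a pairing yields
  two terms.\<close>

definition pairing :: "('b => 'r::comm_ring_1) => ('b => 'r) => 'r" where
 "pairing x W = Sum_any (%b. x b * W b)"

lemma mult_nonzeroD: "a * b ~= (0::'r::mult_zero) ==> a ~= 0 \<and> b ~= 0"
 by auto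

text \<open>A functional of bounded degree meets a formal series in finitely many terms only, so
  that their pairing is a finite sum. The bound is imposed on \<open>B\<close> alone: series are
  supported there, and values elsewhere never enter.\<close>

definition bounded_by :: "'b set => ('b => nat) => nat => ('b => 'r::comm_ring_1) => bool" where
 "bounded_by B d N W \<longleftrightarrow> (\<forall>b\<in>B. W b ~= 0 --> d b \<le> N)"

definition supp_upto :: "('b => nat) => nat => ('b => 'r::comm_ring_1) => 'b set" where
 "supp_upto d N x = {b. d b \<le> N \<and> x b ~= 0}"

lemma finite_supp_upto:
 assumes "x \<in> series B d"
 shows "finite (supp_upto d N x)"
proof -
 have "supp_upto d N x = (\<Union>n\<le>N. {b. d b = n \<and> x b ~= 0})"
  by (auto simp: supp_upto_def)
 then show ?thesis using assms by (auto simp: series_def)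
qed

lemma seriesD: "x \<in> series B d ==> x b ~= 0 ==> b \<in> B"
 by (auto simp: series_def)

lemma seriesI:
 assumes "\<And>b. x b ~= 0 ==> b \<in> B" "\<And>N. finite (supp_upto d N x)"
 shows "x \<in> series B d"
 unfolding series_def supp_upto_def
proof (intro CollectI conjI allI impI)
 fix n show "finite {b. d b = n \<and> x b ~= 0}"
  by (rule finite_subset[OF _ assms(2)[of n]]) (auto simp: supp_upto_def)
qed (use assms(1) in auto)

lemma pairing_eq_sum:
 assumes "finite F" "\<And>b. x b * W b ~= 0 ==> b \<in> F"
 shows "pairing x W = (\<Sum>b\<in>F. x b * W b)"
 unfolding pairing_def using assms by (intro Sum_any.expand_superset) auto

lemma pairing_series:
 assumes "x \<in> series B d" "bounded_by B d N W"
 shows "pairing x W = (\<Sum>b\<in>supp_upto d N x. x b * W b)"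
 using assms finite_supp_upto[OF assms(1)]
 by (intro pairing_eq_sum) (auto simp: supp_upto_def bounded_by_def series_def dest!: mult_nonzeroD)

lemma pairing_superset:
 assumes "x \<in> series B d" "bounded_by B d N W" "finite F" "supp_upto d N x \<subseteq> F"
 shows "pairing x W = (\<Sum>b\<in>F. x b * W b)"
 using assms by (intro pairing_eq_sum) (auto simp: supp_upto_def bounded_by_def series_def subset_iff dest!: mult_nonzeroD)

lemma pairing_cong:
 assumes "\<And>b. x b ~= 0 ==> W b = V b"
 shows "pairing x W = pairing x V"
 unfolding pairing_def by (rule Sum_any.cong) (metis assms mult_zero_left)

lemma pairing_cong_series:
 assumes "x \<in> series B d" "\<And>b. b \<in> B ==> W b = V b"
 shows "pairing x W = pairing x V"
 using assms by (intro pairing_cong) (auto simp: series_def)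

lemma pairing_delta [simp]: "pairing (delta b) W = W b"
 by (subst pairing_eq_sum[of "{b}"]) (auto simp: delta_def split: if_splits)

lemma pairing_zero_left [simp]: "pairing (%_. 0) W = 0"
 by (simp add: pairing_def)

lemma pairing_zero_right [simp]: "pairing x (%_. 0) = 0"
 by (simp add: pairing_def)

lemma bounded_by_mono: "bounded_by B d N W ==> N \<le> M ==> bounded_by B d M W"
 by (force simp: bounded_by_def)

lemma bounded_by_zero [simp]: "bounded_by B d N (%_. 0)"
 by (simp add: bounded_by_def)

lemma bounded_by_add: "bounded_by B d N W ==> bounded_by B d N V ==> bounded_by B d N (%b. W b + V b)"
 by (force simp: bounded_by_def)

lemma bounded_by_diff: "bounded_by B d N W ==> bounded_by B d N V ==> bounded_by B d N (%b. W b - V b)"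
 by (force simp: bounded_by_def)

lemma bounded_by_scale: "bounded_by B d N W ==> bounded_by B d N (%b. c * W b)"
 by (force simp: bounded_by_def)

lemma bounded_by_sum: "(\<And>i. i \<in> I ==> bounded_by B d N (W i)) ==> bounded_by B d N (%b. \<Sum>i\<in>I. W i b)"
 unfolding bounded_by_def by (meson sum.not_neutral_contains_not_neutral)

lemma series_zero [simp]: "(%_. 0) \<in> series B d"
 by (simp add: series_def)

lemma series_subset:
 assumes "x \<in> series B d" "\<And>b. y b ~= 0 ==> x b ~= 0"
 shows "y \<in> series B d"
proof (rule seriesI)
 fix N show "finite (supp_upto d N y)"
  by (rule finite_subset[OF _ finite_supp_upto[OF assms(1), of N]]) (use assms in \<open>auto simp: supp_upto_def\<close>)
qed (use assms in \<open>auto simp: series_def\<close>)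

lemma series_subset2:
 assumes "x \<in> series B d" "y \<in> series B d" "\<And>b. z b ~= 0 ==> x b ~= 0 \<or> y b ~= 0"
 shows "z \<in> series B d"
proof (rule seriesI)
 fix N
 have "supp_upto d N z \<subseteq> supp_upto d N x \<union> supp_upto d N y"
  using assms(3) by (auto simp: supp_upto_def)
 then show "finite (supp_upto d N z)"
  using finite_supp_upto[OF assms(1)] finite_supp_upto[OF assms(2)] by (meson finite_UnI finite_subset)
qed (use assms in \<open>auto simp: series_def\<close>)

lemma series_add: "x \<in> series B d ==> y \<in> series B d ==> (%b. x b + y b) \<in> series B d"
 by (erule series_subset2, assumption) auto

lemma series_diff: "x \<in> series B d ==> y \<in> series B d ==> (%b. x b - y b) \<in> series B d"
 by (erule series_subset2, assumption) auto

lemma series_scale: "x \<in> series B d ==> (%b. c * x b) \<in> series B d"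
 by (erule series_subset) auto

lemma series_delta: "b \<in> B ==> delta b \<in> series B d"
 by (auto simp: series_def delta_def)

lemma series_sum: "finite I ==> (\<And>i. i \<in> I ==> x i \<in> series B d) ==> (%b. \<Sum>i\<in>I. x i b) \<in> series B d"
 by (induction I rule: finite_induct) (auto intro!: series_add)

lemma pairing_add_right:
 assumes "x \<in> series B d" "bounded_by B d N W" "bounded_by B d N V"
 shows "pairing x (%b. W b + V b) = pairing x W + pairing x V"
 using assms by (simp add: pairing_series[OF assms(1), of N] bounded_by_add algebra_simps sum.distrib)

lemma pairing_diff_right:
 assumes "x \<in> series B d" "bounded_by B d N W" "bounded_by B d N V"
 shows "pairing x (%b. W b - V b) = pairing x W - pairing x V"
 using assms by (simp add: pairing_series[OF assms(1), of N] bounded_by_diff algebra_simps sum_subtractf)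

lemma pairing_scale_right:
 assumes "x \<in> series B d" "bounded_by B d N W"
 shows "pairing x (%b. c * W b) = c * pairing x W"
 using assms by (simp add: pairing_series[OF assms(1), of N] bounded_by_scale algebra_simps sum_distrib_left)

lemma pairing_sum_right:
 assumes "x \<in> series B d" "finite I" "\<And>i. i \<in> I ==> bounded_by B d N (W i)"
 shows "pairing x (%b. \<Sum>i\<in>I. W i b) = (\<Sum>i\<in>I. pairing x (W i))"
 using assms(2,3)
 by (induction I rule: finite_induct)
  (auto simp: pairing_add_right[OF assms(1), of N] bounded_by_sum)

lemma pairing_add_left:
 assumes "x \<in> series B d" "y \<in> series B d" "bounded_by B d N W"
 shows "pairing (%b. x b + y b) W = pairing x W + pairing y W"
proof -
 let ?F = "supp_upto d N x \<union> supp_upto d N y"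
 have F: "finite ?F" using assms finite_supp_upto by auto
 show ?thesis
  by (subst (1 2 3) pairing_superset[where F = ?F, OF _ assms(3) F])
    (use assms in \<open>auto simp: supp_upto_def series_add algebra_simps sum.distrib\<close>)
qed

lemma pairing_scale_left:
 assumes "x \<in> series B d" "bounded_by B d N W"
 shows "pairing (%b. c * x b) W = c * pairing x W"
 by (subst (1 2) pairing_superset[where F = "supp_upto d N x", OF _ assms(2) finite_supp_upto[OF assms(1)]])
   (use assms in \<open>auto simp: supp_upto_def series_scale algebra_simps sum_distrib_left\<close>)

lemma pairing_diff_left:
 assumes "x \<in> series B d" "y \<in> series B d" "bounded_by B d N W"
 shows "pairing (%b. x b - y b) W = pairing x W - pairing y W"
 using pairing_add_left[OF assms(1) series_scale[OF assms(2), of "-1"] assms(3)]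
  pairing_scale_left[OF assms(2,3), of "-1"] by simp

lemma pairing_sum_left:
 assumes "finite I" "\<And>i. i \<in> I ==> x i \<in> series B d" "bounded_by B d N W"
 shows "pairing (%b. \<Sum>i\<in>I. x i b) W = (\<Sum>i\<in>I. pairing (x i) W)"
 using assms(1,2)
 by (induction I rule: finite_induct) (auto simp: pairing_add_left[OF _ _ assms(3)] series_sum)

lemma pairing_bounded:
 assumes "x \<in> series B d" "\<And>b c. b \<in> B ==> c \<in> C ==> W c b ~= 0 ==> e c \<le> N"
 shows "bounded_by C e N (%c. pairing x (W c))"
 unfolding bounded_by_def
proof (intro ballI impI)
 fix c assume c: "c \<in> C" "pairing x (W c) ~= 0"
 from c(2) obtain b where "x b * W c b ~= 0"
  unfolding pairing_def by (rule Sum_any.not_neutral_obtains_not_neutral) auto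
 then show "e c \<le> N" using assms c(1) by (auto simp: series_def dest!: mult_nonzeroD)
qed

text \<open>Fubini: the common degree bound \<open>N\<close> in both arguments reduces the two
  iterated pairings to the same finite double sum.\<close>

lemma pairing_swap:
 assumes x: "x \<in> series B d" and y: "y \<in> series C e"
  and W: "\<And>b c. b \<in> B ==> c \<in> C ==> W b c ~= 0 ==> d b \<le> N \<and> e c \<le> N"
 shows "pairing x (%b. pairing y (W b)) = pairing y (%c. pairing x (%b. W b c))"
proof -
 let ?F = "supp_upto d N x" let ?G = "supp_upto e N y"
 have F: "finite ?F" "finite ?G" using x y finite_supp_upto by auto
 have b1: "pairing y (W b) = (\<Sum>c\<in>?G. y c * W b c)" if "b \<in> B" for b
  by (rule pairing_series[OF y]) (use W that in \<open>auto simp: bounded_by_def\<close>)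
 have b2: "pairing x (%b. W b c) = (\<Sum>b\<in>?F. x b * W b c)" if "c \<in> C" for c
  by (rule pairing_series[OF x]) (use W that in \<open>auto simp: bounded_by_def\<close>)
 have "pairing x (%b. pairing y (W b)) = (\<Sum>b\<in>?F. x b * pairing y (W b))"
  by (rule pairing_series[OF x pairing_bounded[OF y]]) (use W in auto)
 also have "... = (\<Sum>b\<in>?F. \<Sum>c\<in>?G. x b * y c * W b c)"
  by (rule sum.cong) (use x in \<open>auto simp: b1 series_def supp_upto_def sum_distrib_left algebra_simps\<close>)
 also have "... = (\<Sum>c\<in>?G. \<Sum>b\<in>?F. x b * y c * W b c)" by (rule sum.swap)
 also have "... = (\<Sum>c\<in>?G. y c * pairing x (%b. W b c))"
  by (rule sum.cong) (use y in \<open>auto simp: b2 series_def supp_upto_def sum_distrib_left algebra_simps\<close>)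
 also have "... = pairing y (%c. pairing x (%b. W b c))"
  by (rule pairing_series[OF y pairing_bounded[OF x], symmetric]) (use W in auto)
 finally show ?thesis .
qed

text \<open>The linear extension is adjoint to pulling functionals back along \<open>f\<close>.
  Since \<open>f\<close> does not lower the degree, a coefficient up to degree \<open>N\<close> only
  receives contributions from the finitely many terms of \<open>x\<close> up to degree
  \<open>N\<close>; this gives both convergence and the exchange of the sums.\<close>

lemma lin_series_pairing:
 assumes x: "x \<in> series B d"
  and f: "\<And>b. b \<in> B ==> f b \<in> series C e" "\<And>b c. b \<in> B ==> f b c ~= 0 ==> d b \<le> e c"
 shows "lin f x \<in> series C e"
  and "bounded_by C e N W ==> pairing (lin f x) W = pairing x (%b. pairing (f b) W)"
proof -
 have fin: "finite (supp_upto d N x)" for N using x finite_supp_upto by auto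
 have lin_eq: "lin f x c = (\<Sum>b\<in>supp_upto d N x. x b * f b c)" if "e c \<le> N" for c N
  unfolding lin_def
 proof (rule Sum_any.expand_superset[OF fin], clarify)
  fix b assume "x b * f b c ~= 0"
  then have "x b ~= 0" "f b c ~= 0" by (auto dest!: mult_nonzeroD)
  then show "b \<in> supp_upto d N x" using that f(2)[of b c] x by (auto simp: supp_upto_def series_def)
 qed
 let ?C = "%N. \<Union>b\<in>supp_upto d N x. supp_upto e N (f b)"
 have C: "finite (?C N)" for N
  using fin finite_supp_upto[OF f(1)] x by (auto simp: supp_upto_def[of d] series_def)
 have sub: "supp_upto e N (lin f x) \<subseteq> ?C N" for N
 proof
  fix c assume c: "c \<in> supp_upto e N (lin f x)"
  then have "(\<Sum>b\<in>supp_upto d N x. x b * f b c) ~= 0" using lin_eq[of c N] by (simp add: supp_upto_def)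
  then obtain b where "b \<in> supp_upto d N x" "x b * f b c ~= 0" by (meson sum.not_neutral_contains_not_neutral)
  then show "c \<in> ?C N" using c by (intro UN_I[of b]) (auto simp: supp_upto_def)
 qed
 show *: "lin f x \<in> series C e"
 proof (rule seriesI)
  fix c assume "lin f x c ~= 0"
  then have "c \<in> ?C (e c)" using sub[of "e c"] by (auto simp: supp_upto_def)
  then show "c \<in> C" using f(1) x by (auto simp: supp_upto_def series_def)
 qed (use finite_subset[OF sub C] in auto)
 assume W: "bounded_by C e N W"
 have in_B: "b \<in> B" if "b \<in> supp_upto d N x" for b using that x by (auto simp: supp_upto_def series_def)
 have bd: "bounded_by B d N (%b. pairing (f b) W)"
  unfolding bounded_by_def
 proof (intro ballI impI)
  fix b assume b: "b \<in> B" "pairing (f b) W ~= 0"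
  from b(2) obtain c where c: "f b c * W c ~= 0"
   unfolding pairing_def by (rule Sum_any.not_neutral_obtains_not_neutral) auto
  then have "f b c ~= 0" "W c ~= 0" by (auto dest!: mult_nonzeroD)
  then have "c \<in> C" "f b c ~= 0" "W c ~= 0" using f(1)[of b] b by (auto simp: series_def)
  then show "d b \<le> N" using f(2)[of b c] b W by (force simp: bounded_by_def)
 qed
 have "pairing (lin f x) W = (\<Sum>c\<in>?C N. lin f x c * W c)"
  by (rule pairing_superset[OF * W C sub])
 also have "... = (\<Sum>c\<in>?C N. \<Sum>b\<in>supp_upto d N x. x b * f b c * W c)"
  by (rule sum.cong) (auto simp: lin_eq[of _ N] supp_upto_def[of e] sum_distrib_right)
 also have "... = (\<Sum>b\<in>supp_upto d N x. x b * (\<Sum>c\<in>?C N. f b c * W c))"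
  by (subst sum.swap) (simp add: sum_distrib_left algebra_simps)
 also have "... = (\<Sum>b\<in>supp_upto d N x. x b * pairing (f b) W)"
  by (intro sum.cong refl arg_cong2[where f = "(*)"] pairing_superset[symmetric, OF f(1) W C])
    (use in_B in auto)
 also have "... = pairing x (%b. pairing (f b) W)"
  by (rule pairing_series[symmetric, OF x bd])
 finally show "pairing (lin f x) W = pairing x (%b. pairing (f b) W)" .
qed

lemma series_prod:
 assumes x: "x \<in> series B d" and y: "y \<in> series C e"
 shows "(%(b, c). x b * y c) \<in> series (B \<times> C) (%(b, c). d b + e c)"
proof (rule seriesI)
 fix N
 have "supp_upto (%(b, c). d b + e c) N (%(b, c). x b * y c) \<subseteq> supp_upto d N x \<times> supp_upto e N y"
  by (auto simp: supp_upto_def dest!: mult_nonzeroD)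
 then show "finite (supp_upto (%(b, c). d b + e c) N (%(b, c). x b * y c))"
  using finite_supp_upto[OF x] finite_supp_upto[OF y] by (meson finite_SigmaI finite_subset)
qed (use x y in \<open>auto simp: series_def dest!: mult_nonzeroD\<close>)

lemma pairing_prod:
 assumes x: "x \<in> series B d" and y: "y \<in> series C e"
  and V: "\<And>b c. b \<in> B ==> c \<in> C ==> V (b, c) ~= 0 ==> d b \<le> N \<and> e c \<le> N"
 shows "pairing (%(b, c). x b * y c) V = pairing x (%b. pairing y (%c. V (b, c)))"
proof -
 let ?F = "supp_upto d N x" let ?G = "supp_upto e N y"
 have F: "finite ?F" "finite ?G" using x y finite_supp_upto by auto
 have "pairing (%(b, c). x b * y c) V = (\<Sum>p\<in>?F \<times> ?G. (%(b, c). x b * y c) p * V p)"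
  using F V x y by (intro pairing_eq_sum) (fastforce simp: supp_upto_def series_def dest!: mult_nonzeroD)+
 also have "... = (\<Sum>b\<in>?F. x b * (\<Sum>c\<in>?G. y c * V (b, c)))"
  by (simp add: sum.cartesian_product sum_distrib_left case_prod_beta algebra_simps)
 also have "... = (\<Sum>b\<in>?F. x b * pairing y (%c. V (b, c)))"
  by (intro sum.cong refl arg_cong2[where f = "(*)"] pairing_series[symmetric, OF y])
    (use V x in \<open>auto simp: bounded_by_def supp_upto_def series_def\<close>)
 also have "... = pairing x (%b. pairing y (%c. V (b, c)))"
  by (rule pairing_series[OF x pairing_bounded[OF y], symmetric]) (use V in auto)
 finally show ?thesis .
qed

text \<open>Applied to the bracket of trees, to stacking and merging of diagrams and to the
  formation of pairs; all of these add degrees.\<close>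

lemma bilin_series_pairing:
 assumes x: "x \<in> series B d" and y: "y \<in> series C e"
  and m: "\<And>b c. b \<in> B ==> c \<in> C ==> m b c \<in> E \<and> g (m b c) = d b + e c"
 shows "bilin m x y \<in> series E g"
  and "bounded_by E g N W ==>
   pairing (bilin m x y) W = pairing x (%b. pairing y (%c. W (m b c)))"
proof -
 note l = lin_series_pairing[OF series_prod[OF x y], of "%(b, c). delta (m b c)" E g]
 have h: "(case p of (b, c) => delta (m b c)) \<in> series E g" if "p \<in> B \<times> C" for p
  using that m by (auto intro!: series_delta)
 have h2: "(case p of (b, c) => d b + e c) \<le> g r"
  if "p \<in> B \<times> C" "(case p of (b, c) => delta (m b c)) r ~= 0" for p r
  using that m by (auto simp: delta_def split: if_splits)
 show "bilin m x y \<in> series E g"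
  unfolding bilin_def by (rule l(1)[OF h h2])
 assume W: "bounded_by E g N W"
 have "pairing (bilin m x y) W = pairing (%(b, c). x b * y c) (%p. pairing ((%(b, c). delta (m b c)) p) W)"
  unfolding bilin_def by (rule l(2)[OF h h2 W])
 also have "... = pairing x (%b. pairing y (%c. pairing ((%(b, c). delta (m b c)) (b, c)) W))"
  by (rule pairing_prod[OF x y, of _ N]) (use W m in \<open>force simp: bounded_by_def\<close>)
 finally show "pairing (bilin m x y) W = pairing x (%b. pairing y (%c. W (m b c)))" by simp
qed

section \<open>Classes\<close>

definition homogeneous_rels :: "'b set => ('b => nat) => ('b => 'r::comm_ring_1) set => bool" where
 "homogeneous_rels B d R \<longleftrightarrow>
   (\<forall>r\<in>R. finite {b. r b ~= 0} \<and> (\<exists>n. \<forall>b. r b ~= 0 --> b \<in> B \<and> d b = n))"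

definition kills :: "('b => 'r::comm_ring_1) set => ('b => 'r) => bool" where
 "kills R W \<longleftrightarrow> (\<forall>r\<in>R. pairing r W = 0)"

lemma finite_support_series:
 assumes "finite {b. x b ~= 0}"
 shows "x \<in> series UNIV (%_. 0::nat)"
 using assms by (auto simp: series_def)

lemma pairing_span:
 assumes "\<And>r. r \<in> R ==> finite {b. r b ~= 0}" "kills R W" "x \<in> fmod.span R"
 shows "finite {b. x b ~= 0} \<and> pairing x W = 0"
 using assms(3)
proof (induction rule: fmod.span_induct_alt)
 case base
 then show ?case by (simp add: zero_fun_def)
next
 case (step c r y)
 have r: "finite {b. r b ~= 0}" "pairing r W = 0" using assms step by (auto simp: kills_def)
 have bW: "bounded_by UNIV (%_. 0) 0 W" by (simp add: bounded_by_def)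
 have "finite {b. (fscale c r + y) b ~= 0}"
  by (rule finite_subset[of _ "{b. r b ~= 0} \<union> {b. y b ~= 0}"]) (use r step in \<open>auto simp: fscale_def\<close>)
 moreover have "pairing (fscale c r + y) W = c * pairing r W + pairing y W"
  using pairing_add_left[OF series_scale[OF finite_support_series[OF r(1)], of c]
    finite_support_series[OF conjunct1[OF step(2)]] bW]
   pairing_scale_left[OF finite_support_series[OF r(1)] bW, of c]
  by (simp add: plus_fun_def fscale_def)
 ultimately show ?case using r(2) step(2) by (metis add_0 mult_zero_right)
qed

lemma null_seriesD: "x \<in> null_series B d R ==> x \<in> series B d"
 by (simp add: null_series_def)

text \<open>Each homogeneous part of a null series lies in the span of \<open>R\<close> and pairs to
  zero, and \<open>W\<close> only sees the finitely many parts up to degree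
  \<open>N\<close>.\<close>

lemma pairing_null:
 assumes R: "homogeneous_rels B d R" and k: "kills R W" and x: "x \<in> null_series B d R" and W: "bounded_by B d N W"
 shows "pairing x W = 0"
proof -
 let ?part = "%n b. if d b = n then x b else 0"
 have xs: "x \<in> series B d" using x by (rule null_seriesD)
 have ps: "?part n \<in> series B d" for n by (rule series_subset[OF xs]) (auto split: if_splits)
 have p0: "pairing (?part n) W = 0" for n
  using pairing_span[of R W "?part n"] R k x by (auto simp: homogeneous_rels_def null_series_def)
 have "pairing x W = pairing (%b. \<Sum>n\<le>N. ?part n b) W"
  using pairing_series[OF xs W] pairing_superset[OF series_sum[OF _ ps] W finite_supp_upto[OF xs, of N], of "{..N}"]
  by (subst pairing_superset[where F = "supp_upto d N x", OF series_sum[OF _ ps] W finite_supp_upto[OF xs, of N]])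
    (auto simp: pairing_series[OF xs W] supp_upto_def split: if_splits intro!: sum.cong)
 also have "... = (\<Sum>n\<le>N. pairing (?part n) W)"
  by (rule pairing_sum_left[OF _ ps W]) auto
 finally show ?thesis using p0 by simp
qed

lemma null_series_add:
 assumes "x \<in> null_series B d R" "y \<in> null_series B d R"
 shows "(%b. x b + y b) \<in> null_series B d R"
proof -
 have "(%b. if d b = n then x b + y b else 0) = (%b. if d b = n then x b else 0) + (%b. if d b = n then y b else 0)" for n
  by (auto simp: fun_eq_iff)
 then show ?thesis using assms by (auto simp: null_series_def series_add fmod.span_add)
qed

lemma null_series_minus:
 assumes "x \<in> null_series B d R"
 shows "(%b. - x b) \<in> null_series B d R"
proof -
 have "(%b. if d b = n then - x b else 0) = - (%b. if d b = n then x b else 0)" for n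
  by (auto simp: fun_eq_iff)
 then show ?thesis using assms series_scale[of x B d "-1"] by (auto simp: null_series_def fmod.span_neg)
qed

lemma null_series_zero: "(%_. 0) \<in> null_series B d R"
 using fmod.span_zero[of R] by (auto simp: null_series_def zero_fun_def)

lemma qclass_eqI:
 assumes "(%b. x b - y b) \<in> null_series B d R"
 shows "qclass B d R x = qclass B d R y"
proof -
 have "(%b. y b - z b) \<in> null_series B d R" if "(%b. x b - z b) \<in> null_series B d R" for z
  using null_series_add[OF that null_series_minus[OF assms]] by simp
 moreover have "(%b. x b - z b) \<in> null_series B d R" if "(%b. y b - z b) \<in> null_series B d R" for z
  using null_series_add[OF that assms] by simp
 ultimately show ?thesis by (auto simp: qclass_def)
qed

lemma qclass_self: "x \<in> series B d ==> x \<in> qclass B d R x"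
 by (simp add: qclass_def null_series_zero)

lemma rep_in: "x \<in> X ==> rep X \<in> X"
 unfolding rep_def by (rule someI)

lemma rep_qclass:
 assumes "x \<in> series B d"
 shows "rep (qclass B d R x) \<in> series B d" "(%b. x b - rep (qclass B d R x) b) \<in> null_series B d R"
 using rep_in[OF qclass_self[OF assms, of R]] by (auto simp: qclass_def)

lemma qclass_rep:
 assumes "x \<in> series B d"
 shows "qclass B d R (rep (qclass B d R x)) = qclass B d R x"
 by (rule qclass_eqI[symmetric]) (rule rep_qclass[OF assms])

text \<open>Pairings with functionals that kill the relations are functions of the class. Through
  this fact the choices hidden in \<open>rep\<close> disappear from all later computations.\<close>

lemma pairing_qclass_mem:
 assumes R: "homogeneous_rels B d R" and k: "kills R W" and W: "bounded_by B d N W"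
  and x: "x \<in> series B d" and y: "y \<in> qclass B d R x"
 shows "pairing y W = pairing x W"
proof -
 have ys: "y \<in> series B d" and yn: "(%b. x b - y b) \<in> null_series B d R" using y by (auto simp: qclass_def)
 show ?thesis
  using pairing_null[OF R k yn W] pairing_diff_left[OF x ys W] by simp
qed

lemma pairing_rep:
 assumes "homogeneous_rels B d R" "kills R W" "bounded_by B d N W" "x \<in> series B d"
 shows "pairing (rep (qclass B d R x)) W = pairing x W"
 using pairing_qclass_mem[OF assms rep_in[OF qclass_self[OF assms(4)]]] .

section \<open>Separation of vectors from spans by rational functionals\<close>

global_interpretation fvec: vector_space "fscale :: rat => ('b => rat) => 'b => rat"
 by unfold_locales (auto simp: fscale_def fun_eq_iff algebra_simps)

text \<open>A basis of the span stays independent when \<open>x\<close> is added to it, and a linear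
  functional may be prescribed on the enlarged basis. This is the point where the coefficients have
  to form a field.\<close>

lemma separating_functional:
 fixes R :: "('b => rat) set"
 assumes "x \<notin> fmod.span R"
 obtains ph :: "('b => rat) => rat" where "\<And>y z. ph (y + z) = ph y + ph z" "\<And>c y. ph (fscale c y) = c * ph y"
  "\<And>y. y \<in> R ==> ph y = 0" "ph x = 1"
proof -
 interpret vp: vector_space_pair "fscale :: rat => ('b => rat) => 'b => rat" "(*) :: rat => rat => rat"
  by unfold_locales (auto simp: fscale_def fun_eq_iff algebra_simps)
 obtain B where B: "B \<subseteq> R" "\<not> fmod.dependent B" "fmod.span B = fmod.span R"
  using fvec.maximal_independent_subset[of R] fmod.span_mono fmod.span_span
  by (metis subset_antisym)
 have xB: "x \<notin> fmod.span B" using B assms by simp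
 then have ind: "\<not> fmod.dependent (insert x B)" by (rule fvec.independent_insertI) (rule B)
 obtain g where g: "Vector_Spaces.linear fscale (*) g" "\<And>b. b \<in> insert x B ==> g b = (if b = x then 1 else 0)"
  using vp.linear_independent_extend[OF ind, of "%b. if b = x then 1 else 0"] by blast
 interpret g: Vector_Spaces.linear fscale "(*)" g by (rule g(1))
 have gB: "g y = 0" if "y \<in> fmod.span B" for y
  using that
 proof (induction rule: fmod.span_induct_alt)
  case base show ?case by (rule g.zero)
 next
  case (step c b y)
  then have "g b = 0" using g(2)[of b] xB fmod.span_base by auto
  then have "g (fscale c b + y) = c * 0 + g y" by (subst g.add, subst g.scale) simp
  then show ?case using step by (simp add: plus_fun_def)
 qed
 have gR: "g y = 0" if "y \<in> R" for y
  using gB[of y] B(3) fmod.span_base[OF that] by simp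
 show ?thesis
  by (rule that[of g]) (use g.add g.scale g(2)[of x] gR in auto)
qed

lemma functional_eq_pairing:
 fixes ph :: "('b => rat) => rat"
 assumes "\<And>y z. ph (y + z) = ph y + ph z" "\<And>c y. ph (fscale c y) = c * ph y" "finite {b. x b ~= 0}"
 shows "ph x = pairing x (%b. ph (delta b))"
proof -
 have z: "ph (%_. 0) = 0" using assms(2)[of 0 x] by (simp add: fscale_def)
 have s: "ph (%c. \<Sum>b\<in>F. x b * delta b c) = (\<Sum>b\<in>F. x b * ph (delta b))" if "finite F" for F
  using that
 proof (induction F rule: finite_induct)
  case (insert b F)
  have "(%c. \<Sum>b\<in>insert b F. x b * delta b c) = fscale (x b) (delta b) + (%c. \<Sum>b\<in>F. x b * delta b c)"
   using insert by (auto simp: fun_eq_iff fscale_def)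
  then show ?case using insert assms by simp
 qed (use z in auto)
 have "(%c. \<Sum>b\<in>{b. x b ~= 0}. x b * delta b c) = x"
  by (auto simp: fun_eq_iff delta_def assms(3) if_distrib cong: if_cong)
 then show ?thesis using s[OF assms(3)] pairing_eq_sum[OF assms(3), of x] by auto
qed

text \<open>Converse of \<open>pairing_null\<close>. A functional separating the part in degree
  \<open>n\<close> from the span is cut down to that degree before it is tested; the result still
  kills the relations because each of them is homogeneous.\<close>

lemma null_seriesI:
 fixes x :: "'b => rat"
 assumes R: "homogeneous_rels B d R" and x: "x \<in> series B d"
  and W: "\<And>n W. (\<And>b. W b ~= 0 ==> b \<in> B \<and> d b = n) ==> kills R W ==> pairing x W = 0"
 shows "x \<in> null_series B d R"
 unfolding null_series_def
proof (intro CollectI conjI allI x)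
 fix n
 let ?p = "%b. if d b = n then x b else 0"
 show "?p \<in> fmod.span R"
 proof (rule ccontr)
  assume "?p \<notin> fmod.span R"
  then obtain ph :: "('b => rat) => rat" where ph: "\<And>y z. ph (y + z) = ph y + ph z" "\<And>c y. ph (fscale c y) = c * ph y"
   "\<And>y. y \<in> R ==> ph y = 0" "ph ?p = 1" by (rule separating_functional) blast
  let ?W = "%b. if b \<in> B \<and> d b = n then ph (delta b) else 0"
  have "kills R ?W"
   unfolding kills_def
  proof
   fix r assume r: "r \<in> R"
   obtain m where fin: "finite {b. r b ~= 0}" and m: "\<And>b. r b ~= 0 ==> b \<in> B \<and> d b = m"
    using R r unfolding homogeneous_rels_def by blast
   show "pairing r ?W = 0"
   proof (cases "m = n")
    case True
    then have "pairing r ?W = pairing r (%b. ph (delta b))" using m by (intro pairing_cong) auto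
    also have "... = ph r" by (rule functional_eq_pairing[OF ph(1,2) fin, symmetric])
    finally show ?thesis using ph(3) r by simp
   next
    case False
    then have "pairing r ?W = pairing r (%b. 0)" using m by (intro pairing_cong) auto
    then show ?thesis by simp
   qed
  qed
  then have "pairing x ?W = 0" by (intro W[of _ n]) (auto split: if_splits)
  moreover have "finite {b. ?p b ~= 0}"
  by (rule finite_subset[of _ "{b. d b = n \<and> x b ~= 0}"]) (use x in \<open>auto simp: series_def split: if_splits\<close>)
  then have "ph ?p = pairing ?p (%b. ph (delta b))" by (rule functional_eq_pairing[OF ph(1,2)])
  moreover have "pairing ?p (%b. ph (delta b)) = pairing x ?W"
   unfolding pairing_def using x by (intro Sum_any.cong) (auto simp: series_def)
  ultimately show False using ph(4) by simp
 qed
qed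

section \<open>Diagrams as words\<close>

type_synonym 'a letter = "'a \<times> strand_end"
type_synonym verts = "(nat \<times> nat \<times> nat) multiset"

definition proj :: "'a => 'a letter list => strand_end list" where
 "proj a zs = map snd (filter (%z. fst z = a) zs)"

text \<open>A diagram is presented by a single word of ends labelled with their strands. Words can
  be split and processed letter by letter, which suits local relations and inductions; the price is
  that the order between letters of different strands is not determined by the diagram.\<close>

definition mk :: "'a letter list => verts => 'a diagram" where
 "mk zs V = Diagram (%a. proj a zs) V"

definition word_src :: "'a letter list => verts => nat multiset" where
 "word_src zs V = mset (map (edge_of \<circ> snd) (filter (is_Tail \<circ> snd) zs)) + image_mset (%(p, q, r). r) V"

definition word_tgt :: "'a letter list => verts => nat multiset" where
 "word_tgt zs V = mset (map (edge_of \<circ> snd) (filter (is_Head \<circ> snd) zs)) + (\<Sum>(p, q, r)\<in>#V. {#p, q#})"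

definition vert_names :: "verts => nat set" where
 "vert_names V = (\<Union>(p, q, r)\<in>set_mset V. {p, q, r})"

definition word_names :: "'a letter list => verts => nat set" where
 "word_names zs V = (edge_of \<circ> snd) ` set zs \<union> vert_names V"

definition closed_for :: "verts => nat set => bool" where
 "closed_for V E \<longleftrightarrow> (\<forall>(p, q, r)\<in>#V. (p \<in> E \<longleftrightarrow> r \<in> E) \<and> (q \<in> E \<longleftrightarrow> r \<in> E))"

text \<open>The word version of membership in \<open>diagrams S\<close>. The connectivity condition
  ranges over all closed sets that meet the names of the word, not only over sets of edges, so that
  such sets can be pulled back along renamings.\<close>

definition wf_word :: "'a set => 'a letter list => verts => bool" where
 "wf_word S zs V \<longleftrightarrow> fst ` set zs \<subseteq> S \<and> word_src zs V = word_tgt zs V \<and>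
   (\<forall>e. count (word_src zs V) e \<le> 1) \<and>
   (\<forall>E. closed_for V E \<and> E \<inter> word_names zs V ~= {} --> (\<exists>z\<in>set zs. edge_of (snd z) \<in> E))"

definition ren_end :: "(nat => nat) => strand_end => strand_end" where
 "ren_end f x = (case x of Head e => Head (f e) | Tail e => Tail (f e))"

definition ren_word :: "(nat => nat) => 'a letter list => 'a letter list" where
 "ren_word f = map (map_prod id (ren_end f))"

definition ren_verts :: "(nat => nat) => verts => verts" where
 "ren_verts f = image_mset (%(p, q, r). (f p, f q, f r))"

lemma ren_end_simps [simp]: "ren_end f (Head e) = Head (f e)" "ren_end f (Tail e) = Tail (f e)"
 by (auto simp: ren_end_def)

lemma ren_end_edge [simp]: "edge_of (ren_end f x) = f (edge_of x)"
 by (cases x) auto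

lemma ren_end_is [simp]: "is_Head (ren_end f x) = is_Head x" "is_Tail (ren_end f x) = is_Tail x"
 by (cases x; simp)+

lemma ren_end_comp [simp]: "ren_end f (ren_end g x) = ren_end (f \<circ> g) x"
 by (cases x) auto

lemma ren_word_simps [simp]: "ren_word f [] = []" "ren_word f ((a, x) # zs) = (a, ren_end f x) # ren_word f zs"
 "ren_word f (xs @ ys) = ren_word f xs @ ren_word f ys"
 by (auto simp: ren_word_def)

lemma ren_word_comp [simp]: "ren_word f (ren_word g zs) = ren_word (f \<circ> g) zs"
 by (auto simp: ren_word_def)

lemma ren_verts_simps [simp]: "ren_verts f {#} = {#}" "ren_verts f (V + V') = ren_verts f V + ren_verts f V'"
 "ren_verts f (add_mset (p, q, r) V) = add_mset (f p, f q, f r) (ren_verts f V)"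
 by (auto simp: ren_verts_def)

lemma ren_verts_comp [simp]: "ren_verts f (ren_verts g V) = ren_verts (f \<circ> g) V"
 by (auto simp: ren_verts_def multiset.map_comp intro!: image_mset_cong)

lemma ren_cong:
 "(\<And>n. n \<in> word_names zs V ==> f n = g n) ==> ren_word f zs = ren_word g zs \<and> ren_verts f V = ren_verts g V"
 unfolding ren_word_def ren_verts_def word_names_def vert_names_def
 by (intro conjI map_cong image_mset_cong refl)
   (auto simp: ren_end_def map_prod_def split: strand_end.splits, force+)

lemma ren_id [simp]: "ren_word (%n. n) zs = zs" "ren_verts (%n. n) V = V"
 by (induction zs) (auto simp: ren_word_def ren_verts_def ren_end_def map_prod_def split: strand_end.splits)

lemma proj_simps [simp]: "proj a [] = []" "proj a (xs @ ys) = proj a xs @ proj a ys"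
 "proj a ((b, x) # zs) = (if b = a then x # proj a zs else proj a zs)"
 by (auto simp: proj_def)

lemma proj_map_Pair [simp]: "proj a (map (Pair b) us) = (if b = a then us else [])"
 by (auto simp: proj_def filter_map comp_def)

lemma mk_sel [simp]: "strand (mk zs V) a = proj a zs" "vertices (mk zs V) = V"
 by (auto simp: mk_def)

lemma proj_ren: "proj a (ren_word f zs) = map (ren_end f) (proj a zs)"
 by (induction zs) (auto simp: ren_word_def)

lemma rename_mk: "rename f (mk zs V) = mk (ren_word f zs) (ren_verts f V)"
 by (auto simp: rename_def mk_def proj_ren ren_verts_def ren_end_def fun_eq_iff)

lemma vert_names_simps [simp]: "vert_names {#} = {}" "vert_names (V + V') = vert_names V \<union> vert_names V'"
 "vert_names (add_mset (p, q, r) V) = {p, q, r} \<union> vert_names V"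
 by (auto simp: vert_names_def)

lemma word_names_simps [simp]: "word_names [] V = vert_names V"
 "word_names ((a, x) # zs) V = insert (edge_of x) (word_names zs V)"
 "word_names (xs @ ys) V = word_names xs V \<union> word_names ys V"
 "word_names xs (V + V') = word_names xs V \<union> word_names xs V'"
 "word_names xs (add_mset (p, q, r) V) = {p, q, r} \<union> word_names xs V"
 by (auto simp: word_names_def)

lemma finite_vert_names [simp]: "finite (vert_names V)"
 by (auto simp: vert_names_def)

lemma finite_word_names [simp]: "finite (word_names zs V)"
 by (auto simp: word_names_def)

lemma vert_names_ren: "vert_names (ren_verts f V) = f ` vert_names V"
 by (induction V) auto

lemma word_names_ren: "word_names (ren_word f zs) (ren_verts f V) = f ` word_names zs V"
 by (auto simp: word_names_def vert_names_ren ren_word_def image_image image_Un)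

lemma word_src_simps [simp]: "word_src [] {#} = {#}"
 "word_src ((a, Head e) # zs) V = word_src zs V" "word_src ((a, Tail e) # zs) V = add_mset e (word_src zs V)"
 "word_src zs (add_mset (p, q, r) V) = add_mset r (word_src zs V)"
 by (auto simp: word_src_def)

lemma word_tgt_simps [simp]: "word_tgt [] {#} = {#}"
 "word_tgt ((a, Tail e) # zs) V = word_tgt zs V" "word_tgt ((a, Head e) # zs) V = add_mset e (word_tgt zs V)"
 "word_tgt zs (add_mset (p, q, r) V) = add_mset p (add_mset q (word_tgt zs V))"
 by (auto simp: word_tgt_def)

lemma word_src_tgt_names: "set_mset (word_src zs V) \<union> set_mset (word_tgt zs V) = word_names zs V"
proof (induction V)
 case empty
 show ?case
 proof (induction zs)
  case (Cons z zs) then show ?case by (cases z; cases "snd z") auto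
 qed simp
next
 case (add v V) then show ?case by (cases v) auto
qed

lemma wf_names: "wf_word S zs V ==> set_mset (word_src zs V) = word_names zs V"
 using word_src_tgt_names[of zs V] by (auto simp: wf_word_def)

lemma word_src_append: "word_src (xs @ ys) (V + V') = word_src xs V + word_src ys V'"
 by (auto simp: word_src_def)

lemma word_tgt_append: "word_tgt (xs @ ys) (V + V') = word_tgt xs V + word_tgt ys V'"
 by (auto simp: word_tgt_def)

lemma word_src_ren: "word_src (ren_word f zs) (ren_verts f V) = image_mset f (word_src zs V)"
proof (induction V)
 case empty
 show ?case
 proof (induction zs)
  case (Cons z zs) then show ?case by (cases z; cases "snd z") auto
 qed simp
next
 case (add v V) then show ?case by (cases v) auto
qed

lemma word_tgt_ren: "word_tgt (ren_word f zs) (ren_verts f V) = image_mset f (word_tgt zs V)"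
proof (induction V)
 case empty
 show ?case
 proof (induction zs)
  case (Cons z zs) then show ?case by (cases z; cases "snd z") auto
 qed simp
next
 case (add v V) then show ?case by (cases v) auto
qed

lemma closed_for_simps [simp]: "closed_for {#} E" "closed_for (V + V') E \<longleftrightarrow> closed_for V E \<and> closed_for V' E"
 "closed_for (add_mset (p, q, r) V) E \<longleftrightarrow> (p \<in> E \<longleftrightarrow> r \<in> E) \<and> (q \<in> E \<longleftrightarrow> r \<in> E) \<and> closed_for V E"
 by (auto simp: closed_for_def ball_Un)

lemma closed_for_ren: "closed_for (ren_verts f V) E \<longleftrightarrow> closed_for V (f -` E)"
proof (induction V)
 case (add v V) then show ?case by (cases v) auto
qed simp

lemma closed_for_cong:
 "(\<And>n. n \<in> vert_names V ==> n \<in> E \<longleftrightarrow> n \<in> E') ==> closed_for V E \<longleftrightarrow> closed_for V E'"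
proof (induction V)
 case (add v V) then show ?case by (cases v) auto
qed simp

lemma wf_touch: "wf_word S zs V ==> closed_for V E ==> n \<in> E ==> n \<in> word_names zs V ==> \<exists>z\<in>set zs. edge_of (snd z) \<in> E"
 unfolding wf_word_def by blast

lemma wf_wordD:
 assumes "wf_word S zs V"
 shows "fst ` set zs \<subseteq> S" "word_src zs V = word_tgt zs V" "count (word_src zs V) e \<le> 1"
 using assms unfolding wf_word_def by blast+

lemma wf_perm:
 assumes "mset zs = mset zs'"
 shows "wf_word S zs V \<longleftrightarrow> wf_word S zs' V"
proof -
 have "set zs = set zs'" using assms by (metis set_mset_mset)
 moreover have "word_src zs V = word_src zs' V" "word_tgt zs V = word_tgt zs' V"
  using assms by (simp_all add: word_src_def word_tgt_def mset_map mset_filter)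
 ultimately show ?thesis unfolding wf_word_def word_names_def by simp
qed

lemma wf_ren:
 assumes inj: "inj_on f (word_names zs V)" and wf: "wf_word S zs V"
 shows "wf_word S (ren_word f zs) (ren_verts f V)"
 unfolding wf_word_def
proof (intro conjI allI impI)
 show "fst ` set (ren_word f zs) \<subseteq> S" using wf by (auto simp: wf_word_def ren_word_def)
 show "word_src (ren_word f zs) (ren_verts f V) = word_tgt (ren_word f zs) (ren_verts f V)"
  using wf by (simp add: word_src_ren word_tgt_ren wf_word_def)
next
 fix e
 have inj': "inj_on f (set_mset (word_src zs V))" using inj wf_names[OF wf] by simp
 show "count (word_src (ren_word f zs) (ren_verts f V)) e \<le> 1"
 proof (cases "e \<in> f ` set_mset (word_src zs V)")
  case True
  then obtain n where n: "n \<in># word_src zs V" "e = f n" by auto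
  have "{m. m \<in># word_src zs V \<and> f m = e} = {n}" using n inj' by (auto dest: inj_onD)
  then have "count (image_mset f (word_src zs V)) e = count (word_src zs V) n"
   by (simp add: count_image_mset vimage_def Int_def conj_commute)
  then show ?thesis using wf_wordD(3)[OF wf] by (simp add: word_src_ren)
 next
  case False
  then have "count (image_mset f (word_src zs V)) e = 0" by (simp add: count_eq_zero_iff)
  then show ?thesis by (simp add: word_src_ren)
 qed
next
 fix E assume E: "closed_for (ren_verts f V) E \<and> E \<inter> word_names (ren_word f zs) (ren_verts f V) ~= {}"
 then obtain n where "n \<in> f -` E" "n \<in> word_names zs V" unfolding word_names_ren by auto
 from wf_touch[OF wf _ this] obtain z where "z \<in> set zs" "f (edge_of (snd z)) \<in> E" using E unfolding closed_for_ren by auto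
 then show "\<exists>z\<in>set (ren_word f zs). edge_of (snd z) \<in> E"
  by (intro bexI[of _ "map_prod id (ren_end f) z"]) (auto simp: ren_word_def)
qed

lemma wf_ren_iff:
 assumes inj: "inj_on f (word_names zs V)"
 shows "wf_word S (ren_word f zs) (ren_verts f V) \<longleftrightarrow> wf_word S zs V"
proof
 let ?g = "inv_into (word_names zs V) f"
 have "ren_word ?g (ren_word f zs) = zs" "ren_verts ?g (ren_verts f V) = V"
  using ren_cong[of zs V "?g \<circ> f" "%n. n"] inv_into_f_f[OF inj] by auto
 moreover have "inj_on ?g (word_names (ren_word f zs) (ren_verts f V))"
  by (simp add: word_names_ren inj_on_inv_into)
 ultimately show "wf_word S (ren_word f zs) (ren_verts f V) ==> wf_word S zs V" using wf_ren by metis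
qed (rule wf_ren[OF inj])

lemma wf_vertices:
 assumes "word_src [] V = word_src [] V'" "word_tgt [] V = word_tgt [] V'" "\<And>E. closed_for V E \<longleftrightarrow> closed_for V' E"
 shows "wf_word S zs V \<longleftrightarrow> wf_word S zs V'"
proof -
 have s: "word_src zs V = word_src zs V'" "word_tgt zs V = word_tgt zs V'"
  using assms(1,2) by (auto simp: word_src_def word_tgt_def)
 then have "word_names zs V = word_names zs V'" by (simp flip: word_src_tgt_names)
 then show ?thesis unfolding wf_word_def s assms(3) by auto
qed

text \<open>The vertex which the relations \<open>STU1\<close> and \<open>STU2\<close> create from a head \<open>p\<close> and the end \<open>x\<close> above it.\<close>

fun stu_vertex :: "nat => strand_end => nat => nat \<times> nat \<times> nat" where
 "stu_vertex p (Head q) n = (p, q, n)"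
| "stu_vertex p (Tail e) n = (n, p, e)"

abbreviation set_edge :: "nat => strand_end => strand_end" where
 "set_edge n \<equiv> ren_end (%_. n)"

text \<open>The new edge \<open>n\<close> has one source and one target, and the remaining sources
  and targets are the same on both sides; a closed set of either diagram is turned into one of the
  other by letting \<open>n\<close> follow its neighbours. Hence freshness of \<open>n\<close> is
  all that has to be required when the relation is stated for words.\<close>

lemma wf_STU:
 assumes n: "n \<notin> word_names ((a, Head p) # (a, x) # zs) V"
 shows "wf_word S ((a, Head p) # (a, x) # zs) V \<longleftrightarrow> wf_word S ((a, set_edge n x) # zs) (V + {#stu_vertex p x n#})"
  (is "?L \<longleftrightarrow> ?R")
proof
 assume L: ?L
 have 0: "count (word_src zs V) n = 0" unfolding count_eq_zero_iff using n word_src_tgt_names[of zs V] by auto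
 show ?R unfolding wf_word_def
 proof (intro conjI allI impI)
  fix E assume "closed_for (V + {#stu_vertex p x n#}) E \<and> E \<inter> word_names ((a, set_edge n x) # zs) (V + {#stu_vertex p x n#}) ~= {}"
  then show "\<exists>z\<in>set ((a, set_edge n x) # zs). edge_of (snd z) \<in> E"
   using wf_touch[OF L, of E] by (cases x; cases "n \<in> E") auto
 next
  show "count (word_src ((a, set_edge n x) # zs) (V + {#stu_vertex p x n#})) m \<le> 1" for m
   using wf_wordD(3)[OF L, of m] n 0 by (cases x) auto
 qed (use wf_wordD(1,2)[OF L] in \<open>cases x; simp add: add_mset_commute\<close>)+
next
 assume R: ?R
 show ?L unfolding wf_word_def
 proof (intro conjI allI impI)
  show "count (word_src ((a, Head p) # (a, x) # zs) V) e \<le> 1" for e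
   using wf_wordD(3)[OF R, of e] by (cases x) (simp_all split: if_splits)
 next
  fix E assume E: "closed_for V E \<and> E \<inter> word_names ((a, Head p) # (a, x) # zs) V ~= {}"
  \<comment> \<open>A closed set of the diagram without the new vertex may contain \<open>n\<close>
    by accident; once the vertex is present this would force its neighbours into the set, so
    \<open>n\<close> is removed.\<close>
  have "closed_for V (E - {n}) \<longleftrightarrow> closed_for V E" by (rule closed_for_cong) (use n in \<open>auto simp: word_names_def\<close>)
  then show "\<exists>z\<in>set ((a, Head p) # (a, x) # zs). edge_of (snd z) \<in> E"
   using wf_touch[OF R, of "E - {n}"] E n by (cases x; cases "p \<in> E \<or> edge_of x \<in> E") auto
 qed (use wf_wordD(1,2)[OF R] in \<open>cases x; simp add: add_mset_commute\<close>)+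
qed

lemma wf_append:
 assumes d: "word_names xs V \<inter> word_names ys V' = {}" and wf: "wf_word S xs V" "wf_word S ys V'"
 shows "wf_word S (xs @ ys) (V + V')"
 unfolding wf_word_def
proof (intro conjI allI impI)
 show "fst ` set (xs @ ys) \<subseteq> S" using wf_wordD(1)[OF wf(1)] wf_wordD(1)[OF wf(2)] by auto
 show "word_src (xs @ ys) (V + V') = word_tgt (xs @ ys) (V + V')"
  using wf_wordD(2)[OF wf(1)] wf_wordD(2)[OF wf(2)] by (simp add: word_src_append word_tgt_append)
 fix e
 have "count (word_src xs V) e = 0 \<or> count (word_src ys V') e = 0"
  using d wf_names[OF wf(1)] wf_names[OF wf(2)] unfolding count_eq_zero_iff by blast
 then show "count (word_src (xs @ ys) (V + V')) e \<le> 1"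
  using wf_wordD(3)[OF wf(1), of e] wf_wordD(3)[OF wf(2), of e] by (auto simp: word_src_append)
next
 fix E assume E: "closed_for (V + V') E \<and> E \<inter> word_names (xs @ ys) (V + V') ~= {}"
 then obtain n where "n \<in> E" "n \<in> word_names xs V \<or> n \<in> word_names ys V'" by (auto simp: word_names_def)
 then show "\<exists>z\<in>set (xs @ ys). edge_of (snd z) \<in> E"
  using wf_touch[OF wf(1), of E n] wf_touch[OF wf(2), of E n] E by auto
qed

section \<open>Weight systems\<close>

text \<open>A combination of diagrams is a list of entries \<^term>\<open>(k, zs, V)\<close> with the coefficient \<^term>\<open>k\<close>.
 In the rules below the new edge only has to be fresh: in each relation either all diagrams are
 well-formed or none is.\<close>

type_synonym 'a comb = "(int \<times> 'a letter list \<times> verts) list"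

inductive rel :: "'a comb => bool" where
 AS: "rel [(1, zs, V + {#(p, q, r)#}), (1, zs, V + {#(q, p, r)#})]"
| IHX: "rel [(1, zs, V + {#(p, q, i), (i, r, e)#}), (1, zs, V + {#(q, r, i), (i, p, e)#}),
  (1, zs, V + {#(r, p, i), (i, q, e)#})]"
| STU: "n \<notin> word_names (xs @ [(a, Head p), (a, x)] @ ys) V ==>
  rel [(1, xs @ [(a, Head p), (a, x)] @ ys, V), (- 1, xs @ [(a, x), (a, Head p)] @ ys, V),
   (- 1, xs @ [(a, set_edge n x)] @ ys, V + {#stu_vertex p x n#})]"
| TC: "rel [(1, xs @ [(a, Tail e), (a, Tail f)] @ ys, V), (- 1, xs @ [(a, Tail f), (a, Tail e)] @ ys, V)]"

definition cval :: "('a letter list => verts => 'r::comm_ring_1) => 'a comb => 'r" where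
 "cval f c = (\<Sum>(k, zs, V)\<leftarrow>c. of_int k * f zs V)"

lemma cval_simps [simp]: "cval f [] = 0" "cval f ((k, zs, V) # c) = of_int k * f zs V + cval f c"
 by (simp_all add: cval_def)

lemma cval_map: "cval f (map (%(k, zs, V). (k, g zs, h V)) c) = cval (%zs V. f (g zs) (h V)) c"
 by (induction c) auto

lemma cval_cong: "(\<And>k zs V. (k, zs, V) \<in> set c ==> f zs V = g zs V) ==> cval f c = cval g c"
 unfolding cval_def by (intro arg_cong[where f = sum_list] map_cong) auto

lemma cval_zero: "(\<And>k zs V. (k, zs, V) \<in> set c ==> f zs V = 0) ==> cval f c = 0"
proof (induction c)
 case (Cons x c)
 obtain k zs V where "x = (k, zs, V)" by (cases x)
 then show ?case using Cons.IH Cons.prems[of k zs V] Cons.prems by auto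
qed simp

lemma cval_lincomb: "cval (%zs V. x * f zs V + y * g zs V) c = x * cval f c + y * cval g c"
 by (induction c) (auto simp: algebra_simps)

lemma rel_wf: "rel c ==> (k, zs, V) \<in> set c ==> (k', zs', V') \<in> set c ==> wf_word S zs V \<longleftrightarrow> wf_word S zs' V'"
proof (induction rule: rel.induct)
 case (AS zs V p q r)
 have "wf_word S zs (V + {#(p, q, r)#}) \<longleftrightarrow> wf_word S zs (V + {#(q, p, r)#})"
  by (rule wf_vertices) (auto simp: word_src_def word_tgt_def)
 then show ?case using AS by auto
next
 case (IHX zs V p q i r e)
 have "wf_word S zs (V + {#(p, q, i), (i, r, e)#}) \<longleftrightarrow> wf_word S zs (V + {#(q, r, i), (i, p, e)#})" for p q r
  by (rule wf_vertices) (auto simp: word_src_def word_tgt_def)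
 from this[of p q r] this[of q r p] show ?case using IHX by auto
next
 case (STU n xs a p x ys V)
 have p: "wf_word S (xs @ y # ys) U = wf_word S (y # xs @ ys) U" "wf_word S (xs @ y # z # ys) U = wf_word S (y # z # xs @ ys) U"
  "wf_word S ((a, x) # (a, Head p) # xs @ ys) U = wf_word S ((a, Head p) # (a, x) # xs @ ys) U" for y z U
  by (rule wf_perm; simp)+
 have "wf_word S ((a, Head p) # (a, x) # xs @ ys) V \<longleftrightarrow> wf_word S ((a, set_edge n x) # xs @ ys) (V + {#stu_vertex p x n#})"
  by (rule wf_STU) (use STU(1) in auto)
 then show ?case using STU(2,3) by (auto simp: p)
next
 case (TC xs a e f ys V)
 have "mset (xs @ [(a, Tail e), (a, Tail f)] @ ys) = mset (xs @ [(a, Tail f), (a, Tail e)] @ ys)" by simp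
 from wf_perm[OF this] show ?case using TC by auto
qed

abbreviation tail_count :: "'a letter list => nat" where
 "tail_count zs \<equiv> length (filter (is_Tail \<circ> snd) zs)"

lemma rel_tails: "rel c ==> (k, zs, V) \<in> set c ==> (k', zs', V') \<in> set c ==> tail_count zs = tail_count zs'"
 by (cases rule: rel.cases) auto

lemma tail_count_ren [simp]: "tail_count (ren_word f zs) = tail_count zs"
 by (induction zs) auto

text \<open>All relations are local: they survive injective renaming and surrounding letters and
  vertices. Disjointness from the surrounding names keeps the new edge of \<open>STU\<close>
  fresh.\<close>

lemma rel_context:
 assumes "rel c" and g: "inj g" and d: "range g \<inter> word_names (A @ B) VX = {}"
 shows "rel (map (%(k, zs, V). (k, A @ ren_word g zs @ B, VX + ren_verts g V)) c)"
proof -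
 have fresh: "g r \<notin> word_names ((A @ ren_word g xs) @ ren_word g us @ (ren_word g ys @ B)) (VX + ren_verts g V)"
  if "r \<notin> word_names (xs @ us @ ys) V" for r xs us ys V
 proof -
  have "word_names ((A @ ren_word g xs) @ ren_word g us @ (ren_word g ys @ B)) (VX + ren_verts g V) =
    word_names (A @ B) VX \<union> word_names (ren_word g (xs @ us @ ys)) (ren_verts g V)" by (auto simp: word_names_def)
  moreover have "g r \<notin> g ` word_names (xs @ us @ ys) V" using that g by (auto dest: injD)
  ultimately show ?thesis using d unfolding word_names_ren by blast
 qed
 show ?thesis using assms(1)
 proof cases
  case (AS zs V p q r) then show ?thesis
   using rel.AS[of "A @ ren_word g zs @ B" "VX + ren_verts g V" "g p" "g q" "g r"] by simp
 next
  case (IHX zs V p q i r e) then show ?thesis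
   using rel.IHX[of "A @ ren_word g zs @ B" "VX + ren_verts g V" "g p" "g q" "g i" "g r" "g e"] by simp
 next
  case (STU n xs a p x ys V)
  have "stu_vertex (g p) (ren_end g x) (g n) = (case stu_vertex p x n of (p, q, r) => (g p, g q, g r))" by (cases x) auto
  then show ?thesis
   using rel.STU[of "g n" "A @ ren_word g xs" a "g p" "ren_end g x" "ren_word g ys @ B" "VX + ren_verts g V"]
    fresh[of n xs "[(a, Head p), (a, x)]" ys V] STU by (simp add: comp_def ren_verts_def)
 next
  case (TC xs a e f ys V) then show ?thesis
   using rel.TC[of "A @ ren_word g xs" a "g e" "g f" "ren_word g ys @ B" "VX + ren_verts g V"] by simp
 qed
qed

text \<open>A renaming \<open>f\<close> of an inserted diagram, whose edges are named through
  \<open>g\<close>, is transported to the composite so that it fixes the names of the context. It is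
  injective on the names in use and on everything outside \<open>range g\<close>, where the context
  lives.\<close>

lemma extend_renaming:
 assumes g: "inj g" and f: "inj_on f N"
 obtains F where "\<And>n. F (g n) = g (f n)" "\<And>n. n \<notin> range g ==> F n = n" "inj_on F (g ` N \<union> - range g)"
proof
 let ?F = "%n. if n \<in> range g then g (f (inv g n)) else n"
 show F: "?F (g n) = g (f n)" "m \<notin> range g ==> ?F m = m" for n m using g by auto
 show "inj_on ?F (g ` N \<union> - range g)"
  using f g F unfolding inj_on_Un by (auto simp: inj_on_def dest: injD)
qed

lemma pairing_comb:
 fixes W :: "'a diagram => 'r::comm_ring_1"
 shows "(%D. cval (%zs V. delta (mk zs V) D) c :: 'r) \<in> series UNIV (%_. 0::nat) \<and>
  pairing (%D. cval (%zs V. delta (mk zs V) D) c) W = cval (%zs V. W (mk zs V)) c"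
proof (induction c)
 case (Cons x c)
 obtain k zs V where x: "x = (k, zs, V)" by (cases x)
 have d: "(delta (mk zs V) :: 'a diagram => 'r) \<in> series UNIV (%_. 0::nat)" by (rule series_delta) simp
 have b: "bounded_by UNIV (%_. 0::nat) 0 W" by (simp add: bounded_by_def)
 note s = series_scale[OF d, of "of_int k"]
 show ?case
  using conjunct2[OF Cons] unfolding x cval_simps
  by (simp add: pairing_add_left[OF s conjunct1[OF Cons] b] pairing_scale_left[OF d b] series_add[OF s conjunct1[OF Cons]])
qed simp

lemma mk_insert: "mk (xs @ map (Pair a) us @ ys) V =
  Diagram ((%c. proj c (xs @ ys))(a := proj a xs @ us @ proj a ys)) V"
 by (auto simp: mk_def fun_eq_iff)

lemma proj_concat: "proj a (concat xss) = concat (map (proj a) xss)"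
 by (induction xss) auto

section \<open>Words as presentations of diagrams on finitely many strands\<close>

locale strands =
 fixes S :: "'a set"
 assumes finite_S: "finite S"
begin

lemma sum_proj_mset:
 assumes "fst ` set zs \<subseteq> S"
 shows "(\<Sum>a\<in>S. mset (map edge_of (filter P (proj a zs)))) = mset (map (edge_of \<circ> snd) (filter (P \<circ> snd) zs))"
 using assms
proof (induction zs)
 case (Cons z zs)
 obtain a x where z: "z = (a, x)" by (cases z)
 have a: "a \<in> S" using Cons z by auto
 have "(\<Sum>c\<in>S. mset (map edge_of (filter P (proj c (z # zs))))) =
  (\<Sum>c\<in>S. (if c = a \<and> P x then {#edge_of x#} else {#}) + mset (map edge_of (filter P (proj c zs))))"
  by (rule sum.cong) (auto simp: z)
 then show ?case using a finite_S Cons unfolding sum.distrib by (cases "P x") (auto simp: z)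
qed simp

lemma mk_diagrams: "mk zs V \<in> diagrams S \<longleftrightarrow> wf_word S zs V"
proof -
 have outside: "(\<forall>a. a \<notin> S --> proj a zs = []) \<longleftrightarrow> fst ` set zs \<subseteq> S"
  by (auto simp: proj_def filter_empty_conv)
 show ?thesis
 proof (cases "fst ` set zs \<subseteq> S \<and> word_src zs V = word_tgt zs V")
  case True
  have src: "sources S (mk zs V) = word_src zs V" and tgt: "targets S (mk zs V) = word_tgt zs V"
   using sum_proj_mset True by (auto simp: sources_def targets_def word_src_def word_tgt_def)
  have "(\<Union>a\<in>S. set (proj a zs)) = snd ` set zs" using True by (force simp: proj_def)
  then have "(\<exists>x\<in>(\<Union>a\<in>S. set (proj a zs)). edge_of x \<in> E) \<longleftrightarrow> (\<exists>x\<in>snd ` set zs. edge_of x \<in> E)" for E by simp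
  then have touch: "(\<exists>a\<in>S. \<exists>x\<in>set (strand (mk zs V) a). edge_of x \<in> E) \<longleftrightarrow> (\<exists>z\<in>set zs. edge_of (snd z) \<in> E)" for E
   by simp
  have cc: "component_closed (mk zs V) E \<longleftrightarrow> closed_for V E" for E by (simp add: component_closed_def closed_for_def)
  have nm: "set_mset (word_src zs V) = word_names zs V" using True word_src_tgt_names[of zs V] by auto
  \<comment> \<open>Closedness only depends on the names that occur, so the condition on sets of
    edges and the one on arbitrary closed sets can be exchanged.\<close>
  have c: "closed_for V (E \<inter> word_names zs V) \<longleftrightarrow> closed_for V E" for E by (rule closed_for_cong) (simp add: word_names_def)
  have "(\<forall>E. E \<subseteq> word_names zs V \<and> E ~= {} \<and> closed_for V E --> (\<exists>z\<in>set zs. edge_of (snd z) \<in> E)) \<longleftrightarrow>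
    (\<forall>E. closed_for V E \<and> E \<inter> word_names zs V ~= {} --> (\<exists>z\<in>set zs. edge_of (snd z) \<in> E))" (is "?A \<longleftrightarrow> ?B")
  proof (intro iffI allI impI)
   fix E assume ?A "closed_for V E \<and> E \<inter> word_names zs V ~= {}"
   then show "\<exists>z\<in>set zs. edge_of (snd z) \<in> E" using spec[OF \<open>?A\<close>, of "E \<inter> word_names zs V"] c[of E] by blast
  next
   fix E assume ?B "E \<subseteq> word_names zs V \<and> E ~= {} \<and> closed_for V E"
   then show "\<exists>z\<in>set zs. edge_of (snd z) \<in> E" by (simp add: inf.absorb1)
  qed
  then show ?thesis
   unfolding diagrams_def mem_Collect_eq src tgt touch cc edges_def nm wf_word_def using True outside by simp
 next
  case False
  have "sources S (mk zs V) = word_src zs V" "targets S (mk zs V) = word_tgt zs V" if "fst ` set zs \<subseteq> S"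
   using sum_proj_mset[OF that] by (auto simp: sources_def targets_def word_src_def word_tgt_def)
  then show ?thesis using outside False by (auto simp: diagrams_def wf_word_def)
 qed
qed

lemma edges_mk: "wf_word S zs V ==> edges S (mk zs V) = word_names zs V"
 using sum_proj_mset[of zs is_Tail, OF wf_wordD(1)] wf_names[of S zs V] unfolding edges_def sources_def
 by (simp add: word_src_def del: mset_map mset_filter)

abbreviation deg :: "'a diagram => nat" where "deg \<equiv> degree_diag S"

text \<open>Counted by sources, the edges are the tails plus the vertices; counted by targets, the
  heads plus twice the vertices. So the tails are as many as the heads and vertices together, and
  half of the total is the number of tails.\<close>

lemma degree_wf:
 assumes "wf_word S zs V"
 shows "deg (mk zs V) = tail_count zs"
proof -
 have "length zs = length (filter (is_Head \<circ> snd) zs) + tail_count zs"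
 proof (induction zs)
  case (Cons z zs) then show ?case by (cases z; cases "snd z") auto
 qed simp
 moreover have "(\<Sum>a\<in>S. length (proj a zs)) = length zs"
  using arg_cong[OF sum_proj_mset[of zs "%_. True"], of size] assms by (simp add: wf_word_def size_multiset_sum)
 moreover have "size (\<Sum>(p, q, r)\<in>#V. {#p, q#}) = 2 * size V" by (induction V) auto
 moreover have "size (word_src zs V) = size (word_tgt zs V)" using assms by (simp add: wf_word_def)
 ultimately show ?thesis
  unfolding degree_diag_def word_src_def word_tgt_def by (simp del: mset_map mset_filter)
qed

definition slist :: "'a list" where
 "slist = (SOME xs. set xs = S \<and> distinct xs)"

lemma slist: "set slist = S" "distinct slist"
 using someI_ex[OF finite_distinct_list[OF finite_S]] by (simp_all add: slist_def)

text \<open>The canonical word: strand after strand in a fixed order. It settles the ambiguity in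
  the order of letters on different strands.\<close>

definition word_of :: "'a diagram => 'a letter list" where
 "word_of D = concat (map (%a. map (Pair a) (strand D a)) slist)"

lemma word_of_mk: "word_of (mk zs V) = word_of (mk zs V')"
 by (simp add: word_of_def)

lemma mk_word_of:
 assumes "\<And>a. a \<notin> S ==> strand D a = []"
 shows "mk (word_of D) (vertices D) = D"
proof -
 have c: "concat (map (%c. if c = a then strand D c else []) xs) = (if a \<in> set xs then strand D a else [])"
  if "distinct xs" for a and xs :: "'a list"
  using that by (induction xs) auto
 have "proj a (word_of D) = strand D a" for a
  using c[OF slist(2), of a] slist(1) assms by (auto simp: word_of_def proj_concat comp_def)
 then show ?thesis unfolding mk_def by (simp add: diagram.expand)
qed

lemma mk_word_of_mk: "fst ` set zs \<subseteq> S ==> mk (word_of (mk zs V)) V = mk zs V"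
 using mk_word_of[of "mk zs V"] by (auto simp: proj_def filter_empty_conv)

lemma diagram_cases:
 assumes "D \<in> diagrams S"
 obtains zs V where "D = mk zs V" "wf_word S zs V"
proof (rule that)
 show "D = mk (word_of D) (vertices D)" using mk_word_of[of D] assms by (simp add: diagrams_def)
 then show "wf_word S (word_of D) (vertices D)" using assms mk_diagrams by metis
qed

lemma word_of_split:
 assumes "a \<in> S"
 shows "\<exists>xs ys. \<forall>us V. word_of (Diagram (s(a := X @ us @ Y)) V) = xs @ map (Pair a) us @ ys"
proof -
 obtain l1 l2 where l: "slist = l1 @ a # l2" using assms slist(1) by (metis split_list)
 have d: "a \<notin> set l1" "a \<notin> set l2" using slist(2) l by auto
 let ?c = "%l. concat (map (%c. map (Pair c) (s c)) l)"
 have c: "concat (map (%c. map (Pair c) ((s(a := L)) c)) l) = ?c l" if "a \<notin> set l" for l L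
  using that by (induction l) auto
 have "word_of (Diagram (s(a := X @ us @ Y)) V) =
  (?c l1 @ map (Pair a) X) @ map (Pair a) us @ (map (Pair a) Y @ ?c l2)" for us V
  unfolding word_of_def l using c[OF d(1)] c[OF d(2)] by simp
 then show ?thesis by blast
qed

text \<open>The letters moved by a relation are neighbours on one strand, so they remain neighbours
  in the canonical word. A function defined on words can therefore be tested on relations between
  canonical words.\<close>

lemma rel_word_of:
 assumes "rel c" "\<And>k zs V. (k, zs, V) \<in> set c ==> wf_word S zs V"
 shows "rel (map (%(k, zs, V). (k, word_of (mk zs {#}), V)) c)"
proof -
 have split: "\<exists>xs' ys'. (\<forall>us. word_of (mk (xs @ map (Pair a) us @ ys) {#}) = xs' @ map (Pair a) us @ ys') \<and>
   set (xs' @ ys') \<subseteq> set (xs @ ys)" if a: "a \<in> S" for a and xs ys :: "'a letter list"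
 proof -
  obtain xs' ys' where e: "\<And>us V. word_of (Diagram ((%c. proj c (xs @ ys))(a := proj a xs @ us @ proj a ys)) V) = xs' @ map (Pair a) us @ ys'"
   using word_of_split[OF a] by blast
  moreover have "set (word_of (mk zs V)) \<subseteq> set zs" for zs V by (auto simp: word_of_def proj_def)
  ultimately show ?thesis unfolding mk_insert using e[of "[]"] mk_insert[of xs a "[]" ys]
   by (metis append_Nil list.map(1))
 qed
 have fresh: "r \<notin> word_names (xs' @ us @ ys') V" if "r \<notin> word_names (xs @ us @ ys) V" "set (xs' @ ys') \<subseteq> set (xs @ ys)" for r xs ys xs' ys' us V
  using that by (auto simp: word_names_def)
 show ?thesis using assms(1)
 proof cases
  case (AS zs V p q r) then show ?thesis using rel.AS by simp
 next
  case (IHX zs V p q i r e) then show ?thesis using rel.IHX by simp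
 next
  case (STU n xs a p x ys V)
  have "wf_word S (xs @ [(a, Head p), (a, x)] @ ys) V" using assms(2)[of 1 "xs @ [(a, Head p), (a, x)] @ ys" V] STU(1) by simp
  then have "a \<in> S" using wf_wordD(1) by fastforce
  from split[OF this, of xs ys] obtain xs' ys' where w: "\<And>us. word_of (mk (xs @ map (Pair a) us @ ys) {#}) = xs' @ map (Pair a) us @ ys'"
   "set (xs' @ ys') \<subseteq> set (xs @ ys)" by blast
  show ?thesis
   using rel.STU[OF fresh[OF STU(2) w(2)]] w(1)[of "[Head p, x]"] w(1)[of "[x, Head p]"] w(1)[of "[set_edge n x]"] STU(1) by simp
 next
  case (TC xs a e f ys V)
  have "wf_word S (xs @ [(a, Tail e), (a, Tail f)] @ ys) V" using assms(2)[of 1 "xs @ [(a, Tail e), (a, Tail f)] @ ys" V] TC by simp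
  then have "a \<in> S" using wf_wordD(1) by fastforce
  from split[OF this, of xs ys] obtain xs' ys' where w: "\<And>us. word_of (mk (xs @ map (Pair a) us @ ys) {#}) = xs' @ map (Pair a) us @ ys'"
   "set (xs' @ ys') \<subseteq> set (xs @ ys)" by blast
  show ?thesis
   using rel.TC[of xs' a e f ys' V] w(1)[of "[Tail e, Tail f]"] w(1)[of "[Tail f, Tail e]"] TC by simp
 qed
qed

text \<open>These are the functionals killing \<open>aw_rels S\<close>
  (\<open>kills_iff_weight\<close>), but with values in any commutative ring. The relations have
  integer coefficients, so one notion serves both \<open>rat\<close> and
  \<open>rat poly\<close>.\<close>

definition weight :: "('a diagram => 'r::comm_ring_1) => bool" where
 "weight W \<longleftrightarrow> (\<forall>D. W D ~= 0 --> D \<in> diagrams S) \<and>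
  (\<forall>zs V f. wf_word S zs V --> inj_on f (word_names zs V) --> W (mk (ren_word f zs) (ren_verts f V)) = W (mk zs V)) \<and>
  (\<forall>c. rel c --> (\<forall>(k, zs, V)\<in>set c. wf_word S zs V) --> cval (%zs V. W (mk zs V)) c = 0)"

lemma weight_supp: "weight W ==> W D ~= 0 ==> D \<in> diagrams S"
 by (simp add: weight_def)

lemma weight_wf: "weight W ==> \<not> wf_word S zs V ==> W (mk zs V) = 0"
 using weight_supp mk_diagrams by metis

lemma weight_ren: "weight W ==> inj_on f (word_names zs V) ==> W (mk (ren_word f zs) (ren_verts f V)) = W (mk zs V)"
 using weight_wf[of W zs V] weight_wf[of W "ren_word f zs" "ren_verts f V"] wf_ren_iff[of f zs V S]
 by (cases "wf_word S zs V") (simp add: weight_def, simp)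

text \<open>Either all diagrams of a relation are well-formed or none is, and in the second case
  every term is zero. Later applications therefore only have to supply a fresh name.\<close>

lemma weight_rel:
 assumes W: "weight W" and c: "rel c"
 shows "cval (%zs V. W (mk zs V)) c = 0"
proof (cases "\<forall>(k, zs, V)\<in>set c. wf_word S zs V")
 case True
 then show ?thesis using assms by (simp add: weight_def)
next
 case False
 then obtain k zs V where "(k, zs, V) \<in> set c" "\<not> wf_word S zs V" by auto
 then show ?thesis using rel_wf[OF c] weight_wf[OF W] by (intro cval_zero) blast
qed

lemma weight_AS: "weight W ==> W (mk zs (V + {#(p, q, r)#})) + W (mk zs (V + {#(q, p, r)#})) = 0"
 using weight_rel[OF _ rel.AS] by simp

lemma weight_IHX: "weight W ==> W (mk zs (V + {#(p, q, i), (i, r, e)#})) + W (mk zs (V + {#(q, r, i), (i, p, e)#})) +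
  W (mk zs (V + {#(r, p, i), (i, q, e)#})) = 0"
 using weight_rel[OF _ rel.IHX, of W zs V p q i r e] by (simp add: add.assoc)

lemma weight_STU: "weight W ==> n \<notin> word_names (xs @ [(a, Head p), (a, x)] @ ys) V ==>
  W (mk (xs @ [(a, Head p), (a, x)] @ ys) V) - W (mk (xs @ [(a, x), (a, Head p)] @ ys) V) =
  W (mk (xs @ [(a, set_edge n x)] @ ys) (V + {#stu_vertex p x n#}))"
 using weight_rel[OF _ rel.STU, of W n xs a p x ys V] by (simp add: algebra_simps)

lemmas weight_STU1 = weight_STU[of _ _ _ _ _ "Head q" for q, unfolded ren_end_simps stu_vertex.simps]
lemmas weight_STU2 = weight_STU[of _ _ _ _ _ "Tail e" for e, unfolded ren_end_simps stu_vertex.simps]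

lemma weight_TC: "weight W ==> W (mk (xs @ [(a, Tail e), (a, Tail f)] @ ys) V) = W (mk (xs @ [(a, Tail f), (a, Tail e)] @ ys) V)"
 using weight_rel[OF _ rel.TC, of W xs a e f ys V] by simp

definition comb :: "'a comb => 'a diagram => rat" where
 "comb c D = cval (%zs V. delta (mk zs V) D) c"

inductive word_rel :: "'a comb => bool" where
 "inj_on f (word_names zs V) ==> wf_word S zs V ==> word_rel [(1, zs, V), (- 1, ren_word f zs, ren_verts f V)]"
| "rel c ==> \<forall>(k, zs, V)\<in>set c. wf_word S zs V ==> word_rel c"

lemma diagram_update:
 assumes "a \<in> S"
 obtains xs ys where "\<And>us V. Diagram (s(a := X @ us @ Y)) V \<in> diagrams S ==>
  Diagram (s(a := X @ us @ Y)) V = mk (xs @ map (Pair a) us @ ys) V \<and> wf_word S (xs @ map (Pair a) us @ ys) V"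
proof -
 obtain xs ys where w: "\<And>us V. word_of (Diagram (s(a := X @ us @ Y)) V) = xs @ map (Pair a) us @ ys"
  using word_of_split[OF assms, of s X Y] by blast
 have "mk (xs @ map (Pair a) us @ ys) V = Diagram (s(a := X @ us @ Y)) V"
  if "Diagram (s(a := X @ us @ Y)) V \<in> diagrams S" for us V
  using mk_word_of[of "Diagram (s(a := X @ us @ Y)) V"] that w by (simp add: diagrams_def)
 then show ?thesis using that mk_diagrams by metis
qed

text \<open>In the diagram with the new vertex, \<open>r\<close> is a source in addition to all
  sources of the old diagram, and no edge has two sources.\<close>

lemma fresh_STU:
 assumes "wf_word S zs V" "wf_word S zs' V'" "word_src zs' V' = add_mset r (word_src zs V)"
 shows "r \<notin> word_names zs V"
 using wf_wordD(3)[OF assms(2), of r] assms(3) unfolding wf_names[OF assms(1), symmetric] by (simp flip: count_eq_zero_iff)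

text \<open>The passage from the given presentation, with strands as functions, to relations between
  words. Freshness of the new edge, explicit in the word relations, is read off from well-formedness
  of the three diagrams.\<close>

lemma aw_rels_comb: "aw_rels S = comb ` Collect word_rel"
proof (intro equalityI subsetI)
 have I: "x \<in> comb ` Collect word_rel" if "word_rel c" "comb c = x" for c x using that by blast
 have stu: "(%D'. delta D1 D' - delta D2 D' - delta D3 D') \<in> comb ` Collect word_rel"
  if a: "a \<in> S" and D: "D1 = Diagram (s(a := X @ [Head p, x] @ Y)) V" "D2 = Diagram (s(a := X @ [x, Head p] @ Y)) V"
   "D3 = Diagram (s(a := X @ [set_edge n x] @ Y)) (V + {#stu_vertex p x n#})" "{D1, D2, D3} \<subseteq> diagrams S" for a s X p x Y V n D1 D2 D3
 proof -
  obtain xs ys where w: "\<And>us V. Diagram (s(a := X @ us @ Y)) V \<in> diagrams S ==>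
    Diagram (s(a := X @ us @ Y)) V = mk (xs @ map (Pair a) us @ ys) V \<and> wf_word S (xs @ map (Pair a) us @ ys) V"
   using diagram_update[OF a, of s X Y] by blast
  have D': "D1 = mk (xs @ [(a, Head p), (a, x)] @ ys) V" "D2 = mk (xs @ [(a, x), (a, Head p)] @ ys) V"
   "D3 = mk (xs @ [(a, set_edge n x)] @ ys) (V + {#stu_vertex p x n#})"
   and wf: "wf_word S (xs @ [(a, Head p), (a, x)] @ ys) V" "wf_word S (xs @ [(a, x), (a, Head p)] @ ys) V"
    "wf_word S (xs @ [(a, set_edge n x)] @ ys) (V + {#stu_vertex p x n#})"
   using w[of "[Head p, x]" V] w[of "[x, Head p]" V] w[of "[set_edge n x]" "V + {#stu_vertex p x n#}"] D by simp_all
  have "word_src (xs @ [(a, set_edge n x)] @ ys) (V + {#stu_vertex p x n#}) = add_mset n (word_src (xs @ [(a, Head p), (a, x)] @ ys) V)"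
   by (cases x) (simp_all add: word_src_def add_mset_commute)
  then have fr: "n \<notin> word_names (xs @ [(a, Head p), (a, x)] @ ys) V" by (rule fresh_STU[OF wf(1,3)])
  show ?thesis
   by (rule I[OF word_rel.intros(2)[OF rel.STU[OF fr]]]) (use wf in \<open>simp_all add: comb_def[abs_def] D' fun_eq_iff\<close>)
 qed
 fix x assume "x \<in> aw_rels S"
 then show "x \<in> comb ` Collect word_rel"
 proof cases
  case (iso D f)
  obtain zs V where z: "D = mk zs V" "wf_word S zs V" using diagram_cases[OF iso(2)] .
  then have "word_rel [(1, zs, V), (- 1, ren_word f zs, ren_verts f V)]" using iso(3) by (intro word_rel.intros(1)) (simp_all add: edges_mk)
  then show ?thesis by (rule I) (simp add: comb_def[abs_def] iso(1) z rename_mk)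
 next
  case (AS D1 s V p q r D2)
  obtain zs V' where "D1 = mk zs V'" "wf_word S zs V'" using diagram_cases[of D1] AS by auto
  then have D: "D1 = mk zs (V + {#(p, q, r)#})" "D2 = mk zs (V + {#(q, p, r)#})" using AS by (auto simp: mk_def)
  then have "word_rel [(1, zs, V + {#(p, q, r)#}), (1, zs, V + {#(q, p, r)#})]" using AS(4) by (intro word_rel.intros(2) rel.AS) (simp add: mk_diagrams)
  then show ?thesis by (rule I) (simp add: comb_def[abs_def] AS(1) D)
 next
  case (IHX D1 s V p q i r e D2 D3)
  obtain zs V' where "D1 = mk zs V'" "wf_word S zs V'" using diagram_cases[of D1] IHX by auto
  then have D: "D1 = mk zs (V + {#(p, q, i), (i, r, e)#})" "D2 = mk zs (V + {#(q, r, i), (i, p, e)#})"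
   "D3 = mk zs (V + {#(r, p, i), (i, q, e)#})" using IHX by (auto simp: mk_def)
  then have "word_rel [(1, zs, V + {#(p, q, i), (i, r, e)#}), (1, zs, V + {#(q, r, i), (i, p, e)#}), (1, zs, V + {#(r, p, i), (i, q, e)#})]"
   using IHX(5) by (intro word_rel.intros(2) rel.IHX) (simp add: mk_diagrams)
  then show ?thesis by (rule I) (simp add: comb_def[abs_def] IHX(1) D add.assoc)
 next
  case (STU1 a D1 s X p q Y V D2 D3 r)
  then show ?thesis using stu[of a D1 s X p "Head q" Y V D2 D3 r] by simp
 next
  case (STU2 a D1 s X p e Y V D2 D3 f)
  then show ?thesis using stu[of a D1 s X p "Tail e" Y V D2 D3 f] by simp
 next
  case (TC a D1 s X e f Y V D2)
  obtain xs ys where w: "\<And>us V. Diagram (s(a := X @ us @ Y)) V \<in> diagrams S ==>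
    Diagram (s(a := X @ us @ Y)) V = mk (xs @ map (Pair a) us @ ys) V \<and> wf_word S (xs @ map (Pair a) us @ ys) V"
   using diagram_update[OF TC(2), of s X Y] by blast
  have D: "D1 = mk (xs @ [(a, Tail e), (a, Tail f)] @ ys) V" "D2 = mk (xs @ [(a, Tail f), (a, Tail e)] @ ys) V"
   and wf: "wf_word S (xs @ [(a, Tail e), (a, Tail f)] @ ys) V" "wf_word S (xs @ [(a, Tail f), (a, Tail e)] @ ys) V"
   using w[of "[Tail e, Tail f]" V] w[of "[Tail f, Tail e]" V] TC(3-5) by simp_all
  show ?thesis
   by (rule I[OF word_rel.intros(2)[OF rel.TC]]) (use wf in \<open>simp_all add: comb_def[abs_def] TC(1) D\<close>)
 qed
next
 fix x assume "x \<in> comb ` Collect word_rel"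
 then obtain c where x: "x = comb c" "word_rel c" by blast
 show "x \<in> aw_rels S" using x(2)
 proof cases
  case (1 f zs V)
  have "(%D'. delta (mk zs V) D' - delta (rename f (mk zs V)) D') \<in> aw_rels S"
   by (rule aw_rels.iso) (use 1 in \<open>simp_all add: mk_diagrams edges_mk\<close>)
  then show ?thesis by (simp add: x 1 comb_def[abs_def] rename_mk)
 next
  case 2
  have d: "mk zs V \<in> diagrams S" if "(k, zs, V) \<in> set c" for k zs V using that 2(2) by (auto simp: mk_diagrams)
  show ?thesis using 2(1)
  proof cases
   case (AS zs V p q r)
   have "(%D'. delta (mk zs (V + {#(p, q, r)#})) D' + delta (mk zs (V + {#(q, p, r)#})) D') \<in> aw_rels S"
    by (rule aw_rels.AS[of _ "%a. proj a zs" V p q r]) (use d in \<open>auto simp: AS\<close>, auto simp: mk_def)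
   then show ?thesis by (simp add: x AS comb_def[abs_def])
  next
   case (IHX zs V p q i r e)
   have "(%D'. delta (mk zs (V + {#(p, q, i), (i, r, e)#})) D' + delta (mk zs (V + {#(q, r, i), (i, p, e)#})) D'
     + delta (mk zs (V + {#(r, p, i), (i, q, e)#})) D') \<in> aw_rels S"
    by (rule aw_rels.IHX[of _ "%a. proj a zs" V p q i r e]) (use d in \<open>auto simp: IHX\<close>, auto simp: mk_def)
   then show ?thesis by (simp add: x IHX comb_def[abs_def] add.assoc)
  next
   case (STU n xs a p x' ys V)
   note m = mk_insert[of xs a "[Head p, x']" ys V] mk_insert[of xs a "[x', Head p]" ys V] mk_insert[of xs a "[set_edge n x']" ys "V + {#stu_vertex p x' n#}"]
   have "wf_word S (xs @ [(a, Head p), (a, x')] @ ys) V" using 2(2) STU(1) by simp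
   then have "a \<in> S" using wf_wordD(1) by fastforce
   moreover have "{mk (xs @ [(a, Head p), (a, x')] @ ys) V, mk (xs @ [(a, x'), (a, Head p)] @ ys) V, mk (xs @ [(a, set_edge n x')] @ ys) (V + {#stu_vertex p x' n#})} \<subseteq> diagrams S"
    using 2(2) by (simp add: STU(1) mk_diagrams)
   ultimately have "(%D'. delta (mk (xs @ [(a, Head p), (a, x')] @ ys) V) D' - delta (mk (xs @ [(a, x'), (a, Head p)] @ ys) V) D' -
     delta (mk (xs @ [(a, set_edge n x')] @ ys) (V + {#stu_vertex p x' n#})) D') \<in> aw_rels S"
    using m by (cases x') (auto intro: aw_rels.STU1 aw_rels.STU2)
   then show ?thesis by (simp add: x comb_def[abs_def] STU(1) algebra_simps)
  next
   case (TC xs a e f ys V)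
   note m = mk_insert[of xs a "[Tail e, Tail f]" ys V] mk_insert[of xs a "[Tail f, Tail e]" ys V]
   have "wf_word S (xs @ [(a, Tail e), (a, Tail f)] @ ys) V" using 2(2) TC by simp
   then have "a \<in> S" using wf_wordD(1) by fastforce
   moreover have "{mk (xs @ [(a, Tail e), (a, Tail f)] @ ys) V, mk (xs @ [(a, Tail f), (a, Tail e)] @ ys) V} \<subseteq> diagrams S"
    using 2(2) by (simp add: TC mk_diagrams)
   ultimately show ?thesis using aw_rels.TC[OF _ m[unfolded list.map]] by (simp add: x comb_def[abs_def] TC)
  qed
 qed
qed

lemma homogeneous_aw_rels: "homogeneous_rels (diagrams S) deg (aw_rels S)"
 unfolding homogeneous_rels_def aw_rels_comb
proof safe
 fix c assume c: "word_rel c"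
 have nz: "\<exists>k zs V. (k, zs, V) \<in> set c \<and> D = mk zs V" if "comb c D ~= 0" for D
  using that cval_zero[of c "%zs V. delta (mk zs V) D :: rat"] unfolding comb_def delta_def by metis
 have "finite ((%(k, zs, V). mk zs V) ` set c)" by simp
 then show "finite {D. comb c D ~= 0}" by (rule rev_finite_subset) (use nz in force)
 have wf: "wf_word S zs V" and t: "tail_count zs = tail_count zs'" if "(k, zs, V) \<in> set c" "(k', zs', V') \<in> set c" for k zs V k' zs' V'
  using c that by (cases; auto intro: wf_ren rel_tails)+
 show "\<exists>n. \<forall>D. comb c D ~= 0 --> D \<in> diagrams S \<and> deg D = n"
 proof (cases c)
  case (Cons x c')
  obtain k zs V where x: "x = (k, zs, V)" by (cases x)
  show ?thesis
   using nz wf t[of _ _ _ k zs V] Cons x by (intro exI[of _ "tail_count zs"]) (fastforce simp: mk_diagrams degree_wf)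
 qed (simp add: comb_def)
qed

lemma kills_iff_weight:
 fixes W :: "'a diagram => rat"
 assumes "\<And>D. W D ~= 0 ==> D \<in> diagrams S"
 shows "kills (aw_rels S) W \<longleftrightarrow> weight W"
proof -
 have p: "pairing (comb c) W = cval (%zs V. W (mk zs V)) c" for c
  using pairing_comb[of c W] by (simp add: comb_def[abs_def])
 have "kills (aw_rels S) W \<longleftrightarrow> (\<forall>c. word_rel c --> cval (%zs V. W (mk zs V)) c = 0)"
  by (auto simp: kills_def aw_rels_comb p)
 also have "... \<longleftrightarrow> weight W"
 proof
  assume k: "\<forall>c. word_rel c --> cval (%zs V. W (mk zs V)) c = 0"
  show "weight W"
   unfolding weight_def using assms k[rule_format, OF word_rel.intros(1)] k[rule_format, OF word_rel.intros(2)] by auto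
 qed (auto elim!: word_rel.cases simp: weight_ren weight_rel)
 finally show ?thesis .
qed

lemma weight_zero: "weight (%_. 0)"
 by (simp add: weight_def cval_zero)

text \<open>An additive map commutes with integer combinations, and the relations have integer
  coefficients. The instances needed are differentiation in t, evaluation at a value of t, and the
  inclusion of constants.\<close>

lemma weight_hom:
 assumes W: "weight W" and h: "\<And>x y. h (x + y) = h x + h y"
 shows "weight (%D. h (W D))"
proof -
 have h0: "h 0 = 0" using h[of 0 0] by simp
 have "h (x * y) = of_int k * h y" if "x = of_int k" for x y k
 proof -
  have n: "h (- z) = - h z" for z using h[of z "- z"] by (simp add: h0 eq_neg_iff_add_eq_0 add.commute)
  have "h (of_nat m * y) = of_nat m * h y" for m by (induction m) (simp_all add: h0 h distrib_right)
  then show ?thesis unfolding that by (cases k) (simp_all add: n del: of_nat_Suc)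
 qed
 then have c: "h (cval (%zs V. W (mk zs V)) c) = cval (%zs V. h (W (mk zs V))) c" for c
  by (induction c) (auto simp: h0 h)
 have "W D ~= 0" if "h (W D) ~= 0" for D using that h0 by auto
 then show ?thesis
  unfolding weight_def using weight_supp[OF W] weight_ren[OF W] weight_rel[OF W] h0 by (auto simp flip: c)
qed

lemma weight_lincomb: "weight W ==> weight V ==> weight (%D. c * W D + d * V D)"
 unfolding weight_def cval_lincomb by (auto, metis mult_zero_right add_0)

lemma weight_sum: "(\<And>i. i \<in> I ==> weight (W i)) ==> weight (%D. \<Sum>i\<in>I. c i * W i D)"
 by (induction I rule: infinite_finite_induct) (auto simp: weight_zero weight_lincomb[where d = 1, simplified])

text \<open>All diagrams in a relation have the same number of tails, hence the same degree, so a
  relation is either kept or annihilated as a whole.\<close>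

lemma weight_restrict:
 assumes W: "weight W"
 shows "weight (%D. if deg D \<in> A then W D else 0)"
 unfolding weight_def
proof (intro conjI allI impI)
 fix zs :: "'a letter list" and V and f :: "nat => nat" assume w: "wf_word S zs V" and i: "inj_on f (word_names zs V)"
 show "(if deg (mk (ren_word f zs) (ren_verts f V)) \<in> A then W (mk (ren_word f zs) (ren_verts f V)) else 0) =
   (if deg (mk zs V) \<in> A then W (mk zs V) else 0)"
  by (simp add: degree_wf[OF w] degree_wf[OF wf_ren[OF i w]] weight_ren[OF W i])
next
 fix c assume c: "rel c" "\<forall>(k, zs, V)\<in>set c. wf_word S zs V"
 show "cval (%zs V. if deg (mk zs V) \<in> A then W (mk zs V) else 0) c = 0"
 proof (cases "\<exists>(k, zs, V)\<in>set c. tail_count zs \<in> A")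
  case True
  then obtain k' zs' V' where t: "(k', zs', V') \<in> set c" "tail_count zs' \<in> A" by blast
  have "deg (mk zs V) \<in> A" if "(k, zs, V) \<in> set c" for k zs V
   using degree_wf[of zs V] c(2) that rel_tails[OF c(1) that t(1)] t(2) by auto
  then have "cval (%zs V. if deg (mk zs V) \<in> A then W (mk zs V) else 0) c = cval (%zs V. W (mk zs V)) c"
   by (intro cval_cong) simp
  then show ?thesis using weight_rel[OF W c(1)] by simp
 next
  case False
  then show ?thesis using c(2) degree_wf by (intro cval_zero) fastforce
 qed
qed (use weight_supp[OF W] in \<open>auto split: if_splits\<close>)

end

section \<open>Normal ordering\<close>

definition hword :: "('a \<times> nat) list => 'a letter list" where
 "hword = map (%(a, p). (a, Head p))"

definition tword :: "('a \<times> nat) list => 'a letter list" where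
 "tword = map (%(a, e). (a, Tail e))"

lemma hword_simps [simp]: "hword [] = []" "hword ((a, p) # hw) = (a, Head p) # hword hw"
 "hword (hw @ hw') = hword hw @ hword hw'"
 by (auto simp: hword_def)

lemma tword_simps [simp]: "tword [] = []" "tword ((a, p) # tw) = (a, Tail p) # tword tw"
 "tword (tw @ tw') = tword tw @ tword tw'"
 by (auto simp: tword_def)

lemma word_names_hword [simp]: "word_names (hword hw) V = snd ` set hw \<union> vert_names V"
 by (auto simp: word_names_def hword_def image_image case_prod_beta)

lemma word_names_tword [simp]: "word_names (tword hw) V = snd ` set hw \<union> vert_names V"
 by (auto simp: word_names_def tword_def image_image case_prod_beta)

definition ren_tl :: "(nat => nat) => ('a \<times> nat) list => ('a \<times> nat) list" where
 "ren_tl f = map (%(a, n). (a, f n))"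

lemma ren_tl_simps [simp]: "ren_tl f [] = []" "ren_tl f ((a, n) # xs) = (a, f n) # ren_tl f xs"
 "ren_tl f (xs @ ys) = ren_tl f xs @ ren_tl f ys" "length (ren_tl f xs) = length xs"
 "ren_tl f (xs[i := (a, n)]) = (ren_tl f xs)[i := (a, f n)]"
 "i < length xs ==> ren_tl f xs ! i = (fst (xs ! i), f (snd (xs ! i)))"
 by (auto simp: ren_tl_def map_update split: prod.splits)

lemma ren_tl_id: "(\<And>n. n \<in> snd ` set xs ==> f n = n) ==> ren_tl f xs = xs"
 by (induction xs) auto

lemma ren_hword: "ren_word f (hword hw) = hword (ren_tl f hw)"
 by (induction hw) auto

lemma ren_tword: "ren_word f (tword hw) = tword (ren_tl f hw)"
 by (induction hw) auto

definition tails_at :: "'a => ('a \<times> nat) list => nat set" where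
 "tails_at a tw = {i. i < length tw \<and> fst (tw ! i) = a}"

lemma finite_tails_at [simp]: "finite (tails_at a tw)"
 by (simp add: tails_at_def)

lemma tails_at_update: "i \<in> tails_at a tw ==> tails_at b (tw[i := (a, n)]) = tails_at b tw"
 by (auto simp: tails_at_def nth_list_update)

lemma tails_at_map: "tails_at a (ren_tl f tw) = tails_at a tw"
 by (auto simp: tails_at_def)

text \<open>Sorts the word \<open>zs\<close> standing on top of the sorted diagram with heads \<open>hw\<close> and tails \<open>tw\<close>,
 by pushing each head of \<open>zs\<close> down: it passes all the tails or stops at one of them.  The name
 \<open>nu p\<close> is used for the edge between the stopped head \<open>p\<close> and the strand.\<close>

fun nord :: "(('a \<times> nat) list => ('a \<times> nat) list => verts => 'r::comm_ring_1) => (nat => nat) =>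
  ('a \<times> nat) list => ('a \<times> nat) list => verts => 'a letter list => 'r" where
 "nord u nu hw tw V [] = u hw tw V"
| "nord u nu hw tw V ((a, Tail e) # zs) = nord u nu hw (tw @ [(a, e)]) V zs"
| "nord u nu hw tw V ((a, Head p) # zs) = nord u nu (hw @ [(a, p)]) tw V zs -
   (\<Sum>i\<in>tails_at a tw. nord u nu hw (tw[i := (a, nu p)]) (V + {#(nu p, p, snd (tw ! i))#}) zs)"

definition head_edges :: "'a letter list => nat set" where
 "head_edges zs = {p. \<exists>a. (a, Head p) \<in> set zs}"

lemma head_edges_simps [simp]: "head_edges [] = {}" "head_edges ((a, Tail e) # zs) = head_edges zs"
 "head_edges ((a, Head e) # zs) = insert e (head_edges zs)"
 by (auto simp: head_edges_def)

text \<open>What is left of the relations among sorted diagrams: exchange of tails, renaming, AS,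
  IHX, and STU1 between neighbouring heads. Heads and tails are kept as two separate words, each
  running over all strands.\<close>

definition sorted_weight :: "(('a \<times> nat) list => ('a \<times> nat) list => verts => 'r::comm_ring_1) => bool" where
 "sorted_weight u \<longleftrightarrow>
  (\<forall>hw tw tw' V. mset tw = mset tw' --> u hw tw V = u hw tw' V) \<and>
  (\<forall>f hw tw V. bij f --> u (ren_tl f hw) (ren_tl f tw) (ren_verts f V) = u hw tw V) \<and>
  (\<forall>hw tw V p q r. u hw tw (V + {#(p, q, r)#}) + u hw tw (V + {#(q, p, r)#}) = 0) \<and>
  (\<forall>hw tw V p q r i e. u hw tw (V + {#(p, q, i), (i, r, e)#}) + u hw tw (V + {#(q, r, i), (i, p, e)#}) +
    u hw tw (V + {#(r, p, i), (i, q, e)#}) = 0) \<and>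
  (\<forall>xs ys a tw V p q r. r \<notin> word_names (hword (xs @ [(a, p), (a, q)] @ ys) @ tword tw) V -->
    u (xs @ [(a, p), (a, q)] @ ys) tw V - u (xs @ [(a, q), (a, p)] @ ys) tw V =
    u (xs @ [(a, r)] @ ys) tw (V + {#(p, q, r)#}))"

lemmas sw_perm = sorted_weight_def[THEN iffD1, THEN conjunct1, rule_format]
lemmas sw_ren = sorted_weight_def[THEN iffD1, THEN conjunct2, THEN conjunct1, rule_format]
lemmas sw_AS = sorted_weight_def[THEN iffD1, THEN conjunct2, THEN conjunct2, THEN conjunct1, rule_format]
lemmas sw_IHX = sorted_weight_def[THEN iffD1, THEN conjunct2, THEN conjunct2, THEN conjunct2, THEN conjunct1, rule_format]
lemmas sw_STU1 = sorted_weight_def[THEN iffD1, THEN conjunct2, THEN conjunct2, THEN conjunct2, THEN conjunct2, rule_format]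

lemma mset_update_perm:
 assumes "ta permutes {..<length ys}" "i < length ys"
 shows "mset ((permute_list ta ys)[i := x]) = mset (ys[ta i := x])"
 using assms permutes_in_image[OF assms(1), of i] by (simp add: mset_update permute_list_nth)

text \<open>Pushing a head down sums over all tails on its strand, so a permutation of the tails
  merely reindexes that sum.\<close>

lemma nord_perm:
 assumes u: "sorted_weight u"
 shows "mset tw = mset tw' ==> nord u nu hw tw V zs = nord u nu hw tw' V zs"
proof (induction zs arbitrary: hw tw tw' V)
 case Nil
 show ?case unfolding nord.simps by (rule sw_perm[OF u Nil])
next
 case (Cons z zs)
 obtain a x where z: "z = (a, x)" by (cases z)
 show ?case
 proof (cases x)
  case (Head p)
  obtain ta where ta: "ta permutes {..<length tw'}" "permute_list ta tw' = tw"
   using mset_eq_permutation[OF Cons.prems] by blast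
  have nth: "tw ! i = tw' ! ta i" if "i < length tw'" for i
   using permute_list_nth[OF ta(1)] ta(2) that by blast
  have len: "length tw = length tw'" using ta(2) by auto
  have bij: "bij_betw ta (tails_at a tw) (tails_at a tw')"
  proof (rule bij_betw_imageI)
   show "inj_on ta (tails_at a tw)"
    by (rule inj_on_subset[OF permutes_inj[OF ta(1)] subset_UNIV])
   have in_im: "ta i < length tw' \<longleftrightarrow> i < length tw'" for i
    using permutes_in_image[OF ta(1), of i] by simp
   have iff: "i \<in> tails_at a tw \<longleftrightarrow> ta i \<in> tails_at a tw'" for i
    unfolding tails_at_def mem_Collect_eq in_im len using nth[of i] by metis
   show "ta ` tails_at a tw = tails_at a tw'"
   proof (intro equalityI subsetI)
    fix j assume "j \<in> ta ` tails_at a tw"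
    then show "j \<in> tails_at a tw'" using iff by blast
   next
    fix j assume j: "j \<in> tails_at a tw'"
    obtain i where "j = ta i" using permutes_surj[OF ta(1)] by (metis surjD)
    then show "j \<in> ta ` tails_at a tw" using j iff by blast
   qed
  qed
  have "(\<Sum>i\<in>tails_at a tw. nord u nu hw (tw[i := (a, nu p)]) (V + {#(nu p, p, snd (tw ! i))#}) zs) =
   (\<Sum>i\<in>tails_at a tw. nord u nu hw (tw'[ta i := (a, nu p)]) (V + {#(nu p, p, snd (tw' ! ta i))#}) zs)"
  proof (rule sum.cong)
   fix i assume "i \<in> tails_at a tw"
   then have i: "i < length tw'" using len by (auto simp: tails_at_def)
   show "nord u nu hw (tw[i := (a, nu p)]) (V + {#(nu p, p, snd (tw ! i))#}) zs =
     nord u nu hw (tw'[ta i := (a, nu p)]) (V + {#(nu p, p, snd (tw' ! ta i))#}) zs"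
    unfolding nth[OF i] by (rule Cons.IH) (use mset_update_perm[OF ta(1) i] ta(2) in simp)
  qed simp
  also have "... = (\<Sum>i\<in>tails_at a tw'. nord u nu hw (tw'[i := (a, nu p)]) (V + {#(nu p, p, snd (tw' ! i))#}) zs)"
   by (rule sum.reindex_bij_betw[OF bij])
  finally show ?thesis using Cons.IH[OF Cons.prems] by (simp add: z Head)
 next
  case (Tail e)
  then show ?thesis using Cons.IH[of "tw @ [(a, e)]" "tw' @ [(a, e)]"] Cons.prems by (simp add: z)
 qed
qed

lemma set_update_names:
 assumes "i \<in> tails_at a tw"
 shows "snd ` set (tw[i := (a, n)]) \<subseteq> insert n (snd ` set tw)" "snd (tw ! i) \<in> snd ` set tw"
 using assms set_update_subset_insert[of tw i "(a, n)"] by (auto simp: tails_at_def)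

lemma word_names_update:
 assumes "i \<in> tails_at a tw"
 shows "word_names (xs @ tword (tw[i := (a, n)])) (V + {#(n, p, snd (tw ! i))#}) \<subseteq>
  insert n (insert p (word_names (xs @ tword tw) V))"
 using set_update_names(1)[OF assms, of n] set_update_names(2)[OF assms] by simp blast

lemma word_names_append2: "word_names (xs @ ys) V = word_names xs V \<union> word_names ys {#}"
 by (auto simp: word_names_def)

text \<open>A common prefix turns the current sorted state into a signed sum of other sorted states,
  so a linear relation between suffixes that holds from every state carries over. \<open>F\<close>
  collects names reserved for the relation; the prefix must neither contain nor create them.\<close>

lemma nord_prefix:
 assumes base: "\<And>hw tw V. F \<inter> word_names (hword hw @ tword tw) V = {} ==>
   (\<Sum>(c, v, us)\<leftarrow>L. c * nord u nu hw tw (V + v) us) = 0"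
 shows "F \<inter> word_names (hword hw @ tword tw) V = {} ==> F \<inter> word_names xs {#} = {} ==> F \<inter> nu ` head_edges xs = {} ==>
  (\<Sum>(c, v, us)\<leftarrow>L. c * nord u nu hw tw (V + v) (xs @ us)) = 0"
proof (induction xs arbitrary: hw tw V)
 case Nil
 then show ?case using base by simp
next
 case (Cons z xs)
 obtain a x where z: "z = (a, x)" by (cases z)
 show ?case
 proof (cases x)
  case (Head p)
  let ?n = "%hw tw V. (\<Sum>(c, v, us)\<leftarrow>L. c * nord u nu hw tw (V + v) (xs @ us))"
  have 1: "?n (hw @ [(a, p)]) tw V = 0"
   by (rule Cons.IH) (use Cons.prems z Head in auto)
  have 2: "?n hw (tw[i := (a, nu p)]) (V + {#(nu p, p, snd (tw ! i))#}) = 0" if i: "i \<in> tails_at a tw" for i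
  proof (rule Cons.IH)
   have "nu p \<notin> F" "p \<notin> F" using Cons.prems z Head by auto
   then show "F \<inter> word_names (hword hw @ tword (tw[i := (a, nu p)])) (V + {#(nu p, p, snd (tw ! i))#}) = {}"
    using word_names_update[OF i, of "hword hw" "nu p" V p] Cons.prems(1) by blast
  qed (use Cons.prems z Head in auto)
  have "(\<Sum>(c, v, us)\<leftarrow>L. c * nord u nu hw tw (V + v) ((z # xs) @ us)) =
   ?n (hw @ [(a, p)]) tw V - (\<Sum>i\<in>tails_at a tw. ?n hw (tw[i := (a, nu p)]) (V + {#(nu p, p, snd (tw ! i))#}))"
  proof (induction L)
   case (Cons l L)
   obtain c v us where l: "l = (c, v, us)" by (cases l)
   show ?case using Cons by (simp add: l z Head sum.distrib right_diff_distrib sum_distrib_left)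
  qed simp
  then show ?thesis using 1 2 by simp
 next
  case (Tail e)
  then show ?thesis using Cons.IH[of hw "tw @ [(a, e)]" V] Cons.prems by (simp add: z)
 qed
qed

lemma nord_AS:
 assumes "sorted_weight u"
 shows "nord u nu hw tw (V + {#(p, q, r)#}) zs + nord u nu hw tw (V + {#(q, p, r)#}) zs = 0"
 using nord_prefix[of "{}" u nu "[(1, {#(p, q, r)#}, []), (1, {#(q, p, r)#}, [])]" hw tw V zs]
  sw_AS[OF assms] by simp

lemma nord_IHX:
 assumes "sorted_weight u"
 shows "nord u nu hw tw (V + {#(p, q, i), (i, r, e)#}) zs + nord u nu hw tw (V + {#(q, r, i), (i, p, e)#}) zs +
    nord u nu hw tw (V + {#(r, p, i), (i, q, e)#}) zs = 0"
 using nord_prefix[of "{}" u nu "[(1, {#(p, q, i), (i, r, e)#}, []), (1, {#(q, r, i), (i, p, e)#}, []),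
   (1, {#(r, p, i), (i, q, e)#}, [])]" hw tw V zs] sw_IHX[OF assms, of _ _ _ p q i r e] by (simp add: add.assoc)

lemma nord_ren:
 assumes u: "sorted_weight u" and f: "bij f"
 shows "(\<And>p. p \<in> head_edges zs ==> nu' (f p) = f (nu p)) ==>
  nord u nu' (ren_tl f hw) (ren_tl f tw) (ren_verts f V) (ren_word f zs) = nord u nu hw tw V zs"
proof (induction zs arbitrary: hw tw V)
 case Nil
 show ?case unfolding ren_word_simps nord.simps by (rule sw_ren[OF u f])
next
 case (Cons z zs)
 obtain a x where z: "z = (a, x)" by (cases z)
 show ?case
 proof (cases x)
  case (Head p)
  have "nord u nu' (ren_tl f hw) ((ren_tl f tw)[i := (a, f (nu p))])
    (ren_verts f V + {#(f (nu p), f p, snd (ren_tl f tw ! i))#}) (ren_word f zs) =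
   nord u nu hw (tw[i := (a, nu p)]) (V + {#(nu p, p, snd (tw ! i))#}) zs" if "i \<in> tails_at a tw" for i
   using Cons.IH[of hw "tw[i := (a, nu p)]" "V + {#(nu p, p, snd (tw ! i))#}"] Cons.prems that
   by (simp add: z Head tails_at_def)
  then show ?thesis
   using Cons.IH[of "hw @ [(a, p)]" tw V] Cons.prems by (simp add: z Head tails_at_map)
 next
  case (Tail e)
  then show ?thesis using Cons.IH[of hw "tw @ [(a, e)]" V] Cons.prems by (simp add: z)
 qed
qed

text \<open>Heads that have reached the bottom are never touched again, so a relation between two of
  them passes unchanged through the remaining letters.\<close>

lemma nord_STU1_heads:
 assumes u: "sorted_weight u"
 shows "r \<notin> word_names (hword (hs @ [(a, p), (a, q)] @ hs') @ tword tw @ zs) V ==> r \<notin> nu ` head_edges zs ==>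
  nord u nu (hs @ [(a, p), (a, q)] @ hs') tw V zs - nord u nu (hs @ [(a, q), (a, p)] @ hs') tw V zs =
  nord u nu (hs @ [(a, r)] @ hs') tw (V + {#(p, q, r)#}) zs"
proof (induction zs arbitrary: hs' tw V)
 case Nil
 then show ?case using sw_STU1[OF u, of r hs a p q hs' tw V] by simp
next
 case (Cons z zs)
 obtain b x where z: "z = (b, x)" by (cases z)
 show ?case
 proof (cases x)
  case (Head h)
  have 1: "nord u nu (hs @ [(a, p), (a, q)] @ hs') (tw[i := (b, nu h)]) (V + {#(nu h, h, snd (tw ! i))#}) zs -
    nord u nu (hs @ [(a, q), (a, p)] @ hs') (tw[i := (b, nu h)]) (V + {#(nu h, h, snd (tw ! i))#}) zs =
    nord u nu (hs @ [(a, r)] @ hs') (tw[i := (b, nu h)]) (V + {#(p, q, r)#} + {#(nu h, h, snd (tw ! i))#}) zs"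
   if i: "i \<in> tails_at b tw" for i
  proof -
   have "r ~= nu h" "r ~= h" "r \<notin> word_names zs {#}" using Cons.prems z Head by (auto simp: word_names_def)
   moreover have "r \<notin> word_names (hword (hs @ [(a, p), (a, q)] @ hs') @ tword tw) V" using Cons.prems by auto
   ultimately have "r \<notin> word_names (hword (hs @ [(a, p), (a, q)] @ hs') @ tword (tw[i := (b, nu h)]) @ zs)
     (V + {#(nu h, h, snd (tw ! i))#})"
    using word_names_update[OF i, of "hword (hs @ [(a, p), (a, q)] @ hs')" "nu h" V h]
    unfolding append_assoc[symmetric] word_names_append2[of _ zs] by blast
   from Cons.IH[OF this] show ?thesis using Cons.prems z Head by (simp add: add_mset_commute)
  qed
  have 2: "nord u nu (hs @ [(a, p), (a, q)] @ hs' @ [(b, h)]) tw V zs - nord u nu (hs @ [(a, q), (a, p)] @ hs' @ [(b, h)]) tw V zs =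
    nord u nu (hs @ [(a, r)] @ hs' @ [(b, h)]) tw (V + {#(p, q, r)#}) zs"
   using Cons.IH[of "hs' @ [(b, h)]" tw V] Cons.prems z Head by auto
  have ring: "(x - P) - (y - Q) = z - R" if "x - y = z" "P - Q = R" for x y z P Q R :: 'b
   using that by (simp add: algebra_simps)
  show ?thesis
   unfolding z Head nord.simps append_assoc
   by (rule ring[OF 2]) (unfold sum_subtractf[symmetric], rule sum.cong[OF refl 1])
 next
  case (Tail e)
  then show ?thesis using Cons.IH[of hs' "tw @ [(b, e)]" V] Cons.prems by (simp add: z)
 qed
qed

lemma nord_swap_names:
 assumes u: "sorted_weight u" and f: "bij f"
  and fx: "\<And>n. n \<in> word_names (hword hw @ zs) V \<union> nu ` head_edges zs ==> f n = n"
 shows "nord u nu hw (ren_tl f tw) (V + ren_verts f V') zs = nord u nu hw tw (V + V') zs"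
proof -
 have "f n = n" if "n \<in> snd ` set hw" for n using fx that by simp
 then have h: "ren_tl f hw = hw" by (rule ren_tl_id)
 have "ren_word f zs = zs" "ren_verts f V = V"
  using ren_cong[of zs V f "%n. n"] fx by auto
 moreover have "head_edges zs \<subseteq> word_names zs V" by (force simp: head_edges_def word_names_def)
 ultimately show ?thesis
  using nord_ren[OF u f, of zs nu nu hw tw "V + V'"] fx h by (simp add: subset_iff)
qed

text \<open>When \<open>e\<close> stands below the head \<open>p\<close> instead of above it,
  \<open>p\<close> has exactly one more tail at which it can stop. The recursion of
  \<open>nord\<close> is made for this relation.\<close>

lemma nord_STU2:
 "nord u nu hw tw V ((a, Head p) # (a, Tail e) # zs) - nord u nu hw tw V ((a, Tail e) # (a, Head p) # zs) =
  nord u nu hw tw (V + {#(nu p, p, e)#}) ((a, Tail (nu p)) # zs)"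
proof -
 have s: "tails_at a (tw @ [(a, e)]) = insert (length tw) (tails_at a tw)"
  by (auto simp: tails_at_def nth_append)
 have n: "length tw \<notin> tails_at a tw" by (simp add: tails_at_def)
 have "(\<Sum>i\<in>tails_at a tw. nord u nu hw ((tw @ [(a, e)])[i := (a, nu p)]) (V + {#(nu p, p, snd ((tw @ [(a, e)]) ! i))#}) zs) =
   (\<Sum>i\<in>tails_at a tw. nord u nu hw (tw[i := (a, nu p)] @ [(a, e)]) (V + {#(nu p, p, snd (tw ! i))#}) zs)"
  by (rule sum.cong) (auto simp: tails_at_def list_update_append1 nth_append)
 then show ?thesis by (simp add: s n)
qed

text \<open>The heart of the normal ordering. Terms in which exactly one head stops agree in both
  orders, and so do those in which the heads stop at different tails. If both stop at the same tail,
  the two orders give differently nested vertices, and by IHX and AS their difference is a stop of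
  the bracket. If both pass all tails, the relation is STU1 at the bottom.\<close>

lemma nord_STU1:
 assumes u: "sorted_weight u"
  and F: "F = {r, nu p, nu q, nu r}" "F \<inter> (word_names (hword hw @ tword tw @ zs) V \<union> {p, q} \<union> nu ` head_edges zs) = {}"
  and d: "distinct [r, nu p, nu q, nu r]"
 shows "nord u nu hw tw V ((a, Head p) # (a, Head q) # zs) - nord u nu hw tw V ((a, Head q) # (a, Head p) # zs) =
  nord u nu hw tw (V + {#(p, q, r)#}) ((a, Head r) # zs)"
proof -
 let ?I = "tails_at a tw" let ?g = "%hw tw V. nord u nu hw tw V zs"
 let ?e = "%i. snd (tw ! i)"
 let ?A = "%i j. ?g hw (tw[i := (a, nu p), j := (a, nu q)])
   (V + {#(nu p, p, ?e i)#} + {#(nu q, q, snd (tw[i := (a, nu p)] ! j))#})"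
 let ?B = "%i j. ?g hw (tw[j := (a, nu q), i := (a, nu p)])
   (V + {#(nu q, q, ?e j)#} + {#(nu p, p, snd (tw[j := (a, nu q)] ! i))#})"
 let ?C = "%i. ?g hw (tw[i := (a, nu r)]) (V + {#(p, q, r)#} + {#(nu r, r, ?e i)#})"
 have off: "?A i j = ?B i j" if "i ~= j" for i j
  using that by (simp add: list_update_swap add_mset_commute)
 have diag: "?A i i - ?B i i = - ?C i" if i: "i \<in> ?I" for i
 proof -
  have il: "i < length tw" using i by (simp add: tails_at_def)
  let ?D = "%V'. ?g hw (tw[i := (a, nu q)]) (V + V')"
  have nn: "e \<notin> F" if "e \<in> snd ` set tw" for e using that F(2) by auto
  have ei: "?e i \<notin> F" using nn[of "?e i"] il by auto
  have fx: "f n = n" if "n \<in> word_names (hword hw @ zs) V \<union> nu ` head_edges zs" "\<And>m. m \<notin> F ==> f m = m" for f :: "nat => nat" and n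
   using that(2)[of n] that(1) F(2) by auto
  \<comment> \<open>The three terms name the two new edges at the common tail differently.
    Exchanging reserved names brings \<open>?B\<close> and \<open>?C\<close> to the names used in
    \<open>?A\<close>: the strand edge becomes \<open>nu q\<close> and the inner edge
    \<open>nu p\<close>.\<close>
  let ?f = "transpose (nu p) (nu q)"
  have f: "bij ?f" "\<And>m. m \<notin> F ==> ?f m = m" using F(1) by (auto simp: transpose_def)
  let ?f' = "transpose r (nu p) \<circ> transpose (nu r) (nu q)"
  have f': "bij ?f'" "\<And>m. m \<notin> F ==> ?f' m = m" using F(1) by (auto simp: transpose_def bij_comp)
  have pq: "p \<notin> F" "q \<notin> F" using F(2) by auto
  have ff': "?f' n = n" if "n \<in> word_names (hword hw @ zs) V \<union> nu ` head_edges zs" for n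
   by (rule fx[OF that f'(2)])
  have ff: "?f n = n" if "n \<in> word_names (hword hw @ zs) V \<union> nu ` head_edges zs" for n
   by (rule fx[OF that f(2)])
  have twf': "ren_tl ?f' tw = tw" by (rule ren_tl_id) (rule f'(2)[OF nn])
  have twf: "ren_tl ?f tw = tw" by (rule ren_tl_id) (rule f(2)[OF nn])
  have A: "?A i i = ?D {#(nu q, q, nu p), (nu p, p, ?e i)#}"
   using il by (simp add: add_mset_commute)
  have "?B i i = nord u nu hw (tw[i := (a, nu p)]) (V + {#(nu q, q, ?e i), (nu p, p, nu q)#}) zs"
   using il by (simp add: add_mset_commute)
  also have "... = ?D {#(nu q, p, nu p), (nu p, q, ?e i)#}"
   using nord_swap_names[OF u f(1) ff, of hw zs V nu "tw[i := (a, nu p)]" "{#(nu q, q, ?e i), (nu p, p, nu q)#}"]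
    f(2)[OF pq(1)] f(2)[OF pq(2)] f(2)[OF ei] by (simp add: add_mset_commute twf)
  finally have B: "?B i i = ?D {#(nu q, p, nu p), (nu p, q, ?e i)#}" .
  have v: "?f' (nu r) = nu q" "?f' r = nu p" using d by (auto simp: transpose_def)
  have "?C i = nord u nu hw (tw[i := (a, nu r)]) (V + {#(p, q, r), (nu r, r, ?e i)#}) zs"
   by (simp add: add_mset_commute)
  also have "... = ?D {#(p, q, nu p), (nu q, nu p, ?e i)#}"
   using nord_swap_names[OF u f'(1) ff', of hw zs V nu "tw[i := (a, nu r)]" "{#(p, q, r), (nu r, r, ?e i)#}", symmetric]
   by (simp only: ren_tl_simps twf' ren_verts_simps v f'(2)[OF pq(1)] f'(2)[OF pq(2)] f'(2)[OF ei])
  finally have C: "?C i = ?D {#(p, q, nu p), (nu q, nu p, ?e i)#}" .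
  \<comment> \<open>The Jacobi identity for \<open>nu q\<close>, \<open>q\<close>, \<open>p\<close>
    with inner edge \<open>nu p\<close>; the three antisymmetries that follow bring its terms to the
    order of inputs in \<open>A\<close>, \<open>B\<close> and \<open>C\<close>.\<close>
  have 1: "?D {#(nu q, q, nu p), (nu p, p, ?e i)#} + ?D {#(q, p, nu p), (nu p, nu q, ?e i)#} +
    ?D {#(p, nu q, nu p), (nu p, q, ?e i)#} = 0" by (rule nord_IHX[OF u])
  have 2: "?D {#(q, p, nu p), (nu p, nu q, ?e i)#} + ?D {#(p, q, nu p), (nu p, nu q, ?e i)#} = 0"
   using nord_AS[OF u, of nu hw "tw[i := (a, nu q)]" "V + {#(nu p, nu q, ?e i)#}" q p "nu p" zs] by (simp add: add_mset_commute)
  have 3: "?D {#(p, q, nu p), (nu p, nu q, ?e i)#} + ?D {#(p, q, nu p), (nu q, nu p, ?e i)#} = 0"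
   using nord_AS[OF u, of nu hw "tw[i := (a, nu q)]" "V + {#(p, q, nu p)#}" "nu p" "nu q" "?e i" zs] by (simp add: add_mset_commute)
  have 4: "?D {#(p, nu q, nu p), (nu p, q, ?e i)#} + ?D {#(nu q, p, nu p), (nu p, q, ?e i)#} = 0"
   using nord_AS[OF u, of nu hw "tw[i := (a, nu q)]" "V + {#(nu p, q, ?e i)#}" p "nu q" "nu p" zs] by (simp add: add_mset_commute)
  show ?thesis unfolding A B C using 1 2 3 4 by (simp only: add_eq_0_iff2) (simp add: algebra_simps add_eq_0_iff)
 qed
 let ?P = "%j. ?g (hw @ [(a, p)]) (tw[j := (a, nu q)]) (V + {#(nu q, q, ?e j)#})"
 let ?Q = "%i. ?g (hw @ [(a, q)]) (tw[i := (a, nu p)]) (V + {#(nu p, p, ?e i)#})"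
 have L1: "nord u nu hw tw V ((a, Head p) # (a, Head q) # zs) =
   ?g (hw @ [(a, p), (a, q)]) tw V - (\<Sum>j\<in>?I. ?P j) - ((\<Sum>i\<in>?I. ?Q i) - (\<Sum>i\<in>?I. \<Sum>j\<in>?I. ?A i j))"
  unfolding nord.simps sum_subtractf[symmetric]
  by (intro arg_cong2[where f = "(-)"] sum.cong refl) (simp_all add: tails_at_update)
 have L2: "nord u nu hw tw V ((a, Head q) # (a, Head p) # zs) =
   ?g (hw @ [(a, q), (a, p)]) tw V - (\<Sum>i\<in>?I. ?Q i) - ((\<Sum>j\<in>?I. ?P j) - (\<Sum>j\<in>?I. \<Sum>i\<in>?I. ?B i j))"
  unfolding nord.simps sum_subtractf[symmetric]
  by (intro arg_cong2[where f = "(-)"] sum.cong refl) (simp_all add: tails_at_update)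
 have "(\<Sum>i\<in>?I. \<Sum>j\<in>?I. ?A i j) - (\<Sum>j\<in>?I. \<Sum>i\<in>?I. ?B i j) = (\<Sum>i\<in>?I. \<Sum>j\<in>?I. ?A i j - ?B i j)"
  unfolding sum.swap[of "%j i. ?B i j"] by (simp only: sum_subtractf)
 also have "... = (\<Sum>i\<in>?I. \<Sum>j\<in>?I. if j = i then - ?C i else 0)"
  by (intro sum.cong refl) (use off diag in auto)
 also have "... = - (\<Sum>i\<in>?I. ?C i)" by (simp add: sum_negf)
 finally have S: "(\<Sum>i\<in>?I. \<Sum>j\<in>?I. ?A i j) - (\<Sum>j\<in>?I. \<Sum>i\<in>?I. ?B i j) = - (\<Sum>i\<in>?I. ?C i)" .
 have H: "?g (hw @ [(a, p), (a, q)]) tw V - ?g (hw @ [(a, q), (a, p)]) tw V = ?g (hw @ [(a, r)]) tw (V + {#(p, q, r)#})"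
  using nord_STU1_heads[OF u, of r hw a p q "[]" tw zs V nu] F by auto
 have R: "nord u nu hw tw (V + {#(p, q, r)#}) ((a, Head r) # zs) = ?g (hw @ [(a, r)]) tw (V + {#(p, q, r)#}) - (\<Sum>i\<in>?I. ?C i)"
  by simp
 have ring: "(x - P - (Q - A)) - (y - Q - (P - B)) = z - C" if "x - y = z" "A - B = - C" for x y z P Q A B C :: 'b
  using that by (simp add: algebra_simps)
 show ?thesis unfolding L1 L2 R by (rule ring[OF H S])
qed

text \<open>Sorted weights are invariant under bijections of all names, whereas a renaming of
  diagrams is only injective on the finitely many names present.\<close>

lemma bij_extension:
 fixes f :: "nat => nat"
 assumes A: "finite A" and f: "inj_on f A"
 obtains g where "bij g" "\<And>x. x \<in> A ==> g x = f x"
proof -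
 let ?B = "A \<union> f ` A"
 have fB: "finite ?B" using A by simp
 have "card (?B - A) = card ?B - card A" "card (?B - f ` A) = card ?B - card (f ` A)"
  using A by (auto intro!: card_Diff_subset)
 then have "card (?B - A) = card (?B - f ` A)" using card_image[OF f] by simp
 then obtain h where h: "bij_betw h (?B - A) (?B - f ` A)"
  using finite_same_card_bij[of "?B - A" "?B - f ` A"] fB by (meson finite_Diff)
 define g where "g x = (if x \<in> A then f x else if x \<in> ?B then h x else x)" for x
 have 1: "bij_betw g A (f ` A)" using f by (simp add: bij_betw_def g_def inj_on_def)
 have 2: "bij_betw g (?B - A) (?B - f ` A)" using h by (rule bij_betw_cong[THEN iffD1, rotated]) (auto simp: g_def)
 have 3: "bij_betw g (- ?B) (- ?B)" by (rule bij_betw_cong[THEN iffD1, OF _ bij_betw_id]) (auto simp: g_def)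
 have B: "A \<union> (?B - A) = ?B" "f ` A \<union> (?B - f ` A) = ?B" by blast+
 have "bij_betw g (A \<union> (?B - A)) (f ` A \<union> (?B - f ` A))" by (rule bij_betw_combine[OF 1 2]) blast
 then have 4: "bij_betw g ?B ?B" unfolding B .
 have "bij_betw g (?B \<union> - ?B) (?B \<union> - ?B)" by (rule bij_betw_combine[OF 4 3]) blast
 then have "bij g" unfolding Compl_partition .
 then show ?thesis by (rule that) (simp add: g_def)
qed

abbreviation dbl :: "nat => nat" where "dbl \<equiv> %n. 2 * n"

lemma head_edges_append [simp]: "head_edges (xs @ ys) = head_edges xs \<union> head_edges ys"
 by (auto simp: head_edges_def)

lemma head_edges_ren: "head_edges (ren_word f zs) = f ` head_edges zs"
proof (induction zs)
 case (Cons z zs) then show ?case by (cases z; cases "snd z") auto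
qed simp

lemma head_edges_names: "head_edges zs \<subseteq> word_names zs V"
 by (force simp: head_edges_def word_names_def)

lemma count_head_edges: "p \<in> head_edges zs ==> 1 \<le> count (word_tgt zs V) p"
proof (induction zs)
 case (Cons z zs) then show ?case by (cases z; cases "snd z") auto
qed simp

text \<open>Different heads of a diagram have different names, so that they create different new
  edges when they are stopped at tails.\<close>

lemma wf_heads_distinct:
 assumes wf: "wf_word S (xs @ (a, Head p) # ys) V"
 shows "p \<notin> head_edges (xs @ ys)"
proof
 assume "p \<in> head_edges (xs @ ys)"
 then have "1 \<le> count (word_tgt (xs @ ys) V) p" by (rule count_head_edges)
 moreover have "word_tgt (xs @ (a, Head p) # ys) V = add_mset p (word_tgt (xs @ ys) V)" by (simp add: word_tgt_def)
 ultimately show False using wf_wordD(2,3)[OF wf] by (metis count_add_mset not_less_eq_eq One_nat_def)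
qed

fun sorted_letters :: "'a set => 'a letter list => bool" where
 "sorted_letters T [] = True"
| "sorted_letters T ((a, Tail e) # zs) = sorted_letters (insert a T) zs"
| "sorted_letters T ((a, Head e) # zs) = (a \<notin> T \<and> sorted_letters T zs)"

fun heads_of :: "'a letter list => ('a \<times> nat) list" where
 "heads_of [] = []"
| "heads_of ((a, Tail e) # zs) = heads_of zs"
| "heads_of ((a, Head e) # zs) = (a, e) # heads_of zs"

fun tails_of :: "'a letter list => ('a \<times> nat) list" where
 "tails_of [] = []"
| "tails_of ((a, Tail e) # zs) = (a, e) # tails_of zs"
| "tails_of ((a, Head e) # zs) = tails_of zs"

lemma nord_sorted:
 "sorted_letters T zs ==> fst ` set tw \<subseteq> T ==> nord u nu hw tw V zs = u (hw @ heads_of zs) (tw @ tails_of zs) V"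
proof (induction zs arbitrary: T hw tw)
 case (Cons z zs)
 obtain a x where z: "z = (a, x)" by (cases z)
 show ?case
 proof (cases x)
  case (Head p)
  then have "tails_at a tw = {}" using Cons.prems z by (force simp: tails_at_def)
  then show ?thesis using Cons.IH[of T tw "hw @ [(a, p)]"] Cons.prems z Head by simp
 next
  case (Tail e)
  then show ?thesis using Cons.IH[of "insert a T" "tw @ [(a, e)]" hw] Cons.prems z by auto
 qed
qed simp

lemma sorted_letters_proj:
 "sorted_letters T zs ==> proj a (hword (heads_of zs)) @ proj a (tword (tails_of zs)) = proj a zs \<and>
  (a \<in> T --> proj a (hword (heads_of zs)) = [])"
proof (induction T zs rule: sorted_letters.induct)
 case (2 T b e zs) then show ?case by (cases "a = b") auto
qed auto

lemma sorted_letters_mk: "sorted_letters {} zs ==> mk (hword (heads_of zs) @ tword (tails_of zs)) V = mk zs V"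
 using sorted_letters_proj[of "{}" zs] by (simp add: mk_def)

lemma sorted_letters_append:
 "sorted_letters T (xs @ ys) \<longleftrightarrow> sorted_letters T xs \<and> sorted_letters (T \<union> fst ` set (tails_of xs)) ys"
 by (induction T xs rule: sorted_letters.induct) auto

lemma sorted_letters_word_of:
 assumes "distinct l" "\<And>a. \<exists>xs ys. s a = xs @ ys \<and> list_all is_Head xs \<and> list_all is_Tail ys" "T \<inter> set l = {}"
 shows "sorted_letters T (concat (map (%a. map (Pair a) (s a)) l))"
 using assms(1,3)
proof (induction l arbitrary: T)
 case (Cons a l)
 obtain xs ys where s: "s a = xs @ ys" "list_all is_Head xs" "list_all is_Tail ys" using assms(2) by blast
 have h: "sorted_letters T (map (Pair a) xs) \<and> tails_of (map (Pair a) xs) = []" if "list_all is_Head xs" "a \<notin> T" for xs T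
  using that by (induction xs) (auto simp: is_Head_def)
 have t: "sorted_letters T (map (Pair a) ys) \<and> tails_of (map (Pair a) ys) = map (%y. (a, edge_of y)) ys" if "list_all is_Tail ys" for ys T
  using that by (induction ys arbitrary: T) (auto simp: is_Tail_def)
 have aT: "a \<notin> T" using Cons.prems by auto
 let ?T = "T \<union> fst ` set (tails_of (map (Pair a) (s a)))"
 have to: "tails_of (xs @ ys) = tails_of xs @ tails_of ys" for xs ys :: "'a letter list"
  by (induction xs rule: tails_of.induct) auto
 have "?T \<subseteq> insert a T" unfolding s(1) map_append to using h[OF s(2) aT] t[OF s(3)] by auto
 then have "sorted_letters ?T (concat (map (%a. map (Pair a) (s a)) l))"
  using Cons.IH[of ?T] Cons.prems by auto
 then show ?case using h[OF s(2) aT] t[OF s(3)] by (simp add: s(1) sorted_letters_append to)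
qed simp

lemma ren_heads_of: "heads_of (ren_word f zs) = ren_tl f (heads_of zs)"
 by (induction zs rule: heads_of.induct) auto

lemma ren_tails_of: "tails_of (ren_word f zs) = ren_tl f (tails_of zs)"
 by (induction zs rule: tails_of.induct) auto

lemma sorted_letters_ren: "sorted_letters T (ren_word f zs) = sorted_letters T zs"
 by (induction T zs rule: sorted_letters.induct) auto

lemma sw_ren_inj:
 assumes u: "sorted_weight u" and f: "inj_on f (word_names (hword hw @ tword tw) V)"
 shows "u (ren_tl f hw) (ren_tl f tw) (ren_verts f V) = u hw tw V"
proof -
 obtain g where g: "bij g" "\<And>x. x \<in> word_names (hword hw @ tword tw) V ==> g x = f x"
  using bij_extension[OF finite_word_names f] by blast
 have "ren_tl f hw = ren_tl g hw" "ren_tl f tw = ren_tl g tw"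
  unfolding ren_tl_def using g(2) by (auto intro!: map_cong) (force simp: image_iff)+
 moreover have "ren_verts f V = ren_verts g V" using ren_cong[of "[]" V f g] g(2) by auto
 ultimately show ?thesis using sw_ren[OF u g(1)] by simp
qed

section \<open>Extension of functions on sorted diagrams to weights\<close>

context strands begin

text \<open>Doubling all names leaves the odd ones free, and \<open>Suc\<close> then supplies for
  each head the name of the edge it creates when it stops. The canonical word makes the value a
  function of the diagram.\<close>

definition ext :: "(('a \<times> nat) list => ('a \<times> nat) list => verts => 'r::comm_ring_1) => 'a diagram => 'r" where
 "ext u D = (if D \<in> diagrams S
   then nord u Suc [] [] (ren_verts dbl (vertices D)) (ren_word dbl (word_of D)) else 0)"

lemma word_of_ren: "word_of (mk (ren_word f zs) V) = ren_word f (word_of (mk zs V'))"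
 unfolding word_of_def ren_word_def mk_sel map_concat map_map
 by (intro arg_cong[where f = concat] map_cong refl) (simp add: proj_ren[unfolded ren_word_def])

text \<open>The letters before the place of the relation are absorbed by \<open>nord_prefix\<close>,
  those after it belong to the suffixes. What remains is bookkeeping of names: the edge introduced
  by the relation has to be matched with the edges that \<open>nord\<close> introduces
  itself.\<close>

lemma nord_rel:
 assumes u: "sorted_weight u" and c: "rel c" and wf: "\<And>k zs V. (k, zs, V) \<in> set c ==> wf_word S zs V"
 shows "cval (%zs V. nord u Suc [] [] (ren_verts dbl V) (ren_word dbl zs)) c = 0"
 using c
proof cases
 case (AS zs V p q r)
 show ?thesis using nord_AS[OF u, of Suc "[]" "[]" "ren_verts dbl V" "2 * p" "2 * q" "2 * r" "ren_word dbl zs"] by (simp add: AS)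
next
 case (IHX zs V p q i r e)
 show ?thesis
  using nord_IHX[OF u, of Suc "[]" "[]" "ren_verts dbl V" "2 * p" "2 * q" "2 * i" "2 * r" "2 * e" "ren_word dbl zs"] by (simp add: IHX add.assoc)
next
 case (STU r xs a p x ys V)
 show ?thesis
 proof (cases x)
  case (Head q)
  note STU1 = STU[unfolded Head ren_end_simps stu_vertex.simps]
  have w: "wf_word S (xs @ [(a, Head p), (a, Head q)] @ ys) V" "wf_word S (xs @ [(a, Head q), (a, Head p)] @ ys) V"
   using wf STU1(1) by auto
  have ph: "p \<notin> head_edges (xs @ (a, Head q) # ys)" "q \<notin> head_edges (xs @ (a, Head p) # ys)"
   using wf_heads_distinct[of S xs a p "(a, Head q) # ys" V] wf_heads_distinct[of S xs a q "(a, Head p) # ys" V] w by simp_all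
  have rh: "r \<notin> head_edges (xs @ ys)" "r ~= p" "r ~= q" using STU1(2) head_edges_names[of xs V] head_edges_names[of ys V] by auto
  \<comment> \<open>The reserved names: the edge \<open>r\<close> of the relation and the edges
    created when \<open>p\<close>, \<open>q\<close> or \<open>r\<close> stops at a tail. The first
    is even and the others are odd, so parity separates them from most of the names in use.\<close>
  let ?F = "{2 * r, Suc (2 * p), Suc (2 * q), Suc (2 * r)}"
  have par: "Suc (2 * n) ~= 2 * m" "2 * m ~= Suc (2 * n)" for m n :: nat by presburger+
  have Fd: "?F \<inter> dbl ` A = {}" if "r \<notin> A" for A using that par by auto
  have Fs: "?F \<inter> Suc ` dbl ` A = {}" if "r \<notin> A" "p \<notin> A" "q \<notin> A" for A using that par by auto
  have "(\<Sum>(c, v, us)\<leftarrow>[(1, {#}, ren_word dbl ([(a, Head p), (a, Head q)] @ ys)),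
     (-1, {#}, ren_word dbl ([(a, Head q), (a, Head p)] @ ys)),
     (-1, {#(2 * p, 2 * q, 2 * r)#}, ren_word dbl ([(a, Head r)] @ ys))].
    c * nord u Suc [] [] (ren_verts dbl V + v) (ren_word dbl xs @ us)) = 0"
  proof (rule nord_prefix[of ?F])
   fix hw tw :: "('a \<times> nat) list" and V assume F: "?F \<inter> word_names (hword hw @ tword tw) V = {}"
   have "nord u Suc hw tw V ((a, Head (2 * p)) # (a, Head (2 * q)) # ren_word dbl ys) -
     nord u Suc hw tw V ((a, Head (2 * q)) # (a, Head (2 * p)) # ren_word dbl ys) =
     nord u Suc hw tw (V + {#(2 * p, 2 * q, 2 * r)#}) ((a, Head (2 * r)) # ren_word dbl ys)"
   proof (rule nord_STU1[OF u refl])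
    have "r \<notin> word_names ys {#}" using STU1(2) by (auto simp: word_names_def)
    then have "?F \<inter> word_names (ren_word dbl ys) (ren_verts dbl {#}) = {}" unfolding word_names_ren by (rule Fd)
    moreover have "?F \<inter> Suc ` head_edges (ren_word dbl ys) = {}"
     unfolding head_edges_ren by (rule Fs) (use ph rh in auto)
    moreover have "?F \<inter> dbl ` {p, q} = {}" by (rule Fd) (use rh in auto)
    ultimately show "?F \<inter> (word_names (hword hw @ tword tw @ ren_word dbl ys) V \<union> {2 * p, 2 * q} \<union>
      Suc ` head_edges (ren_word dbl ys)) = {}"
     using F word_names_append2[of "hword hw @ tword tw" "ren_word dbl ys" V] by simp
    show "distinct [2 * r, Suc (2 * p), Suc (2 * q), Suc (2 * r)]" using ph rh par by auto
   qed
   then show "(\<Sum>(c, v, us)\<leftarrow>[(1, {#}, ren_word dbl ([(a, Head p), (a, Head q)] @ ys)),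
     (-1, {#}, ren_word dbl ([(a, Head q), (a, Head p)] @ ys)),
     (-1, {#(2 * p, 2 * q, 2 * r)#}, ren_word dbl ([(a, Head r)] @ ys))].
    c * nord u Suc hw tw (V + v) us) = 0" by (simp add: algebra_simps del: nord.simps mult.commute mult.left_commute mult.assoc)
  next
   have "r \<notin> word_names xs V" using STU1(2) by auto
   then have "?F \<inter> word_names (ren_word dbl xs) (ren_verts dbl V) = {}" unfolding word_names_ren by (rule Fd)
   then show "?F \<inter> word_names (hword [] @ tword []) (ren_verts dbl V) = {}" "?F \<inter> word_names (ren_word dbl xs) {#} = {}"
    by (auto simp: word_names_def)
   show "?F \<inter> Suc ` head_edges (ren_word dbl xs) = {}"
    unfolding head_edges_ren by (rule Fs) (use ph rh in auto)
  qed
  then show ?thesis by (simp add: STU1(1) algebra_simps del: nord.simps mult.commute mult.left_commute mult.assoc)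
 next
  case (Tail e)
  note STU2 = STU[unfolded Tail ren_end_simps stu_vertex.simps]
  have w: "wf_word S (xs @ [(a, Head p), (a, Tail e)] @ ys) V" using wf STU2(1) by auto
  have ph: "p \<notin> head_edges (xs @ ys)" using wf_heads_distinct[of S xs a p "(a, Tail e) # ys" V] w by simp
  have rh: "r \<notin> head_edges (xs @ ys)" "r ~= p" "r ~= e" using STU2(2) head_edges_names[of xs V] head_edges_names[of ys V] by auto
  have main: "(\<Sum>(c, v, us)\<leftarrow>[(1, {#}, ren_word dbl ([(a, Head p), (a, Tail e)] @ ys)),
     (-1, {#}, ren_word dbl ([(a, Tail e), (a, Head p)] @ ys)),
     (-1, {#(Suc (2 * p), 2 * p, 2 * e)#}, (a, Tail (Suc (2 * p))) # ren_word dbl ys)].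
    c * nord u Suc [] [] (ren_verts dbl V + v) (ren_word dbl xs @ us)) = 0"
   by (rule nord_prefix[of "{}"])
    (use nord_STU2[of u Suc _ _ _ a "2 * p" "2 * e" "ren_word dbl ys"] in \<open>simp_all add: algebra_simps del: nord.simps mult.commute mult.left_commute mult.assoc\<close>)
  \<comment> \<open>The relation calls the new edge \<open>r\<close>, while the stopped head
    \<open>p\<close> creates \<open>Suc (2 * p)\<close>. Exchanging these names identifies the two
    terms, and it is compatible with \<open>Suc\<close> on the other heads since none of them is
    called \<open>p\<close> or \<open>r\<close>.\<close>
  let ?g = "transpose (Suc (2 * p)) (2 * r)"
  have par: "Suc (2 * n) ~= 2 * m" "2 * m ~= Suc (2 * n)" for m n :: nat by presburger+
  have gd: "?g (2 * n) = 2 * n" if "n ~= r" for n using that par by (simp add: transpose_def)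
  have "(?g \<circ> dbl) n = dbl n" if "n \<in> word_names (xs @ ys) V" for n using that STU2(2) gd[of n] by auto
  then have id: "ren_word (?g \<circ> dbl) (xs @ ys) = ren_word dbl (xs @ ys)" "ren_verts (?g \<circ> dbl) V = ren_verts dbl V"
   using ren_cong[of "xs @ ys" V "?g \<circ> dbl" dbl] by auto
  then have id': "ren_word (?g \<circ> dbl) xs = ren_word dbl xs" "ren_word (?g \<circ> dbl) ys = ren_word dbl ys"
   by (auto simp: ren_word_def)
  have "nord u Suc (ren_tl ?g []) (ren_tl ?g []) (ren_verts ?g (ren_verts dbl (V + {#(r, p, e)#})))
    (ren_word ?g (ren_word dbl (xs @ [(a, Tail r)] @ ys))) =
   nord u Suc [] [] (ren_verts dbl (V + {#(r, p, e)#})) (ren_word dbl (xs @ [(a, Tail r)] @ ys))"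
  proof (rule nord_ren[OF u])
   fix h assume "h \<in> head_edges (ren_word dbl (xs @ [(a, Tail r)] @ ys))"
   then obtain k where k: "h = 2 * k" "k \<in> head_edges (xs @ ys)" unfolding head_edges_ren by auto
   then have "k ~= r" "k ~= p" using ph rh by auto
   then show "Suc (?g h) = ?g (Suc h)" using par k by (simp add: transpose_def)
  qed auto
  then have "nord u Suc [] [] (ren_verts dbl (V + {#(r, p, e)#})) (ren_word dbl (xs @ [(a, Tail r)] @ ys)) =
    nord u Suc [] [] (ren_verts dbl V + {#(Suc (2 * p), 2 * p, 2 * e)#}) (ren_word dbl xs @ (a, Tail (Suc (2 * p))) # ren_word dbl ys)"
   unfolding ren_word_comp ren_verts_comp using id' id(2) gd[OF rh(2)[symmetric]] gd[OF rh(3)[symmetric]] by simp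
  then show ?thesis using main by (simp add: STU2(1) algebra_simps del: nord.simps mult.commute mult.left_commute mult.assoc)
 qed
next
 case (TC xs a e f ys V)
 have "(\<Sum>(c, v, us)\<leftarrow>[(1, {#}, ren_word dbl ([(a, Tail e), (a, Tail f)] @ ys)),
    (-1, {#}, ren_word dbl ([(a, Tail f), (a, Tail e)] @ ys))].
   c * nord u Suc [] [] (ren_verts dbl V + v) (ren_word dbl xs @ us)) = 0"
  by (rule nord_prefix[of "{}"])
   (use nord_perm[OF u, of "_ @ [(a, 2 * e), (a, 2 * f)]" "_ @ [(a, 2 * f), (a, 2 * e)]" Suc _ _ "ren_word dbl ys"] in simp_all)
 then show ?thesis by (simp add: TC del: nord.simps)
qed

text \<open>Together with \<open>ext_sorted\<close> this is the dual form of the uniqueness of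
  sorted forms: the relations of the whole space force no relation among sorted diagrams beyond
  those listed in \<open>sorted_weight\<close>.\<close>

lemma weight_ext:
 assumes u: "sorted_weight u"
 shows "weight (ext u)"
 unfolding weight_def
proof (intro conjI allI impI)
 fix zs :: "'a letter list" and V and f :: "nat => nat"
 assume wf: "wf_word S zs V" and inj: "inj_on f (word_names zs V)"
 obtain g where g: "bij g" "\<And>x. x \<in> word_names zs V ==> g x = f x"
  using bij_extension[OF finite_word_names inj] by blast
 let ?zs = "word_of (mk zs V)"
 have "set ?zs = set zs" using wf_wordD(1)[OF wf] by (force simp: word_of_def proj_def slist(1))
 then have nm: "word_names ?zs V = word_names zs V" by (simp add: word_names_def)
 \<comment> \<open>The renaming acts on each even name and on its odd successor in the same way, so
   that it commutes with \<open>Suc\<close> on the names of the heads.\<close>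
 let ?F = "%n. if even n then 2 * g (n div 2) else 2 * g (n div 2) + 1"
 have F: "bij ?F"
 proof (rule o_bij[of "%n. if even n then 2 * inv g (n div 2) else 2 * inv g (n div 2) + 1"])
  show "(%n. if even n then 2 * inv g (n div 2) else 2 * inv g (n div 2) + 1) \<circ> ?F = id"
   using bij_is_inj[OF g(1)] by (auto simp: fun_eq_iff inv_f_f elim: oddE)
  show "?F \<circ> (%n. if even n then 2 * inv g (n div 2) else 2 * inv g (n div 2) + 1) = id"
   using bij_is_surj[OF g(1)] by (auto simp: fun_eq_iff surj_f_inv_f elim: oddE)
 qed
 have "ext u (mk (ren_word f zs) (ren_verts f V)) =
  nord u Suc [] [] (ren_verts dbl (ren_verts f V)) (ren_word dbl (ren_word f ?zs))"
  using wf_ren[OF inj wf] word_of_ren[of f zs "ren_verts f V" V] by (simp add: ext_def mk_diagrams)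
 also have "... = nord u Suc (ren_tl ?F []) (ren_tl ?F []) (ren_verts ?F (ren_verts dbl V)) (ren_word ?F (ren_word dbl ?zs))"
  using ren_cong[of ?zs V "dbl \<circ> f" "?F \<circ> dbl"] g(2) nm by auto
 also have "... = nord u Suc [] [] (ren_verts dbl V) (ren_word dbl ?zs)"
  by (rule nord_ren[OF u F]) (auto simp: head_edges_ren)
 finally show "ext u (mk (ren_word f zs) (ren_verts f V)) = ext u (mk zs V)"
  using wf by (simp add: ext_def mk_diagrams)
next
 fix c assume c: "rel c" "\<forall>(k, zs, V)\<in>set c. wf_word S zs V"
 let ?c = "map (%(k, zs, V). (k, word_of (mk zs {#}), V)) c"
 have r: "rel ?c" by (rule rel_word_of) (use c in auto)
 have e: "ext u (mk zs V) = nord u Suc [] [] (ren_verts dbl V) (ren_word dbl (word_of (mk zs {#})))" if "wf_word S zs V" for zs V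
  using that word_of_mk[of zs V "{#}"] by (simp add: ext_def mk_diagrams)
 have "cval (%zs V. ext u (mk zs V)) c = cval (%zs V. nord u Suc [] [] (ren_verts dbl V) (ren_word dbl zs)) ?c"
  unfolding cval_map[where h = "%V. V"] using c(2) e by (intro cval_cong) blast
 also have "... = 0"
 proof (rule nord_rel[OF u r])
  fix k zs V assume "(k, zs, V) \<in> set ?c"
  then obtain zs' where z: "(k, zs', V) \<in> set c" "zs = word_of (mk zs' {#})" by auto
  then have w: "wf_word S zs' V" using c(2) by auto
  show "wf_word S zs V"
   using mk_word_of_mk[OF wf_wordD(1)[OF w], of V] w word_of_mk[of zs' V "{#}"] z(2) by (simp flip: mk_diagrams)
 qed
 finally show "cval (%zs V. ext u (mk zs V)) c = 0" .
qed (auto simp: ext_def split: if_splits)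

lemma sorted_word:
 assumes "D \<in> diagrams S" "sorted_diagram D"
 shows "sorted_letters {} (word_of D)" "D = mk (hword (heads_of (word_of D)) @ tword (tails_of (word_of D))) (vertices D)"
proof -
 show "sorted_letters {} (word_of D)"
  unfolding word_of_def by (rule sorted_letters_word_of[OF slist(2)]) (use assms(2) in \<open>auto simp: sorted_diagram_def\<close>)
 from sorted_letters_mk[OF this] show "D = mk (hword (heads_of (word_of D)) @ tword (tails_of (word_of D))) (vertices D)"
  using mk_word_of[of D] assms(1) by (simp add: diagrams_def)
qed

lemma ext_sorted:
 assumes u: "sorted_weight u" and D: "D \<in> diagrams S" "sorted_diagram D"
 shows "ext u D = u (heads_of (word_of D)) (tails_of (word_of D)) (vertices D)"
proof -
 let ?zs = "word_of D"
 have "ext u D = u (ren_tl dbl (heads_of ?zs)) (ren_tl dbl (tails_of ?zs)) (ren_verts dbl (vertices D))"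
  using nord_sorted[of "{}" "ren_word dbl ?zs" "[]" u Suc "[]" "ren_verts dbl (vertices D)"] sorted_word(1)[OF D] D
  by (simp add: ext_def sorted_letters_ren ren_heads_of ren_tails_of)
 also have "... = u (heads_of ?zs) (tails_of ?zs) (vertices D)"
  by (rule sw_ren_inj[OF u]) (simp add: inj_on_def)
 finally show ?thesis .
qed

text \<open>STU2 is applied to the tails of the strand from the top downwards, while tails on other
  strands are passed freely. Each summand creates a single vertex, so one fresh name serves for all
  of them. The formula has the shape of the recursion of \<open>nord\<close>.\<close>

lemma weight_push:
 assumes W: "weight W"
 shows "n \<notin> word_names (xs @ tword tw @ (a, Head p) # zs) V ==>
  W (mk (xs @ tword tw @ (a, Head p) # zs) V) = W (mk (xs @ (a, Head p) # tword tw @ zs) V) -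
   (\<Sum>i\<in>tails_at a tw. W (mk (xs @ tword (tw[i := (a, n)]) @ zs) (V + {#(n, p, snd (tw ! i))#})))"
proof (induction tw arbitrary: zs rule: rev_induct)
 case (snoc x tw)
 obtain b e where x: "x = (b, e)" by (cases x)
 let ?s = "%i. W (mk (xs @ tword (tw[i := (a, n)]) @ (b, Tail e) # zs) (V + {#(n, p, snd (tw ! i))#}))"
 have IH: "W (mk (xs @ tword tw @ (a, Head p) # (b, Tail e) # zs) V) =
   W (mk (xs @ (a, Head p) # tword tw @ (b, Tail e) # zs) V) - (\<Sum>i\<in>tails_at a tw. ?s i)"
  by (rule snoc.IH) (use snoc.prems x in auto)
 have up: "(\<Sum>i\<in>tails_at a tw. W (mk (xs @ tword ((tw @ [x])[i := (a, n)]) @ zs) (V + {#(n, p, snd ((tw @ [x]) ! i))#}))) =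
   (\<Sum>i\<in>tails_at a tw. ?s i)"
  by (rule sum.cong) (auto simp: tails_at_def list_update_append1 nth_append x)
 show ?case
 proof (cases "b = a")
  case True
  have "n \<notin> word_names ((xs @ tword tw) @ [(a, Head p), (a, Tail e)] @ zs) V" using snoc.prems x by auto
  from weight_STU2[OF W this]
  have "W (mk (xs @ tword tw @ (a, Head p) # (a, Tail e) # zs) V) - W (mk (xs @ tword tw @ (a, Tail e) # (a, Head p) # zs) V) =
   W (mk (xs @ tword tw @ (a, Tail n) # zs) (V + {#(n, p, e)#}))"
   by simp
  then have 1: "W (mk (xs @ tword tw @ (a, Tail e) # (a, Head p) # zs) V) =
   W (mk (xs @ tword tw @ (a, Head p) # (a, Tail e) # zs) V) - W (mk (xs @ tword tw @ (a, Tail n) # zs) (V + {#(n, p, e)#}))"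
   by (metis add_diff_cancel_left' diff_add_cancel)
  have s: "tails_at a (tw @ [x]) = insert (length tw) (tails_at a tw)" "length tw \<notin> tails_at a tw"
   using True x by (auto simp: tails_at_def nth_append)
  have sm: "(\<Sum>i\<in>tails_at a (tw @ [x]). W (mk (xs @ tword ((tw @ [x])[i := (a, n)]) @ zs) (V + {#(n, p, snd ((tw @ [x]) ! i))#}))) =
    W (mk (xs @ tword tw @ (a, Tail n) # zs) (V + {#(n, p, e)#})) + (\<Sum>i\<in>tails_at a tw. ?s i)"
   unfolding s(1) using s(2) up by (simp add: x)
  have ring: "y = z - t" if "y = w - b" "w = z - s" "t = b + s" for y z w b s t :: 'b
   using that by (simp add: algebra_simps)
  show ?thesis using ring[OF 1 IH[unfolded True] sm[unfolded True]] by (simp only: x True append_assoc append.simps tword_simps)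
 next
  case False
  have s: "tails_at a (tw @ [x]) = tails_at a tw" using False x by (auto simp: tails_at_def nth_append)
  have "mk (xs @ tword (tw @ [x]) @ (a, Head p) # zs) V = mk (xs @ tword tw @ (a, Head p) # (b, Tail e) # zs) V"
   using False by (auto simp: mk_def x fun_eq_iff)
  then show ?thesis using IH up s by (simp add: x)
 qed
qed (simp add: tails_at_def)

lemma sorted_diagram_mk: "sorted_diagram (mk (hword hw @ tword tw) V)"
 unfolding sorted_diagram_def
proof
 fix a
 have "list_all is_Head (proj a (hword hw))" by (induction hw) auto
 moreover have "list_all is_Tail (proj a (tword tw))" by (induction tw) auto
 ultimately show "\<exists>xs ys. strand (mk (hword hw @ tword tw) V) a = xs @ ys \<and> list_all is_Head xs \<and> list_all is_Tail ys"
  by auto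
qed

text \<open>Dual to the fact that sorted diagrams span: reading the word from below, every further
  letter is sorted into the part below it by \<open>weight_push\<close>, and fewer unsorted letters
  remain.\<close>

lemma weight_eq_sorted:
 assumes W: "weight W" "weight W'"
  and eq: "\<And>D. D \<in> diagrams S ==> sorted_diagram D ==> W D = W' D"
 shows "W = W'"
proof
 have main: "W (mk (hword hw @ tword tw @ zs) V) = W' (mk (hword hw @ tword tw @ zs) V)" for hw tw zs V
 proof (induction zs arbitrary: hw tw V)
  case Nil
  show ?case
   using eq[OF _ sorted_diagram_mk[of hw tw V]] weight_supp[OF W(1)] weight_supp[OF W(2)] by (metis append_Nil2)
 next
  case (Cons z zs)
  obtain a x where z: "z = (a, x)" by (cases z)
  show ?case
  proof (cases x)
   case (Head p)
   let ?w = "hword hw @ tword tw @ (a, Head p) # zs"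
   obtain n where n: "n \<notin> word_names ?w V" using ex_new_if_finite[OF infinite_UNIV_nat finite_word_names] by blast
   show ?thesis unfolding z Head weight_push[OF W(1) n] weight_push[OF W(2) n]
    using Cons.IH[of "hw @ [(a, p)]" tw V] Cons.IH by simp
  next
   case (Tail e)
   show ?thesis using Cons.IH[of hw "tw @ [(a, e)]" V] by (simp add: z Tail)
  qed
 qed
 fix D
 show "W D = W' D"
 proof (cases "D \<in> diagrams S")
  case True
  then obtain zs V where "D = mk zs V" using diagram_cases by metis
  then show ?thesis using main[of "[]" "[]" zs V] by simp
 next
  case False
  then show ?thesis using weight_supp W by metis
 qed
qed

end

section \<open>Stacking and merging\<close>

abbreviation odd_name :: "nat => nat" where "odd_name \<equiv> %n. Suc (2 * n)"

lemma inj_names [simp]: "inj dbl" "inj odd_name"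
 by (auto simp: inj_def)

lemma parity_disjoint: "dbl ` A \<inter> odd_name ` B = {}"
 by (auto, presburger)

lemma heads_tails_append [simp]: "heads_of (xs @ ys) = heads_of xs @ heads_of ys" "tails_of (xs @ ys) = tails_of xs @ tails_of ys"
 by (induction xs rule: heads_of.induct) auto

lemma heads_tails_word [simp]: "heads_of (hword hw) = hw" "tails_of (hword hw) = []" "heads_of (tword tw) = []" "tails_of (tword tw) = tw"
proof -
 show "heads_of (hword hw) = hw" "tails_of (hword hw) = []" by (induction hw) auto
 show "heads_of (tword tw) = []" "tails_of (tword tw) = tw" by (induction tw) auto
qed

lemma proj_heads_tails: "proj a (hword (heads_of zs)) = filter is_Head (proj a zs)" "proj a (tword (tails_of zs)) = filter is_Tail (proj a zs)"
 by (induction zs rule: heads_of.induct) auto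

lemma mset_heads_tails: "mset (hword (heads_of zs) @ tword (tails_of zs)) = mset zs"
 by (induction zs rule: heads_of.induct) auto

lemma stack_mk: "stack (mk zs V) (mk zs' V') = mk (ren_word dbl zs @ ren_word odd_name zs') (ren_verts dbl V + ren_verts odd_name V')"
 unfolding stack_def Let_def rename_mk by (simp add: mk_def)

lemma merge_mk: "merge (mk zs V) (mk zs' V') =
  mk (hword (heads_of (ren_word dbl zs) @ heads_of (ren_word odd_name zs')) @ tword (tails_of (ren_word dbl zs) @ tails_of (ren_word odd_name zs')))
   (ren_verts dbl V + ren_verts odd_name V')"
 unfolding merge_def Let_def rename_mk by (simp add: mk_def proj_heads_tails fun_eq_iff)

text \<open>The heads of \<^term>\<open>X\<close> are put at the bottom of \<^term>\<open>D\<close> and its tails on top.  For sorted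
 \<^term>\<open>D\<close> this is \<^term>\<open>merge X D\<close> up to the relation TC, but being local at the ends of the strands it respects
 the relations for all \<^term>\<open>D\<close>.\<close>

definition wrap :: "'a diagram => 'a diagram => 'a diagram" where
 "wrap X D = (let X' = rename dbl X; D' = rename odd_name D in Diagram
   (%a. filter is_Head (strand X' a) @ strand D' a @ filter is_Tail (strand X' a)) (vertices X' + vertices D'))"

lemma wrap_mk: "wrap (mk zs V) (mk zs' V') =
  mk (hword (heads_of (ren_word dbl zs)) @ ren_word odd_name zs' @ tword (tails_of (ren_word dbl zs))) (ren_verts dbl V + ren_verts odd_name V')"
 unfolding wrap_def Let_def rename_mk by (simp add: mk_def proj_heads_tails fun_eq_iff)

abbreviation under :: "'a diagram => 'a diagram => 'a diagram" where "under X D \<equiv> stack D X"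

text \<open>The operations inserting \<^term>\<open>D\<close> into the fixed diagram \<^term>\<open>X\<close>.\<close>

definition insertion :: "('a diagram => 'a diagram => 'a diagram) => bool" where
 "insertion K \<longleftrightarrow> (\<exists>f g L R. inj f \<and> inj g \<and> range f \<inter> range g = {} \<and>
   (\<forall>zs V zs' V'. mset (L zs @ R zs) = mset (ren_word f zs) \<and>
    K (mk zs V) (mk zs' V') = mk (L zs @ ren_word g zs' @ R zs) (ren_verts f V + ren_verts g V')))"

lemma insertionE:
 assumes "insertion K"
 obtains f g L R where "inj f" "inj g" "range f \<inter> range g = {}" "\<And>zs. mset (L zs @ R zs) = mset (ren_word f zs)"
  "\<And>zs V zs' V'. K (mk zs V) (mk zs' V') = mk (L zs @ ren_word g zs' @ R zs) (ren_verts f V + ren_verts g V')"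
proof -
 obtain f g L R where k: "inj f \<and> inj g \<and> range f \<inter> range g = {} \<and>
   (\<forall>zs V zs' V'. mset (L zs @ R zs) = mset (ren_word f zs) \<and>
    K (mk zs V) (mk zs' V') = mk (L zs @ ren_word g zs' @ R zs) (ren_verts f V + ren_verts g V'))"
  using assms unfolding insertion_def by (elim exE)
 show thesis by (rule that[of f g L R]) (use k in \<open>blast+\<close>)
qed

lemma insertions: "insertion stack" "insertion under" "insertion wrap"
proof -
 have d: "range dbl \<inter> range odd_name = {}" "range odd_name \<inter> range dbl = {}" using parity_disjoint[of UNIV UNIV] by auto
 show "insertion stack" unfolding insertion_def
  by (intro exI[of _ dbl] exI[of _ odd_name] exI[of _ "ren_word dbl"] exI[of _ "%_. []"]) (use d in \<open>simp add: stack_mk\<close>)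
 show "insertion under" unfolding insertion_def
  by (intro exI[of _ odd_name] exI[of _ dbl] exI[of _ "%_. []"] exI[of _ "ren_word odd_name"]) (use d in \<open>simp add: stack_mk add.commute\<close>)
 show "insertion wrap" unfolding insertion_def
  by (intro exI[of _ dbl] exI[of _ odd_name] exI[of _ "%zs. hword (heads_of (ren_word dbl zs))"] exI[of _ "%zs. tword (tails_of (ren_word dbl zs))"])
   (intro conjI allI inj_names d mset_heads_tails wrap_mk)
qed

context strands begin

lemma insertion_diagrams:
 assumes K: "insertion K" and X: "X \<in> diagrams S" and D: "D \<in> diagrams S"
 shows "K X D \<in> diagrams S" "deg (K X D) = deg X + deg D"
proof -
 obtain f g L R where k: "inj f" "inj g" "range f \<inter> range g = {}"
  "\<And>zs. mset (L zs @ R zs) = mset (ren_word f zs)"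
  "\<And>zs V zs' V'. K (mk zs V) (mk zs' V') = mk (L zs @ ren_word g zs' @ R zs) (ren_verts f V + ren_verts g V')"
  by (rule insertionE[OF K]) (rule that)
 obtain zs V zs' V' where z: "X = mk zs V" "wf_word S zs V" "D = mk zs' V'" "wf_word S zs' V'" using diagram_cases X D by metis
 have "wf_word S (ren_word f zs @ ren_word g zs') (ren_verts f V + ren_verts g V')"
  by (intro wf_append wf_ren z inj_on_subset[OF k(1)] inj_on_subset[OF k(2)]) (use k(3) in \<open>auto simp: word_names_ren\<close>)
 moreover have m: "mset (L zs @ ren_word g zs' @ R zs) = mset (ren_word f zs @ ren_word g zs')" using k(4)[of zs] by simp
 ultimately have w: "wf_word S (L zs @ ren_word g zs' @ R zs) (ren_verts f V + ren_verts g V')" using wf_perm[OF m] by simp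
 then show "K X D \<in> diagrams S" by (simp add: z k(5) mk_diagrams)
 have "tail_count ys = size (filter_mset (is_Tail \<circ> snd) (mset ys))" for ys :: "'a letter list" by (simp flip: mset_filter)
 from this[of "L zs @ ren_word g zs' @ R zs"] this[of "ren_word f zs @ ren_word g zs'"]
 have "tail_count (L zs @ ren_word g zs' @ R zs) = tail_count (ren_word f zs) + tail_count (ren_word g zs')"
  unfolding m by simp
 then show "deg (K X D) = deg X + deg D"
  unfolding z(1,3) k(5) degree_wf[OF w] degree_wf[OF z(2)] degree_wf[OF z(4)] by simp
qed

text \<open>For fixed \<open>X\<close> the operation surrounds the word of \<open>D\<close> with
  letters and adds vertices, all with disjoint names; hence relations and renamings of
  \<open>D\<close> become relations and renamings of the composite.\<close>

lemma weight_insertion: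
 assumes W: "weight W" and K: "insertion K" and X: "X \<in> diagrams S"
 shows "weight (%D. if D \<in> diagrams S then W (K X D) else 0)"
proof -
 obtain f g L R where k': "inj f" and k: "inj g" "range f \<inter> range g = {}"
  "\<And>zs. mset (L zs @ R zs) = mset (ren_word f zs)"
  "\<And>zs V zs' V'. K (mk zs V) (mk zs' V') = mk (L zs @ ren_word g zs' @ R zs) (ren_verts f V + ren_verts g V')"
  by (rule insertionE[OF K]) (rule that)
 obtain xs U where X: "X = mk xs U" using diagram_cases X by metis
 let ?U = "ren_verts f U"
 have s: "set (L xs) \<union> set (R xs) = set (ren_word f xs)" using k(3)[of xs] by (metis set_append set_mset_mset)
 then have "word_names (L xs @ R xs) ?U = word_names (ren_word f xs) ?U" by (simp add: word_names_def)
 then have d: "range g \<inter> word_names (L xs @ R xs) ?U = {}" unfolding word_names_ren using k(2) by blast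
 show ?thesis unfolding weight_def X
 proof (intro conjI allI impI)
  fix zs :: "'a letter list" and V and h :: "nat => nat" assume wf: "wf_word S zs V" and h: "inj_on h (word_names zs V)"
  obtain F where F: "\<And>n. F (g n) = g (h n)" "\<And>n. n \<notin> range g ==> F n = n" "inj_on F (g ` word_names zs V \<union> - range g)"
   using extend_renaming[OF k(1) h] by metis
  have "ren_word F (L xs @ R xs) = L xs @ R xs \<and> ren_verts F ?U = ?U"
   using ren_cong[of "L xs @ R xs" ?U F "%n. n"] F(2) d by auto
  then have "ren_word F (L xs) = L xs" "ren_word F (R xs) = R xs" "ren_verts F ?U = ?U" by (auto simp: ren_word_def)
  moreover have "F \<circ> g = g \<circ> h" using F(1) by auto
  ultimately have e: "K (mk xs U) (mk (ren_word h zs) (ren_verts h V)) = mk (ren_word F (L xs @ ren_word g zs @ R xs)) (ren_verts F (?U + ren_verts g V))"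
   by (simp add: k(4))
  have "word_names (L xs @ ren_word g zs @ R xs) (?U + ren_verts g V) = word_names (L xs @ R xs) ?U \<union> g ` word_names zs V"
   using word_names_ren[of g zs V] by (auto simp: word_names_def)
  then have i: "inj_on F (word_names (L xs @ ren_word g zs @ R xs) (?U + ren_verts g V))" using d by (intro inj_on_subset[OF F(3)]) auto
  have "W (K (mk xs U) (mk (ren_word h zs) (ren_verts h V))) = W (K (mk xs U) (mk zs V))"
   unfolding e k(4)[of xs U zs V] by (rule weight_ren[OF W i])
  then show "(if mk (ren_word h zs) (ren_verts h V) \<in> diagrams S then W (K (mk xs U) (mk (ren_word h zs) (ren_verts h V))) else 0) =
    (if mk zs V \<in> diagrams S then W (K (mk xs U) (mk zs V)) else 0)"
   using wf wf_ren[OF h wf] by (simp add: mk_diagrams)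
 next
  fix c assume c: "rel c" "\<forall>(k, zs, V)\<in>set c. wf_word S zs V"
  have "cval (%zs V. if mk zs V \<in> diagrams S then W (K (mk xs U) (mk zs V)) else 0) c =
    cval (%zs V. W (mk (L xs @ ren_word g zs @ R xs) (?U + ren_verts g V))) c"
   using c(2) by (intro cval_cong) (auto simp: mk_diagrams k(4))
  then show "cval (%zs V. if mk zs V \<in> diagrams S then W (K (mk xs U) (mk zs V)) else 0) c = 0"
   using weight_rel[OF W rel_context[OF c(1) k(1) d]]
   unfolding cval_map[of _ "%zs. L xs @ ren_word g zs @ R xs" "%V. ?U + ren_verts g V"] by simp
 qed (auto split: if_splits)
qed

section \<open>Exchange of tails, and merging compared with wrapping\<close>

lemma weight_swap_tails:
 assumes W: "weight W"
 shows "W (mk (xs @ (a, Tail e) # (b, Tail f) # ys) V) = W (mk (xs @ (b, Tail f) # (a, Tail e) # ys) V)"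
proof (cases "a = b")
 case False
 then have "mk (xs @ (a, Tail e) # (b, Tail f) # ys) V = mk (xs @ (b, Tail f) # (a, Tail e) # ys) V"
  by (auto simp: mk_def fun_eq_iff)
 then show ?thesis by simp
qed (use weight_TC[OF W, of xs a e f ys V] in simp)

lemma weight_move_tail:
 assumes W: "weight W"
 shows "W (mk (xs @ tword tw @ (a, Tail e) # ys) V) = W (mk (xs @ (a, Tail e) # tword tw @ ys) V)"
proof (induction tw arbitrary: xs)
 case (Cons t tw)
 obtain b f where t: "t = (b, f)" by (cases t)
 show ?case using Cons.IH[of "xs @ [(b, Tail f)]"] weight_swap_tails[OF W, of xs b f a e "tword tw @ ys" V] by (simp add: t)
qed simp

lemma weight_tail_perm:
 assumes W: "weight W"
 shows "mset tw = mset tw' ==> W (mk (xs @ tword tw @ ys) V) = W (mk (xs @ tword tw' @ ys) V)"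
proof (induction tw' arbitrary: tw xs)
 case (Cons t tw')
 obtain a e where t: "t = (a, e)" by (cases t)
 have "t \<in> set tw" using Cons.prems by (metis list.set_intros(1) set_mset_mset)
 then obtain l1 l2 where l: "tw = l1 @ t # l2" by (auto dest: split_list)
 have "mset (l1 @ l2) = mset tw'" using Cons.prems l by simp
 from Cons.IH[OF this, of "xs @ [(a, Tail e)]"] weight_move_tail[OF W, of xs l1 a e "tword l2 @ ys" V]
 show ?case by (simp add: l t)
qed simp

lemma weight_merge_wrap:
 assumes W: "weight W" and X: "X \<in> diagrams S" and D: "D \<in> diagrams S" "sorted_diagram D"
 shows "W (merge X D) = W (wrap X D)"
proof -
 obtain zs V where x: "X = mk zs V" using diagram_cases X by metis
 obtain hw tw V' where d: "D = mk (hword hw @ tword tw) V'" using sorted_word(2)[OF D] by blast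
 let ?H = "hword (heads_of (ren_word dbl zs) @ ren_tl odd_name hw)" and ?T = "tails_of (ren_word dbl zs)"
 have "W (mk (?H @ tword (?T @ ren_tl odd_name tw) @ []) U) = W (mk (?H @ tword (ren_tl odd_name tw @ ?T) @ []) U)" for U
  by (rule weight_tail_perm[OF W]) simp
 then show ?thesis by (simp add: x d merge_mk wrap_mk ren_heads_of ren_tails_of ren_hword ren_tword)
qed

lemma merge_diagrams:
 assumes "X \<in> diagrams S" "D \<in> diagrams S"
 shows "merge X D \<in> diagrams S" "deg (merge X D) = deg X + deg D"
proof -
 obtain zs V zs' V' where z: "X = mk zs V" "D = mk zs' V'" using diagram_cases assms by metis
 have m: "mset (hword (heads_of (ren_word dbl zs) @ heads_of (ren_word odd_name zs')) @ tword (tails_of (ren_word dbl zs) @ tails_of (ren_word odd_name zs')))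
   = mset (ren_word dbl zs @ ren_word odd_name zs')"
  using mset_heads_tails[of "ren_word dbl zs @ ren_word odd_name zs'"] by simp
 have l: "length (filter is_Head xs) + length (filter is_Tail xs) = length xs" for xs :: "strand_end list"
  by (induction xs) (auto, (metis strand_end.exhaust_disc strand_end.distinct_disc)+)
 have "length (strand (merge X D) a) = length (strand (stack X D) a)" for a
  using l[of "strand (rename dbl X) a"] l[of "strand (rename odd_name D) a"] by (simp add: merge_def stack_def Let_def)
 moreover have "vertices (merge X D) = vertices (stack X D)" by (simp add: merge_def stack_def Let_def)
 ultimately show "merge X D \<in> diagrams S" "deg (merge X D) = deg X + deg D"
  using insertion_diagrams[OF insertions(1) assms] wf_perm[OF m] unfolding degree_diag_def z merge_mk stack_mk mk_diagrams by simp_all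
qed

lemma sorted_weight_merge:
 assumes W: "weight W"
 shows "sorted_weight (%hw tw V. W (merge (mk (hword hw @ tword tw) V) (mk zs U)))"
proof -
 let ?H = "ren_tl odd_name (heads_of zs)" and ?T = "ren_tl odd_name (tails_of zs)" and ?U = "ren_verts odd_name U"
 let ?u = "%hw tw V. W (mk (hword (ren_tl dbl hw @ ?H) @ tword (ren_tl dbl tw @ ?T)) (?U + ren_verts dbl V))"
 have e: "W (merge (mk (hword hw @ tword tw) V) (mk zs U)) = ?u hw tw V" for hw tw V
  by (simp add: merge_mk ren_hword ren_tword ren_heads_of ren_tails_of add.commute)
 show ?thesis unfolding e sorted_weight_def
 proof (intro conjI allI impI)
  fix hw tw tw' :: "('a \<times> nat) list" and V
  assume "mset tw = mset tw'"
  then have "mset (ren_tl dbl tw @ ?T) = mset (ren_tl dbl tw' @ ?T)" by (simp add: ren_tl_def)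
  from weight_tail_perm[OF W this, of "hword (ren_tl dbl hw @ ?H)" "[]"] show "?u hw tw V = ?u hw tw' V" by simp
 next
  fix f :: "nat => nat" and hw tw :: "('a \<times> nat) list" and V assume f: "bij f"
  obtain F where F: "\<And>n. F (dbl n) = dbl (f n)" "\<And>n. n \<notin> range dbl ==> F n = n" "inj_on F (dbl ` UNIV \<union> - range dbl)"
   using extend_renaming[OF inj_names(1) bij_is_inj[OF f]] by metis
  have Fo: "F (odd_name n) = odd_name n" for n using F(2) parity_disjoint[of UNIV UNIV] by blast
  have c: "ren_tl F (ren_tl g xs) = ren_tl (%n. F (g n)) xs" "ren_tl dbl (ren_tl f xs) = ren_tl (%n. dbl (f n)) xs" for xs :: "('a \<times> nat) list" and g
   by (induction xs) auto
  have v: "ren_verts F (ren_verts g V) = ren_verts (%n. F (g n)) V" "ren_verts dbl (ren_verts f V) = ren_verts (%n. dbl (f n)) V" for V g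
   by (simp_all add: comp_def)
  have i: "inj F" using F(3) by (simp add: Un_commute)
  have "W (mk (ren_word F zs) (ren_verts F V)) = W (mk zs V)" for zs V
   by (rule weight_ren[OF W inj_on_subset[OF i subset_UNIV]])
  from this[of "hword (ren_tl dbl hw @ ?H) @ tword (ren_tl dbl tw @ ?T)" "?U + ren_verts dbl V"]
  show "?u (ren_tl f hw) (ren_tl f tw) (ren_verts f V) = ?u hw tw V"
   by (simp only: ren_word_simps ren_verts_simps ren_hword ren_tword ren_tl_simps c v F(1) Fo)
 next
  fix hw tw :: "('a \<times> nat) list" and V p q r
  show "?u hw tw (V + {#(p, q, r)#}) + ?u hw tw (V + {#(q, p, r)#}) = 0"
   using weight_AS[OF W, of _ "?U + ren_verts dbl V" "2 * p" "2 * q" "2 * r"] by simp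
 next
  fix hw tw :: "('a \<times> nat) list" and V p q r i e
  show "?u hw tw (V + {#(p, q, i), (i, r, e)#}) + ?u hw tw (V + {#(q, r, i), (i, p, e)#}) + ?u hw tw (V + {#(r, p, i), (i, q, e)#}) = 0"
   using weight_IHX[OF W, of _ "?U + ren_verts dbl V" "2 * p" "2 * q" "2 * i" "2 * r" "2 * e"] by simp
 next
  fix xs ys tw :: "('a \<times> nat) list" and a V p q r
  assume r: "r \<notin> word_names (hword (xs @ [(a, p), (a, q)] @ ys) @ tword tw) V"
  let ?ys = "hword (ren_tl dbl ys @ ?H) @ tword (ren_tl dbl tw @ ?T)"
  have sn: "snd ` set (ren_tl g zs) = g ` snd ` set zs" for g and zs :: "('a \<times> nat) list"
   by (simp add: ren_tl_def image_image case_prod_beta)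
  have "2 * r \<notin> odd_name ` A" for A by (auto, presburger)
  then have "2 * r \<notin> word_names (hword (ren_tl dbl xs) @ [(a, Head (2 * p)), (a, Head (2 * q))] @ ?ys) (?U + ren_verts dbl V)"
   using r by (simp add: sn vert_names_ren image_Un inj_image_mem_iff[OF inj_names(1)])
  from weight_STU1[OF W this]
  show "?u (xs @ [(a, p), (a, q)] @ ys) tw V - ?u (xs @ [(a, q), (a, p)] @ ys) tw V = ?u (xs @ [(a, r)] @ ys) tw (V + {#(p, q, r)#})" by simp
 qed
qed

text \<open>Merging separates heads from tails in its first argument, so it is not local there and a
  weight cannot be pulled back along it directly. It is pulled back on sorted diagrams and then
  extended by normal ordering. This makes the product on sorted diagrams independent of the sorted
  representative.\<close>

lemma merge_right_extension:
 assumes W: "weight W" and X: "X \<in> diagrams S"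
 shows "\<exists>U. weight U \<and> (\<forall>D\<in>diagrams S. sorted_diagram D --> U D = W (merge D X))"
proof -
 obtain zs V where X: "X = mk zs V" using diagram_cases X by metis
 note u = sorted_weight_merge[OF W, of zs V]
 show ?thesis
 proof (intro exI conjI ballI impI)
  show "weight (ext (%hw tw V'. W (merge (mk (hword hw @ tword tw) V') (mk zs V))))" by (rule weight_ext[OF u])
  fix D assume D: "D \<in> diagrams S" "sorted_diagram D"
  show "ext (%hw tw V'. W (merge (mk (hword hw @ tword tw) V') (mk zs V))) D = W (merge D X)"
   unfolding ext_sorted[OF u D] X using sorted_word(2)[OF D] by simp
 qed
qed

section \<open>Operators on weight systems\<close>

abbreviation dser :: "('a diagram => 'r::comm_ring_1) set" where "dser \<equiv> series (diagrams S) deg"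

definition positive :: "('a diagram => 'r::comm_ring_1) => bool" where
 "positive x \<longleftrightarrow> x \<in> dser \<and> (\<forall>X. x X ~= 0 --> 0 < deg X)"

text \<open>The bound is strict, so that \<open>wts 0\<close> consists of zero only and an operator
  of positive degree maps \<open>wts (Suc N)\<close> into \<open>wts N\<close>; inductions on the
  degree start there.\<close>

definition wts :: "nat => ('a diagram => 'r::comm_ring_1) set" where
 "wts N = {W. weight W \<and> (\<forall>D. W D ~= 0 --> deg D < N)}"

lemma wts_weight: "W \<in> wts N ==> weight W"
 by (simp add: wts_def)

lemma wts_bounded: "W \<in> wts N ==> bounded_by (diagrams S) deg N W"
 by (force simp: wts_def bounded_by_def)

lemma wts_0: "W \<in> wts 0 \<longleftrightarrow> W = (%_. 0)"
 by (auto simp: wts_def weight_zero)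

lemma wts_mono: "W \<in> wts N ==> N \<le> M ==> W \<in> wts M"
 by (force simp: wts_def)

lemma wts_lincomb: "W \<in> wts N ==> V \<in> wts N ==> (%D. c * W D + d * V D) \<in> wts N"
 unfolding wts_def mem_Collect_eq
 by (intro conjI weight_lincomb allI impI; (elim conjE)?; (assumption | metis add_0 mult_zero_right))

lemma wts_restrict: "weight W ==> (%D. if deg D \<in> {..<n} then W D else 0) \<in> wts n"
 unfolding wts_def mem_Collect_eq by (intro conjI weight_restrict) (auto split: if_splits)

lemma wts_hom: "W \<in> wts N ==> (\<And>x y. h (x + y) = h x + h y) ==> (%D. h (W D)) \<in> wts N"
 unfolding wts_def mem_Collect_eq using weight_hom[of W h] by (metis add_cancel_right_left)

text \<open>The transpose of inserting the series \<open>x\<close>. Transposition reverses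
  composition: in \<open>Op K x (Op K y W)\<close> the diagrams of \<open>y\<close> are inserted
  last, outside those of \<open>x\<close>.\<close>

definition Op :: "('a diagram => 'a diagram => 'a diagram) => ('a diagram => 'r::comm_ring_1) => ('a diagram => 'r) => 'a diagram => 'r" where
 "Op K x W D = (if D \<in> diagrams S then pairing x (%X. W (K X D)) else 0)"

lemma insertion_deg:
 "insertion K ==> W \<in> wts N ==> X \<in> diagrams S ==> D \<in> diagrams S ==> W (K X D) ~= 0 ==> deg X + deg D < N"
 using insertion_diagrams(2)[of K X D] by (auto simp: wts_def)

lemma insertion_wts:
 assumes W: "W \<in> wts N" and K: "insertion K" and X: "X \<in> diagrams S"
 shows "(%D. if D \<in> diagrams S then W (K X D) else 0) \<in> wts N"
 unfolding wts_def mem_Collect_eq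
 using weight_insertion[OF wts_weight[OF W] K X] insertion_deg[OF K W X] by (auto split: if_splits) fastforce

lemma insertion_bounded:
 "insertion K ==> W \<in> wts N ==> D \<in> diagrams S ==> bounded_by (diagrams S) deg N (%X. W (K X D))"
 unfolding bounded_by_def using insertion_deg by fastforce

text \<open>Every diagram of \<open>x\<close> has positive degree, so the degree left for
  \<open>D\<close> drops by at least one. Only finitely many terms of \<open>x\<close> are seen by
  \<open>W\<close>, so the result is a finite combination of weights.\<close>

lemma Op_wts:
 assumes K: "insertion K" and x: "positive x" and W: "W \<in> wts (Suc N)"
 shows "Op K x W \<in> wts N"
proof -
 have xs: "x \<in> dser" using x by (simp add: positive_def)
 let ?F = "supp_upto deg (Suc N) x"
 have F: "X \<in> diagrams S" "0 < deg X" if "X \<in> ?F" for X using that x xs by (auto simp: supp_upto_def positive_def dest: seriesD)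
 have e: "Op K x W = (%D. \<Sum>X\<in>?F. x X * (if D \<in> diagrams S then W (K X D) else 0))"
  unfolding Op_def using pairing_series[OF xs insertion_bounded[OF K W]] by auto
 have "deg D < N" if nz: "Op K x W D ~= 0" for D
 proof -
  obtain X where X: "X \<in> ?F" "x X * (if D \<in> diagrams S then W (K X D) else 0) ~= 0"
   using nz unfolding e by (rule sum.not_neutral_contains_not_neutral)
  then show ?thesis using insertion_deg[OF K W F(1)[OF X(1)], of D] F(2)[OF X(1)] by (auto split: if_splits dest!: mult_nonzeroD)
 qed
 moreover have "weight (Op K x W)"
  unfolding e sum.inter_restrict using F(1) weight_insertion[OF wts_weight[OF W] K]
   weight_sum[of ?F "%X D. if D \<in> diagrams S then W (K X D) else 0" x] by blast
 ultimately show ?thesis unfolding wts_def by auto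
qed

lemma Op_wts_same: "insertion K ==> positive x ==> W \<in> wts N ==> Op K x W \<in> wts N"
 by (rule Op_wts[OF _ _ wts_mono]) auto

lemma pairing_lincomb:
 assumes "x \<in> series B d" "bounded_by B d N W" "bounded_by B d N V"
 shows "pairing x (%b. c * W b + e * V b) = c * pairing x W + e * pairing x V"
 using assms by (simp add: pairing_add_right[OF _ bounded_by_scale bounded_by_scale] pairing_scale_right)

lemma Op_lincomb:
 assumes "insertion K" "x \<in> dser" "W \<in> wts N" "V \<in> wts N"
 shows "Op K x (%D. c * W D + e * V D) = (%D. c * Op K x W D + e * Op K x V D)"
 unfolding Op_def using pairing_lincomb[OF assms(2) insertion_bounded[OF assms(1,3)] insertion_bounded[OF assms(1,4)]] by auto

lemma Op_add_left:
 assumes "insertion K" "x \<in> dser" "y \<in> dser" "W \<in> wts N"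
 shows "Op K (%X. x X + y X) W = (%D. Op K x W D + Op K y W D)"
 unfolding Op_def using pairing_add_left[OF assms(2,3) insertion_bounded[OF assms(1,4)]] by auto

section \<open>Commutation and associativity of insertions\<close>

lemma Op_commute:
 assumes K: "insertion K" "insertion K'" and x: "x \<in> dser" and y: "y \<in> dser" and W: "W \<in> wts N"
  and c: "\<And>X Y D. X \<in> diagrams S ==> y Y ~= 0 ==> D \<in> diagrams S ==> W (K' Y (K X D)) = W (K X (K' Y D))"
 shows "Op K x (Op K' y W) = Op K' y (Op K x W)"
proof
 fix D
 show "Op K x (Op K' y W) D = Op K' y (Op K x W) D"
 proof (cases "D \<in> diagrams S")
  case D: True
  note d = insertion_diagrams(1)[OF K(1) _ D] insertion_diagrams(1)[OF K(2) _ D]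
  have "Op K x (Op K' y W) D = pairing x (%X. pairing y (%Y. W (K' Y (K X D))))"
   unfolding Op_def using D d by (auto intro!: pairing_cong_series[OF x])
  also have "... = pairing y (%Y. pairing x (%X. W (K' Y (K X D))))"
   by (rule pairing_swap[OF x y, where N = N])
    (use insertion_deg[OF K(2) W] insertion_diagrams[OF K(1) _ D] in fastforce)
  also have "... = pairing y (%Y. pairing x (%X. W (K X (K' Y D))))"
   by (rule pairing_cong, rule pairing_cong_series[OF x]) (rule c[OF _ _ D])
  also have "... = Op K' y (Op K x W) D"
   unfolding Op_def using D d by (auto intro!: pairing_cong_series[OF y])
  finally show ?thesis .
 qed (simp add: Op_def)
qed

text \<open>Stacking gives even names to the lower factor and odd names to the upper one. For three
  factors, one bracketing uses the classes 0 mod 4, 2 mod 4 and 1 mod 2, the other 0 mod 2, 1 mod 4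
  and 3 mod 4; this map translates the former into the latter.\<close>

definition assoc_name :: "nat => nat" where
 "assoc_name n = (if even n then if even (n div 2) then n div 2 else n - 1 else 2 * n + 1)"

lemma assoc_name_simps: "assoc_name (2 * (2 * k)) = 2 * k" "assoc_name (2 * Suc (2 * k)) = Suc (2 * (2 * k))"
 "assoc_name (Suc (2 * k)) = Suc (2 * Suc (2 * k))"
 by (simp_all add: assoc_name_def)

lemma assoc_name_inj: "inj assoc_name"
proof (rule inj_on_inverseI)
 fix n :: nat
 let ?dec = "%k::nat. if even k then 2 * k else if even (k div 2) then k + 1 else k div 2"
 have "(\<exists>k. n = 2 * (2 * k)) \<or> (\<exists>k. n = 2 * Suc (2 * k)) \<or> (\<exists>k. n = Suc (2 * k))" by presburger
 then show "?dec (assoc_name n) = n" by (elim disjE exE; hypsubst; unfold assoc_name_simps) simp_all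
qed

lemma assoc_name_comp: "assoc_name \<circ> dbl \<circ> dbl = dbl" "assoc_name \<circ> dbl \<circ> odd_name = odd_name \<circ> dbl"
 "assoc_name \<circ> odd_name = odd_name \<circ> odd_name"
 unfolding comp_def assoc_name_simps by simp_all

lemma weight_assoc_name: "weight W ==> W (mk (ren_word assoc_name zs) (ren_verts assoc_name V)) = W (mk zs V)"
 by (rule weight_ren) (auto intro: inj_on_subset[OF assoc_name_inj])

lemma weight_stack_assoc:
 assumes W: "weight W" and d: "A \<in> diagrams S" "B \<in> diagrams S" "C \<in> diagrams S"
 shows "W (stack (stack A B) C) = W (stack A (stack B C))"
proof -
 obtain zs V zs' V' zs'' V'' where z: "A = mk zs V" "B = mk zs' V'" "C = mk zs'' V''" using d diagram_cases by metis
 show ?thesis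
  using weight_assoc_name[OF W, of "ren_word dbl (ren_word dbl zs @ ren_word odd_name zs') @ ren_word odd_name zs''"
   "ren_verts dbl (ren_verts dbl V + ren_verts odd_name V') + ren_verts odd_name V''"]
  by (simp only: z stack_mk ren_word_simps ren_verts_simps ren_word_comp ren_verts_comp comp_assoc[symmetric] assoc_name_comp
    append_assoc add.assoc)
qed

definition tails_only :: "'a diagram => bool" where
 "tails_only X \<longleftrightarrow> (\<exists>tw V. X = mk (tword tw) V)"

text \<open>On top of the strands, the tails of \<open>X\<close> and the letters of \<open>C\<close>
  come in opposite orders. The latter are tails as well, so TC exchanges them.\<close>

lemma weight_wrap_under:
 assumes W: "weight W" and d: "X \<in> diagrams S" "D \<in> diagrams S" and C: "tails_only C"
 shows "W (stack (wrap X D) C) = W (wrap X (stack D C))"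
proof -
 obtain zs V zs' V' where z: "X = mk zs V" "D = mk zs' V'" using diagram_cases d by metis
 obtain cw U where c: "C = mk (tword cw) U" using C by (auto simp: tails_only_def)
 have rc: "ren_tl f (ren_tl g xs) = ren_tl (f \<circ> g) xs" for f g and xs :: "('a \<times> nat) list" by (induction xs) auto
 let ?xs = "hword (ren_tl dbl (heads_of zs)) @ ren_word (odd_name \<circ> dbl) zs'"
 have "W (mk (?xs @ tword (ren_tl dbl (tails_of zs) @ ren_tl (odd_name \<circ> odd_name) cw) @ []) Y) =
   W (mk (?xs @ tword (ren_tl (odd_name \<circ> odd_name) cw @ ren_tl dbl (tails_of zs)) @ []) Y)" for Y
  by (rule weight_tail_perm[OF W]) simp
 moreover note weight_assoc_name[OF W, of "ren_word dbl (hword (heads_of (ren_word dbl zs)) @ ren_word odd_name zs' @ tword (tails_of (ren_word dbl zs)))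
    @ ren_word odd_name (tword cw)" "ren_verts dbl (ren_verts dbl V + ren_verts odd_name V') + ren_verts odd_name U"]
 ultimately show ?thesis
  by (simp only: z c stack_mk wrap_mk ren_heads_of ren_tails_of ren_hword ren_tword ren_word_simps ren_verts_simps rc ren_word_comp ren_verts_comp
   comp_assoc[symmetric] assoc_name_comp append_assoc add.assoc append_Nil2 tword_simps)
qed

text \<open>Without heads nothing is placed at the bottom, and wrapping differs from stacking on top
  only by the parity of the names.\<close>

lemma weight_wrap_tails:
 assumes W: "weight W" and D: "D \<in> diagrams S" and C: "tails_only C"
 shows "W (wrap C D) = W (stack D C)"
proof -
 obtain zs V where d: "D = mk zs V" using diagram_cases[OF D] by metis
 obtain cw U where c: "C = mk (tword cw) U" using C by (auto simp: tails_only_def)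
 let ?f = "%n::nat. if even n then Suc n else n - 1"
 have i: "inj ?f"
 proof (rule injI)
  fix m n assume "?f m = ?f n"
  then show "m = n" by (cases "even m"; cases "even n"; simp; presburger)
 qed
 have f: "?f \<circ> dbl = odd_name" "?f \<circ> odd_name = dbl" by (auto simp: fun_eq_iff)
 have "wrap C D = mk (ren_word ?f (ren_word dbl zs @ ren_word odd_name (tword cw))) (ren_verts ?f (ren_verts dbl V + ren_verts odd_name U))"
  unfolding d c wrap_mk ren_word_simps ren_verts_simps ren_word_comp ren_verts_comp f by (simp add: ren_tword add.commute)
 then show ?thesis using weight_ren[OF W inj_on_subset[OF i subset_UNIV]] by (simp only: d c stack_mk)
qed

abbreviation nil :: "'a diagram" where "nil \<equiv> mk [] {#}"

lemma nil_diagram: "nil \<in> diagrams S"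
 by (simp add: mk_diagrams wf_word_def)

definition sorted_series :: "('a diagram => 'r::comm_ring_1) => bool" where
 "sorted_series x \<longleftrightarrow> (\<forall>X. x X ~= 0 --> sorted_diagram X)"

definition tails_series :: "('a diagram => 'r::comm_ring_1) => bool" where
 "tails_series x \<longleftrightarrow> (\<forall>X. x X ~= 0 --> tails_only X)"

lemma weight_nil:
 assumes W: "weight W" and X: "X \<in> diagrams S"
 shows "W (stack X nil) = W X" "W (stack nil X) = W X" "sorted_diagram X ==> W (wrap X nil) = W X"
proof -
 have r: "W (mk (ren_word dbl zs) (ren_verts dbl V)) = W (mk zs V)" "W (mk (ren_word odd_name zs) (ren_verts odd_name V)) = W (mk zs V)" for zs V
  by (rule weight_ren[OF W]; auto simp: inj_on_def)+
 obtain zs V where "X = mk zs V" using diagram_cases X by metis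
 then show "W (stack X nil) = W X" "W (stack nil X) = W X" by (simp_all add: stack_mk r)
 assume "sorted_diagram X"
 then obtain hw tw V where "X = mk (hword hw @ tword tw) V" using sorted_word(2)[OF X] by blast
 then show "W (wrap X nil) = W X" using r(1)[of "hword hw @ tword tw" V] by (simp add: wrap_mk ren_hword ren_tword)
qed

text \<open>Into the empty diagram the insertions of a series cannot be told apart, for
  \<open>wrap\<close> provided that the series is sorted. The comparison of exponentials exploits
  this to trade one operator for another with different commutation rules.\<close>

lemma Op_nil:
 assumes x: "x \<in> dser" and W: "weight W"
 shows "Op stack x W nil = pairing x W" "Op under x W nil = pairing x W" "sorted_series x ==> Op wrap x W nil = pairing x W"
proof -
 have "W X = W (stack X nil)" "W X = W (stack nil X)" "sorted_series x ==> W X = W (wrap X nil)" if "x X ~= 0" for X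
  using weight_nil[OF W seriesD[OF x that]] that by (auto simp: sorted_series_def)
 then show "Op stack x W nil = pairing x W" "Op under x W nil = pairing x W" "sorted_series x ==> Op wrap x W nil = pairing x W"
  unfolding Op_def using nil_diagram by (auto intro!: pairing_cong)
qed

lemma Op_stack_under:
 assumes x: "x \<in> dser" and y: "y \<in> dser" and W: "W \<in> wts N"
 shows "Op stack x (Op under y W) = Op under y (Op stack x W)"
 by (rule Op_commute[OF insertions(1,2) x y W]) (use weight_stack_assoc[OF wts_weight[OF W]] seriesD[OF y] in blast)

lemma Op_wrap_under:
 assumes x: "x \<in> dser" and c: "c \<in> dser" "tails_series c" and W: "W \<in> wts N"
 shows "Op wrap x (Op under c W) = Op under c (Op wrap x W)"
 by (rule Op_commute[OF insertions(3,2) x c(1) W])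
  (use weight_wrap_under[OF wts_weight[OF W]] c(2) in \<open>auto simp: tails_series_def\<close>)

lemma Op_wrap_tails:
 assumes c: "tails_series c" and W: "weight W"
 shows "Op wrap c W = Op under c W"
 unfolding Op_def using weight_wrap_tails[OF W] c by (intro ext if_cong refl pairing_cong) (auto simp: tails_series_def)

end

section \<open>Evaluation of the products\<close>

context strands begin

lemma wts_kills: "W \<in> wts N ==> kills (aw_rels S) (W :: 'a diagram => rat)"
 using kills_iff_weight[of W] wts_weight weight_supp by metis

lemma aw_class_pairing:
 fixes x W :: "'a diagram => rat"
 assumes "x \<in> dser" "W \<in> wts N"
 shows "pairing (rep (aw_class S x)) W = pairing x W"
 unfolding aw_class_def
 by (rule pairing_rep[OF homogeneous_aw_rels wts_kills[OF assms(2)] wts_bounded[OF assms(2)] assms(1)])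

lemma aw_mem_pairing:
 fixes x W :: "'a diagram => rat"
 assumes "x \<in> dser" "y \<in> aw_class S x" "W \<in> wts N"
 shows "pairing y W = pairing x W"
 using pairing_qclass_mem[OF homogeneous_aw_rels wts_kills[OF assms(3)] wts_bounded[OF assms(3)] assms(1)] assms(2)
 by (simp add: aw_class_def)

lemma aw_null:
 assumes x: "x \<in> dser" and z: "\<And>N W. W \<in> wts N ==> pairing x W = 0"
 shows "x \<in> null_series (diagrams S) deg (aw_rels S)"
proof (rule null_seriesI[OF homogeneous_aw_rels x])
 fix n and W :: "'a diagram => rat"
 assume W: "\<And>D. W D ~= 0 ==> D \<in> diagrams S \<and> deg D = n" and k: "kills (aw_rels S) W"
 have "weight W" using kills_iff_weight[of W] k W by blast
 then have "W \<in> wts (Suc n)" using W by (auto simp: wts_def)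
 then show "pairing x W = 0" by (rule z)
qed

lemma aw_class_eqI:
 assumes x: "x \<in> dser" and y: "y \<in> dser" and eq: "\<And>N W. W \<in> wts N ==> pairing x W = pairing y W"
 shows "aw_class S x = aw_class S y"
 unfolding aw_class_def
proof (rule qclass_eqI[OF aw_null[OF series_diff[OF x y]]])
 fix N and W :: "'a diagram => rat" assume W: "W \<in> wts N"
 show "pairing (%b. x b - y b) W = 0"
  using pairing_diff_left[OF x y wts_bounded[OF W]] eq[OF W] by simp
qed

lemma AW_rep:
 assumes "X \<in> AW S"
 shows "rep X \<in> dser" "aw_class S (rep X) = X"
proof -
 obtain x where x: "X = aw_class S x" "x \<in> dser" using assms unfolding AW_def by blast
 show "rep X \<in> dser" "aw_class S (rep X) = X"
  unfolding x(1) aw_class_def by (rule rep_qclass(1)[OF x(2)], rule qclass_rep[OF x(2)])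
qed

lemma aw_class_AW: "x \<in> dser ==> aw_class S x \<in> AW S"
 by (simp add: AW_def)

lemma AW_eqI:
 assumes "X \<in> AW S" "Y \<in> AW S" "\<And>N W. W \<in> wts N ==> pairing (rep X) W = pairing (rep Y) W"
 shows "X = Y"
 using aw_class_eqI[OF AW_rep(1)[OF assms(1)] AW_rep(1)[OF assms(2)] assms(3)] AW_rep(2) assms by simp

lemma one_AW: "aw_one S \<in> AW S" "W \<in> wts N ==> pairing (rep (aw_one S)) W = W nil"
proof -
 have n: "Diagram (%_. []) {#} = nil" by (simp add: mk_def)
 have d: "delta nil \<in> dser" by (rule series_delta[OF nil_diagram])
 show "aw_one S \<in> AW S" unfolding aw_one_def n by (rule aw_class_AW[OF d])
 show "W \<in> wts N ==> pairing (rep (aw_one S)) W = W nil" unfolding aw_one_def n by (simp add: aw_class_pairing[OF d])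
qed

lemma star_AW:
 assumes "X \<in> AW S" "Y \<in> AW S"
 shows "aw_star S X Y \<in> AW S"
  "W \<in> wts N ==> pairing (rep (aw_star S X Y)) W = pairing (rep X) (%D. pairing (rep Y) (%D'. W (stack D D')))"
proof -
 note b = bilin_series_pairing[OF AW_rep(1)[OF assms(1)] AW_rep(1)[OF assms(2)], of stack "diagrams S" deg]
 have b1: "bilin stack (rep X) (rep Y) \<in> dser" by (rule b(1)) (simp add: insertion_diagrams[OF insertions(1)])
 show "aw_star S X Y \<in> AW S" unfolding aw_star_def by (rule aw_class_AW[OF b1])
 assume W: "W \<in> wts N"
 show "pairing (rep (aw_star S X Y)) W = pairing (rep X) (%D. pairing (rep Y) (%D'. W (stack D D')))"
  unfolding aw_star_def aw_class_pairing[OF b1 W]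
  by (rule b(2)[OF _ wts_bounded[OF W]]) (simp add: insertion_diagrams[OF insertions(1)])
qed

lemma star_pairing:
 assumes X: "X \<in> AW S" and Y: "Y \<in> AW S" and W: "W \<in> wts N"
 shows "pairing (rep (aw_star S X Y)) W = pairing (rep Y) (Op stack (rep X) W)"
proof -
 note Xs = AW_rep(1)[OF X] and Ys = AW_rep(1)[OF Y]
 have "pairing (rep (aw_star S X Y)) W = pairing (rep Y) (%D'. pairing (rep X) (%D. W (stack D D')))"
  unfolding star_AW(2)[OF X Y W]
  by (rule pairing_swap[OF Xs Ys, where N = N]) (use insertion_deg[OF insertions(1) W] in force)
 also have "... = pairing (rep Y) (Op stack (rep X) W)"
  by (rule pairing_cong_series[OF Ys]) (simp add: Op_def)
 finally show ?thesis .
qed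

text \<open>If all sorted diagrams are added to the relations, a functional killing everything is a
  weight vanishing on sorted diagrams, hence zero; by separation every series is null for the
  enlarged relations. In each degree this splits the series into relations and sorted diagrams, and
  the sorted parts are assembled.\<close>

lemma sorted_rep_exists:
 assumes X: "X \<in> AW S"
 shows "\<exists>x. x \<in> X \<and> (\<forall>D. x D ~= 0 --> sorted_diagram D)"
proof -
 let ?y = "rep X" let ?T = "{delta D | D. D \<in> diagrams S \<and> sorted_diagram D} :: ('a diagram => rat) set"
 note ys = AW_rep(1)[OF X]
 have ht: "homogeneous_rels (diagrams S) deg (aw_rels S \<union> ?T)"
  using homogeneous_aw_rels unfolding homogeneous_rels_def by (auto simp: delta_def)
 have "?y \<in> null_series (diagrams S) deg (aw_rels S \<union> ?T)"
 proof (rule null_seriesI[OF ht ys])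
  fix n and W :: "'a diagram => rat"
  assume W: "\<And>D. W D ~= 0 ==> D \<in> diagrams S \<and> deg D = n" and k: "kills (aw_rels S \<union> ?T) W"
  have "weight W" using kills_iff_weight[of W] k W by (auto simp: kills_def)
  moreover have "W D = 0" if "D \<in> diagrams S" "sorted_diagram D" for D
  proof -
   have "pairing (delta D) W = 0" using k that unfolding kills_def by blast
   then show ?thesis by simp
  qed
  ultimately have "W = (%_. 0)" by (intro weight_eq_sorted[OF _ weight_zero]) auto
  then show "pairing ?y W = 0" by simp
 qed
 then have ex: "\<exists>r z. r \<in> fmod.span (aw_rels S) \<and> z \<in> fmod.span ?T \<and> (%b. if deg b = n then ?y b else 0) = r + z" for n
  unfolding null_series_def fmod.span_Un by blast
 have "\<forall>n. \<exists>p. fst p \<in> fmod.span (aw_rels S) \<and> snd p \<in> fmod.span ?T \<and>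
   (%b. if deg b = n then ?y b else 0) = fst p + snd p"
 proof
  fix n
  obtain r z where "r \<in> fmod.span (aw_rels S)" "z \<in> fmod.span ?T" "(%b. if deg b = n then ?y b else 0) = r + z"
   using ex[of n] by blast
  then show "\<exists>p. fst p \<in> fmod.span (aw_rels S) \<and> snd p \<in> fmod.span ?T \<and>
   (%b. if deg b = n then ?y b else 0) = fst p + snd p" by (intro exI[of _ "(r, z)"]) simp
 qed
 from choice[OF this] obtain p where p: "\<And>n. fst (p n) \<in> fmod.span (aw_rels S)" "\<And>n. snd (p n) \<in> fmod.span ?T"
  "\<And>n. (%b. if deg b = n then ?y b else 0) = fst (p n) + snd (p n)" by blast
 define r where "r n = fst (p n)" for n
 define z where "z n = snd (p n)" for n
 note rz = p[folded r_def z_def]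
 have zT: "finite {b. z n b ~= 0} \<and> (\<forall>b. z n b ~= 0 --> b \<in> diagrams S \<and> sorted_diagram b)" for n
  using rz(2)[of n]
 proof (induction rule: fmod.span_induct_alt)
  case (step c t y)
  then obtain D where D: "t = delta D" "D \<in> diagrams S" "sorted_diagram D" by auto
  have "{b. (fscale c t + y) b ~= 0} \<subseteq> insert D {b. y b ~= 0}" by (auto simp: D fscale_def delta_def split: if_splits)
  then show ?case using step D by (auto intro: finite_subset)
 qed (simp add: zero_fun_def)
 \<comment> \<open>The sorted part \<open>z n\<close> obtained for degree \<open>n\<close> may
   contain diagrams of other degrees. Only its coefficients in degree \<open>n\<close> are kept, and
   a functional concentrated in that degree does not see the difference.\<close>
 let ?x = "%b. z (deg b) b"
 have xs: "?x \<in> dser"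
  unfolding series_def
 proof (intro CollectI conjI allI impI)
  fix n show "finite {b. deg b = n \<and> ?x b ~= 0}"
   by (rule finite_subset[of _ "{b. z n b ~= 0}"]) (use zT in auto)
 qed (use zT in auto)
 have "(%b. ?y b - ?x b) \<in> null_series (diagrams S) deg (aw_rels S)"
 proof (rule null_seriesI[OF homogeneous_aw_rels series_diff[OF ys xs]])
  fix n and W :: "'a diagram => rat"
  assume W: "\<And>D. W D ~= 0 ==> D \<in> diagrams S \<and> deg D = n" and k: "kills (aw_rels S) W"
  have "pairing (%b. ?y b - ?x b) W = pairing (r n) W"
   unfolding pairing_def
  proof (rule Sum_any.cong)
   fix b
   have "?y b = r n b + z n b" if "deg b = n" using fun_cong[OF rz(3)[of n], of b] that by simp
   then show "(?y b - ?x b) * W b = r n b * W b" using W[of b] by (cases "W b = 0") auto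
  qed
  also have "... = 0"
   using pairing_span[OF _ k rz(1)] homogeneous_aw_rels by (auto simp: homogeneous_rels_def)
  finally show "pairing (%b. ?y b - ?x b) W = 0" .
 qed
 then have "?x \<in> X" using xs AW_rep(2)[OF X] by (auto simp: aw_class_def qclass_def)
 then show ?thesis using zT by blast
qed

lemma pairing_cong_sorted:
 assumes "x \<in> dser" "sorted_series x" "\<And>D. D \<in> diagrams S ==> sorted_diagram D ==> W D = V D"
 shows "pairing x W = pairing x V"
 by (rule pairing_cong) (use assms seriesD[OF assms(1)] in \<open>auto simp: sorted_series_def\<close>)

lemma sorted_rep:
 assumes X: "X \<in> AW S"
 shows "sorted_rep X \<in> dser" "sorted_series (sorted_rep X)" "W \<in> wts N ==> pairing (sorted_rep X) W = pairing (rep X) W"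
proof -
 have s: "sorted_rep X \<in> X \<and> (\<forall>D. sorted_rep X D ~= 0 --> sorted_diagram D)"
  unfolding sorted_rep_def by (rule someI_ex[OF sorted_rep_exists[OF X]])
 then have m: "sorted_rep X \<in> aw_class S (rep X)" using AW_rep(2)[OF X] by simp
 show "sorted_rep X \<in> dser" using m by (simp add: aw_class_def qclass_def)
 show "sorted_series (sorted_rep X)" using s by (simp add: sorted_series_def)
 show "W \<in> wts N ==> pairing (sorted_rep X) W = pairing (rep X) W"
  by (rule aw_mem_pairing[OF AW_rep(1)[OF X] m])
qed

lemma sharp_AW:
 assumes "X \<in> AW S" "Y \<in> AW S"
 shows "aw_sharp S X Y \<in> AW S"
  "W \<in> wts N ==> pairing (rep (aw_sharp S X Y)) W = pairing (sorted_rep X) (%D. pairing (sorted_rep Y) (%D'. W (merge D D')))"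
proof -
 note b = bilin_series_pairing[OF sorted_rep(1)[OF assms(1)] sorted_rep(1)[OF assms(2)], of merge "diagrams S" deg]
 have b1: "bilin merge (sorted_rep X) (sorted_rep Y) \<in> dser" by (rule b(1)) (simp add: merge_diagrams)
 show "aw_sharp S X Y \<in> AW S" unfolding aw_sharp_def by (rule aw_class_AW[OF b1])
 assume W: "W \<in> wts N"
 show "pairing (rep (aw_sharp S X Y)) W = pairing (sorted_rep X) (%D. pairing (sorted_rep Y) (%D'. W (merge D D')))"
  unfolding aw_sharp_def aw_class_pairing[OF b1 W]
  by (rule b(2)[OF _ wts_bounded[OF W]]) (simp add: merge_diagrams)
qed

text \<open>For a fixed sorted \<open>D'\<close> the functional in the left factor agrees on sorted
  diagrams with a weight, so the chosen sorted representative may be exchanged for \<open>x\<close>.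
  Then merging is replaced by wrapping, which is a weight in its second argument, and the chosen
  sorted representative of \<open>Y\<close> may be replaced by \<open>rep Y\<close>.\<close>

lemma sharp_pairing:
 assumes x: "positive x" "sorted_series x" and Y: "Y \<in> AW S" and W: "W \<in> wts N"
 shows "pairing (rep (aw_sharp S (aw_class S x) Y)) W = pairing (rep Y) (Op wrap x W)"
proof -
 let ?X = "aw_class S x"
 have xs: "x \<in> dser" using x by (simp add: positive_def)
 note X = aw_class_AW[OF xs]
 have wd: "deg D < N \<and> deg D' < N" if "D \<in> diagrams S" "D' \<in> diagrams S" "W (merge D D') ~= 0" for D D'
  using merge_diagrams(2)[OF that(1,2)] that(3) W by (force simp: wts_def)
 have inner: "pairing (sorted_rep ?X) (%D. W (merge D D')) = Op wrap x W D'" if D': "D' \<in> diagrams S" "sorted_diagram D'" for D'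
 proof -
  obtain U where U: "weight U" "\<And>D. D \<in> diagrams S ==> sorted_diagram D ==> U D = W (merge D D')"
   using merge_right_extension[OF wts_weight[OF W] D'(1)] by metis
  let ?U = "%D. if deg D \<in> {..<N} then U D else 0"
  have Uw: "?U \<in> wts N" by (rule wts_restrict[OF U(1)])
  have eq: "?U D = W (merge D D')" if "D \<in> diagrams S" "sorted_diagram D" for D
   using U(2)[OF that] wd[OF that(1) D'(1)] by auto
  have "pairing (sorted_rep ?X) (%D. W (merge D D')) = pairing (sorted_rep ?X) ?U"
   by (rule pairing_cong_sorted[OF sorted_rep(1,2)[OF X]]) (rule eq[symmetric])
  also have "... = pairing x ?U" using sorted_rep(3)[OF X Uw] aw_class_pairing[OF xs Uw] by simp
  also have "... = pairing x (%D. W (wrap D D'))"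
   by (rule pairing_cong_sorted[OF xs x(2)]) (simp only: eq weight_merge_wrap[OF wts_weight[OF W] _ D'])
  finally show ?thesis using D' by (simp add: Op_def)
 qed
 have "pairing (rep (aw_sharp S ?X Y)) W = pairing (sorted_rep Y) (%D'. pairing (sorted_rep ?X) (%D. W (merge D D')))"
  unfolding sharp_AW(2)[OF X Y W]
  by (rule pairing_swap[OF sorted_rep(1)[OF X] sorted_rep(1)[OF Y], where N = N]) (use wd in force)
 also have "... = pairing (sorted_rep Y) (Op wrap x W)"
  by (rule pairing_cong_sorted[OF sorted_rep(1,2)[OF Y]]) (rule inner)
 also have "... = pairing (rep Y) (Op wrap x W)" by (rule sorted_rep(3)[OF Y Op_wts_same[OF insertions(3) x(1) W]])
 finally show ?thesis .
qed

text \<open>As a class the \<open>n\<close>-th power vanishes below degree \<open>n\<close>, which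
  is what the assumption on \<open>wts n\<close> expresses, but its chosen representative may have
  coefficients there. The truncated sum in \<open>aw_exp\<close> drops these coefficients, and they
  contribute nothing to pairings.\<close>

lemma exp_AW:
 assumes P: "\<And>n. (m X ^^ n) (aw_one S) \<in> AW S"
  and z: "\<And>n W. W \<in> wts n ==> pairing (rep ((m X ^^ n) (aw_one S))) W = 0"
 shows "aw_exp S m X \<in> AW S"
  "W \<in> wts N ==> pairing (rep (aw_exp S m X)) W = (\<Sum>n<N. pairing (rep ((m X ^^ n) (aw_one S))) W / fact n)"
proof -
 let ?p = "%n. rep ((m X ^^ n) (aw_one S))"
 let ?x = "%D. \<Sum>n\<le>deg D. ?p n D / fact n"
 note ps = AW_rep(1)[OF P]
 have xs: "?x \<in> dser"
 proof (rule seriesI)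
  fix D assume "?x D ~= 0"
  then obtain n where "?p n D / fact n ~= 0" by (rule sum.not_neutral_contains_not_neutral)
  then show "D \<in> diagrams S" using ps[of n] by (auto dest: seriesD)
 next
  fix N
  have "supp_upto deg N ?x \<subseteq> (\<Union>n\<le>N. supp_upto deg N (?p n))"
  proof
   fix D assume D: "D \<in> supp_upto deg N ?x"
   then have "?x D ~= 0" by (simp add: supp_upto_def)
   then obtain n where "n \<in> {..deg D}" "?p n D / fact n ~= 0" by (rule sum.not_neutral_contains_not_neutral)
   then show "D \<in> (\<Union>n\<le>N. supp_upto deg N (?p n))" using D by (auto simp: supp_upto_def)
  qed
  then show "finite (supp_upto deg N ?x)" by (rule finite_subset) (auto intro: finite_supp_upto[OF ps])
 qed
 show "aw_exp S m X \<in> AW S" unfolding aw_exp_def by (rule aw_class_AW[OF xs])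
 assume W: "W \<in> wts N"
 let ?q = "%n D. if n \<le> deg D then ?p n D / fact n else 0"
 have qs: "?q n \<in> dser" for n by (rule series_subset[OF ps]) (auto split: if_splits)
 have q: "pairing (?q n) W = pairing (?p n) W / fact n" for n
 proof -
  \<comment> \<open>The part of \<open>W\<close> below degree \<open>n\<close> is itself a weight,
    so it pairs to zero with the \<open>n\<close>-th power and may be subtracted.\<close>
  let ?W = "%D. if deg D \<in> {..<n} then W D else 0"
  have Ww: "?W \<in> wts n" by (rule wts_restrict[OF wts_weight[OF W]])
  have Wb: "bounded_by (diagrams S) deg N (%D. W D - ?W D)" using wts_bounded[OF W] by (auto simp: bounded_by_def)
  have "bounded_by (diagrams S) deg N ?W" using wts_bounded[OF W] by (auto simp: bounded_by_def)
  then have "pairing (?p n) (%D. W D - ?W D) = pairing (?p n) W" using z[OF Ww] pairing_diff_right[OF ps wts_bounded[OF W]] by simp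
  moreover have "pairing (?q n) W = pairing (%D. (1 / fact n) * ?p n D) (%D. W D - ?W D)"
   unfolding pairing_def by (rule Sum_any.cong) auto
  ultimately show ?thesis unfolding pairing_scale_left[OF ps Wb] by simp
 qed
 have "pairing (rep (aw_exp S m X)) W = pairing ?x W" unfolding aw_exp_def by (rule aw_class_pairing[OF xs W])
 also have "... = pairing (%D. \<Sum>n<N. ?q n D) W"
  unfolding pairing_def
 proof (rule Sum_any.cong)
  fix D
  have "?x D = (\<Sum>n<N. ?q n D)" if "deg D < N"
  proof -
   have "(\<Sum>n<N. ?q n D) = (\<Sum>n\<in>{..<N}. if n \<in> {..deg D} then ?p n D / fact n else 0)" by (rule sum.cong) auto
   also have "... = (\<Sum>n\<in>{..<N} \<inter> {..deg D}. ?p n D / fact n)" by (rule sum.inter_restrict[symmetric]) simp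
   also have "{..<N} \<inter> {..deg D} = {..deg D}" using that by auto
   finally show ?thesis by simp
  qed
  then show "?x D * W D = (\<Sum>n<N. ?q n D) * W D" using W by (cases "W D = 0") (auto simp: wts_def)
 qed
 also have "... = (\<Sum>n<N. pairing (?q n) W)"
  by (rule pairing_sum_left[OF _ qs wts_bounded[OF W]]) simp
 also have "... = (\<Sum>n<N. pairing (?p n) W / fact n)" using q by simp
 finally show "pairing (rep (aw_exp S m X)) W = (\<Sum>n<N. pairing (rep ((m X ^^ n) (aw_one S))) W / fact n)" .
qed

end

section \<open>Planted trees\<close>

text \<open>The edges of a tree are named by an arbitrary function \<open>ph\<close> on addresses,
  the paths from the root with \<open>False\<close> for left. The heap numbering is the instance
  \<open>addr 1\<close>; other instances provide fresh names, and a subtree is named by prefixing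
  its address.\<close>

fun htails :: "(bool list => nat) => 'a lie_tree => ('a \<times> nat) list" where
 "htails ph (Leaf b) = [(b, ph [])]"
| "htails ph (Br p q) = htails (%l. ph (False # l)) p @ htails (%l. ph (True # l)) q"

fun hverts :: "(bool list => nat) => 'a lie_tree => verts" where
 "hverts ph (Leaf b) = {#}"
| "hverts ph (Br p q) = {#(ph [False], ph [True], ph [])#} + hverts (%l. ph (False # l)) p + hverts (%l. ph (True # l)) q"

fun addr :: "nat => bool list => nat" where
 "addr e [] = e"
| "addr e (b # l) = addr (2 * e + of_bool b) l"

lemma tree_tails_htails: "tree_tails e p = htails (addr e) p"
 by (induction p arbitrary: e) auto

lemma tree_vertices_hverts: "tree_vertices e p = hverts (addr e) p"
 by (induction p arbitrary: e) auto

lemma addr_snoc: "addr e (l @ [b]) = 2 * addr e l + of_bool b"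
 by (induction l arbitrary: e) auto

lemma addr_pos: "0 < e ==> 0 < addr e l"
 by (induction l arbitrary: e) auto

lemma inj_addr: "inj (addr 1)"
proof (rule injI)
 show "addr 1 l = addr 1 l' ==> l = l'" for l l'
 proof (induction l arbitrary: l' rule: rev_induct)
  case Nil
  show ?case
  proof (cases l' rule: rev_cases)
   case (snoc k b)
   then show ?thesis using Nil addr_pos[of 1 k] by (simp add: addr_snoc)
  qed simp
 next
  case (snoc b l)
  show ?case
  proof (cases l' rule: rev_cases)
   case Nil
   then show ?thesis using snoc.prems addr_pos[of 1 l] by (simp add: addr_snoc)
  next
   case s: (snoc k c)
   have "2 * addr 1 l + of_bool b = 2 * addr 1 k + (of_bool c :: nat)" using snoc.prems s by (simp add: addr_snoc)
   then have "addr 1 l = addr 1 k \<and> b = c" by (cases b; cases c; simp; presburger)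
   then show ?thesis using snoc.IH s by simp
  qed
 qed
qed

lemma plant_mk: "plant a p = mk (hword [(a, addr 1 [])] @ tword (htails (addr 1) p)) (hverts (addr 1) p)"
proof -
 have "proj c (tword tw) = map (%(b, e). Tail e) (filter (%(b, e). b = c) tw)" for c :: 'a and tw
  by (induction tw) auto
 then show ?thesis by (simp add: plant_def mk_def tree_tails_htails tree_vertices_hverts fun_eq_iff)
qed

lemma ren_htails: "ren_tl F (htails ph p) = htails (%l. F (ph l)) p"
 by (induction p arbitrary: ph) auto

lemma ren_hverts: "ren_verts F (hverts ph p) = hverts (%l. F (ph l)) p"
 by (induction p arbitrary: ph) auto

lemma length_htails: "length (htails ph p) = leaves p"
 by (induction p arbitrary: ph) auto

lemma fst_htails: "fst ` set (htails ph p) = set_lie_tree p"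
 by (induction p arbitrary: ph) (auto simp: image_Un)

definition tree_names :: "(bool list => nat) => 'a lie_tree => nat set" where
 "tree_names ph p = word_names (tword (htails ph p)) (hverts ph p)"

lemma tree_names_Br: "tree_names ph (Br p q) =
  insert (ph []) (tree_names (%l. ph (False # l)) p \<union> tree_names (%l. ph (True # l)) q) \<union> {ph [False], ph [True]}"
 unfolding tree_names_def by auto

lemma tree_names_root: "ph [] \<in> tree_names ph p"
 by (cases p) (auto simp: tree_names_def)

lemma tree_names_range: "tree_names ph p \<subseteq> range ph"
proof (induction p arbitrary: ph)
 case (Br p q)
 have "range (%l. ph (b # l)) \<subseteq> range ph" for b by auto
 then show ?case unfolding tree_names_Br using Br.IH[of "%l. ph (False # l)"] Br.IH(2)[of "%l. ph (True # l)"] by blast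
qed (auto simp: tree_names_def)

lemma tree_closed: "closed_for (hverts ph p) E ==> n \<in> tree_names ph p ==> n \<in> E \<longleftrightarrow> ph [] \<in> E"
proof (induction p arbitrary: ph)
 case (Br p q)
 then show ?case unfolding tree_names_Br by auto
qed (auto simp: tree_names_def)

text \<open>Every edge of the tree has its source in the tree, and all except the root edge have
  their target there; the missing target is the place where the tree is hung.\<close>

lemma tree_src: "word_src (tword (htails ph p)) (hverts ph p) = add_mset (ph []) (word_tgt (tword (htails ph p)) (hverts ph p))"
proof (induction p arbitrary: ph)
 case (Br p q)
 then show ?case by (simp add: word_src_append word_tgt_append add_mset_commute)
qed simp

lemma tree_src_count:
 assumes "inj ph"
 shows "count (word_src (tword (htails ph p)) (hverts ph p)) e \<le> 1"
 using assms
proof (induction p arbitrary: ph)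
 case (Br p q)
 let ?F = "%l. ph (False # l)" let ?T = "%l. ph (True # l)"
 have i: "inj ?F" "inj ?T" using Br.prems by (auto simp: inj_def)
 have s: "set_mset (word_src (tword (htails ps r)) (hverts ps r)) \<subseteq> range ps" for ps and r :: "'a lie_tree"
  using tree_names_range[of ps r] word_src_tgt_names[of "tword (htails ps r)" "hverts ps r"] unfolding tree_names_def by blast
 have z: "count (word_src (tword (htails ps r)) (hverts ps r)) e = 0" if "e \<notin> range ps" for ps and r :: "'a lie_tree"
  unfolding count_eq_zero_iff using s[of ps r] that by blast
 consider "e \<in> range ?F" | "e \<in> range ?T" | "e \<notin> range ?F" "e \<notin> range ?T" by blast
 then show ?case
 proof cases
  case 1
  then have "e ~= ph []" "e \<notin> range ?T" using Br.prems by (auto dest: injD)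
  then show ?thesis using Br.IH(1)[OF i(1)] z by (simp add: word_src_append)
 next
  case 2
  then have "e ~= ph []" "e \<notin> range ?F" using Br.prems by (auto dest: injD)
  then show ?thesis using Br.IH(2)[OF i(2)] z by (simp add: word_src_append)
 next
  case 3
  then show ?thesis using z[of ?F] z[of ?T] by (simp add: word_src_append)
 qed
qed simp

lemma wf_tree:
 assumes "inj ph" "a \<in> S" "p \<in> trees S"
 shows "wf_word S (hword [(a, ph [])] @ tword (htails ph p)) (hverts ph p)"
 unfolding wf_word_def
proof (intro conjI allI impI)
 have "fst ` set (tword tw) = fst ` set tw" for tw :: "('a \<times> nat) list"
  by (simp add: tword_def image_image case_prod_beta)
 then show "fst ` set (hword [(a, ph [])] @ tword (htails ph p)) \<subseteq> S"
  using assms fst_htails[of ph p] by (auto simp: trees_def)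
 show "word_src (hword [(a, ph [])] @ tword (htails ph p)) (hverts ph p) = word_tgt (hword [(a, ph [])] @ tword (htails ph p)) (hverts ph p)"
  by (simp add: tree_src)
 show "count (word_src (hword [(a, ph [])] @ tword (htails ph p)) (hverts ph p)) e \<le> 1" for e
  using tree_src_count[OF assms(1), of p e] by simp
 fix E assume E: "closed_for (hverts ph p) E \<and> E \<inter> word_names (hword [(a, ph [])] @ tword (htails ph p)) (hverts ph p) ~= {}"
 have "word_names (hword [(a, ph [])] @ tword (htails ph p)) (hverts ph p) = tree_names ph p"
  using tree_names_root[of ph p] by (auto simp: tree_names_def)
 then have "ph [] \<in> E" using E tree_closed[of ph p E] by blast
 then show "\<exists>z\<in>set (hword [(a, ph [])] @ tword (htails ph p)). edge_of (snd z) \<in> E" by auto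
qed

section \<open>Relations of the free Lie algebra and derivations on trees\<close>

lemma trees_Br [simp]: "Br p q \<in> trees S \<longleftrightarrow> p \<in> trees S \<and> q \<in> trees S"
 by (auto simp: trees_def)

lemma trees_Leaf [simp]: "Leaf a \<in> trees S \<longleftrightarrow> a \<in> S"
 by (auto simp: trees_def)

lemma bilin_Br_eval: "bilin Br x y (Br p q) = x p * y q" "bilin Br x y (Leaf a) = 0"
proof -
 show "bilin Br x y (Br p q) = x p * y q"
  unfolding bilin_def lin_def by (subst Sum_any.expand_superset[of "{(p, q)}"]) (auto simp: delta_def split: if_splits)
qed (simp add: bilin_def lin_def delta_def case_prod_beta)

text \<open>All generating relations of the free Lie algebra are sums of trees with coefficient 1.
  Recording only the list of trees frees them from the coefficient ring, so that relations over
  \<open>rat\<close> and \<open>rat poly\<close> can be compared.\<close>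

inductive lie_rel :: "'a set => 'a lie_tree list => bool" for S :: "'a set" where
 anti: "p \<in> trees S ==> q \<in> trees S ==> lie_rel S [Br p q, Br q p]"
| jacobi: "p \<in> trees S ==> q \<in> trees S ==> r \<in> trees S ==> lie_rel S [Br (Br p q) r, Br (Br q r) p, Br (Br r p) q]"
| left: "lie_rel S c ==> p \<in> trees S ==> lie_rel S (map (Br p) c)"
| right: "lie_rel S c ==> p \<in> trees S ==> lie_rel S (map (%q. Br q p) c)"

lemma lie_rel_trees: "lie_rel S c ==> (\<exists>n. \<forall>p\<in>set c. p \<in> trees S \<and> leaves p = n)"
 by (induction rule: lie_rel.induct) (auto simp: add_ac)

abbreviation delta_list :: "'b list => 'b => 'r::comm_ring_1" where
 "delta_list c u \<equiv> \<Sum>p\<leftarrow>c. delta p u"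

lemma delta_list_Br:
 "bilin Br (delta p) (delta_list c) = (delta_list (map (Br p) c) :: _ => 'r::comm_ring_1)"
 "bilin Br (delta_list c) (delta p) = (delta_list (map (%q. Br q p) c) :: _ => 'r)"
proof -
 have d: "delta (Br a b) (Br s t) = (delta a s * delta b t :: 'r)" "delta (Br a b) (Leaf e) = (0 :: 'r)" for a b s t and e :: 'a
  by (auto simp: delta_def)
 have "bilin Br (delta p) (delta_list c) u = (delta_list (map (Br p) c) u :: 'r) \<and>
   bilin Br (delta_list c) (delta p) u = (delta_list (map (%q. Br q p) c) u :: 'r)" for u
  by (cases u; induction c) (simp_all add: bilin_Br_eval d distrib_left distrib_right)
 then show "bilin Br (delta p) (delta_list c) = (delta_list (map (Br p) c) :: _ => 'r)"
  "bilin Br (delta_list c) (delta p) = (delta_list (map (%q. Br q p) c) :: _ => 'r)" by blast+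
qed

lemma lie_rels_eq: "lie_rels S = (delta_list ` Collect (lie_rel S) :: ('a lie_tree => 'r::comm_ring_1) set)"
proof (intro equalityI subsetI)
 fix x :: "'a lie_tree => 'r" assume "x \<in> lie_rels S"
 then have "\<exists>c. lie_rel S c \<and> x = delta_list c"
 proof induction
  case (anti p q)
  then show ?case by (intro exI[of _ "[Br p q, Br q p]"]) (simp add: lie_rel.anti)
 next
  case (jacobi p q r)
  then show ?case by (intro exI[of _ "[Br (Br p q) r, Br (Br q r) p, Br (Br r p) q]"]) (simp add: lie_rel.jacobi add_ac)
 next
  case (left x p)
  then show ?case using lie_rel.left delta_list_Br(1) by metis
 next
  case (right x p)
  then show ?case using lie_rel.right delta_list_Br(2) by metis
 qed
 then show "x \<in> delta_list ` Collect (lie_rel S)" by blast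
next
 have "delta_list c \<in> (lie_rels S :: ('a lie_tree => 'r) set)" if "lie_rel S c" for c
  using that
 proof induction
  case (anti p q)
  then show ?case using lie_rels.anti[of p S q] by simp
 next
  case (jacobi p q r)
  then show ?case using lie_rels.jacobi[of p S q r] by (simp add: add_ac)
 qed (simp_all only: delta_list_Br[symmetric] lie_rels.left lie_rels.right)
 then show "x \<in> lie_rels S" if "x \<in> delta_list ` Collect (lie_rel S)" for x :: "'a lie_tree => 'r" using that by blast
qed

lemma delta_list_nonzero: "delta_list c u ~= 0 ==> u \<in> set c"
 by (induction c) (auto simp: delta_def split: if_splits)

lemma finite_delta_list: "finite {u. delta_list c u ~= 0}"
 by (rule finite_subset[of _ "set c"]) (auto dest: delta_list_nonzero)

lemma kills_lie_rels: "kills (lie_rels S) f \<longleftrightarrow> (\<forall>c. lie_rel S c --> (\<Sum>p\<leftarrow>c. f p) = 0)"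
proof -
 have "pairing (delta_list c) f = (\<Sum>p\<leftarrow>c. f p)" for c
 proof (induction c)
  case (Cons a c)
  have s: "delta a \<in> series UNIV (%_. 0::nat)" "delta_list c \<in> series UNIV (%_. 0::nat)"
   by (rule series_delta) (simp_all add: series_def finite_delta_list)
  have "bounded_by UNIV (%_. 0::nat) 0 f" by (simp add: bounded_by_def)
  from pairing_add_left[OF s this] show ?case by (simp add: Cons)
 qed simp
 then show ?thesis by (simp add: kills_def lie_rels_eq)
qed

lemma homogeneous_lie_rels: "homogeneous_rels (trees S) leaves (lie_rels S)"
 unfolding homogeneous_rels_def lie_rels_eq by (auto simp: finite_delta_list dest!: lie_rel_trees delta_list_nonzero)

lemma lie_rels_series:
 assumes "x \<in> lie_rels S"
 shows "x \<in> series (trees S) leaves"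
proof -
 have h: "finite {b. x b ~= 0}" "\<And>b. x b ~= 0 ==> b \<in> trees S"
  using homogeneous_lie_rels[of S] assms unfolding homogeneous_rels_def by blast+
 show ?thesis
  by (rule seriesI) (use h in \<open>auto simp: supp_upto_def intro: finite_subset[of _ "{b. x b ~= 0}"]\<close>)
qed

type_synonym ('a, 'r) tree_tuple = "'a => 'a lie_tree => 'r"

abbreviation tree_bounded :: "'a set => nat => ('a lie_tree => 'r::comm_ring_1) => bool" where
 "tree_bounded S \<equiv> bounded_by (trees S) leaves"

abbreviation tser :: "'a set => ('a lie_tree => 'r::comm_ring_1) set" where
 "tser S \<equiv> series (trees S) leaves"

lemma bilin_Br:
 assumes "x \<in> tser S" "y \<in> tser S"
 shows "bilin Br x y \<in> tser S"
  "tree_bounded S N f ==> pairing (bilin Br x y) f = pairing x (%p. pairing y (%q. f (Br p q)))"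
 by (rule bilin_series_pairing(1)[OF assms], simp) (rule bilin_series_pairing(2)[OF assms], simp_all)

lemma bilin_Br_delta_left:
 assumes "p \<in> trees S" "y \<in> tser S" "tree_bounded S N f"
 shows "pairing (bilin Br (delta p) y) f = pairing y (%q. f (Br p q))"
 using bilin_Br(2)[OF series_delta[OF assms(1)] assms(2,3)] by simp

lemma bilin_Br_delta_right:
 assumes "p \<in> trees S" "y \<in> tser S" "tree_bounded S N f"
 shows "pairing (bilin Br y (delta p)) f = pairing y (%q. f (Br q p))"
 using bilin_Br(2)[OF assms(2) series_delta[OF assms(1)] assms(3)] by simp

lemma leaves_pos: "0 < leaves p"
 by (induction p) auto

text \<open>Each term replaces one leaf \<open>a\<close> by a tree of \<open>[a, u a]\<close>, which
  has more leaves. Hence the linear extension of the derivation to series converges.\<close>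

lemma tree_der_series:
 assumes u: "\<And>a. a \<in> S ==> u a \<in> tser S"
 shows "p \<in> trees S ==> tree_der u p \<in> tser S \<and> (\<forall>r. tree_der u p r ~= 0 --> leaves p < leaves r)"
proof (induction p)
 case (Leaf a)
 then have ua: "u a \<in> tser S" using u by simp
 have "tree_der u (Leaf a) r = 0" if "\<not> leaves (Leaf a) < leaves r" for r
  unfolding tree_der.simps bilin_def lin_def
 proof -
  have "(case b of (b, c) => delta (Leaf a) b * u a c) * (case b of (b, c) => delta (Br b c)) r = 0" for b
   using that leaves_pos[of "fst b"] leaves_pos[of "snd b"] by (cases b) (auto simp: delta_def)
  then show "(\<Sum>b. (case b of (b, c) => delta (Leaf a) b * u a c) * (case b of (b, c) => delta (Br b c)) r) = 0" by simp
 qed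
 then show ?case using bilin_Br(1)[OF series_delta[of "Leaf a" "trees S"] ua] Leaf by auto
next
 case (Br p q)
 have pq: "p \<in> trees S" "q \<in> trees S" using Br.prems by auto
 note IH = Br.IH(1)[OF pq(1)] Br.IH(2)[OF pq(2)]
 have s: "bilin Br (tree_der u p) (delta q) \<in> tser S" "bilin Br (delta p) (tree_der u q) \<in> tser S"
  using IH pq by (auto intro!: bilin_Br(1) series_delta)
 have 1: "bilin Br (tree_der u p) (delta q) r = 0" if "\<not> leaves (Br p q) < leaves r" for r
 proof -
  have "(case b of (b, c) => tree_der u p b * delta q c) * (case b of (b, c) => delta (Br b c)) r = 0" for b
   using that IH(1) by (cases b) (auto simp: delta_def)
  then show ?thesis unfolding bilin_def lin_def by simp
 qed
 have 2: "bilin Br (delta p) (tree_der u q) r = 0" if "\<not> leaves (Br p q) < leaves r" for r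
 proof -
  have "(case b of (b, c) => delta p b * tree_der u q c) * (case b of (b, c) => delta (Br b c)) r = 0" for b
   using that IH(2) by (cases b) (auto simp: delta_def)
  then show ?thesis unfolding bilin_def lin_def by simp
 qed
 have "leaves (Br p q) < leaves r" if "tree_der u (Br p q) r ~= 0" for r
  by (rule ccontr) (use that 1[of r] 2[of r] in simp)
 then show ?case using series_add[OF s] by simp
qed

lemma lin_tree_der:
 assumes u: "\<And>a. a \<in> S ==> u a \<in> tser S" and x: "x \<in> tser S"
 shows "lin (tree_der u) x \<in> tser S"
  "tree_bounded S N f ==> pairing (lin (tree_der u) x) f = pairing x (%p. pairing (tree_der u p) f)"
proof -
 have t: "p \<in> trees S ==> tree_der u p r ~= 0 ==> leaves p \<le> leaves r" for p r
  using tree_der_series[of S u p] u by fastforce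
 show "lin (tree_der u) x \<in> tser S"
  by (rule lin_series_pairing(1)[OF x]) (use tree_der_series[of S u] u t in auto)
 show "tree_bounded S N f ==> pairing (lin (tree_der u) x) f = pairing x (%p. pairing (tree_der u p) f)"
  by (rule lin_series_pairing(2)[OF x]) (use tree_der_series[of S u] u t in auto)
qed

lemma tree_der_pairing_Br:
 assumes u: "\<And>a. a \<in> S ==> u a \<in> tser S" and pq: "p \<in> trees S" "q \<in> trees S" and f: "tree_bounded S N f"
 shows "pairing (tree_der u (Br p q)) f = pairing (tree_der u p) (%r. f (Br r q)) + pairing (tree_der u q) (%r. f (Br p r))"
proof -
 have t: "tree_der u p \<in> tser S" "tree_der u q \<in> tser S" using tree_der_series[of S u] u pq by auto
 show ?thesis
  using pairing_add_left[OF bilin_Br(1)[OF t(1) series_delta[OF pq(2)]] bilin_Br(1)[OF series_delta[OF pq(1)] t(2)] f]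
  by (simp add: bilin_Br_delta_left[OF pq(1) t(2) f] bilin_Br_delta_right[OF pq(2) t(1) f])
qed


section \<open>Hanging trees into diagrams\<close>

lemma fresh_addr:
 assumes "finite A"
 obtains ph :: "bool list => nat" where "inj ph" "range ph \<inter> A = {}"
proof
 let ?ph = "%l. addr 1 l + Suc (Max (insert 0 A))"
 show "inj ?ph" using inj_addr by (auto simp: inj_def)
 have "?ph l \<notin> A" for l
 proof
  assume "?ph l \<in> A"
  then have "?ph l \<le> Max (insert 0 A)" by (intro Max_ge) (use assms in auto)
  then show False by simp
 qed
 then show "range ?ph \<inter> A = {}" by blast
qed

text \<open>The tree \<^term>\<open>p\<close> is hung at the edge \<^term>\<open>ph []\<close>, of which the context \<^term>\<open>(xs, V)\<close> contains the target.\<close>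

definition graft :: "('a diagram => 'r) => 'a letter list => verts => (bool list => nat) => 'a lie_tree => 'r::comm_ring_1" where
 "graft W xs V ph p = W (mk (xs @ tword (htails ph p)) (V + hverts ph p))"

text \<open>The root edge ends in the context, so its name occurs there; all other names of the tree
  are fresh.\<close>

definition graft_ok :: "'a letter list => verts => (bool list => nat) => bool" where
 "graft_ok xs V ph \<longleftrightarrow> inj ph \<and> ph [] \<in> word_names xs V \<and> (\<forall>l. l ~= [] --> ph l \<notin> word_names xs V)"

text \<open>The permutation of addresses of order three that rotates the subtrees of
  \<open>[[p, q], r]\<close> and fixes the root and the inner edge. With it the three trees of the
  Jacobi identity are drawn with the same names.\<close>

fun rotate_addr :: "bool list => bool list" where
 "rotate_addr [] = []"
| "rotate_addr (True # l) = False # False # l"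
| "rotate_addr [False] = [False]"
| "rotate_addr (False # False # l) = False # True # l"
| "rotate_addr (False # True # l) = True # l"

lemma inj_rotate_addr: "inj rotate_addr"
proof (rule inj_on_inverseI)
 show "(rotate_addr \<circ> rotate_addr) (rotate_addr l) = l" for l by (induction l rule: rotate_addr.induct) auto
qed

fun flip_addr :: "bool list => bool list" where
 "flip_addr [] = []"
| "flip_addr (b # l) = (\<not> b) # l"

lemma inj_flip_addr: "inj flip_addr"
proof (rule inj_on_inverseI)
 show "flip_addr (flip_addr l) = l" for l by (cases l) auto
qed

lemma names_htails: "word_names (xs @ tword (htails ph p) @ ys) (V + hverts ph p) = word_names (xs @ ys) V \<union> tree_names ph p"
 unfolding tree_names_def by (auto simp: word_names_def)

lemma names_htails2: "word_names (xs @ tword (htails ph p) @ ys @ tword (htails ps q)) (V + hverts ph p + hverts ps q) =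
  word_names (xs @ ys) V \<union> tree_names ph p \<union> tree_names ps q"
 unfolding tree_names_def by (auto simp: word_names_def)

lemma graft_ok_Br:
 assumes ok: "graft_ok xs V ph"
 shows "graft_ok (xs @ tword (htails (%l. ph (b # l)) p)) (V + {#(ph [False], ph [True], ph [])#} + hverts (%l. ph (b # l)) p)
   (%l. ph ((\<not> b) # l))"
proof -
 have i: "inj ph" using ok by (simp add: graft_ok_def)
 have n: "word_names (xs @ tword (htails (%l. ph (b # l)) p)) (V + {#(ph [False], ph [True], ph [])#} + hverts (%l. ph (b # l)) p) =
   word_names xs V \<union> tree_names (%l. ph (b # l)) p \<union> {ph [False], ph [True], ph []}"
  using names_htails[of xs "%l. ph (b # l)" p "[]"] by auto
 have "ph ((\<not> b) # l) \<notin> tree_names (%l. ph (b # l)) p" for l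
  using tree_names_range[of "%l. ph (b # l)" p] i by (auto dest: injD)
 moreover have "inj (%l. ph ((\<not> b) # l))" using i by (auto simp: inj_def)
 ultimately show ?thesis
  using ok i unfolding graft_ok_def n by (cases b) (auto simp: inj_eq)
qed

context strands begin

text \<open>The renaming of the context and the change of names in the tree are glued along the root
  edge, the only name which they share, to one injective renaming of the whole diagram.\<close>

lemma graft_ren:
 assumes W: "weight W" and ok: "graft_ok xs V ph" "graft_ok (ren_word g xs) (ren_verts g V) ps"
  and g: "inj_on g (word_names xs V)" "ps [] = g (ph [])"
 shows "graft W (ren_word g xs) (ren_verts g V) ps p = graft W xs V ph p"
proof -
 let ?F = "%n. if n \<in> range ph then ps (inv ph n) else g n" and ?N = "word_names xs V"
 have ph: "inj ph" "ph [] \<in> ?N" "\<And>l. l ~= [] ==> ph l \<notin> ?N" and ps: "inj ps" "\<And>l. l ~= [] ==> ps l \<notin> g ` ?N"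
  using ok by (simp_all add: graft_ok_def word_names_ren)
 have Fph: "?F (ph l) = ps l" for l using ph(1) by simp
 have Fg: "?F n = g n" if "n \<in> ?N" for n
 proof (cases "n \<in> range ph")
  case True
  then have "n = ph []" using ph(3) that by (metis imageE)
  then show ?thesis using ph(1) g(2) by simp
 qed simp
 have inj: "inj_on ?F (?N \<union> range ph)"
 proof (rule inj_onI)
  fix m n assume mn: "m \<in> ?N \<union> range ph" "n \<in> ?N \<union> range ph" and e: "?F m = ?F n"
  have x: "ph l = n" if "n \<in> ?N" "ps l = g n" for l n
   using that ps(2)[of l] g ph(2) by (cases "l = []") (auto dest: inj_onD)
  consider (a) k l where "m = ph k" "n = ph l" | (b) k where "m = ph k" "n \<in> ?N" | (c) l where "m \<in> ?N" "n = ph l" | (d) "m \<in> ?N" "n \<in> ?N"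
   using mn by blast
  then show "m = n"
  proof cases
   case a then show ?thesis using e ps(1) unfolding a Fph by (simp add: inj_eq)
  next
   case b then show ?thesis using e x unfolding b(1) Fph Fg[OF b(2)] by metis
  next
   case c then show ?thesis using e x unfolding c(2) Fph Fg[OF c(1)] by metis
  next
   case d then show ?thesis using e g(1) unfolding Fg[OF d(1)] Fg[OF d(2)] by (simp add: inj_on_def)
  qed
 qed
 have "word_names (xs @ tword (htails ph p)) (V + hverts ph p) \<subseteq> ?N \<union> range ph"
  using names_htails[of xs ph p "[]"] tree_names_range[of ph p] by auto
 then have "W (mk (ren_word ?F (xs @ tword (htails ph p))) (ren_verts ?F (V + hverts ph p))) = graft W xs V ph p"
  unfolding graft_def by (intro weight_ren[OF W] inj_on_subset[OF inj])
 moreover have "ren_word ?F xs = ren_word g xs \<and> ren_verts ?F V = ren_verts g V" by (rule ren_cong[OF Fg])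
 ultimately show ?thesis by (simp add: graft_def ren_tword ren_htails ren_hverts ph(1))
qed

lemma graft_addr:
 assumes W: "weight W" and ok: "graft_ok xs V ph" and s: "inj s" "s [] = []"
 shows "graft W xs V (%l. ph (s l)) p = graft W xs V ph p"
proof -
 have "s l ~= []" if "l ~= []" for l using s that by (metis injD)
 then have "graft_ok xs V (%l. ph (s l))" using ok s inj_compose[of ph s] by (auto simp: graft_ok_def comp_def)
 then show ?thesis using graft_ren[OF W ok, of "%n. n"] s by simp
qed

lemma graft_head:
 assumes W: "weight W" and ph: "inj ph" "range ph \<inter> word_names (xs @ ys) V = {}" and ps: "inj ps" "range ps \<inter> range g = {}" and g: "inj g"
 shows "graft W (ren_word g xs @ (a, Head (ps [])) # ren_word g ys) (ren_verts g V) ps p = graft W (xs @ (a, Head (ph [])) # ys) V ph p"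
proof -
 let ?h = "g(ph [] := ps [])" and ?xs = "xs @ (a, Head (ph [])) # ys"
 have "ren_word ?h (xs @ ys) = ren_word g (xs @ ys) \<and> ren_verts ?h V = ren_verts g V" by (rule ren_cong) (use ph(2) in auto)
 then have r: "ren_word ?h ?xs = ren_word g xs @ (a, Head (ps [])) # ren_word g ys" "ren_verts ?h V = ren_verts g V"
  by (auto simp: ren_word_def)
 have "graft_ok ?xs V ph" using ph by (auto simp: graft_ok_def inj_eq)
 moreover have "graft_ok (ren_word ?h ?xs) (ren_verts ?h V) ps"
 proof -
  have "ps l \<notin> ?h ` word_names ?xs V" if "l ~= []" for l
   using that ps by (auto simp: inj_eq dest: sym)
  then show ?thesis using ps(1) unfolding graft_ok_def word_names_ren by (auto simp: r(2) intro!: imageI)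
 qed
 moreover have "inj_on ?h (word_names ?xs V)"
  using ps(2) by (intro inj_on_fun_updI inj_on_subset[OF g]) auto
 ultimately show ?thesis using graft_ren[OF W, of ?xs V ph ?h ps p] unfolding r by simp
qed

lemma graft_Br_right:
 "graft W xs V ph (Br p q) =
  graft W (xs @ tword (htails (%l. ph (False # l)) p)) (V + {#(ph [False], ph [True], ph [])#} + hverts (%l. ph (False # l)) p)
   (%l. ph (True # l)) q"
 unfolding graft_def by (simp add: add_ac)

lemma weight_tail_swap: "weight W ==> W (mk (xs @ tword us @ tword vs) V) = W (mk (xs @ tword vs @ tword us) V)"
 using weight_tail_perm[of W "us @ vs" "vs @ us" xs "[]" V] by simp

lemma graft_Br_left:
 assumes W: "weight W"
 shows "graft W xs V ph (Br p q) =
  graft W (xs @ tword (htails (%l. ph (True # l)) q)) (V + {#(ph [False], ph [True], ph [])#} + hverts (%l. ph (True # l)) q)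
   (%l. ph (False # l)) p"
 unfolding graft_def using weight_tail_swap[OF W] by (simp add: add_ac)

lemma tail_count_tword [simp]: "tail_count (tword tw) = length tw"
 by (induction tw) auto

lemma wts_tails:
 assumes W: "W \<in> wts N" and nz: "W (mk zs V) ~= 0"
 shows "tail_count zs < N"
 using degree_wf[of zs V] weight_wf[OF wts_weight[OF W]] W nz by (force simp: wts_def)

lemma graft_bounded: "W \<in> wts N ==> bounded_by B leaves N (graft W xs V ph)"
 unfolding bounded_by_def graft_def using wts_tails[of W N] by (force simp: length_htails)

text \<open>As a function of the hung tree, a weight is a functional on the free Lie algebra. At the
  root, antisymmetry and Jacobi are AS and IHX for the vertices of the diagram; for relations deeper
  in the tree, the sibling subtree is moved into the context.\<close>

lemma graft_kills:
 assumes W: "W \<in> wts N" and c: "lie_rel S c"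
 shows "graft_ok xs V ph ==> (\<Sum>p\<leftarrow>c. graft W xs V ph p) = 0"
 using c
proof (induction arbitrary: xs V ph)
 case (anti p q)
 note w = wts_weight[OF W]
 let ?P = "%l. ph (False # l)" and ?Q = "%l. ph (True # l)"
 let ?D = "%v. W (mk (xs @ tword (htails ?P p) @ tword (htails ?Q q)) (V + hverts ?P p + hverts ?Q q + {#v#}))"
 have "graft W xs V ph (Br p q) = ?D (ph [False], ph [True], ph [])" by (simp add: graft_def add_ac)
 moreover have "graft W xs V ph (Br q p) = ?D (ph [True], ph [False], ph [])"
  unfolding graft_addr[OF w anti.prems inj_flip_addr, of "Br q p", symmetric, simplified]
  using weight_tail_swap[OF w, of xs "htails ?Q q" "htails ?P p"]
  by (simp add: graft_def add_ac)
 ultimately show ?case using weight_AS[OF w] by simp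
next
 case (jacobi p q r)
 note w = wts_weight[OF W]
 let ?P = "%l. ph (False # False # l)" and ?Q = "%l. ph (False # True # l)" and ?R = "%l. ph (True # l)"
 let ?T = "htails ?P p @ htails ?Q q @ htails ?R r"
 let ?V = "V + hverts ?P p + hverts ?Q q + hverts ?R r"
 have t: "W (mk (xs @ tword T) U) = W (mk (xs @ tword ?T) U)" if "mset T = mset ?T" for T U
  using weight_tail_perm[OF w that, of xs "[]"] by simp
 have e1: "graft W xs V ph (Br (Br p q) r) = W (mk (xs @ tword ?T) (?V + {#(ph [False, False], ph [False, True], ph [False]), (ph [False], ph [True], ph [])#}))"
  by (simp add: graft_def add_ac)
 have "graft W xs V ph (Br (Br q r) p) = W (mk (xs @ tword (htails ?Q q @ htails ?R r @ htails ?P p))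
   (?V + {#(ph [False, True], ph [True], ph [False]), (ph [False], ph [False, False], ph [])#}))"
  unfolding graft_addr[OF w jacobi.prems inj_rotate_addr, of "Br (Br q r) p", symmetric, simplified]
  by (simp add: graft_def add_ac)
 also have "... = W (mk (xs @ tword ?T) (?V + {#(ph [False, True], ph [True], ph [False]), (ph [False], ph [False, False], ph [])#}))"
  by (rule t) (simp add: add_ac)
 finally have e2: "graft W xs V ph (Br (Br q r) p) = W (mk (xs @ tword ?T) (?V + {#(ph [False, True], ph [True], ph [False]), (ph [False], ph [False, False], ph [])#}))" .
 have i: "inj (%l. rotate_addr (rotate_addr l))" using inj_compose[OF inj_rotate_addr inj_rotate_addr] by (simp add: comp_def)
 have "graft W xs V ph (Br (Br r p) q) = W (mk (xs @ tword (htails ?R r @ htails ?P p @ htails ?Q q))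
   (?V + {#(ph [True], ph [False, False], ph [False]), (ph [False], ph [False, True], ph [])#}))"
  unfolding graft_addr[OF w jacobi.prems i, of "Br (Br r p) q", symmetric, simplified]
  by (simp add: graft_def add_ac)
 also have "... = W (mk (xs @ tword ?T) (?V + {#(ph [True], ph [False, False], ph [False]), (ph [False], ph [False, True], ph [])#}))"
  by (rule t) (simp add: add_ac)
 finally have e3: "graft W xs V ph (Br (Br r p) q) = W (mk (xs @ tword ?T) (?V + {#(ph [True], ph [False, False], ph [False]), (ph [False], ph [False, True], ph [])#}))" .
 show ?case using weight_IHX[OF w] by (simp add: e1 e2 e3 add.assoc[symmetric])
next
 case (left c p)
 show ?case using left.IH[of _ _ "%l. ph (True # l)"] graft_ok_Br[OF left.prems, of False p] by (simp add: comp_def graft_Br_right)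
next
 case (right c p)
 show ?case using right.IH graft_ok_Br[OF right.prems, of True p] by (simp add: comp_def graft_Br_left[OF wts_weight[OF W]])
qed

lemma under_plant:
 assumes W: "weight W" and i: "inj ph" "range ph \<inter> word_names zs V = {}"
 shows "W (stack (mk zs V) (plant a p)) = graft W (zs @ [(a, Head (ph []))]) V ph p"
 using graft_head[OF W i(1), of zs "[]" V "%l. odd_name (addr 1 l)" dbl a p] i(2) parity_disjoint[of UNIV "range (addr 1)"] inj_addr
 by (auto simp: graft_def plant_mk stack_mk ren_tword ren_htails ren_hverts inj_def image_image)

lemma wrap_plant:
 assumes W: "weight W" and i: "inj ph" "range ph \<inter> word_names zs V = {}"
 shows "W (wrap (plant a p) (mk zs V)) = graft W ((a, Head (ph [])) # zs) V ph p"
 using graft_head[OF W i(1), of "[]" zs V "%l. dbl (addr 1 l)" odd_name a p] i(2) parity_disjoint[of "range (addr 1)" UNIV] inj_addr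
 by (auto simp: graft_def plant_mk wrap_mk ren_tword ren_htails ren_hverts inj_def image_image add.commute)

lemma plant_diagram:
 assumes "a \<in> S" "p \<in> trees S"
 shows "plant a p \<in> diagrams S" "deg (plant a p) = leaves p" "sorted_diagram (plant a p)"
proof -
 have wf: "wf_word S (hword [(a, addr 1 [])] @ tword (htails (addr 1) p)) (hverts (addr 1) p)" by (rule wf_tree[OF inj_addr assms])
 show "plant a p \<in> diagrams S" unfolding plant_mk mk_diagrams by (rule wf)
 show "deg (plant a p) = leaves p" unfolding plant_mk degree_wf[OF wf] by (simp add: length_htails)
 show "sorted_diagram (plant a p)" unfolding plant_mk by (rule sorted_diagram_mk)
qed

section \<open>Tuples of trees as operators on weights, and their commutators\<close>

definition lser :: "('a => 'a lie_tree => 'r::comm_ring_1) => 'a diagram => 'r" where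
 "lser mu D = (\<Sum>a\<in>S. lin (%p. delta (plant a p)) (mu a) D)"

abbreviation tuple :: "('a => 'a lie_tree => 'r::comm_ring_1) => bool" where
 "tuple mu \<equiv> \<forall>a\<in>S. mu a \<in> tser S"

lemma lin_plant:
 assumes a: "a \<in> S" and x: "x \<in> tser S"
 shows "lin (%p. delta (plant a p)) x \<in> dser"
  "bounded_by (diagrams S) deg N F ==> pairing (lin (%p. delta (plant a p)) x) F = pairing x (%p. F (plant a p))"
proof -
 have 1: "delta (plant a p) \<in> dser" if "p \<in> trees S" for p by (rule series_delta[OF plant_diagram(1)[OF a that]])
 have 2: "leaves p \<le> deg D" if "p \<in> trees S" "delta (plant a p) D ~= 0" for p D
  using that plant_diagram(2)[OF a that(1)] by (auto simp: delta_def split: if_splits)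
 note l = lin_series_pairing[OF x, of "%p. delta (plant a p)" "diagrams S" deg, OF 1 2]
 show "lin (%p. delta (plant a p)) x \<in> dser" by (rule l(1))
 show "bounded_by (diagrams S) deg N F ==> pairing (lin (%p. delta (plant a p)) x) F = pairing x (%p. F (plant a p))"
  using l(2)[of N F] by simp
qed

lemma lser_series: "tuple mu ==> lser mu \<in> dser"
 unfolding lser_def by (rule series_sum[OF finite_S]) (simp add: lin_plant(1))

lemma pairing_lser:
 assumes "tuple mu" "bounded_by (diagrams S) deg N F"
 shows "pairing (lser mu) F = (\<Sum>a\<in>S. pairing (mu a) (%p. F (plant a p)))"
 unfolding lser_def using assms
 by (subst pairing_sum_left[OF finite_S _ assms(2)]) (auto simp: lin_plant)

lemma lser_support:
 assumes m: "tuple mu" and nz: "lser mu D ~= 0"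
 shows "\<exists>a p. a \<in> S \<and> p \<in> trees S \<and> D = plant a p"
proof -
 obtain a where a: "a \<in> S" "lin (%p. delta (plant a p)) (mu a) D ~= 0" using nz unfolding lser_def by (rule sum.not_neutral_contains_not_neutral)
 then obtain p where p: "mu a p * delta (plant a p) D ~= 0" unfolding lin_def by (meson Sum_any.not_neutral_obtains_not_neutral)
 then have "mu a p ~= 0 \<and> delta (plant a p) D ~= (0::'b)" by (rule mult_nonzeroD)
 then have "D = plant a p" "p \<in> trees S" using m a seriesD[of "mu a" "trees S" leaves p] by (auto simp: delta_def split: if_splits)
 then show ?thesis using a by blast
qed

lemma lser_positive:
 assumes m: "tuple mu"
 shows "positive (lser mu)" "sorted_series (lser mu)"
proof -
 have "0 < deg D \<and> sorted_diagram D" if nz: "lser mu D ~= 0" for D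
 proof -
  obtain a p where ap: "a \<in> S" "p \<in> trees S" "D = plant a p" using lser_support[OF m nz] by blast
  show ?thesis unfolding ap(3) plant_diagram(2)[OF ap(1,2)] using plant_diagram(3)[OF ap(1,2)] leaves_pos by blast
 qed
 then show "positive (lser mu)" "sorted_series (lser mu)" unfolding positive_def sorted_series_def using lser_series[OF m] by blast+
qed

definition tpair :: "('a => 'a lie_tree => 'r::comm_ring_1) => ('a, 'r) tree_tuple => 'r" where
 "tpair mu F = (\<Sum>a\<in>S. pairing (mu a) (F a))"

lemma tpair_cong: "tuple mu ==> (\<And>a p. a \<in> S ==> p \<in> trees S ==> F a p = G a p) ==> tpair mu F = tpair mu G"
 unfolding tpair_def by (intro sum.cong refl pairing_cong_series) auto

abbreviation tbounded :: "nat => ('a => 'a lie_tree => 'r::comm_ring_1) => bool" where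
 "tbounded N F \<equiv> \<forall>a\<in>S. tree_bounded S N (F a)"

lemma tpair_add: "tuple mu ==> tbounded N F ==> tbounded N G ==> tpair mu (%a p. F a p + G a p) = tpair mu F + tpair mu G"
 unfolding tpair_def sum.distrib[symmetric]
 by (intro sum.cong refl pairing_add_right[where B = "trees S" and d = leaves and N = N]) auto

lemma tpair_diff: "tuple mu ==> tbounded N F ==> tbounded N G ==> tpair mu (%a p. F a p - G a p) = tpair mu F - tpair mu G"
 unfolding tpair_def sum_subtractf[symmetric]
 by (intro sum.cong refl pairing_diff_right[where B = "trees S" and d = leaves and N = N]) auto

lemma tpair_bounded:
 assumes "tuple mu" "\<And>c a p. c \<in> C ==> a \<in> S ==> p \<in> trees S ==> F c a p ~= 0 ==> e c \<le> N"
 shows "bounded_by C e N (%c. tpair mu (F c))"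
 unfolding tpair_def by (intro bounded_by_sum pairing_bounded[where B = "trees S" and d = leaves]) (use assms in auto)

lemma tpair_swap:
 assumes m: "tuple mu" and n: "tuple nu"
  and G: "\<And>a p b q. G a p b q ~= 0 ==> leaves p \<le> N \<and> leaves q \<le> N"
 shows "tpair mu (%a p. tpair nu (G a p)) = tpair nu (%b q. tpair mu (%a p. G a p b q))"
proof -
 have 1: "tree_bounded S N (%p. pairing (nu b) (G a p b))" if "b \<in> S" for a b
  by (rule pairing_bounded[where B = "trees S" and d = leaves]) (use n G that in auto)
 have 2: "tree_bounded S N (%q. pairing (mu a) (%p. G a p b q))" if "a \<in> S" for a b
  by (rule pairing_bounded[where B = "trees S" and d = leaves]) (use m G that in auto)
 have "tpair mu (%a p. tpair nu (G a p)) = (\<Sum>a\<in>S. \<Sum>b\<in>S. pairing (mu a) (%p. pairing (nu b) (G a p b)))"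
  unfolding tpair_def by (intro sum.cong refl pairing_sum_right[OF _ finite_S 1]) (use m in auto)
 also have "... = (\<Sum>a\<in>S. \<Sum>b\<in>S. pairing (nu b) (%q. pairing (mu a) (%p. G a p b q)))"
  by (intro sum.cong refl pairing_swap[where N = N and B = "trees S" and C = "trees S" and d = leaves and e = leaves]) (use m n G in auto)
 also have "... = (\<Sum>b\<in>S. \<Sum>a\<in>S. pairing (nu b) (%q. pairing (mu a) (%p. G a p b q)))" by (rule sum.swap)
 also have "... = tpair nu (%b q. tpair mu (%a p. G a p b q))"
  unfolding tpair_def by (intro sum.cong refl pairing_sum_right[OF _ finite_S 2, symmetric]) (use n in auto)
 finally show ?thesis .
qed

lemma Op_lser:
 assumes m: "tuple mu" and W: "W \<in> wts N" and K: "insertion K" and D: "D \<in> diagrams S"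
 shows "Op K (lser mu) W D = tpair mu (%a p. W (K (plant a p) D))"
 unfolding Op_def tpair_def using pairing_lser[OF m insertion_bounded[OF K W D]] D by simp

lemma Op_under_lser:
 assumes m: "tuple mu" and W: "W \<in> wts N" and i: "inj ph" "range ph \<inter> word_names zs V = {}" and wf: "wf_word S zs V"
 shows "Op under (lser mu) W (mk zs V) = tpair mu (%a. graft W (zs @ [(a, Head (ph []))]) V ph)"
 unfolding Op_lser[OF m W insertions(2) mk_diagrams[THEN iffD2, OF wf]] under_plant[OF wts_weight[OF W] i] ..

lemma Op_wrap_lser:
 assumes m: "tuple mu" and W: "W \<in> wts N" and i: "inj ph" "range ph \<inter> word_names zs V = {}" and wf: "wf_word S zs V"
 shows "Op wrap (lser mu) W (mk zs V) = tpair mu (%a. graft W ((a, Head (ph [])) # zs) V ph)"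
 unfolding Op_lser[OF m W insertions(3) mk_diagrams[THEN iffD2, OF wf]] wrap_plant[OF wts_weight[OF W] i] ..

lemma wf_plant:
 assumes wf: "wf_word S zs V" and i: "inj ph" "range ph \<inter> word_names zs V = {}" and a: "a \<in> S" "p \<in> trees S"
  and m: "mset ws = mset ((a, Head (ph [])) # tword (htails ph p) @ zs)"
 shows "wf_word S ws (V + hverts ph p)"
proof -
 have "word_names (hword [(a, ph [])] @ tword (htails ph p)) (hverts ph p) \<subseteq> range ph"
  using tree_names_range[of ph p] names_htails[of "hword [(a, ph [])]" ph p "[]" "{#}"] by auto
 then have "wf_word S ((hword [(a, ph [])] @ tword (htails ph p)) @ zs) (hverts ph p + V)"
  using i(2) by (intro wf_append wf_tree i(1) a wf) blast
 then show ?thesis using wf_perm[OF m, of S] by (simp add: add.commute)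
qed

lemma Op_lser_wts: "insertion K ==> tuple mu ==> W \<in> wts N ==> Op K (lser mu) W \<in> wts N"
 by (rule Op_wts_same[OF _ lser_positive(1)])

lemma tuple_Br: "tuple mu ==> tuple nu ==> tuple (%a. bilin Br (mu a) (nu a))"
 by (auto intro: bilin_Br(1))

lemma fresh_pair:
 assumes "finite A"
 obtains n :: nat and ph ps :: "bool list => nat" where "inj ph" "inj ps" "range ph \<inter> A = {}" "range ps \<inter> A = {}" "n \<notin> A"
  "range ph \<inter> range ps = {}" "n \<notin> range ph" "n \<notin> range ps"
proof -
 obtain ch :: "bool list => nat" where c: "inj ch" "range ch \<inter> A = {}" using fresh_addr[OF assms] by metis
 have "ch l \<notin> A" for l using c(2) by blast
 then show thesis using c(1) by (intro that[of "%l. ch (False # l)" "%l. ch (True # l)" "ch []"]) (auto simp: inj_def)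
qed

text \<open>The two orders of wrapping place two heads at the bottom in opposite order, and the
  tails on top, where their order is irrelevant. Heads on different strands do not interact; on the
  same strand STU1 yields the bracket. The head of the inner operator is the lower one, which fixes
  the sign.\<close>

theorem wrap_commutator:
 assumes m: "tuple mu" and n: "tuple nu" and W: "W \<in> wts N"
 shows "Op wrap (lser nu) (Op wrap (lser mu) W) D - Op wrap (lser mu) (Op wrap (lser nu) W) D = Op wrap (lser (%a. bilin Br (mu a) (nu a))) W D"
proof (cases "D \<in> diagrams S")
 case True
 note w = wts_weight[OF W]
 obtain zs V where d: "D = mk zs V" "wf_word S zs V" using diagram_cases[OF True] .
 obtain ch :: "bool list => nat" where c: "inj ch" "range ch \<inter> word_names zs V = {}"
  using fresh_addr[OF finite_word_names] by metis
 \<comment> \<open>The two trees are named as the left and right subtree of one tree addressed by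
   \<open>ch\<close>, so that STU1 with new edge \<open>ch []\<close> directly produces
   \<open>Br p q\<close>.\<close>
 let ?ph = "%b l. ch (b # l)"
 have i: "inj (?ph b)" "range (?ph b) \<inter> word_names zs V = {}" for b using c by (auto simp: inj_def) blast
 have step: "Op wrap (lser ka) (Op wrap (lser io) W) D =
   tpair ka (%a q. tpair io (%e p. W (mk ((e, Head (?ph (\<not> b) [])) # (a, Head (?ph b [])) # zs @ tword (htails (?ph b) q) @ tword (htails (?ph (\<not> b)) p))
    (V + hverts (?ph b) q + hverts (?ph (\<not> b)) p))))" if k: "tuple ka" "tuple io" for ka io b
 proof -
  have "Op wrap (lser io) W (mk ((a, Head (?ph b [])) # zs @ tword (htails (?ph b) q)) (V + hverts (?ph b) q)) =
    tpair io (%e. graft W ((e, Head (?ph (\<not> b) [])) # (a, Head (?ph b [])) # zs @ tword (htails (?ph b) q)) (V + hverts (?ph b) q) (?ph (\<not> b)))"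
   if aq: "a \<in> S" "q \<in> trees S" for a q
  proof (rule Op_wrap_lser[OF k(2) W i(1)])
   show "wf_word S ((a, Head (?ph b [])) # zs @ tword (htails (?ph b) q)) (V + hverts (?ph b) q)"
    by (rule wf_plant[OF d(2) i aq]) simp
   have "?ph (\<not> b) l \<notin> tree_names (?ph b) q" for l using tree_names_range[of "?ph b" q] c(1) by (auto dest: injD)
   then show "range (?ph (\<not> b)) \<inter> word_names ((a, Head (?ph b [])) # zs @ tword (htails (?ph b) q)) (V + hverts (?ph b) q) = {}"
    using i(2)[of "\<not> b"] c(1) names_htails[of "(a, Head (?ph b [])) # zs" "?ph b" q "[]" V] by (auto dest: injD)
  qed
  then show ?thesis
   unfolding d(1) Op_wrap_lser[OF k(1) Op_lser_wts[OF insertions(3) k(2) W] i[of b] d(2)] graft_def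
   by (intro tpair_cong[OF k(1)]) simp
 qed
 let ?F = "%a q e p. W (mk ((e, Head (?ph False [])) # (a, Head (?ph True [])) # zs @ tword (htails (?ph False) p @ htails (?ph True) q)) (V + hverts (?ph False) p + hverts (?ph True) q))"
 let ?G = "%a q e p. W (mk ((a, Head (?ph True [])) # (e, Head (?ph False [])) # zs @ tword (htails (?ph False) p @ htails (?ph True) q)) (V + hverts (?ph False) p + hverts (?ph True) q))"
 let ?H = "%a p q. graft W ((a, Head (ch [])) # zs) V ch (Br p q)"
 have bd: "leaves p \<le> N \<and> leaves q \<le> N" if "?F a q e p ~= 0 \<or> ?G a q e p ~= 0" for a q e p
  using that wts_tails[OF W] by (force simp: length_htails)
 have 1: "Op wrap (lser nu) (Op wrap (lser mu) W) D = tpair nu (%a q. tpair mu (?F a q))"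
  unfolding step[OF n m, of True] using weight_tail_swap[OF w, of "_ # _ # zs"] by (simp add: add_ac)
 have "Op wrap (lser mu) (Op wrap (lser nu) W) D = tpair mu (%e p. tpair nu (%a q. ?G a q e p))"
  unfolding step[OF m n, of False] by (simp add: add_ac)
 also have "... = tpair nu (%a q. tpair mu (?G a q))" by (rule tpair_swap[OF m n]) (use bd in blast)
 finally have 2: "Op wrap (lser mu) (Op wrap (lser nu) W) D = tpair nu (%a q. tpair mu (?G a q))" .
 have FG: "?F a q e p - ?G a q e p = (if e = a then ?H a p q else 0)" for a q e p
 proof (cases "e = a")
  case True
  have "ch [] \<notin> word_names ([] @ [(a, Head (?ph False [])), (a, Head (?ph True []))] @ zs @ tword (htails (?ph False) p @ htails (?ph True) q))
    (V + hverts (?ph False) p + hverts (?ph True) q)"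
  proof -
   have "ch [] \<notin> tree_names (?ph b) r" for b and r :: "'a lie_tree" using tree_names_range[of "?ph b" r] c(1) by (auto dest: injD)
   moreover have "ch [] \<notin> word_names zs V" using c(2) by blast
   ultimately show ?thesis using c(1) names_htails2[of zs "?ph False" p "[]" "?ph True" q V]
    by (simp add: inj_eq del: word_names_simps(3,4))
  qed
  from weight_STU1[OF w this] show ?thesis using True by (simp add: graft_def add_ac)
 next
  case False
  then have "mk ((e, Head x) # (a, Head y) # zs) U = mk ((a, Head y) # (e, Head x) # zs) U" for x y zs U
   by (auto simp: mk_def fun_eq_iff)
  then show ?thesis using False by simp
 qed
 have "Op wrap (lser nu) (Op wrap (lser mu) W) D - Op wrap (lser mu) (Op wrap (lser nu) W) D = tpair nu (%a q. tpair mu (?F a q) - tpair mu (?G a q))"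
  unfolding 1 2 using bd by (intro tpair_diff[OF n, of N, symmetric] ballI tpair_bounded[OF m]) blast+
 also have "... = tpair nu (%a q. pairing (mu a) (%p. ?H a p q))"
 proof (rule tpair_cong[OF n])
  fix a q assume a: "a \<in> S"
  have "tpair mu (?F a q) - tpair mu (?G a q) = tpair mu (%e p. ?F a q e p - ?G a q e p)"
   by (rule tpair_diff[OF m, of N, symmetric]) (use bd in \<open>auto simp: bounded_by_def\<close>)
  also have "... = (\<Sum>e\<in>S. if e = a then pairing (mu a) (%p. ?H a p q) else 0)"
   unfolding FG tpair_def by (intro sum.cong refl) simp
  finally show "tpair mu (?F a q) - tpair mu (?G a q) = pairing (mu a) (%p. ?H a p q)" using a finite_S by simp
 qed
 also have "... = tpair (%a. bilin Br (mu a) (nu a)) (%a. graft W ((a, Head (ch [])) # zs) V ch)"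
  unfolding tpair_def
 proof (intro sum.cong refl)
  fix a assume a: "a \<in> S"
  have b: "tree_bounded S N (graft W ((a, Head (ch [])) # zs) V ch)" by (rule graft_bounded[OF W])
  have "?H a p q ~= 0 ==> leaves p \<le> N \<and> leaves q \<le> N" for p q
   unfolding graft_def using wts_tails[OF W] by (force simp: length_htails)
  then show "pairing (nu a) (%q. pairing (mu a) (%p. ?H a p q)) = pairing (bilin Br (mu a) (nu a)) (graft W ((a, Head (ch [])) # zs) V ch)"
   using m n a by (subst bilin_Br(2)[OF _ _ b]) (auto intro!: pairing_swap[where N = N and B = "trees S" and C = "trees S" and d = leaves and e = leaves])
 qed
 finally show ?thesis unfolding d(1) Op_wrap_lser[OF tuple_Br[OF m n] W c d(2)] .
qed (simp add: Op_def)

text \<open>The tree with root \<^term>\<open>ps []\<close>, hung by a new vertex on each leaf of \<^term>\<open>p\<close> with the label \<^term>\<open>b\<close>.\<close>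

definition attach where
 "attach W xs V ph p n ps b q = (\<Sum>i\<in>tails_at b (htails ph p).
   W (mk (xs @ tword ((htails ph p)[i := (b, n)]) @ tword (htails ps q)) (V + hverts ph p + hverts ps q + {#(n, ps [], snd (htails ph p ! i))#})))"

lemma tails_at_append: "tails_at b (us @ vs) = tails_at b us \<union> (%i. length us + i) ` tails_at b vs"
proof -
 have "i \<in> (%i. length us + i) ` tails_at b vs \<longleftrightarrow> length us \<le> i \<and> i - length us \<in> tails_at b vs" for i
  by (metis (no_types, lifting) diff_add_inverse image_iff le_add1 le_add_diff_inverse)
 then show ?thesis by (auto simp: tails_at_def nth_append)
qed

text \<open>The Leibniz rule: a leaf belongs to one of the two subtrees, and the other subtree
  becomes part of the context.\<close>

lemma attach_Br:
 assumes W: "weight W"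
 shows "attach W xs V ph (Br p p') n ps b q =
  attach W (xs @ tword (htails (%l. ph (True # l)) p')) (V + {#(ph [False], ph [True], ph [])#} + hverts (%l. ph (True # l)) p') (%l. ph (False # l)) p n ps b q +
  attach W (xs @ tword (htails (%l. ph (False # l)) p)) (V + {#(ph [False], ph [True], ph [])#} + hverts (%l. ph (False # l)) p) (%l. ph (True # l)) p' n ps b q"
proof -
 have perm: "W (mk (xs @ tword us @ tword vs @ tword ws) U) = W (mk (xs @ tword vs @ tword us @ tword ws) U)" for us vs ws U
  using weight_tail_perm[OF W, of "us @ vs @ ws" "vs @ us @ ws" xs "[]" U] by simp
 have s: "(\<Sum>i\<in>tails_at b (us @ vs). f i) = (\<Sum>i\<in>tails_at b us. f i) + (\<Sum>i\<in>tails_at b vs. f (length us + i))" for us vs and f :: "nat => 'b"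
 proof -
  have "tails_at b us \<inter> (%i. length us + i) ` tails_at b vs = {}" by (auto simp: tails_at_def)
  then show ?thesis unfolding tails_at_append by (subst sum.union_disjoint) (simp_all add: sum.reindex)
 qed
 show ?thesis
  unfolding attach_def htails.simps s
  by (intro arg_cong2[where f = "(+)"] sum.cong refl)
    (simp_all add: list_update_append nth_append tails_at_def perm add_ac)
qed

lemma attach_bounded:
 assumes W: "W \<in> wts N" and nz: "attach W xs V ph p n ps b q ~= 0"
 shows "leaves p \<le> N \<and> leaves q \<le> N"
proof -
 obtain i where "W (mk (xs @ tword ((htails ph p)[i := (b, n)]) @ tword (htails ps q)) (V + hverts ph p + hverts ps q + {#(n, ps [], snd (htails ph p ! i))#})) ~= 0"
  using nz unfolding attach_def by (rule sum.not_neutral_contains_not_neutral)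
 from wts_tails[OF W this] show ?thesis by (simp add: length_htails)
qed

text \<open>At a leaf \<open>a\<close> the new vertex has the leaf as its left and the attached tree
  as its right input, which is \<open>[a, mu a]\<close>. Summing over the leaves therefore gives the
  derivation, by induction over the tree.\<close>

lemma tpair_attach:
 assumes m: "tuple mu" and W: "W \<in> wts N" and p: "p \<in> trees S" and ps: "inj ps" "n \<notin> range ps"
 shows "graft_ok xs V ph ==> insert n (range ps) \<inter> (word_names xs V \<union> range ph) = {} ==>
  tpair mu (attach W xs V ph p n ps) = pairing (tree_der mu p) (graft W xs V ph)"
 using p
proof (induction p arbitrary: xs V ph)
 case (Leaf a)
 note w = wts_weight[OF W]
 have a: "a \<in> S" using Leaf.prems by simp
 let ?V = "V + {#(ph [False], ph [True], ph [])#}" and ?xs = "xs @ [(a, Tail (ph [False]))]"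
 have ok: "inj ph" "ph [] \<in> word_names xs V" "\<And>l. l ~= [] ==> ph l \<notin> word_names xs V" using Leaf.prems(1) by (auto simp: graft_ok_def)
 define g where "g = (%m. m)(ph [False] := n, ph [True] := ps [])"
 have gs: "g (ph [False]) = n" "g (ph [True]) = ps []" "\<And>m. m \<in> word_names xs V ==> g m = m"
  unfolding g_def using ok by (auto simp: inj_eq)
 have r: "ren_word g xs = xs \<and> ren_verts g V = V" using ren_cong[of xs V g "%m. m"] gs(3) by simp
 have nm: "word_names ?xs ?V = word_names xs V \<union> {ph [False], ph [True]}" using ok(2) by (auto simp: word_names_def)
 have inj: "inj_on g (word_names ?xs ?V)"
 proof -
  have "inj_on g (word_names xs V)" "g ` word_names xs V = word_names xs V" using gs(3) by (auto simp: inj_on_def)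
  moreover have "n \<notin> word_names xs V" "ps [] \<notin> word_names xs V" "n ~= ps []" using Leaf.prems(2) ps(2) by blast+
  ultimately show ?thesis using gs(1,2) ok(3)[of "[_]"] unfolding nm by auto
 qed
 have ok1: "graft_ok ?xs ?V (%l. ph (True # l))" using graft_ok_Br[OF Leaf.prems(1), of False "Leaf a"] by simp
 have "g ` word_names ?xs ?V = word_names xs V \<union> {n, ps []}" unfolding nm image_Un using gs by simp
 then have ok2: "graft_ok (ren_word g ?xs) (ren_verts g ?V) ps"
 proof -
  have "ps l \<notin> word_names xs V" for l using Leaf.prems(2) by blast
  moreover have "n ~= ps l" for l using ps(2) by blast
  ultimately show ?thesis using \<open>g ` _ = _\<close> ps unfolding graft_ok_def word_names_ren by (auto simp: inj_eq simp del: image_insert image_Un)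
 qed
 have g: "graft W xs V ph (Br (Leaf a) q) = graft W (xs @ [(a, Tail n)]) (V + {#(n, ps [], ph [])#}) ps q" for q
  using graft_ren[OF w ok1 ok2 inj] gs ok(2) r by (simp add: graft_Br_right)
 have "tails_at b [(a, ph [])] = (if b = a then {0} else {})" for b by (auto simp: tails_at_def)
 then have "attach W xs V ph (Leaf a) n ps b = (if b = a then %q. graft W xs V ph (Br (Leaf a) q) else (%_. 0))" for b
  unfolding g by (intro ext) (simp add: attach_def graft_def add_ac)
 then have "tpair mu (attach W xs V ph (Leaf a) n ps) = (\<Sum>b\<in>S. if b = a then pairing (mu a) (%q. graft W xs V ph (Br (Leaf a) q)) else 0)"
  unfolding tpair_def by (intro sum.cong refl) simp
 also have "... = pairing (tree_der mu (Leaf a)) (graft W xs V ph)"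
  using a m finite_S bilin_Br_delta_left[of "Leaf a" S "mu a" N, OF _ _ graft_bounded[OF W]] by simp
 finally show ?case .
next
 case (Br p p')
 note w = wts_weight[OF W]
 have pS: "p \<in> trees S" "p' \<in> trees S" using Br.prems by auto
 let ?X = "%b r. xs @ tword (htails (%l. ph (b # l)) r)" and ?U = "%b r. V + {#(ph [False], ph [True], ph [])#} + hverts (%l. ph (b # l)) r"
 have d: "insert n (range ps) \<inter> (word_names (?X b r) (?U b r) \<union> range (%l. ph (c # l))) = {}" for b c r
 proof -
  have "word_names (?X b r) (?U b r) = word_names xs V \<union> tree_names (%l. ph (b # l)) r \<union> {ph [False], ph [True], ph []}"
   using names_htails[of xs "%l. ph (b # l)" r "[]"] by auto
  then show ?thesis using tree_names_range[of "%l. ph (b # l)" r] Br.prems(2) by blast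
 qed
 have ok: "graft_ok (?X True p') (?U True p') (%l. ph (False # l))" "graft_ok (?X False p) (?U False p) (%l. ph (True # l))"
  using graft_ok_Br[OF Br.prems(1), of True p'] graft_ok_Br[OF Br.prems(1), of False p] by simp_all
 have bd: "tbounded N (attach W ys U th r n ps)" for ys U th r
  using attach_bounded[OF W] by (auto simp: bounded_by_def)
 have u: "\<And>a. a \<in> S ==> mu a \<in> tser S" using m by simp
 have "tpair mu (attach W xs V ph (Br p p') n ps) =
  tpair mu (attach W (?X True p') (?U True p') (%l. ph (False # l)) p n ps) + tpair mu (attach W (?X False p) (?U False p) (%l. ph (True # l)) p' n ps)"
  unfolding attach_Br[OF w, abs_def] by (rule tpair_add[OF m bd bd])
 also have "... = pairing (tree_der mu (Br p p')) (graft W xs V ph)"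
  by (subst tree_der_pairing_Br[where S = S and N = N, OF u pS graft_bounded[OF W]], assumption)
   (simp only: Br.IH(1)[OF ok(1) d pS(1)] Br.IH(2)[OF ok(2) d pS(2)]
    graft_Br_left[OF w, of xs V ph _ p'] graft_Br_right[of W xs V ph p])
 finally show ?case .
qed

lemma tuple_der: "tuple ka ==> tuple mu ==> tuple (%a. lin (tree_der ka) (mu a))"
 using lin_tree_der(1)[of S ka] by blast

text \<open>If stacking on top follows the wrapping, the stacked head lies above the tails of the
  wrapped tree; otherwise it lies below them. Pushing it down through these tails hangs its tree on
  every leaf labelled by its strand, which is the derivation.\<close>

theorem wrap_under:
 assumes l: "tuple ka" and m: "tuple mu" and W: "W \<in> wts N"
 shows "Op wrap (lser mu) (Op under (lser ka) W) D = Op under (lser ka) (Op wrap (lser mu) W) D - Op wrap (lser (%a. lin (tree_der ka) (mu a))) W D"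
proof (cases "D \<in> diagrams S")
 case True
 note w = wts_weight[OF W]
 obtain zs V where d: "D = mk zs V" "wf_word S zs V" using diagram_cases[OF True] .
 obtain n and ph ps :: "bool list => nat" where i: "inj ph" "inj ps" and fr: "range ph \<inter> word_names zs V = {}" "range ps \<inter> word_names zs V = {}" "n \<notin> word_names zs V"
  and dj: "range ph \<inter> range ps = {}" "n \<notin> range ph" "n \<notin> range ps" by (rule fresh_pair[OF finite_word_names[of zs V]]) blast
 let ?xs = "%a. (a, Head (ph [])) # zs"
 let ?X = "%a p b q. W (mk (?xs a @ (b, Head (ps [])) # tword (htails ph p) @ tword (htails ps q)) (V + hverts ph p + hverts ps q))"
 let ?A = "%a p. attach W (?xs a) V ph p n ps"
 have nph: "tree_names ph p \<inter> insert n (range ps) = {}" "tree_names ps p \<inter> insert n (range ph) = {}" for p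
  using tree_names_range[of ph p] tree_names_range[of ps p] dj by auto
 have dph: "ph l ~= ps m" "ps m ~= ph l" "ph l \<notin> vert_names V" for l m using dj(1) fr(1) unfolding word_names_def by blast+
 have bX: "?X a p b q ~= 0 ==> leaves p \<le> N \<and> leaves q \<le> N" for a p b q
  using wts_tails[OF W] by (force simp: length_htails)
 have bA: "tree_bounded S N (?A a p b)" for a p b using attach_bounded[OF W] by (auto simp: bounded_by_def)
 have push: "graft W (?xs a @ tword (htails ph p) @ [(b, Head (ps []))]) (V + hverts ph p) ps q = ?X a p b q - ?A a p b q" for a p b q
 proof -
  have "n \<notin> word_names (?xs a @ tword (htails ph p) @ (b, Head (ps [])) # tword (htails ps q)) (V + hverts ph p + hverts ps q)"
  proof -
   have "n ~= ph []" "n ~= ps []" "n \<notin> tree_names ph p" "n \<notin> tree_names ps q" using nph[of p] nph[of q] dj by blast+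
   moreover from this have "n \<notin> word_names (zs @ tword (htails ph p) @ [(b, Head (ps []))] @ tword (htails ps q)) (V + hverts ph p + hverts ps q)"
    unfolding names_htails2 using fr(3) by (auto simp: word_names_def)
   ultimately show ?thesis by (simp del: word_names_simps(3,4))
  qed
  from weight_push[OF w this] show ?thesis by (simp add: graft_def attach_def add_ac)
 qed
 have ok: "graft_ok (?xs a) V ph" "insert n (range ps) \<inter> (word_names (?xs a) V \<union> range ph) = {}" for a
 proof -
  have "ph l \<notin> word_names zs V" for l using fr(1) by blast
  then show "graft_ok (?xs a) V ph" "insert n (range ps) \<inter> (word_names (?xs a) V \<union> range ph) = {}"
   using fr dj dph i(1) by (auto simp: graft_ok_def inj_eq)
 qed
 have "Op wrap (lser mu) (Op under (lser ka) W) D = tpair mu (%a p. tpair ka (%b q. ?X a p b q - ?A a p b q))"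
  unfolding d(1) Op_wrap_lser[OF m Op_lser_wts[OF insertions(2) l W] i(1) fr(1) d(2)]
 proof (rule tpair_cong[OF m])
  fix a p assume ap: "a \<in> S" "p \<in> trees S"
  have f: "range ps \<inter> word_names (?xs a @ tword (htails ph p)) (V + hverts ph p) = {}"
   using names_htails[of "?xs a" ph p "[]" V] nph(1)[of p] fr dph by auto
  have wf: "wf_word S (?xs a @ tword (htails ph p)) (V + hverts ph p)" by (rule wf_plant[OF d(2) i(1) fr(1) ap]) simp
  show "graft (Op under (lser ka) W) (?xs a) V ph p = tpair ka (%b q. ?X a p b q - ?A a p b q)"
   unfolding graft_def[of "Op under (lser ka) W"] Op_under_lser[OF l W i(2) f wf] append_assoc push ..
 qed
 also have "... = tpair mu (%a p. tpair ka (?X a p) - pairing (tree_der ka p) (graft W (?xs a) V ph))"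
 proof (rule tpair_cong[OF m])
  fix a p assume p: "p \<in> trees S"
  have "tpair ka (%b q. ?X a p b q - ?A a p b q) = tpair ka (?X a p) - tpair ka (?A a p)"
   by (rule tpair_diff[OF l, of N]) (use bX bA in \<open>auto simp: bounded_by_def\<close>)
  then show "tpair ka (%b q. ?X a p b q - ?A a p b q) = tpair ka (?X a p) - pairing (tree_der ka p) (graft W (?xs a) V ph)"
   unfolding tpair_attach[OF l W p i(2) dj(3) ok] .
 qed
 also have "... = tpair mu (%a p. tpair ka (?X a p)) - tpair mu (%a p. pairing (tree_der ka p) (graft W (?xs a) V ph))"
 proof (rule tpair_diff[OF m, of N])
  show "tbounded N (%a p. tpair ka (?X a p))" by (intro ballI tpair_bounded[OF l]) (use bX in blast)
  show "tbounded N (%a p. pairing (tree_der ka p) (graft W (?xs a) V ph))"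
  proof
   fix a
   have "tree_bounded S N (%p. tpair ka (?A a p))" by (intro tpair_bounded[OF l]) (use attach_bounded[OF W] in blast)
   then show "tree_bounded S N (%p. pairing (tree_der ka p) (graft W (?xs a) V ph))"
    unfolding bounded_by_def using tpair_attach[OF l W _ i(2) dj(3) ok] by simp
  qed
 qed
 also have "tpair mu (%a p. pairing (tree_der ka p) (graft W (?xs a) V ph)) = Op wrap (lser (%a. lin (tree_der ka) (mu a))) W D"
  unfolding d(1) Op_wrap_lser[OF tuple_der[OF l m] W i(1) fr(1) d(2)] tpair_def
  using l m by (intro sum.cong refl lin_tree_der(2)[where S = S and N = N, symmetric] graft_bounded[OF W]) auto
 also have "tpair mu (%a p. tpair ka (?X a p)) = tpair ka (%b q. tpair mu (%a p. ?X a p b q))"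
  by (rule tpair_swap[OF m l]) (use bX in blast)
 also have "... = Op under (lser ka) (Op wrap (lser mu) W) D"
  unfolding d(1) Op_under_lser[OF l Op_lser_wts[OF insertions(3) m W] i(2) fr(2) d(2)]
 proof (rule tpair_cong[OF l])
  fix b q assume bq: "b \<in> S" "q \<in> trees S"
  have f: "range ph \<inter> word_names ((zs @ [(b, Head (ps []))]) @ tword (htails ps q)) (V + hverts ps q) = {}"
   using names_htails[of "zs @ [(b, Head (ps []))]" ps q "[]" V] nph(2)[of q] fr dph by auto
  have wf: "wf_word S ((zs @ [(b, Head (ps []))]) @ tword (htails ps q)) (V + hverts ps q)" by (rule wf_plant[OF d(2) i(2) fr(2) bq]) simp
  show "tpair mu (%a p. ?X a p b q) = graft (Op wrap (lser mu) W) (zs @ [(b, Head (ps []))]) V ps q"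
   unfolding graft_def[of "Op wrap (lser mu) W"] Op_wrap_lser[OF m W i(1) f wf] graft_def
   using weight_tail_swap[OF w, of "_ # zs @ [(b, Head (ps []))]" "htails ps q"] by (simp add: add_ac)
 qed
 finally show ?thesis .
qed (simp add: Op_def)

text \<open>The tangential bracket on the level of representing series.\<close>

definition tbr where
 "tbr ka mu a p = bilin Br (ka a) (mu a) p + lin (tree_der ka) (mu a) p - lin (tree_der mu) (ka a) p"

lemma tuple_tbr: "tuple ka ==> tuple mu ==> tuple (tbr ka mu)"
 using tuple_Br[of ka mu] tuple_der[of ka mu] tuple_der[of mu ka]
 unfolding tbr_def[abs_def] by (auto intro!: series_diff series_add)

text \<open>With \<open>D\<close> kept on top, the weight becomes a weight in what is stacked below,
  and the computation takes place at the empty diagram. There one stacking is traded for a wrapping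
  and the other for a stacking on top. Exchanging these produces the two derivations, and the
  commutator of the wrappings produces the bracket.\<close>

theorem stack_commutator:
 assumes k: "tuple ka" and m: "tuple mu" and W: "W \<in> wts N"
 shows "Op stack (lser mu) (Op stack (lser ka) W) D - Op stack (lser ka) (Op stack (lser mu) W) D = Op stack (lser (tbr ka mu)) W D"
proof (cases "D \<in> diagrams S")
 case D: True
 let ?V = "%X. if X \<in> diagrams S then W (stack X D) else 0"
 have V: "?V \<in> wts N" by (rule insertion_wts[OF W insertions(2) D])
 have nz: "Op wrap x U nil = pairing x U" "Op under x U nil = pairing x U" if "positive x" "sorted_series x" "U \<in> wts N" for x and U :: "'a diagram => 'b"
  using that Op_nil[of x U] wts_weight by (auto simp: positive_def)
 have sD: "stack X D \<in> diagrams S" if "X \<in> diagrams S" for X by (rule insertion_diagrams(1)[OF insertions(1) that D])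
 have ev: "Op stack x W D = Op wrap x ?V nil" if x: "positive x" "sorted_series x" for x
  unfolding nz(1)[OF x V] using D x(1) unfolding Op_def by (auto simp: positive_def intro!: pairing_cong_series[where d = deg])
 have ev2: "Op stack x (Op stack y W) D = Op wrap y (Op under x ?V) nil"
  if x: "positive x" and y: "positive y" "sorted_series y" for x y
 proof -
  have xs: "x \<in> dser" "y \<in> dser" using x y by (auto simp: positive_def)
  have "Op stack x (Op stack y W) D = pairing x (%X. pairing y (%Y. ?V (stack Y X)))"
   unfolding Op_def using D sD insertion_diagrams(1)[OF insertions(1)] weight_stack_assoc[OF wts_weight[OF W] _ _ D]
   by (auto intro!: pairing_cong_series[OF xs(1)] pairing_cong_series[OF xs(2)])
  also have "... = pairing y (%Y. pairing x (%X. ?V (stack Y X)))"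
   by (rule pairing_swap[OF xs, where N = N]) (use insertion_deg[OF insertions(1) V] in force)
  also have "... = pairing y (Op under x ?V)"
   by (rule pairing_cong_series[OF xs(2)]) (simp add: Op_def)
  finally show ?thesis unfolding nz(1)[OF y Op_wts_same[OF insertions(2) x V]] .
 qed
 note pk = lser_positive[OF k] and pm = lser_positive[OF m]
 note kd = tuple_der[OF k m] and md = tuple_der[OF m k] and kb = tuple_Br[OF k m]
 have "pairing (lser (tbr ka mu)) ?V = pairing (lser (%a. bilin Br (ka a) (mu a))) ?V + pairing (lser (%a. lin (tree_der ka) (mu a))) ?V
   - pairing (lser (%a. lin (tree_der mu) (ka a))) ?V"
  unfolding pairing_lser[OF tuple_tbr[OF k m] wts_bounded[OF V]] pairing_lser[OF kb wts_bounded[OF V]]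
   pairing_lser[OF kd wts_bounded[OF V]] pairing_lser[OF md wts_bounded[OF V]] sum.distrib[symmetric] sum_subtractf[symmetric]
 proof (rule sum.cong[OF refl])
  fix a assume a: "a \<in> S"
  have t: "bilin Br (ka a) (mu a) \<in> tser S" "lin (tree_der ka) (mu a) \<in> tser S" "lin (tree_der mu) (ka a) \<in> tser S"
   using a kd md kb by auto
  have b: "tree_bounded S N (%p. ?V (plant a p))"
   using wts_bounded[OF V] plant_diagram[OF a] by (fastforce simp: bounded_by_def)
  show "pairing (tbr ka mu a) (%p. ?V (plant a p)) = pairing (bilin Br (ka a) (mu a)) (%p. ?V (plant a p)) +
    pairing (lin (tree_der ka) (mu a)) (%p. ?V (plant a p)) - pairing (lin (tree_der mu) (ka a)) (%p. ?V (plant a p))"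
   unfolding tbr_def[abs_def] by (subst pairing_diff_left[OF series_add[OF t(1,2)] t(3) b], subst pairing_add_left[OF t(1,2) b]) simp
 qed
 moreover have "Op stack (lser mu) (Op stack (lser ka) W) D = Op wrap (lser mu) (Op wrap (lser ka) ?V) nil - Op wrap (lser (%a. lin (tree_der mu) (ka a))) ?V nil"
  if "tuple ka" "tuple mu" for ka mu
  unfolding ev2[OF lser_positive(1)[OF that(2)] lser_positive[OF that(1)]] wrap_under[OF that(2,1) V]
  by (simp only: nz lser_positive[OF that(1)] lser_positive[OF that(2)] lser_positive[OF tuple_der[OF that(2,1)]]
   V Op_lser_wts[OF insertions(3) that(1) V])
 ultimately show ?thesis
  using wrap_commutator[OF k m V, of nil] k m by (simp add: ev nz V lser_positive tuple_tbr kd md kb)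
qed (simp add: Op_def)

end

section \<open>Lie functionals and causality\<close>

text \<open>With \<open>R = lie_rels S\<close> the following notions concern elements of the free Lie algebra, with
 \<open>R = {}\<close> the coefficients of the representing series.\<close>

context strands begin

definition lie_fun :: "('a lie_tree => 'r::comm_ring_1) set => nat => ('a lie_tree => 'r) => bool" where
 "lie_fun R n f \<longleftrightarrow> kills R f \<and> tree_bounded S n f"

abbreviation lie_or_none :: "('a lie_tree => 'r::comm_ring_1) set => bool" where
 "lie_or_none R \<equiv> R = lie_rels S \<or> R = {}"

lemma lie_funD: "lie_fun R n f ==> tree_bounded S n f"
 by (simp add: lie_fun_def)

lemma lie_fun_mono: "lie_fun R n f ==> n \<le> m ==> lie_fun R m f"
 using bounded_by_mono[of "trees S" leaves n f m] by (simp add: lie_fun_def)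

lemma lie_fun_Br:
 assumes R: "lie_or_none R" and f: "lie_fun R (Suc n) f" and p: "p \<in> trees S"
 shows "lie_fun R n (%q. f (Br p q))" "lie_fun R n (%q. f (Br q p))"
proof -
 have b: "tree_bounded S n (%q. f (Br p q))" "tree_bounded S n (%q. f (Br q p))"
  using f p leaves_pos[of p] by (fastforce simp: lie_fun_def bounded_by_def)+
 have "(\<Sum>q\<leftarrow>c. f (Br p q)) = 0 \<and> (\<Sum>q\<leftarrow>c. f (Br q p)) = 0" if "lie_rel S c" "R = lie_rels S" for c
 proof -
  have "sum_list (map f d) = 0" if "lie_rel S d" for d using f \<open>R = _\<close> that by (simp add: lie_fun_def kills_lie_rels)
  from this[OF lie_rel.left[OF that(1) p]] this[OF lie_rel.right[OF that(1) p]] show ?thesis by (simp add: comp_def)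
 qed
 then show "lie_fun R n (%q. f (Br p q))" "lie_fun R n (%q. f (Br q p))"
  using R b by (auto simp: lie_fun_def kills_lie_rels kills_def[of "{}"])
qed

lemma lie_fun_pairing:
 assumes R: "lie_or_none R" and y: "y \<in> series B d"
  and g: "\<And>b. b \<in> B ==> lie_fun R n (g b)" and N: "\<And>b p. b \<in> B ==> p \<in> trees S ==> g b p ~= 0 ==> d b \<le> N"
 shows "lie_fun R n (%p. pairing y (%b. g b p))"
 unfolding lie_fun_def
proof
 have n: "g b p ~= 0 ==> leaves p \<le> n" if "b \<in> B" "p \<in> trees S" for b p
  using lie_funD[OF g[OF that(1)]] that by (simp add: bounded_by_def)
 show "tree_bounded S n (%p. pairing y (%b. g b p))" by (rule pairing_bounded[OF y n])
 show "kills R (%p. pairing y (%b. g b p))"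
  unfolding kills_def
 proof
  fix x assume x: "x \<in> R"
  then have xs: "x \<in> tser S" using R lie_rels_series by blast
  have "pairing x (%p. pairing y (%b. g b p)) = pairing y (%b. pairing x (g b))"
   by (rule pairing_swap[OF xs y, where N = "max n N"]) (use n N in fastforce)
  also have "... = 0"
  proof -
   have "pairing y (%b. pairing x (g b)) = pairing y (%_. 0)"
    by (rule pairing_cong_series[OF y]) (use g x in \<open>simp add: lie_fun_def kills_def\<close>)
   then show ?thesis by simp
  qed
  finally show "pairing x (%p. pairing y (%b. g b p)) = 0" .
 qed
qed

lemma lie_fun_pairing_Br:
 assumes R: "lie_or_none R" and y: "y \<in> tser S" and f: "lie_fun R (Suc n) f"
 shows "lie_fun R n (%p. pairing y (%q. f (Br p q)))"
 by (rule lie_fun_pairing[OF R y lie_fun_Br(2)[OF R f], where N = "Suc n"])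
   (use lie_funD[OF f] in \<open>fastforce simp: bounded_by_def\<close>)+

lemma lie_fun_antisym: "lie_fun (lie_rels S) n f ==> p \<in> trees S ==> q \<in> trees S ==> f (Br p q) + f (Br q p) = 0"
 using lie_rel.anti[of p S q] by (fastforce simp: lie_fun_def kills_lie_rels)

lemma lie_fun_jacobi: "lie_fun (lie_rels S) n f ==> p \<in> trees S ==> q \<in> trees S ==> r \<in> trees S ==>
  f (Br (Br p q) r) + f (Br (Br q r) p) + f (Br (Br r p) q) = 0"
 using lie_rel.jacobi[of p S q r] by (fastforce simp: lie_fun_def kills_lie_rels add.assoc)

lemma tree_der_tser: "tuple mu ==> p \<in> trees S ==> tree_der mu p \<in> tser S"
 using tree_der_series[of S mu p] by simp

lemma tree_der_Br: "tuple mu ==> p \<in> trees S ==> q \<in> trees S ==> tree_bounded S N f ==>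
  pairing (tree_der mu (Br p q)) f = pairing (tree_der mu p) (%r. f (Br r q)) + pairing (tree_der mu q) (%r. f (Br p r))"
 by (rule tree_der_pairing_Br) auto

lemma tree_der_bounded:
 assumes m: "tuple mu" and f: "tree_bounded S (Suc n) f"
 shows "tree_bounded S n (%p. pairing (tree_der mu p) f)"
 unfolding bounded_by_def
proof (intro ballI impI)
 fix p assume p: "p \<in> trees S" "pairing (tree_der mu p) f ~= 0"
 then obtain r where "tree_der mu p r * f r ~= 0" unfolding pairing_def by (meson Sum_any.not_neutral_obtains_not_neutral)
 then have r: "tree_der mu p r ~= 0" "f r ~= 0" using mult_nonzeroD by blast+
 then have "leaves p < leaves r" "r \<in> trees S" using tree_der_series[of S mu p] m p(1) seriesD[of "tree_der mu p" "trees S"] by auto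
 then show "leaves p \<le> n" using f r(2) by (fastforce simp: bounded_by_def)
qed

text \<open>A derivation of the free non-associative algebra preserves the ideal of relations,
  stated dually. The induction follows the generation of the ideal, and the Leibniz rule splits each
  case according to the factor on which the derivation acts.\<close>

lemma kills_tree_der:
 assumes m: "tuple mu" and c: "lie_rel S c"
 shows "lie_fun (lie_rels S) (Suc n) f ==> (\<Sum>p\<leftarrow>c. pairing (tree_der mu p) f) = 0"
 using c
proof (induction arbitrary: n f)
 note L = disjI1[OF refl]
 have add: "pairing (tree_der mu p) g + pairing (tree_der mu p) h = 0" if "p \<in> trees S" "tree_bounded S N g" "tree_bounded S N h"
   "\<And>r. r \<in> trees S ==> g r + h r = 0" for p N g h
 proof -
  have "pairing (tree_der mu p) g + pairing (tree_der mu p) h = pairing (tree_der mu p) (%r. g r + h r)"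
   by (rule pairing_add_right[OF tree_der_tser[OF m that(1)] that(2,3), symmetric])
  also have "... = pairing (tree_der mu p) (%_. 0)" by (rule pairing_cong_series[OF tree_der_tser[OF m that(1)] that(4)])
  finally show ?thesis by simp
 qed
 {
  case (anti p q)
  note f = lie_funD[OF anti.prems]
  have b: "tree_bounded S n (%r. f (Br r s)) \<and> tree_bounded S n (%r. f (Br s r))" if "s \<in> trees S" for s
   using lie_fun_Br[OF L anti.prems that] by (simp add: lie_fun_def)
  have a: "f (Br r s) + f (Br s r) = 0" if "r \<in> trees S" "s \<in> trees S" for r s using lie_fun_antisym[OF anti.prems that] .
  have 1: "pairing (tree_der mu p) (%r. f (Br r q)) + pairing (tree_der mu p) (%r. f (Br q r)) = 0"
   by (rule add[of p n]) (use b a anti.hyps in auto)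
  have 2: "pairing (tree_der mu q) (%r. f (Br r p)) + pairing (tree_der mu q) (%r. f (Br p r)) = 0"
   by (rule add[of q n]) (use b a anti.hyps in auto)
  show ?case using arg_cong2[OF 1 2, of "(+)"] by (simp add: tree_der_Br[OF m anti.hyps f] tree_der_Br[OF m anti.hyps(2,1) f] add_ac del: tree_der.simps)
 next
  case (jacobi p q r)
  note f = lie_funD[OF jacobi.prems]
  have J: "pairing (tree_der mu s) (%x. f (Br (Br x t) u)) + pairing (tree_der mu s) (%x. f (Br (Br t u) x)) + pairing (tree_der mu s) (%x. f (Br (Br u x) t)) = 0"
   if "s \<in> trees S" "t \<in> trees S" "u \<in> trees S" for s t u
  proof -
   have b: "tree_bounded S (Suc n) (%x. f (Br (Br x t) u))" "tree_bounded S (Suc n) (%x. f (Br (Br t u) x))"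
    "tree_bounded S (Suc n) (%x. f (Br (Br u x) t))"
    using f that by (fastforce simp: bounded_by_def)+
   show ?thesis
    unfolding pairing_add_right[OF tree_der_tser[OF m that(1)] b(1,2), symmetric]
    by (rule add[OF that(1) bounded_by_add[OF b(1,2)] b(3)]) (rule lie_fun_jacobi[OF jacobi.prems _ that(2,3)])
  qed
  have T: "pairing (tree_der mu (Br (Br s t) u)) f = pairing (tree_der mu s) (%x. f (Br (Br x t) u)) + pairing (tree_der mu t) (%x. f (Br (Br s x) u)) +
    pairing (tree_der mu u) (%x. f (Br (Br s t) x))" if "s \<in> trees S" "t \<in> trees S" "u \<in> trees S" for s t u
  proof -
   have b: "tree_bounded S (Suc n) (%x. f (Br x u))" using f that by (fastforce simp: bounded_by_def)
   have st: "Br s t \<in> trees S" using that by simp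
   show ?thesis unfolding tree_der_Br[OF m st that(3) f] tree_der_Br[OF m that(1,2) b] ..
  qed
  show ?case
   using arg_cong2[OF arg_cong2[OF J[OF jacobi.hyps] J[OF jacobi.hyps(2,3,1)], of "(+)"] J[OF jacobi.hyps(3,1,2)], of "(+)"]
   by (simp add: T[OF jacobi.hyps] T[OF jacobi.hyps(2,3,1)] T[OF jacobi.hyps(3,1,2)] add_ac del: tree_der.simps)
 next
  case (left c p)
  note f = lie_funD[OF left.prems] and p = left.hyps(2)
  note fp = lie_fun_mono[OF lie_fun_Br(1)[OF L left.prems p] le_SucI[OF order_refl]]
  have "lie_fun (lie_rels S) n (%q. pairing (tree_der mu p) (%r. f (Br r q)))"
   by (rule lie_fun_pairing[OF L tree_der_tser[OF m p] lie_fun_Br(1)[OF L left.prems], where N = "Suc n"])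
     (use f in \<open>fastforce simp: bounded_by_def\<close>)+
  moreover have "(\<Sum>q\<leftarrow>c. pairing (tree_der mu (Br p q)) f) = (\<Sum>q\<leftarrow>c. pairing (tree_der mu p) (%r. f (Br r q)) + pairing (tree_der mu q) (%r. f (Br p r)))"
   using lie_rel_trees[OF left.hyps(1)] tree_der_Br[OF m p _ f] by (auto intro!: arg_cong[of _ _ sum_list] map_cong)
  ultimately show ?case using left.hyps(1) left.IH[OF fp] by (simp add: lie_fun_def kills_lie_rels sum_list_addf comp_def del: tree_der.simps)
 next
  case (right c p)
  note f = lie_funD[OF right.prems] and p = right.hyps(2)
  note fp = lie_fun_mono[OF lie_fun_Br(2)[OF L right.prems p] le_SucI[OF order_refl]]
  have "lie_fun (lie_rels S) n (%q. pairing (tree_der mu p) (%r. f (Br q r)))"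
   by (rule lie_fun_pairing[OF L tree_der_tser[OF m p] lie_fun_Br(2)[OF L right.prems], where N = "Suc n"])
     (use f in \<open>fastforce simp: bounded_by_def\<close>)+
  moreover have "(\<Sum>q\<leftarrow>c. pairing (tree_der mu (Br q p)) f) = (\<Sum>q\<leftarrow>c. pairing (tree_der mu q) (%r. f (Br r p)) + pairing (tree_der mu p) (%r. f (Br q r)))"
   using lie_rel_trees[OF right.hyps(1)] tree_der_Br[OF m _ p f] by (auto intro!: arg_cong[of _ _ sum_list] map_cong)
  ultimately show ?case using right.hyps(1) right.IH[OF fp] by (simp add: lie_fun_def kills_lie_rels sum_list_addf comp_def del: tree_der.simps)
 }
qed

lemma lie_fun_tree_der:
 assumes R: "lie_or_none R" and m: "tuple mu" and f: "lie_fun R (Suc n) f"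
 shows "lie_fun R n (%p. pairing (tree_der mu p) f)"
 using R f kills_tree_der[OF m, of _ n f] tree_der_bounded[OF m lie_funD[OF f]] by (auto simp: lie_fun_def kills_lie_rels kills_def[of "{}"])

section \<open>Congruence of tuples up to a degree, and operators raising degrees\<close>

definition agree :: "('a lie_tree => 'r::comm_ring_1) set => nat => ('a, 'r) tree_tuple => ('a, 'r) tree_tuple => bool" where
 "agree R n mu nu \<longleftrightarrow> (\<forall>a\<in>S. \<forall>f. lie_fun R n f --> pairing (mu a) f = pairing (nu a) f)"

lemma agreeD: "agree R n mu nu ==> a \<in> S ==> lie_fun R n f ==> pairing (mu a) f = pairing (nu a) f"
 by (simp add: agree_def)

lemma agree_refl: "agree R n mu mu"
 by (simp add: agree_def)

lemma agree_mono: "agree R n mu nu ==> m \<le> n ==> agree R m mu nu"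
 unfolding agree_def using lie_fun_mono by metis

text \<open>The other factor has at least one leaf, so only the parts of each factor up to degree
  \<open>n\<close> enter degree \<open>Suc n\<close>. This gain of one degree, shared by derivations
  and the tangential bracket, makes the differential equations solvable degree by degree.\<close>

lemma agree_Br:
 assumes R: "lie_or_none R" and t: "tuple mu" "tuple mu'" "tuple nu" "tuple nu'" and a: "agree R n mu mu'" "agree R n nu nu'"
 shows "agree R (Suc n) (%a. bilin Br (mu a) (nu a)) (%a. bilin Br (mu' a) (nu' a))"
 unfolding agree_def
proof (intro ballI allI impI)
 fix c and f :: "'a lie_tree => 'b" assume c: "c \<in> S" and f: "lie_fun R (Suc n) f"
 have s: "mu c \<in> tser S" "mu' c \<in> tser S" "nu c \<in> tser S" "nu' c \<in> tser S" using t c by auto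
 have "pairing (mu c) (%p. pairing (nu c) (%q. f (Br p q))) = pairing (mu c) (%p. pairing (nu' c) (%q. f (Br p q)))"
  by (rule pairing_cong_series[OF s(1)]) (rule agreeD[OF a(2) c lie_fun_Br(1)[OF R f]])
 also have "... = pairing (mu' c) (%p. pairing (nu' c) (%q. f (Br p q)))"
  by (rule agreeD[OF a(1) c lie_fun_pairing_Br[OF R s(4) f]])
 finally show "pairing (bilin Br (mu c) (nu c)) f = pairing (bilin Br (mu' c) (nu' c)) f"
  by (simp add: bilin_Br(2)[OF s(1,3) lie_funD[OF f]] bilin_Br(2)[OF s(2,4) lie_funD[OF f]])
qed

lemma pairing_tree_der_agree:
 assumes R: "lie_or_none R" and t: "tuple mu" "tuple mu'" and a: "agree R n mu mu'"
 shows "p \<in> trees S ==> lie_fun R (Suc n) f ==> pairing (tree_der mu p) f = pairing (tree_der mu' p) f"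
proof (induction p arbitrary: f)
 case (Leaf c)
 then have c: "c \<in> S" "mu c \<in> tser S" "mu' c \<in> tser S" using t by auto
 show ?case
  unfolding tree_der.simps bilin_Br_delta_left[OF Leaf(1) c(2) lie_funD[OF Leaf(2)]] bilin_Br_delta_left[OF Leaf(1) c(3) lie_funD[OF Leaf(2)]]
  by (rule agreeD[OF a c(1) lie_fun_Br(1)[OF R Leaf(2,1)]])
next
 case (Br p q)
 have pq: "p \<in> trees S" "q \<in> trees S" using Br.prems by auto
 note l = lie_fun_mono[OF lie_fun_Br(1)[OF R Br.prems(2) pq(1)] le_SucI[OF order_refl]]
  lie_fun_mono[OF lie_fun_Br(2)[OF R Br.prems(2) pq(2)] le_SucI[OF order_refl]]
 show ?case
  unfolding tree_der_Br[OF t(1) pq lie_funD[OF Br.prems(2)]] tree_der_Br[OF t(2) pq lie_funD[OF Br.prems(2)]]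
   Br.IH(1)[OF pq(1) l(2)] Br.IH(2)[OF pq(2) l(1)] ..
qed

lemma agree_der:
 assumes R: "lie_or_none R" and t: "tuple mu" "tuple mu'" "tuple nu" "tuple nu'" and a: "agree R n mu mu'" "agree R n nu nu'"
 shows "agree R (Suc n) (%a. lin (tree_der mu) (nu a)) (%a. lin (tree_der mu') (nu' a))"
 unfolding agree_def
proof (intro ballI allI impI)
 fix c and f :: "'a lie_tree => 'b" assume c: "c \<in> S" and f: "lie_fun R (Suc n) f"
 have s: "nu c \<in> tser S" "nu' c \<in> tser S" using t c by auto
 have "pairing (nu c) (%p. pairing (tree_der mu p) f) = pairing (nu c) (%p. pairing (tree_der mu' p) f)"
  by (rule pairing_cong_series[OF s(1)]) (rule pairing_tree_der_agree[OF R t(1,2) a(1) _ f])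
 also have "... = pairing (nu' c) (%p. pairing (tree_der mu' p) f)"
  by (rule agreeD[OF a(2) c lie_fun_tree_der[OF R t(2) f]])
 finally show "pairing (lin (tree_der mu) (nu c)) f = pairing (lin (tree_der mu') (nu' c)) f"
  using lin_tree_der(2)[of S mu "nu c", OF _ s(1) lie_funD[OF f]] lin_tree_der(2)[of S mu' "nu' c", OF _ s(2) lie_funD[OF f]] t by simp
qed

lemma agree_lincomb:
 assumes t: "tuple mu" "tuple mu'" "tuple nu" "tuple nu'" and a: "agree R n mu mu'" "agree R n nu nu'"
 shows "agree R n (%a p. c * mu a p + d * nu a p) (%a p. c * mu' a p + d * nu' a p)"
proof -
 have l: "pairing (%p. c * x p + d * y p) f = c * pairing x f + d * pairing y f"
  if "x \<in> tser S" "y \<in> tser S" "lie_fun R n f" for x y f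
  using pairing_add_left[OF series_scale[OF that(1)] series_scale[OF that(2)] lie_funD[OF that(3)]]
   pairing_scale_left[OF that(1) lie_funD[OF that(3)]] pairing_scale_left[OF that(2) lie_funD[OF that(3)]] by simp
 show ?thesis unfolding agree_def
 proof (intro ballI allI impI)
  fix b and f :: "'a lie_tree => 'b" assume b: "b \<in> S" and f: "lie_fun R n f"
  then show "pairing (%p. c * mu b p + d * nu b p) f = pairing (%p. c * mu' b p + d * nu' b p) f"
   using t l[OF _ _ f, of "mu b" "nu b"] l[OF _ _ f, of "mu' b" "nu' b"] agreeD[OF a(1) b f] agreeD[OF a(2) b f] by simp
 qed
qed

lemma tuple_lincomb: "tuple mu ==> tuple nu ==> tuple (%a p. c * mu a p + d * nu a p)"
 by (simp add: series_add series_scale)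

lemma agree_tbr:
 assumes R: "lie_or_none R" and t: "tuple mu" "tuple mu'" "tuple nu" "tuple nu'" and a: "agree R n mu mu'" "agree R n nu nu'"
 shows "agree R (Suc n) (tbr mu nu) (tbr mu' nu')"
proof -
 note d = tuple_Br[OF t(1,3)] tuple_Br[OF t(2,4)] tuple_der[OF t(1,3)] tuple_der[OF t(2,4)] tuple_der[OF t(3,1)] tuple_der[OF t(4,2)]
 have 1: "agree R (Suc n) (%c p. 1 * bilin Br (mu c) (nu c) p + 1 * lin (tree_der mu) (nu c) p)
   (%c p. 1 * bilin Br (mu' c) (nu' c) p + 1 * lin (tree_der mu') (nu' c) p)"
  by (rule agree_lincomb[OF d(1-4) agree_Br[OF R t a] agree_der[OF R t a]])
 have "agree R (Suc n) (%c p. 1 * (1 * bilin Br (mu c) (nu c) p + 1 * lin (tree_der mu) (nu c) p) + -1 * lin (tree_der nu) (mu c) p)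
   (%c p. 1 * (1 * bilin Br (mu' c) (nu' c) p + 1 * lin (tree_der mu') (nu' c) p) + -1 * lin (tree_der nu') (mu' c) p)"
  by (rule agree_lincomb[OF tuple_lincomb[OF d(1,3)] tuple_lincomb[OF d(2,4)] d(5,6) 1 agree_der[OF R t(3,4,1,2) a(2,1)]])
 then show ?thesis by (simp add: tbr_def[abs_def])
qed

definition above :: "nat => ('a => 'a lie_tree => 'r::comm_ring_1) => bool" where
 "above k mu \<longleftrightarrow> (\<forall>a\<in>S. \<forall>p. mu a p ~= 0 --> k < leaves p)"

definition raising :: "(('a => 'a lie_tree => 'r::comm_ring_1) => ('a, 'r) tree_tuple) => bool" where
 "raising F \<longleftrightarrow> (\<forall>nu. tuple nu --> tuple (F nu) \<and> (\<forall>k. above k nu --> above (Suc k) (F nu)))"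

lemma above_0: "above 0 mu"
 by (simp add: above_def leaves_pos)

text \<open>With the empty set of relations the indicator of a single tree is an admissible
  functional, so agreement becomes equality of coefficients.\<close>

lemma agree_none_iff:
 fixes mu nu :: "'a => 'a lie_tree => 'r::comm_ring_1"
 assumes t: "tuple mu" "tuple nu"
 shows "agree {} n mu nu \<longleftrightarrow> (\<forall>a\<in>S. \<forall>p. leaves p \<le> n --> mu a p = nu a p)"
proof (intro iffI ballI allI impI)
 fix a and p :: "'a lie_tree" assume ag: "agree {} n mu nu" and a: "a \<in> S" and p: "leaves p \<le> n"
 have e: "pairing x (%q. if q = p then 1 else 0) = x p" for x :: "'a lie_tree => 'r"
  by (subst pairing_eq_sum[of "{p}"]) (auto split: if_splits)
 have "lie_fun {} n (%q. if q = p then 1 else (0::'r))" using p by (auto simp: lie_fun_def kills_def bounded_by_def)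
 then show "mu a p = nu a p" using agreeD[OF ag a] unfolding e[symmetric] by blast
next
 assume e: "\<forall>a\<in>S. \<forall>p. leaves p \<le> n --> mu a p = nu a p"
 show "agree {} n mu nu"
  unfolding agree_def
 proof (intro ballI allI impI)
  fix a f assume a: "a \<in> S" and f: "lie_fun {} n (f :: 'a lie_tree => 'r)"
  have "mu a p * f p = nu a p * f p" for p
  proof (cases "p \<in> trees S \<and> f p ~= 0")
   case True
   then show ?thesis using lie_funD[OF f] e a by (simp add: bounded_by_def)
  next
   case False
   have "mu a p = 0 \<and> nu a p = 0" if "p \<notin> trees S"
    using seriesD[of "mu a" "trees S" leaves p] seriesD[of "nu a" "trees S" leaves p] t a that by blast
   then show ?thesis using False by auto
  qed
  then show "pairing (mu a) f = pairing (nu a) f" by (simp add: pairing_def)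
 qed
qed

text \<open>A tuple supported above degree \<open>k\<close> agrees with zero up to \<open>k\<close>;
  so the gain of one degree, applied to \<open>nu\<close> and zero, says that \<open>F\<close>
  raises degrees.\<close>

lemma raisingI:
 assumes t: "\<And>nu. tuple nu ==> tuple (F nu)" and z: "\<And>a. F (%_ _. 0) a = (%_. 0)"
  and c: "\<And>k nu nu'. tuple nu ==> tuple nu' ==> agree {} k nu nu' ==> agree {} (Suc k) (F nu) (F nu')"
 shows "raising F"
 unfolding raising_def
proof (intro allI impI conjI)
 fix nu :: "('a, 'b) tree_tuple" and k assume n: "tuple nu"
 then show "tuple (F nu)" by (rule t)
 have 0: "tuple (%_ _. 0 :: 'b)" by (simp add: series_def)
 assume "above k nu"
 then have "agree {} k nu (%_ _. 0)" unfolding agree_none_iff[OF n 0] above_def by (meson leD)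
 from c[OF n 0 this] show "above (Suc k) (F nu)"
  unfolding agree_none_iff[OF t[OF n] t[OF 0]] above_def z by (meson not_less)
qed

lemma bilin_Br_zero: "bilin Br x (%_. 0) = (%_. 0)" "bilin Br (%_. 0) y = (%_. 0)"
 by (simp_all add: bilin_def lin_def case_prod_beta)

lemma tree_der_zero: "tree_der (%_ _. 0) p = (%_. 0)"
 by (induction p) (simp_all add: bilin_Br_zero)

lemma raising_Br: "tuple mu ==> raising (%nu a. bilin Br (mu a) (nu a))"
 by (rule raisingI) (simp_all add: tuple_Br bilin_Br_zero agree_Br agree_refl)

lemma raising_der: "tuple mu ==> raising (%nu a. lin (tree_der mu) (nu a))"
 by (rule raisingI[OF tuple_der _ agree_der]) (simp_all add: lin_def agree_refl)

lemma raising_tbr: "tuple mu ==> raising (tbr mu)"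
 by (rule raisingI[OF tuple_tbr _ agree_tbr]) (simp_all add: agree_refl tbr_def[abs_def] bilin_Br_zero tree_der_zero lin_def)

lemma raising_scale:
 assumes "raising F"
 shows "raising (%nu a p. c * F nu a p)"
 unfolding raising_def
proof (intro allI impI conjI)
 fix nu :: "('a, 'b) tree_tuple" and k assume n: "tuple nu"
 then show "tuple (%a p. c * F nu a p)" using assms by (simp add: raising_def series_scale)
 assume k: "above k nu"
 then have "above (Suc k) (F nu)" using assms n by (simp add: raising_def)
 then show "above (Suc k) (%a p. c * F nu a p)" unfolding above_def using mult_nonzeroD by metis
qed

lemma raising_pow:
 assumes F: "raising F" and n: "tuple nu"
 shows "tuple ((F ^^ k) nu) \<and> above k ((F ^^ k) nu)"
 using assms by (induction k) (auto simp: raising_def above_0)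

text \<open>The power series with coefficients \<open>c\<close> in the operator \<open>F\<close>, on
  representing series. If \<open>F\<close> raises degrees, the truncation keeps every term that can
  be non-zero at \<open>p\<close>.\<close>

definition ser :: "(nat => 'r::comm_ring_1) => (('a, 'r) tree_tuple => ('a, 'r) tree_tuple) =>
  ('a, 'r) tree_tuple => ('a, 'r) tree_tuple" where
 "ser c F nu a p = (\<Sum>n\<le>leaves p. c n * (F ^^ n) nu a p)"

text \<open>The terms \<open>r n\<close> may have coefficients in low degrees, as arbitrary
  representatives of high-degree elements do. The truncation is therefore moved from the series to
  the functional.\<close>

lemma diagonal_series:
 assumes r: "\<And>n. r n \<in> tser S"
 shows "(%p. \<Sum>n\<le>leaves p. c n * r n p) \<in> tser S" (is "?x \<in> _")
  and "tree_bounded S N f ==>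
   pairing (%p. \<Sum>n\<le>leaves p. c n * r n p) f = (\<Sum>n\<le>N. c n * pairing (r n) (%p. if n \<le> leaves p then f p else 0))"
proof -
 let ?r = "%n p. if n \<le> leaves p then r n p else 0"
 let ?s = "%N p. \<Sum>n\<le>N. c n * ?r n p"
 have r': "?r n \<in> tser S" for n by (rule series_subset[OF r]) (auto split: if_splits)
 have s: "?s N \<in> tser S" for N by (rule series_sum) (auto intro: series_scale r')
 have e: "?x p = ?s N p" if "leaves p \<le> N" for p N
  using that by (intro sum.mono_neutral_cong_left) auto
 have supp_upto_e: "supp_upto leaves N ?x = supp_upto leaves N (?s N)" for N
  unfolding supp_upto_def using e[of _ N] by (intro Collect_cong conj_cong) simp_all
 show x: "?x \<in> tser S"
 proof (rule seriesI)
  show "p \<in> trees S" if "?x p ~= 0" for p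
  proof -
   have "?s (leaves p) p ~= 0" using that unfolding e[OF order_refl[of "leaves p"]] .
   then show ?thesis by (rule seriesD[OF s])
  qed
  show "finite (supp_upto leaves N ?x)" for N
   unfolding supp_upto_e by (rule finite_supp_upto[OF s])
 qed
 assume f: "tree_bounded S N f"
 have "pairing ?x f = pairing (?s N) f"
  unfolding pairing_series[OF x f] pairing_series[OF s f] supp_upto_e
  by (intro sum.cong refl arg_cong2[where f = "(*)"] e) (simp add: supp_upto_def)
 also have "... = (\<Sum>n\<le>N. pairing (%p. c n * ?r n p) f)" by (rule pairing_sum_left[OF _ _ f]) (auto intro: series_scale r')
 also have "... = (\<Sum>n\<le>N. c n * pairing (?r n) f)" by (simp add: pairing_scale_left[OF r' f])
 also have "... = (\<Sum>n\<le>N. c n * pairing (r n) (%p. if n \<le> leaves p then f p else 0))"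
 proof -
  have "pairing (?r n) f = pairing (r n) (%p. if n \<le> leaves p then f p else 0)" for n
   unfolding pairing_def by (rule Sum_any.cong) simp
  then show ?thesis by simp
 qed
 finally show "pairing ?x f = (\<Sum>n\<le>N. c n * pairing (r n) (%p. if n \<le> leaves p then f p else 0))" .
qed

lemma tuple_ser: "raising F ==> tuple nu ==> tuple (ser c F nu)"
 unfolding ser_def[abs_def] using raising_pow by (intro ballI diagonal_series(1)) blast

lemma pairing_ser:
 assumes F: "raising F" and n: "tuple nu" and a: "a \<in> S" and f: "tree_bounded S N f"
 shows "pairing (ser c F nu a) f = (\<Sum>n\<le>N. c n * pairing ((F ^^ n) nu a) f)"
proof -
 have "pairing ((F ^^ k) nu a) (%p. if k \<le> leaves p then f p else 0) = pairing ((F ^^ k) nu a) f" for k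
  by (rule pairing_cong) (use raising_pow[OF F n, of k] a in \<open>fastforce simp: above_def\<close>)
 then show ?thesis
  unfolding ser_def[abs_def] using diagonal_series(2)[of "%k. (F ^^ k) nu a", OF _ f] raising_pow[OF F n] a by simp
qed

lemma agree_ser:
 assumes F: "raising F" "raising F'" and n: "tuple nu" "tuple nu'"
  and a: "\<And>k. agree R n ((F ^^ k) nu) ((F' ^^ k) nu')"
 shows "agree R n (ser c F nu) (ser c F' nu')"
 unfolding agree_def using agreeD[OF a]
 by (auto simp: pairing_ser[OF F(1) n(1) _ lie_funD] pairing_ser[OF F(2) n(2) _ lie_funD])

lemma agree_pow:
 assumes F: "raising F" "raising F'" and n: "tuple nu" "tuple nu'" and a: "agree R (Suc n) nu nu'"
  and step: "\<And>nu nu'. tuple nu ==> tuple nu' ==> agree R n nu nu' ==> agree R (Suc n) (F nu) (F' nu')"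
 shows "agree R (Suc n) ((F ^^ k) nu) ((F' ^^ k) nu')"
proof (induction k)
 case (Suc k)
 then show ?case using raising_pow[OF F(1) n(1), of k] raising_pow[OF F(2) n(2), of k]
  by (simp add: step agree_mono[OF Suc])
qed (simp add: a)

section \<open>Change of coefficients, and null series over polynomials\<close>

lemma pairing_hom:
 fixes h :: "'r::comm_ring_1 => 'q::comm_ring_1"
 assumes h: "\<And>x y. h (x + y) = h x + h y" "\<And>x y. h (x * y) = h x * h y" and x: "x \<in> series B d" and f: "bounded_by B d N f"
 shows "h (pairing x f) = pairing (%b. h (x b)) (%b. h (f b))"
proof -
 have h0: "h 0 = 0" using h(1)[of 0 0] by simp
 have hs: "h (sum g A) = (\<Sum>a\<in>A. h (g a))" for g and A :: "'c set"
  by (induction A rule: infinite_finite_induct) (auto simp: h0 h(1))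
 have "(\<Sum>b\<in>supp_upto d N x. h (x b) * h (f b)) = pairing (%b. h (x b)) (%b. h (f b))"
  by (rule pairing_eq_sum[symmetric, OF finite_supp_upto[OF x]])
    (use x f h0 in \<open>force simp: supp_upto_def bounded_by_def dest: mult_nonzeroD seriesD\<close>)
 then show ?thesis unfolding pairing_series[OF x f] hs h(2) by simp
qed

lemma series_hom: "x \<in> series B d ==> h 0 = 0 ==> (%b. h (x b)) \<in> series B d"
 by (erule series_subset) auto

lemma lie_fun_hom:
 assumes f: "lie_fun (lie_rels S) n f" and h: "\<And>x y. h (x + y) = h x + h y"
 shows "lie_fun (lie_rels S) n (%p. h (f p))"
proof -
 have h0: "h 0 = 0" using h[of 0 0] by simp
 have "(\<Sum>p\<leftarrow>c. h (f p)) = h (\<Sum>p\<leftarrow>c. f p)" for c by (induction c) (simp_all add: h h0)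
 then show ?thesis using f h0 by (auto simp: lie_fun_def kills_lie_rels bounded_by_def)
qed

lemma fl_null_rat:
 fixes x :: "'a lie_tree => rat"
 assumes x: "x \<in> tser S" and f: "\<And>n f. lie_fun (lie_rels S) n f ==> pairing x f = 0"
 shows "x \<in> null_series (trees S) leaves (lie_rels S)"
proof (rule null_seriesI[OF homogeneous_lie_rels x])
 fix n and W :: "'a lie_tree => rat"
 assume "\<And>b. W b ~= 0 ==> b \<in> trees S \<and> leaves b = n" "kills (lie_rels S) W"
 then show "pairing x W = 0" by (intro f[of n]) (auto simp: lie_fun_def bounded_by_def)
qed

lemma sum_eval: "(\<Sum>i\<in>I. g i) x = (\<Sum>i\<in>I. g i x)"
 by (induction I rule: infinite_finite_induct) auto

text \<open>\<open>rat poly\<close> is not a field, so the separation argument is applied to the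
  coefficient of each power of t, a series over \<open>rat\<close>. In a fixed degree the support is
  finite, which bounds the powers of t, and the coefficients recombine to a finite combination of
  relations.\<close>

lemma fl_null_poly:
 fixes x :: "'a lie_tree => rat poly"
 assumes x: "x \<in> tser S" and f: "\<And>n f. lie_fun (lie_rels S) n f ==> pairing x f = 0"
 shows "x \<in> null_series (trees S) leaves (lie_rels S)"
 unfolding null_series_def mem_Collect_eq
proof (intro conjI x allI)
 fix n
 let ?c = "%k p. coeff (x p) k"
 have c: "?c k \<in> null_series (trees S) leaves (lie_rels S)" for k
 proof (rule fl_null_rat)
  show s: "?c k \<in> tser S" by (rule series_hom[OF x]) simp
  fix m f assume l: "lie_fun (lie_rels S) m (f :: 'a lie_tree => rat)"
  have l': "lie_fun (lie_rels S) m (%p. [:f p:])" by (rule lie_fun_hom[OF l]) simp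
  note b = lie_funD[OF l] lie_funD[OF l']
  have "pairing (?c k) f = coeff (pairing x (%p. [:f p:])) k"
  proof -
   have "pairing (?c k) f = (\<Sum>p\<in>supp_upto leaves m x. coeff (x p) k * f p)"
    by (rule pairing_superset[OF s b(1) finite_supp_upto[OF x]]) (auto simp: supp_upto_def)
   then show ?thesis unfolding pairing_series[OF x b(2)] by (simp add: coeff_sum mult.commute)
  qed
  then show "pairing (?c k) f = 0" using assms(2)[OF l'] by simp
 qed
 let ?F = "{p. leaves p = n \<and> x p ~= 0}"
 have F: "finite ?F" using x by (simp add: series_def)
 let ?K = "Max (insert 0 ((%p. degree (x p)) ` ?F))"
 have K: "degree (x p) \<le> ?K" if "leaves p = n" for p
  using F that by (cases "x p = 0") (auto intro: Max_ge)
 have lift: "(%p. [:y p:]) \<in> fmod.span (lie_rels S)" if "y \<in> fmod.span (lie_rels S)" for y :: "'a lie_tree => rat"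
  using that
 proof (induction rule: fmod.span_induct_alt)
  case base
  have "(%p. [:(0 :: 'a lie_tree => rat) p:]) = 0" by (simp add: zero_fun_def)
  then show ?case using fmod.span_zero[of "lie_rels S"] by simp
 next
  case (step c r y)
  have "(%p. [:(fscale c r + y) p:]) = fscale [:c:] (%p. [:r p:]) + (%p. [:y p:])"
   by (simp add: fscale_def plus_fun_def mult.commute)
  moreover have "[:a + b:] = [:a:] + [:b:]" "[:delta p u:] = (delta p u :: rat poly)" for a b :: rat and p u :: "'a lie_tree"
   by (simp_all add: delta_def one_pCons)
  then have "[:delta_list d u:] = (delta_list d u :: rat poly)" for d :: "'a lie_tree list" and u
   by (induction d) (simp_all del: add_pCons)
  then have "(%p. [:r p:]) \<in> lie_rels S" using step(1) by (auto simp: lie_rels_eq)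
  ultimately show ?case using step by (simp add: fmod.span_add fmod.span_scale fmod.span_base)
 qed
 have "(%p. if leaves p = n then x p else 0) = (\<Sum>k\<le>?K. fscale (monom 1 k) (%p. [:if leaves p = n then ?c k p else 0:]))"
 proof
  fix p
  have "x p = (\<Sum>k\<le>?K. monom (coeff (x p) k) k)" if "leaves p = n"
   using poly_as_sum_of_monoms'[OF K[OF that]] by simp
  then show "(if leaves p = n then x p else 0) = (\<Sum>k\<le>?K. fscale (monom 1 k) (%p. [:if leaves p = n then ?c k p else 0:])) p"
   by (simp add: sum_eval fscale_def smult_monom mult.commute[of "monom _ _"])
 qed
 also have "... \<in> fmod.span (lie_rels S)"
 proof (intro fmod.span_sum fmod.span_scale)
  fix k
  show "(%p. [:if leaves p = n then ?c k p else 0:]) \<in> fmod.span (lie_rels S)"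
   by (rule lift) (use c[of k] in \<open>simp add: null_series_def\<close>)
 qed
 finally show "(%p. if leaves p = n then x p else 0) \<in> fmod.span (lie_rels S)" .
qed

section \<open>Operations on tuples of classes, computed on representing series\<close>

definition cl :: "('a => 'a lie_tree => 'r::comm_ring_1) => ('a, 'r) fl_tuple" where
 "cl mu = (\<lambda>a\<in>S. fl_class S (mu a))"

abbreviation agree_lie :: "('a => 'a lie_tree => 'r::comm_ring_1) => ('a, 'r) tree_tuple => bool" where
 "agree_lie mu nu \<equiv> \<forall>n. agree (lie_rels S) n mu nu"

definition reps :: "('a, 'r::comm_ring_1) fl_tuple => ('a, 'r) tree_tuple" where
 "reps G a = rep (G a)"

lemma cl_FLS: "tuple mu ==> cl mu \<in> FLS S"
 by (auto simp: cl_def FLS_def FL_def)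

lemma reps_cl: "tuple mu ==> tuple (reps (cl mu))"
 by (auto simp: reps_def cl_def fl_class_def rep_qclass(1))

lemma agree_reps: "tuple mu ==> agree (lie_rels S) n (reps (cl mu)) mu"
 by (auto simp: agree_def reps_def cl_def fl_class_def lie_fun_def intro!: pairing_rep[OF homogeneous_lie_rels])

lemma FLS_cases:
 assumes "G \<in> FLS S"
 shows "tuple (reps G)" "cl (reps G) = G"
proof -
 have g: "\<exists>x\<in>tser S. G a = fl_class S x" if "a \<in> S" for a using assms that by (auto simp: FLS_def FL_def)
 have 1: "reps G a \<in> tser S \<and> fl_class S (reps G a) = G a" if "a \<in> S" for a
 proof -
  obtain x where "x \<in> tser S" "G a = fl_class S x" using g[OF \<open>a \<in> S\<close>] by blast
  then show ?thesis using rep_qclass(1)[of x "trees S" leaves "lie_rels S"] qclass_rep[of x "trees S" leaves "lie_rels S"]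
   by (simp add: reps_def fl_class_def)
 qed
 then show "tuple (reps G)" by blast
 show "cl (reps G) = G"
 proof
  show "cl (reps G) a = G a" for a
   using 1[of a] PiE_arb[OF assms[unfolded FLS_def], of a] by (cases "a \<in> S") (simp_all add: cl_def)
 qed
qed

lemma cl_eqI_gen:
 fixes mu nu :: "'a => 'a lie_tree => 'r::comm_ring_1"
 assumes null: "\<And>x :: 'a lie_tree => 'r. x \<in> tser S ==> (\<And>n f. lie_fun (lie_rels S) n f ==> pairing x f = 0) ==> x \<in> null_series (trees S) leaves (lie_rels S)"
  and t: "tuple mu" "tuple nu" and a: "agree_lie mu nu"
 shows "cl mu = cl nu"
proof -
 have "fl_class S (mu c) = fl_class S (nu c)" if c: "c \<in> S" for c
  unfolding fl_class_def
 proof (intro qclass_eqI null)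
  have s: "mu c \<in> tser S" "nu c \<in> tser S" using t c by auto
  then show "(%b. mu c b - nu c b) \<in> tser S" by (rule series_diff)
  show "pairing (%b. mu c b - nu c b) f = 0" if f: "lie_fun (lie_rels S) n f" for n f
   using pairing_diff_left[OF s lie_funD[OF f]] agreeD[OF a[rule_format, of n] c f] by simp
 qed
 then show ?thesis by (auto simp: cl_def fun_eq_iff)
qed

lemma cl_eqI_poly:
 fixes mu nu :: "('a, rat poly) tree_tuple"
 shows "tuple mu ==> tuple nu ==> agree_lie mu nu ==> cl mu = cl nu"
 by (rule cl_eqI_gen[OF fl_null_poly])

lemma cl_eqI_rat:
 fixes mu nu :: "('a, rat) tree_tuple"
 shows "tuple mu ==> tuple nu ==> agree_lie mu nu ==> cl mu = cl nu"
 by (rule cl_eqI_gen[OF fl_null_rat])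

lemma agree_sym: "agree R n mu nu ==> agree R n nu mu"
 by (simp add: agree_def)

lemma agree_trans: "agree R n mu nu ==> agree R n nu ka ==> agree R n mu ka"
 by (simp add: agree_def)

lemma agree_lieI: "(\<And>n. agree (lie_rels S) (Suc n) mu nu) ==> agree_lie mu nu"
 using agree_mono[of "lie_rels S" "Suc _" mu nu] by (metis le_SucI order_refl)

lemma cl_eqD:
 assumes "tuple mu" "tuple nu" "cl mu = cl nu"
 shows "agree_lie mu nu"
 using agree_trans[OF agree_sym[OF agree_reps[OF assms(1)]]] agree_reps[OF assms(2)] assms(3) by metis

context
 fixes mu nu :: "('a, rat poly) tree_tuple"
 assumes m: "tuple mu" and n: "tuple nu"
begin

private lemmas L = disjI1[OF refl[of "lie_rels S"]]
private lemmas rm = reps_cl[OF m] and rn = reps_cl[OF n]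
private lemmas am = agree_reps[OF m] and an = agree_reps[OF n]

lemma fls_bracket_cl: "fls_bracket S (cl mu) (cl nu) = cl (%a. bilin Br (mu a) (nu a))"
proof -
 have "fls_bracket S (cl mu) (cl nu) = cl (%a. bilin Br (reps (cl mu) a) (reps (cl nu) a))"
  by (auto simp: fls_bracket_def cl_def fl_bracket_def reps_def)
 also have "... = cl (%a. bilin Br (mu a) (nu a))"
  by (rule cl_eqI_poly[OF tuple_Br[OF rm rn] tuple_Br[OF m n] agree_lieI[OF agree_Br[OF L rm m rn n am an]]])
 finally show ?thesis .
qed

lemma fls_der_cl: "fls_der S (cl mu) (cl nu) = cl (%a. lin (tree_der mu) (nu a))"
proof -
 have "fls_der S (cl mu) (cl nu) = cl (%a. lin (tree_der (reps (cl mu))) (reps (cl nu) a))"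
  by (auto simp: fls_der_def cl_def fl_der_def reps_def[abs_def])
 also have "... = cl (%a. lin (tree_der mu) (nu a))"
  by (rule cl_eqI_poly[OF tuple_der[OF rm rn] tuple_der[OF m n] agree_lieI[OF agree_der[OF L rm m rn n am an]]])
 finally show ?thesis .
qed

lemma fls_add_cl: "fls_add S (cl mu) (cl nu) = cl (%a p. mu a p + nu a p)"
proof -
 have "fls_add S (cl mu) (cl nu) = cl (%a p. 1 * reps (cl mu) a p + 1 * reps (cl nu) a p)"
  by (auto simp: fls_add_def cl_def reps_def)
 also have "... = cl (%a p. 1 * mu a p + 1 * nu a p)"
  by (rule cl_eqI_poly[OF tuple_lincomb[OF rm rn] tuple_lincomb[OF m n]]) (intro allI agree_lincomb rm rn m n am an)
 finally show ?thesis by simp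
qed

lemma fls_scale_cl: "fls_scale S c (cl mu) = cl (%a p. c * mu a p)"
proof -
 have "fls_scale S c (cl mu) = cl (%a p. c * reps (cl mu) a p + 0 * reps (cl mu) a p)"
  by (auto simp: fls_scale_def cl_def reps_def)
 also have "... = cl (%a p. c * mu a p + 0 * mu a p)"
  by (rule cl_eqI_poly[OF tuple_lincomb[OF rm rm] tuple_lincomb[OF m m]]) (intro allI agree_lincomb rm m am)
 finally show ?thesis by simp
qed

end

lemma fls_tb_cl:
 assumes m: "tuple mu" and n: "tuple nu"
 shows "fls_tb S (cl mu) (cl nu) = cl (tbr mu nu :: ('a, rat poly) tree_tuple)"
proof -
 note d = tuple_Br[OF m n] tuple_der[OF m n] tuple_der[OF n m]
 have "tuple (%a p. bilin Br (mu a) (nu a) p + lin (tree_der mu) (nu a) p)" using d by (simp add: series_add)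
 moreover have "tuple (%a p. - 1 * lin (tree_der nu) (mu a) p)" using d(3) series_scale[of _ "trees S" leaves "-1"] by blast
 ultimately show ?thesis
  unfolding fls_tb_def fls_bracket_cl[OF m n] fls_der_cl[OF m n] fls_der_cl[OF n m] fls_add_cl[OF d(1,2)] fls_scale_cl[OF d(3) d(3)]
  by (subst fls_add_cl) (simp_all add: tbr_def[abs_def])
qed

lemma tuple_const: "tuple mu ==> tuple (%a p. [:mu a p:])"
 by (auto intro: series_hom[where h = "%c. [:c:]"])

lemma fls_const_def': "fls_const S lam = cl (%a p. [:reps lam a p:])"
 by (simp add: fls_const_def cl_def reps_def)

text \<open>Each Lie relation is homogeneous in the number of leaves, so it is kept or dropped as a
  whole. This pays for the truncation in \<open>op_series\<close>, which is applied to chosen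
  representatives.\<close>

lemma lie_fun_trunc:
 assumes f: "lie_fun (lie_rels S) n f"
 shows "lie_fun (lie_rels S) n (%p. if k \<le> leaves p then f p else 0)"
proof -
 have "(\<Sum>p\<leftarrow>c. if k \<le> leaves p then f p else 0) = 0" if c: "lie_rel S c" for c
 proof -
  obtain m where "\<forall>p\<in>set c. leaves p = m" using lie_rel_trees[OF c] by blast
  then have "(\<Sum>p\<leftarrow>c. if k \<le> leaves p then f p else 0) = (\<Sum>p\<leftarrow>c. if k \<le> m then f p else 0)"
   by (intro arg_cong[of _ _ sum_list] map_cong) auto
  then show ?thesis using f c by (cases "k \<le> m") (simp_all add: lie_fun_def kills_lie_rels)
 qed
 then show ?thesis using f by (auto simp: lie_fun_def kills_lie_rels bounded_by_def)
qed

text \<open>The chosen representatives of the powers differ from the powers on series by null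
  series. The diagonal truncation does not disturb this: moved to the functional, it gives a Lie
  functional again.\<close>

lemma op_series_cl:
 fixes nu :: "('a, rat poly) tree_tuple"
 assumes F: "raising F'" and n: "tuple nu" and FF: "\<And>nu. tuple nu ==> F (cl nu) = cl (F' nu)"
 shows "op_series S f F (cl nu) = cl (ser (%n. [:fps_nth f n:]) F' nu)"
proof -
 have t: "tuple ((F' ^^ k) nu)" for k using raising_pow[OF F n] by blast
 have p: "(F ^^ k) (cl nu) = cl ((F' ^^ k) nu)" for k by (induction k) (simp_all add: FF t)
 have 1: "tuple (%a p. \<Sum>n\<le>leaves p. [:fps_nth f n:] * reps (cl ((F' ^^ n) nu)) a p)"
  using reps_cl[OF t] by (intro ballI diagonal_series(1)) blast
 have 2: "agree (lie_rels S) N (%a p. \<Sum>n\<le>leaves p. [:fps_nth f n:] * reps (cl ((F' ^^ n) nu)) a p) (ser (%n. [:fps_nth f n:]) F' nu)" for N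
  unfolding agree_def ser_def[abs_def]
 proof (intro ballI allI impI)
  fix a g assume a: "a \<in> S" and g: "lie_fun (lie_rels S) N (g :: 'a lie_tree => rat poly)"
  have r: "reps (cl ((F' ^^ k) nu)) a \<in> tser S" "(F' ^^ k) nu a \<in> tser S" for k using reps_cl[OF t] t a by blast+
  show "pairing (%p. \<Sum>n\<le>leaves p. [:fps_nth f n:] * reps (cl ((F' ^^ n) nu)) a p) g = pairing (%p. \<Sum>n\<le>leaves p. [:fps_nth f n:] * (F' ^^ n) nu a p) g"
   unfolding diagonal_series(2)[OF r(1) lie_funD[OF g]] diagonal_series(2)[OF r(2) lie_funD[OF g]]
    agreeD[OF agree_reps[OF t] a lie_fun_trunc[OF g]] ..
 qed
 have "op_series S f F (cl nu) = cl (%a p. \<Sum>n\<le>leaves p. [:fps_nth f n:] * reps (cl ((F' ^^ n) nu)) a p)"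
  unfolding op_series_def p reps_def by (rule cl_def[symmetric])
 also have "... = cl (ser (%n. [:fps_nth f n:]) F' nu)" by (rule cl_eqI_poly[OF 1 tuple_ser[OF F n] allI[OF 2]])
 finally show ?thesis .
qed

end

section \<open>The differential equations\<close>

lemma pderiv_sum: "pderiv (\<Sum>i\<in>I. g i :: rat poly) = (\<Sum>i\<in>I. pderiv (g i))"
 by (induction I rule: infinite_finite_induct) (simp_all add: pderiv_add)

lemma poly_eq_0_if_derivs:
 fixes q :: "rat poly"
 shows "(\<And>k. poly ((pderiv ^^ k) q) 0 = 0) ==> q = 0"
proof (induction "degree q" arbitrary: q rule: less_induct)
 case less
 have 0: "poly q 0 = 0" using less.prems[of 0] by simp
 show ?case
 proof (cases "degree q = 0")
  case True
  then obtain c where "q = [:c:]" by (rule degree_eq_zeroE)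
  then show ?thesis using 0 by simp
 next
  case False
  have "pderiv q = 0"
   by (rule less.hyps) (use False less.prems[of "Suc _"] in \<open>simp_all add: degree_pderiv funpow_swap1\<close>)
  then show ?thesis using False by (simp add: pderiv_eq_0_iff)
 qed
qed

text \<open>All derivatives of \<open>de x\<close> at 0 are initial values of the same family, so
  its Taylor coefficients vanish. In the applications \<open>x\<close> is a functional which may
  itself depend on t, and \<open>D\<close> differentiates it.\<close>

lemma ode_zero:
 fixes de :: "'x => rat poly"
 assumes P: "\<And>x. P x ==> P (D x) \<and> pderiv (de x) = de (D x) \<and> poly (de x) 0 = 0" and x: "P x"
 shows "de x = 0"
proof (rule poly_eq_0_if_derivs)
 fix k
 have "P ((D ^^ k) x) \<and> (pderiv ^^ k) (de x) = de ((D ^^ k) x)"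
  by (induction k) (use P x in auto)
 then show "poly ((pderiv ^^ k) (de x)) 0 = 0" using P by simp
qed

definition pint :: "rat poly => rat poly" where
 "pint q = (\<Sum>i\<le>degree q. monom (coeff q i / of_nat (Suc i)) (Suc i))"

lemma pint: "pderiv (pint q) = q" "poly (pint q) 0 = 0" "pint 0 = 0"
proof -
 have "pderiv (pint q) = (\<Sum>i\<le>degree q. monom (coeff q i) i)"
  unfolding pint_def by (simp add: pderiv_sum pderiv_monom del: of_nat_Suc)
 then show "pderiv (pint q) = q" by (simp add: poly_as_sum_of_monoms)
qed (simp_all add: pint_def poly_sum poly_monom)

lemma pairing_pderiv:
 fixes x f :: "'b => rat poly"
 assumes x: "x \<in> series B d" and f: "bounded_by B d N f"
 shows "pderiv (pairing x f) = pairing (%b. pderiv (x b)) f + pairing x (%b. pderiv (f b))"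
proof -
 have dx: "(%b. pderiv (x b)) \<in> series B d" by (rule series_subset[OF x]) auto
 have df: "bounded_by B d N (%b. pderiv (f b))" using f by (force simp: bounded_by_def)
 have "pairing (%b. pderiv (x b)) f = (\<Sum>b\<in>supp_upto d N x. pderiv (x b) * f b)"
  by (rule pairing_superset[OF dx f finite_supp_upto[OF x]]) (auto simp: supp_upto_def)
 then show ?thesis
  unfolding pairing_series[OF x f] pairing_series[OF x df]
  by (simp add: pderiv_sum pderiv_mult sum.distrib algebra_simps)
qed

context strands begin

lemma tuple_pderiv: "tuple mu ==> tuple (%a p. pderiv (mu a p))"
 by (auto intro: series_hom)

lemma tuple_poly: "tuple mu ==> tuple (%a p. poly (mu a p) c)"
 by (auto intro: series_hom[where h = "%q. poly q c"])

text \<open>Differentiation acts on the coefficients of a representative. By the product rule, its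
  pairing with a Lie functional is the derivative of a pairing minus the pairing with the
  differentiated functional, and both depend on the class only.\<close>

lemma fls_ddt_cl:
 assumes m: "tuple mu"
 shows "fls_ddt S (cl mu) = cl (%a p. pderiv (mu a p))"
proof -
 note r = reps_cl[OF m]
 have "fls_ddt S (cl mu) = cl (%a p. pderiv (reps (cl mu) a p))"
  unfolding fls_ddt_def reps_def by (rule cl_def[symmetric])
 also have "... = cl (%a p. pderiv (mu a p))"
 proof (rule cl_eqI_poly[OF tuple_pderiv[OF r] tuple_pderiv[OF m]], unfold agree_def, intro allI ballI impI)
  fix n a f assume a: "a \<in> S" and f: "lie_fun (lie_rels S) n (f :: 'a lie_tree => rat poly)"
  have s: "reps (cl mu) a \<in> tser S" "mu a \<in> tser S" using r m a by auto
  show "pairing (%p. pderiv (reps (cl mu) a p)) f = pairing (%p. pderiv (mu a p)) f"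
   using pairing_pderiv[OF s(1) lie_funD[OF f]] pairing_pderiv[OF s(2) lie_funD[OF f]]
    agreeD[OF agree_reps[OF m] a f] agreeD[OF agree_reps[OF m] a lie_fun_hom[OF f pderiv_add]] by simp
 qed
 finally show ?thesis .
qed

lemma fls_at_cl:
 assumes m: "tuple mu"
 shows "fls_at S c (cl mu) = cl (%a p. poly (mu a p) c)"
proof -
 note r = reps_cl[OF m]
 have "fls_at S c (cl mu) = cl (%a p. poly (reps (cl mu) a p) c)"
  unfolding fls_at_def reps_def by (rule cl_def[symmetric])
 also have "... = cl (%a p. poly (mu a p) c)"
 proof (rule cl_eqI_rat[OF tuple_poly[OF r] tuple_poly[OF m]], unfold agree_def, intro allI ballI impI)
  fix n a f assume a: "a \<in> S" and f: "lie_fun (lie_rels S) n (f :: 'a lie_tree => rat)"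
  have s: "reps (cl mu) a \<in> tser S" "mu a \<in> tser S" using r m a by auto
  have l: "lie_fun (lie_rels S) n (%p. [:f p:])" by (rule lie_fun_hom[OF f]) simp
  show "pairing (%p. poly (reps (cl mu) a p) c) f = pairing (%p. poly (mu a p) c) f"
   using pairing_hom[of "%q. poly q c", OF _ _ s(1) lie_funD[OF l]] pairing_hom[of "%q. poly q c", OF _ _ s(2) lie_funD[OF l]]
    agreeD[OF agree_reps[OF m] a l] by simp
 qed
 finally show ?thesis .
qed

lemma agree_0: "tuple mu ==> tuple nu ==> agree R 0 mu nu"
proof -
 have "pairing x f = 0" if "x \<in> tser S" "lie_fun R 0 f" for x f
 proof -
  have "f p = 0" if "p \<in> trees S" for p
   using lie_funD[OF \<open>lie_fun R 0 f\<close>] leaves_pos[of p] that by (auto simp: bounded_by_def)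
  then have "pairing x f = pairing x (%_. 0)" by (rule pairing_cong_series[OF that(1)])
  then show ?thesis by simp
 qed
 then show "tuple mu ==> tuple nu ==> agree R 0 mu nu" by (simp add: agree_def)
qed

section \<open>Existence and uniqueness for causal differential equations\<close>

context
 fixes Ps :: "('a, rat poly) tree_tuple => ('a, rat poly) tree_tuple" and Ph
 assumes tuplePs: "\<And>mu. tuple mu ==> tuple (Ps mu)"
  and causal: "\<And>R n mu mu'. lie_or_none R ==> tuple mu ==> tuple mu' ==> agree R n mu mu' ==> agree R (Suc n) (Ps mu) (Ps mu')"
  and Ph: "\<And>mu. tuple mu ==> Ph (cl mu) = cl (Ps mu)"
begin

text \<open>Picard iteration with coefficientwise antiderivatives. By causality the coefficients of
  trees with at most \<open>k\<close> leaves are final after \<open>k\<close> steps, so the solution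
  is read off diagonally. The construction concerns series, hence causality is used with the empty
  set of relations.\<close>

lemma ode_exists: "\<exists>mu. tuple mu \<and> (\<forall>a\<in>S. \<forall>p. poly (mu a p) 0 = 0 \<and> pderiv (mu a p) = Ps mu a p)"
proof -
 define m where "m = rec_nat (%_ _. 0) (%_ x a p. pint (Ps x a p))"
 have m0: "m 0 = (%_ _. 0)" and mS: "m (Suc k) = (%a p. pint (Ps (m k) a p))" for k by (simp_all add: m_def)
 have t: "tuple (m k)" for k
 proof (induction k)
  case (Suc k)
  then show ?case unfolding mS using tuplePs by (auto intro: series_hom[where h = pint] simp: pint)
 qed (simp add: m0)
 have step: "agree {} k (m k) (m (Suc k))" for k
 proof (induction k)
  case 0
  show ?case by (rule agree_0[OF t t])
 next
  case (Suc k)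
  then have "agree {} (Suc k) (Ps (m k)) (Ps (m (Suc k)))" by (intro causal t) auto
  then show ?case unfolding agree_none_iff[OF tuplePs[OF t] tuplePs[OF t]] agree_none_iff[OF t t] by (simp add: mS)
 qed
 have stable: "m (k + j) a p = m k a p" if "a \<in> S" "leaves p \<le> k" for k j a p
 proof (induction j)
  case (Suc j)
  then show ?case using step[of "k + j"] that unfolding agree_none_iff[OF t t] by simp
 qed simp
 define mu where "mu a p = m (leaves p) a p" for a p
 have mum: "mu a p = m k a p" if "a \<in> S" "leaves p \<le> k" for k a p
  using stable[OF that(1) order_refl[of "leaves p"], of "k - leaves p"] that by (simp add: mu_def)
 have tmu: "tuple mu"
 proof
  fix a assume a: "a \<in> S"
  have ms: "m k a \<in> tser S" for k using t a by blast
  show "mu a \<in> tser S"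
  proof (rule seriesI)
   show "mu a p ~= 0 ==> p \<in> trees S" for p unfolding mu_def by (rule seriesD[OF ms])
   have "supp_upto leaves N (mu a) = supp_upto leaves N (m N a)" for N
    unfolding supp_upto_def using mum[OF a, of _ N] by (intro Collect_cong conj_cong) simp_all
   then show "finite (supp_upto leaves N (mu a))" for N by (simp add: finite_supp_upto[OF ms])
  qed
 qed
 have "poly (mu a p) 0 = 0 \<and> pderiv (mu a p) = Ps mu a p" if a: "a \<in> S" for a p
 proof -
  obtain n where n: "leaves p = Suc n" using leaves_pos[of p] by (cases "leaves p") auto
  have e: "mu a p = pint (Ps (m n) a p)" by (simp add: mu_def n mS)
  have "agree {} n mu (m n)" unfolding agree_none_iff[OF tmu t] using mum by simp
  then have "agree {} (Suc n) (Ps mu) (Ps (m n))" by (intro causal t tmu) auto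
  then have "Ps mu a p = Ps (m n) a p" unfolding agree_none_iff[OF tuplePs[OF tmu] tuplePs[OF t]] using a n by simp
  then show ?thesis by (simp add: e pint)
 qed
 then show ?thesis using tmu by blast
qed

text \<open>For uniqueness, causality is used with the Lie relations: agreement of two solutions up
  to degree \<open>n\<close> makes the right-hand sides agree one degree further, and
  \<open>ode_zero\<close> integrates this. Besides resolving the definite description, the lemma
  yields a series satisfying the equation coefficientwise, as needed for operators on
  weights.\<close>

lemma ode_solution:
 "\<exists>mu. tuple mu \<and> (\<forall>a\<in>S. \<forall>p. poly (mu a p) 0 = 0 \<and> pderiv (mu a p) = Ps mu a p) \<and>
  (THE G. G \<in> FLS S \<and> fls_at S 0 G = fls_zero S \<and> fls_ddt S G = Ph G) = cl mu"
proof -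
 obtain mu where t: "tuple mu" and mu: "\<And>a p. a \<in> S ==> poly (mu a p) 0 = 0 \<and> pderiv (mu a p) = Ps mu a p"
  using ode_exists by blast
 have z: "fls_zero S = cl (%_ _. 0 :: rat)" by (simp add: fls_zero_def cl_def)
 have cong: "cl x = cl y" if "\<And>a. a \<in> S ==> x a = y a" for x y :: "'a => 'a lie_tree => 'c::comm_ring_1"
  unfolding cl_def by (rule restrict_cong) (use that in auto)
 have sol: "cl mu \<in> FLS S \<and> fls_at S 0 (cl mu) = fls_zero S \<and> fls_ddt S (cl mu) = Ph (cl mu)"
  unfolding fls_at_cl[OF t] fls_ddt_cl[OF t] Ph[OF t] z
  using mu by (intro conjI cl_FLS[OF t] cong) auto
 have uniq: "G = cl mu" if G: "G \<in> FLS S" "fls_at S 0 G = fls_zero S" "fls_ddt S G = Ph G" for G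
 proof -
  define nu where "nu = reps G"
  have tn: "tuple nu" and Gn: "G = cl nu" using FLS_cases[OF G(1)] by (simp_all add: nu_def)
  have d: "agree_lie (%a p. pderiv (nu a p)) (Ps nu)"
   by (rule cl_eqD[OF tuple_pderiv[OF tn] tuplePs[OF tn]]) (use G(3) in \<open>simp add: Gn fls_ddt_cl[OF tn] Ph[OF tn]\<close>)
  have i: "agree_lie (%a p. poly (nu a p) 0) (%_ _. 0)"
   by (rule cl_eqD[OF tuple_poly[OF tn]]) (use G(2) in \<open>simp_all add: Gn fls_at_cl[OF tn] z\<close>)
  have "agree (lie_rels S) n nu mu" for n
  proof (induction n)
   case 0
   show ?case by (rule agree_0[OF tn t])
  next
   case (Suc n)
   have c: "agree (lie_rels S) (Suc n) (Ps nu) (Ps mu)" by (rule causal[OF _ tn t Suc]) simp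
   show ?case
    unfolding agree_def
   proof (intro ballI allI impI)
    fix a f assume a: "a \<in> S" and f: "lie_fun (lie_rels S) (Suc n) (f :: 'a lie_tree => rat poly)"
    have s: "nu a \<in> tser S" "mu a \<in> tser S" using tn t a by auto
    have "pairing (nu a) f - pairing (mu a) f = 0"
    proof (rule ode_zero[where P = "lie_fun (lie_rels S) (Suc n)" and D = "%g p. pderiv (g p)" and de = "%g. pairing (nu a) g - pairing (mu a) g" and x = f, OF _ f])
     fix g assume g: "lie_fun (lie_rels S) (Suc n) (g :: 'a lie_tree => rat poly)"
     have "pairing (%p. pderiv (nu a p)) g = pairing (%p. pderiv (mu a p)) g"
      using agreeD[OF d[rule_format] a g] agreeD[OF c a g] mu[OF a] by simp
     then have 1: "pderiv (pairing (nu a) g - pairing (mu a) g) = pairing (nu a) (%p. pderiv (g p)) - pairing (mu a) (%p. pderiv (g p))"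
      by (simp add: pderiv_diff pairing_pderiv[OF s(1) lie_funD[OF g]] pairing_pderiv[OF s(2) lie_funD[OF g]])
     have 2: "poly (pairing (nu a) g) 0 = 0"
      using pairing_hom[of "%q. poly q 0", OF _ _ s(1) lie_funD[OF g]] agreeD[OF i[rule_format] a lie_fun_hom[OF g, where h = "%q. poly q 0", OF poly_add]] by simp
     have 3: "poly (pairing (mu a) g) 0 = 0"
      using pairing_hom[of "%q. poly q 0", OF _ _ s(2) lie_funD[OF g]] mu[OF a] by simp
     show "lie_fun (lie_rels S) (Suc n) (%p. pderiv (g p)) \<and>
      pderiv (pairing (nu a) g - pairing (mu a) g) = pairing (nu a) (%p. pderiv (g p)) - pairing (mu a) (%p. pderiv (g p)) \<and>
      poly (pairing (nu a) g - pairing (mu a) g) 0 = 0"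
      using lie_fun_hom[OF g pderiv_add] 1 2 3 by simp
    qed
    then show "pairing (nu a) f = pairing (mu a) f" by simp
   qed
  qed
  then show ?thesis unfolding Gn by (intro cl_eqI_poly tn t) blast
 qed
 show ?thesis
  by (rule exI[of _ mu], intro conjI t the_equality sol) (use mu uniq in blast)+
qed

end

abbreviation poly_coeffs :: "rat fps => nat => rat poly" where
 "poly_coeffs f n \<equiv> [:fps_nth f n:]"

abbreviation ad_br :: "('a => 'a lie_tree => 'r::comm_ring_1) => ('a, 'r) tree_tuple => ('a, 'r) tree_tuple" where
 "ad_br mu nu \<equiv> %a. bilin Br (mu a) (nu a)"

abbreviation der_op :: "('a => 'a lie_tree => 'r::comm_ring_1) => ('a, 'r) tree_tuple => ('a, 'r) tree_tuple" where
 "der_op mu nu \<equiv> %a. lin (tree_der mu) (nu a)"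

lemma ser_causal:
 assumes F: "raising F" "raising F'" and n: "tuple nu" "tuple nu'" and a: "agree R (Suc n) nu nu'"
  and step: "\<And>nu nu'. tuple nu ==> tuple nu' ==> agree R n nu nu' ==> agree R (Suc n) (F nu) (F' nu')"
 shows "agree R (Suc n) (ser c F nu) (ser c F' nu')"
 by (rule agree_ser[OF F n agree_pow[OF F n a step]])

lemma Gamma_solution:
 assumes l: "lam \<in> FLS S"
 defines "c \<equiv> %a p. [:reps lam a p:]"
 defines "y \<equiv> ser (poly_coeffs (fps_exp 1)) (%nu a p. [:0, -1:] * der_op c nu a p) c"
 shows "\<exists>mu. tuple mu \<and> (\<forall>a\<in>S. \<forall>p. poly (mu a p) 0 = 0 \<and> pderiv (mu a p) = ser (poly_coeffs todd_fps) (ad_br mu) y a p) \<and>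
  Gamma_t S lam = cl mu"
proof -
 have c: "tuple c" unfolding c_def by (rule tuple_const[OF FLS_cases(1)[OF l]])
 have k: "fls_const S lam = cl c" by (simp add: fls_const_def' c_def)
 note rd = raising_scale[OF raising_der[OF c], of "[:0, -1:]"]
 have y: "tuple y" unfolding y_def by (rule tuple_ser[OF rd c])
 have Y: "op_series S (fps_exp 1) (%mu. fls_scale S [:0, - 1:] (fls_der S (fls_const S lam) mu)) (fls_const S lam) = cl y"
  unfolding k y_def by (rule op_series_cl[OF rd c]) (simp add: fls_der_cl[OF c] fls_scale_cl[OF tuple_der[OF c] c])
 show ?thesis
  unfolding Gamma_t_def Y
 proof (rule ode_solution)
  fix mu :: "('a, rat poly) tree_tuple" assume m: "tuple mu"
  show "tuple (ser (poly_coeffs todd_fps) (ad_br mu) y)" by (rule tuple_ser[OF raising_Br[OF m] y])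
  show "op_series S todd_fps (fls_bracket S (cl mu)) (cl y) = cl (ser (poly_coeffs todd_fps) (ad_br mu) y)"
   by (rule op_series_cl[OF raising_Br[OF m] y]) (rule fls_bracket_cl[OF m])
  fix R n and mu' :: "('a, rat poly) tree_tuple" assume R: "lie_or_none R" and m': "tuple mu'" and a: "agree R n mu mu'"
  show "agree R (Suc n) (ser (poly_coeffs todd_fps) (ad_br mu) y) (ser (poly_coeffs todd_fps) (ad_br mu') y)"
   by (rule ser_causal[OF raising_Br[OF m] raising_Br[OF m'] y y agree_refl agree_Br[OF R m m' _ _ a]])
 qed
qed

text \<open>Both the inner exponential and the outer Todd series depend on the unknown, so causality
  of the right-hand side is obtained in two stages.\<close>

lemma Lambda_solution:
 assumes l: "lam \<in> FLS S"
 defines "c \<equiv> %a p. [:reps lam a p:]"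
 shows "\<exists>mu. tuple mu \<and> (\<forall>a\<in>S. \<forall>p. poly (mu a p) 0 = 0 \<and>
   pderiv (mu a p) = ser (poly_coeffs todd_fps) (tbr mu) (ser (poly_coeffs (fps_exp 1)) (der_op mu) c) a p) \<and>
  Lambda_t S lam = cl mu"
proof -
 have c: "tuple c" unfolding c_def by (rule tuple_const[OF FLS_cases(1)[OF l]])
 have k: "fls_const S lam = cl c" by (simp add: fls_const_def' c_def)
 show ?thesis
  unfolding Lambda_t_def k
 proof (rule ode_solution)
  fix mu :: "('a, rat poly) tree_tuple" assume m: "tuple mu"
  note y = tuple_ser[OF raising_der[OF m] c]
  show "tuple (ser (poly_coeffs todd_fps) (tbr mu) (ser (poly_coeffs (fps_exp 1)) (der_op mu) c))" by (rule tuple_ser[OF raising_tbr[OF m] y])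
  have Y: "op_series S (fps_exp 1) (fls_der S (cl mu)) (cl c) = cl (ser (poly_coeffs (fps_exp 1)) (der_op mu) c)"
   by (rule op_series_cl[OF raising_der[OF m] c]) (rule fls_der_cl[OF m])
  show "op_series S todd_fps (fls_tb S (cl mu)) (op_series S (fps_exp 1) (fls_der S (cl mu)) (cl c)) =
    cl (ser (poly_coeffs todd_fps) (tbr mu) (ser (poly_coeffs (fps_exp 1)) (der_op mu) c))"
   unfolding Y by (rule op_series_cl[OF raising_tbr[OF m] y]) (rule fls_tb_cl[OF m])
  fix R n and mu' :: "('a, rat poly) tree_tuple" assume R: "lie_or_none R" and m': "tuple mu'" and a: "agree R n mu mu'"
  have "agree R (Suc n) (ser (poly_coeffs (fps_exp 1)) (der_op mu) c) (ser (poly_coeffs (fps_exp 1)) (der_op mu') c)"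
   by (rule ser_causal[OF raising_der[OF m] raising_der[OF m'] c c agree_refl agree_der[OF R m m' _ _ a]])
  then show "agree R (Suc n) (ser (poly_coeffs todd_fps) (tbr mu) (ser (poly_coeffs (fps_exp 1)) (der_op mu) c))
    (ser (poly_coeffs todd_fps) (tbr mu') (ser (poly_coeffs (fps_exp 1)) (der_op mu') c))"
   by (rule ser_causal[OF raising_tbr[OF m] raising_tbr[OF m'] y tuple_ser[OF raising_der[OF m'] c] _ agree_tbr[OF R m m' _ _ a]])
 qed
qed

end

section \<open>Exponentials of operators on weights\<close>

text \<open>A Cauchy product: the non-zero terms lie in a square of side \<open>N\<close>, which is
  contained in the triangle of size \<open>2 * N\<close>.\<close>

lemma sum_triangle_square:
 fixes g :: "nat => nat => 'r::comm_monoid_add"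
 assumes "\<And>j k. N < j \<or> N < k ==> g k j = 0"
 shows "(\<Sum>n\<le>2 * N. \<Sum>k\<le>n. g k (n - k)) = (\<Sum>j\<le>N. \<Sum>k\<le>N. g k j)"
proof -
 have z: "g k j ~= 0 ==> k \<le> N \<and> j \<le> N" for k j unfolding not_less[symmetric] using assms by blast
 have "(\<Sum>n\<le>2 * N. \<Sum>k\<le>n. g k (n - k)) = (\<Sum>(k, j)\<in>{(k, j). k + j \<le> 2 * N}. g k j)"
  by (rule sum.triangle_reindex_eq[symmetric])
 also have "... = (\<Sum>(k, j)\<in>{..N} \<times> {..N}. g k j)"
 proof (rule sum.mono_neutral_right)
  show "finite {(k, j). k + j \<le> 2 * N}" by (rule finite_subset[of _ "{..2 * N} \<times> {..2 * N}"]) auto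
 qed (use z in auto)
 also have "... = (\<Sum>k\<le>N. \<Sum>j\<le>N. g k j)" by (simp add: sum.cartesian_product)
 also have "... = (\<Sum>j\<le>N. \<Sum>k\<le>N. g k j)" by (rule sum.swap)
 finally show ?thesis .
qed

text \<open>The filtration of functionals by degree, kept abstract because it is used for weights of
  one diagram and for weights of pairs. A linear operator lowering the filtration is nilpotent on
  every \<open>A N\<close>, so its exponential is a finite sum.\<close>

locale filtered =
 fixes A :: "nat => ('d => 'r::comm_ring_1) set"
 assumes A_lincomb: "W \<in> A N ==> V \<in> A N ==> (%D. c * W D + e * V D) \<in> A N"
  and A_mono: "W \<in> A N ==> N \<le> M ==> W \<in> A M"
  and A_0: "W \<in> A 0 \<longleftrightarrow> W = (%_. 0)"
begin

lemma A_zero: "(%_. 0) \<in> A N"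
 by (rule A_mono[of _ 0]) (simp_all add: A_0)

lemma A_add: "W \<in> A N ==> V \<in> A N ==> (%D. W D + V D) \<in> A N"
 using A_lincomb[of W N V 1 1] by simp

lemma A_scale: "W \<in> A N ==> (%D. c * W D) \<in> A N"
 using A_lincomb[of W N W c 0] by simp

lemma A_sum: "(\<And>i. i \<in> I ==> W i \<in> A N) ==> (%D. \<Sum>i\<in>I. W i D) \<in> A N"
 by (induction I rule: infinite_finite_induct) (auto simp: A_zero A_add)

definition lowering :: "(('d => 'r::comm_ring_1) => 'd => 'r) => bool" where
 "lowering X \<longleftrightarrow> (\<forall>N. \<forall>W\<in>A N. \<forall>V\<in>A N. \<forall>c e. X (%D. c * W D + e * V D) = (%D. c * X W D + e * X V D)) \<and>
   (\<forall>N. \<forall>W\<in>A (Suc N). X W \<in> A N)"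

lemma lowersD:
 assumes "lowering X"
 shows "W \<in> A N ==> V \<in> A N ==> X (%D. c * W D + e * V D) = (%D. c * X W D + e * X V D)"
  "W \<in> A (Suc N) ==> X W \<in> A N" "W \<in> A N ==> X W \<in> A N" "X (%_. 0) = (%_. 0)"
proof -
 show 1: "W \<in> A N ==> V \<in> A N ==> X (%D. c * W D + e * V D) = (%D. c * X W D + e * X V D)"
  and 2: "W \<in> A (Suc N) ==> X W \<in> A N" for c e W V N using assms unfolding lowering_def by blast+
 show "W \<in> A N ==> X W \<in> A N" by (rule 2[OF A_mono]) auto
 show "X (%_. 0) = (%_. 0)" using 1[OF A_zero[of 0] A_zero[of 0], of 0 0] by simp
qed

lemma lowers_sum:
 assumes X: "lowering X" and W: "\<And>i. i \<in> I ==> W i \<in> A N"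
 shows "X (%D. \<Sum>i\<in>I. c i * W i D) = (%D. \<Sum>i\<in>I. c i * X (W i) D)"
proof (cases "finite I")
 case True
 then show ?thesis using W
 proof (induction I rule: finite_induct)
  case (insert i I)
  have "(%D. \<Sum>i\<in>I. c i * W i D) \<in> A N" using insert.prems by (intro A_sum A_scale) auto
  then show ?case using insert lowersD(1)[OF X insert.prems[OF insertI1], of "%D. \<Sum>i\<in>I. c i * W i D" "c i" 1] by simp
 qed (simp add: lowersD(4)[OF X])
qed (simp add: lowersD(4)[OF X])

lemma lowers_add: "lowering X ==> lowering Y ==> lowering (%W D. X W D + Y W D)"
 unfolding lowering_def by (auto simp: algebra_simps A_add)

lemma lowers_pow:
 assumes X: "lowering X" and W: "W \<in> A N"
 shows "(X ^^ n) W \<in> A (N - n)" "(X ^^ n) W \<in> A N" "N \<le> n ==> (X ^^ n) W = (%_. 0)"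
proof -
 show *: "(X ^^ n) W \<in> A (N - n)" for n
 proof (induction n)
  case (Suc n)
  then show ?case using lowersD(2)[OF X, of "(X ^^ n) W" "N - Suc n"] lowersD(3)[OF X] by (cases "n < N") (auto simp: Suc_diff_Suc)
 qed (simp add: W)
 then show "(X ^^ n) W \<in> A N" by (rule A_mono) simp
 show "N \<le> n ==> (X ^^ n) W = (%_. 0)" using *[of n] by (simp add: A_0)
qed

lemma lowers_pow_sum:
 assumes X: "lowering X" and W: "\<And>i. i \<in> I ==> W i \<in> A N"
 shows "(X ^^ n) (%D. \<Sum>i\<in>I. c i * W i D) = (%D. \<Sum>i\<in>I. c i * (X ^^ n) (W i) D)"
proof (induction n)
 case (Suc n)
 then show ?case using lowers_sum[OF X, of I "%i. (X ^^ n) (W i)" N c] lowers_pow(2)[OF X W] by simp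
qed simp

text \<open>Pascal's triangle for the operator \<open>X\<close> and the shift of the index
  \<open>j\<close>. It covers powers of a sum of commuting operators as well as iterated
  commutators.\<close>

lemma binomial_sequence:
 assumes X: "lowering X" and v: "\<And>n j. v n j \<in> A N" "\<And>n j. v (Suc n) j = (%D. X (v n j) D + v n (Suc j) D)"
 shows "v n j = (%D. \<Sum>k\<le>n. of_nat (n choose k) * (X ^^ (n - k)) (v 0 (j + k)) D)"
proof (induction n arbitrary: j)
 case (Suc n)
 let ?t = "%k. (X ^^ (Suc n - k)) (v 0 (j + k))"
 have "X (v n j) = (%D. \<Sum>k\<le>n. of_nat (n choose k) * X ((X ^^ (n - k)) (v 0 (j + k))) D)"
  unfolding Suc[of j] by (rule lowers_sum[OF X]) (rule lowers_pow(2)[OF X v(1)])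
 then have 1: "v (Suc n) j D = (\<Sum>k\<le>n. of_nat (n choose k) * ?t k D) + (\<Sum>k\<le>n. of_nat (n choose k) * ?t (Suc k) D)" for D
  unfolding v(2) using Suc[of "Suc j"] by (simp add: Suc_diff_le)
 have 2: "(\<Sum>k\<le>n. of_nat (n choose k) * ?t k D) = ?t 0 D + (\<Sum>k\<le>n. of_nat (n choose Suc k) * ?t (Suc k) D)" for D
  using sum.atMost_Suc_shift[of "%k. of_nat (n choose k) * ?t k D" n] by (simp add: binomial_eq_0)
 show ?case
 proof
  show "v (Suc n) j D = (\<Sum>k\<le>Suc n. of_nat (Suc n choose k) * ?t k D)" for D
   unfolding 1 2 sum.atMost_Suc_shift by (simp add: sum.distrib algebra_simps)
 qed
qed (simp add: v)

end

text \<open>The inverse factorials are a parameter because \<open>rat poly\<close> is not a field;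
  there they are constant polynomials.\<close>

locale exponential = filtered A for A :: "nat => ('d => 'r::comm_ring_1) set" +
 fixes ifact :: "nat => 'r"
 assumes ifact: "ifact n * of_nat (fact n) = 1"
begin

lemma ifact_0: "ifact 0 = 1"
 using ifact[of 0] by simp

lemma ifact_binomial:
 assumes "k \<le> n"
 shows "ifact n * of_nat (n choose k) = ifact k * ifact (n - k)"
proof -
 have "of_nat (fact n) = of_nat (fact k) * of_nat (fact (n - k)) * (of_nat (n choose k) :: 'r)"
  unfolding of_nat_mult[symmetric] binomial_fact_lemma[OF assms] ..
 then have "ifact k * ifact (n - k) * of_nat (fact n) = (ifact k * of_nat (fact k)) * (ifact (n - k) * of_nat (fact (n - k))) * of_nat (n choose k)"
  by (simp only: mult_ac)
 then have "ifact k * ifact (n - k) * of_nat (fact n) * ifact n = of_nat (n choose k) * ifact n" by (simp only: ifact mult_1)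
 then show ?thesis using ifact[of n] by (simp add: mult.commute mult.left_commute mult.assoc) (metis ifact mult.assoc mult.commute mult_1)
qed

definition expo :: "nat => (('d => 'r) => 'd => 'r) => ('d => 'r) => 'd => 'r" where
 "expo N X W D = (\<Sum>n\<le>N. ifact n * (X ^^ n) W D)"

lemma expo_wts: "lowering X ==> W \<in> A N ==> expo M X W \<in> A N"
 unfolding expo_def[abs_def] by (intro A_sum A_scale lowers_pow(2))

lemma expo_add:
 assumes X: "lowering X" and W: "W \<in> A N" and V: "V \<in> A N"
 shows "expo M X (%D. W D + V D) D = expo M X W D + expo M X V D"
 unfolding expo_def using lowers_pow_sum[OF X, where I = UNIV and W = "%b. if b then W else V" and N = N and c = "%_. 1"] W V
 by (simp add: UNIV_bool add.commute sum.distrib[symmetric] algebra_simps)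

lemma expo_sequence:
 assumes X: "lowering X" and v: "\<And>n j. v n j \<in> A N" "\<And>n j. v (Suc n) j = (%D. X (v n j) D + v n (Suc j) D)"
  and 0: "\<And>n. N < n ==> v n 0 = (%_. 0)" "\<And>k. N < k ==> v 0 k = (%_. 0)"
 shows "(\<Sum>n\<le>N. ifact n * v n 0 D) = expo N X (%D. \<Sum>k\<le>N. ifact k * v 0 k D) D"
proof -
 let ?g = "%k m. ifact k * ifact m * (X ^^ m) (v 0 k) D"
 have z: "(X ^^ m) (%_. 0) = (%_. 0)" for m by (induction m) (simp_all add: lowersD(4)[OF X])
 have g0: "?g k j = 0" if "N < j \<or> N < k" for j k
  using that lowers_pow(3)[OF X v(1)[of 0 k], of j] 0(2)[of k] z[of j] by auto
 have "(\<Sum>n\<le>N. ifact n * v n 0 D) = (\<Sum>n\<le>2 * N. ifact n * v n 0 D)"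
  by (rule sum.mono_neutral_left) (use 0 in auto)
 also have "... = (\<Sum>n\<le>2 * N. \<Sum>k\<le>n. ?g k (n - k))"
 proof (rule sum.cong[OF refl])
  fix n
  have "ifact n * v n 0 D = (\<Sum>k\<le>n. (ifact n * of_nat (n choose k)) * (X ^^ (n - k)) (v 0 k) D)"
   unfolding binomial_sequence[where v = v, OF X v, of n 0] by (simp add: sum_distrib_left mult.assoc)
  also have "... = (\<Sum>k\<le>n. ?g k (n - k))" by (rule sum.cong) (simp_all add: ifact_binomial)
  finally show "ifact n * v n 0 D = (\<Sum>k\<le>n. ?g k (n - k))" .
 qed
 also have "... = (\<Sum>j\<le>N. \<Sum>k\<le>N. ?g k j)" by (rule sum_triangle_square[OF g0])
 also have "... = expo N X (%D. \<Sum>k\<le>N. ifact k * v 0 k D) D"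
  unfolding expo_def using lowers_pow_sum[OF X, where I = "{..N}" and W = "v 0" and N = N and c = ifact] v(1)
  by (simp add: sum_distrib_left mult.assoc mult.left_commute)
 finally show ?thesis .
qed

text \<open>\<open>M k\<close> is the \<open>k\<close>-fold commutator of \<open>M 0\<close> with
  \<open>X\<close>. This is the expansion of the conjugation by an exponential: \<open>M 0\<close>
  times \<open>e^X\<close> equals \<open>e^X\<close> times the sum of
  \<open>M k / k!\<close>.\<close>

lemma expo_conjugate:
 assumes X: "lowering X" and W: "W \<in> A N"
  and M: "\<And>k V. V \<in> A N ==> M k V \<in> A N" "\<And>k V. V \<in> A N ==> M k (X V) = (%D. X (M k V) D + M (Suc k) V D)"
  and M0: "\<And>k. N < k ==> M k W = (%_. 0)" "M 0 (%_. 0) = (%_. 0)"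
  and lin: "\<And>w. (\<And>n. w n \<in> A N) ==> M 0 (%D. \<Sum>n\<le>N. ifact n * w n D) = (%D. \<Sum>n\<le>N. ifact n * M 0 (w n) D)"
 shows "M 0 (expo N X W) = expo N X (%D. \<Sum>k\<le>N. ifact k * M k W D)"
proof
 fix D
 have "M 0 (expo N X W) D = (\<Sum>n\<le>N. ifact n * M 0 ((X ^^ n) W) D)"
  unfolding expo_def[abs_def] lin[of "%n. (X ^^ n) W", OF lowers_pow(2)[OF X W]] ..
 also have "... = expo N X (%D. \<Sum>k\<le>N. ifact k * M k ((X ^^ 0) W) D) D"
 proof (rule expo_sequence[OF X, where v = "%n k. M k ((X ^^ n) W)"])
  show "M j ((X ^^ n) W) \<in> A N" for n j by (rule M(1)[OF lowers_pow(2)[OF X W]])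
  show "M j ((X ^^ Suc n) W) = (%D. X (M j ((X ^^ n) W)) D + M (Suc j) ((X ^^ n) W) D)" for n j
   using M(2)[OF lowers_pow(2)[OF X W]] by simp
  show "N < n ==> M 0 ((X ^^ n) W) = (%_. 0)" for n using lowers_pow(3)[OF X W, of n] M0(2) by simp
  show "N < k ==> M k ((X ^^ 0) W) = (%_. 0)" for k using M0(1) by simp
 qed
 finally show "M 0 (expo N X W) D = expo N X (%D. \<Sum>k\<le>N. ifact k * M k W D) D" by simp
qed

lemma expo_commute:
 assumes X: "lowering X" and Y: "lowering Y" and W: "W \<in> A N" and c: "\<And>V. V \<in> A N ==> Y (X V) = X (Y V)"
 shows "Y (expo N X W) = expo N X (Y W)"
proof -
 let ?M = "%k. if k = (0::nat) then Y else (%_ _. 0)"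
 have "?M 0 (expo N X W) = expo N X (%D. \<Sum>k\<le>N. ifact k * ?M k W D)"
  by (rule expo_conjugate[OF X W]) (auto simp: A_zero lowersD(3,4)[OF Y] c lowersD(4)[OF X] lowers_sum[OF Y, where N = N])
 also have "(%D. \<Sum>k\<le>N. ifact k * ?M k W D) = Y W"
  by (rule ext) (simp add: sum.atMost_shift ifact_0)
 finally show ?thesis by simp
qed

lemma expo_sum_right:
 assumes X: "lowering X" and W: "\<And>i. i \<in> I ==> W i \<in> A N"
 shows "expo M X (%D. \<Sum>i\<in>I. c i * W i D) D = (\<Sum>i\<in>I. c i * expo M X (W i) D)"
proof -
 have "(X ^^ n) (%D. \<Sum>i\<in>I. c i * W i D) = (%D. \<Sum>i\<in>I. c i * (X ^^ n) (W i) D)" for n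
  by (rule lowers_pow_sum[OF X W])
 then show ?thesis
  unfolding expo_def sum_distrib_left by (subst sum.swap) (simp add: sum_distrib_left mult.left_commute)
qed

lemma expo_expo:
 assumes X: "lowering X" and Y: "lowering Y" and W: "W \<in> A N" and c: "\<And>V. V \<in> A N ==> Y (X V) = X (Y V)"
 shows "expo M Y (expo N X W) = expo N X (expo M Y W)"
proof -
 have "(Y ^^ n) (expo N X W) = expo N X ((Y ^^ n) W)" for n
 proof (induction n)
  case (Suc n)
  then show ?case using expo_commute[OF X Y lowers_pow(2)[OF Y W, of n] c] by simp
 qed simp
 moreover have "expo N X (expo M Y W) D = (\<Sum>n\<le>M. ifact n * expo N X ((Y ^^ n) W) D)" for D
  unfolding expo_def[of M Y, abs_def] by (rule expo_sum_right[OF X lowers_pow(2)[OF Y W]])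
 ultimately show ?thesis by (intro ext) (simp only: expo_def[of M Y "expo N X W"])
qed

text \<open>The array consists of powers of the sum applied to powers of \<open>Y\<close>. Splitting
  one factor of the sum into \<open>X\<close> and \<open>Y\<close> gives the recursion of
  \<open>expo_sequence\<close>, because \<open>X\<close> commutes with the sum.\<close>

lemma expo_sum:
 assumes X: "lowering X" and Y: "lowering Y" and W: "W \<in> A N" and c: "\<And>V. V \<in> A N ==> Y (X V) = X (Y V)"
 shows "expo N (%W D. X W D + Y W D) W = expo N X (expo N Y W)"
proof
 let ?Z = "%W D. X W D + Y W D"
 note Z = lowers_add[OF X Y]
 fix D
 have zc: "(?Z ^^ n) (X V) = X ((?Z ^^ n) V)" if V: "V \<in> A N" for n V
 proof (induction n)
  case (Suc n)
  have w: "(?Z ^^ n) V \<in> A N" by (rule lowers_pow(2)[OF Z V])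
  have "X (?Z ((?Z ^^ n) V)) = (%D. X (X ((?Z ^^ n) V)) D + X (Y ((?Z ^^ n) V)) D)"
   using lowersD(1)[OF X lowersD(3)[OF X w] lowersD(3)[OF Y w], of 1 1] by simp
  then show ?case using Suc c[OF w] by simp
 qed simp
 have zadd: "(?Z ^^ n) (%D. U D + V D) = (%D. (?Z ^^ n) U D + (?Z ^^ n) V D)" if "U \<in> A N" "V \<in> A N" for U V n
  using lowers_pow_sum[OF Z, where I = UNIV and W = "%b. if b then U else V" and N = N and n = n and c = "%_. 1"] that by (simp add: UNIV_bool add.commute)
 have "expo N ?Z W D = (\<Sum>n\<le>N. ifact n * (?Z ^^ n) ((Y ^^ 0) W) D)" by (simp add: expo_def)
 also have "... = expo N X (%D. \<Sum>k\<le>N. ifact k * (?Z ^^ 0) ((Y ^^ k) W) D) D"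
 proof (rule expo_sequence[OF X, where v = "%n k. (?Z ^^ n) ((Y ^^ k) W)"])
  fix n j
  have y: "(Y ^^ j) W \<in> A N" by (rule lowers_pow(2)[OF Y W])
  show "(?Z ^^ n) ((Y ^^ j) W) \<in> A N" by (rule lowers_pow(2)[OF Z y])
  have "(?Z ^^ Suc n) ((Y ^^ j) W) = (?Z ^^ n) (?Z ((Y ^^ j) W))" by (simp only: funpow_Suc_right comp_apply)
  also have "... = (%D. X ((?Z ^^ n) ((Y ^^ j) W)) D + (?Z ^^ n) ((Y ^^ Suc j) W) D)"
   unfolding zadd[OF lowersD(3)[OF X y] lowersD(3)[OF Y y]] zc[OF y] by simp
  finally show "(?Z ^^ Suc n) ((Y ^^ j) W) = (%D. X ((?Z ^^ n) ((Y ^^ j) W)) D + (?Z ^^ n) ((Y ^^ Suc j) W) D)" .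
 qed (simp_all add: lowers_pow(3)[OF Z W] lowers_pow(3)[OF Y W])
 also have "(%D. \<Sum>k\<le>N. ifact k * (?Z ^^ 0) ((Y ^^ k) W) D) = expo N Y W" by (simp add: expo_def[abs_def])
 finally show "expo N ?Z W D = expo N X (expo N Y W) D" .
qed

end

context strands begin

lemma filtered_wts: "filtered wts"
 by unfold_locales (auto simp: wts_lincomb wts_0 intro: wts_mono)

abbreviation lowers :: "(('a diagram => 'r::comm_ring_1) => 'a diagram => 'r) => bool" where
 "lowers \<equiv> filtered.lowering wts"

lemmas lowers_def = filtered.lowering_def[OF filtered_wts]
lemmas lowersD = filtered.lowersD[OF filtered_wts]
lemmas lowers_sum = filtered.lowers_sum[OF filtered_wts]
lemmas lowers_add = filtered.lowers_add[OF filtered_wts]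
lemmas lowers_pow = filtered.lowers_pow[OF filtered_wts]

end

locale weight_exponential = strands S + exponential "strands.wts S" ifact for S :: "'a set" and ifact :: "nat => 'r::comm_ring_1"

section \<open>Operators given by tuples of trees\<close>

text \<open>\<open>x / (e^x - 1)\<close> and \<open>(e^x - 1) / x\<close> are inverse power series;
  the coefficients \<open>1 / (i + 1)!\<close> of the second arise when an exponential is
  differentiated.\<close>

lemma todd_inverse: "(\<Sum>i\<le>n. fps_nth todd_fps (n - i) / fact (Suc i)) = (if n = 0 then 1 else 0)"
proof -
 let ?B = "Abs_fps (%n. 1 / fact (Suc n)) :: rat fps"
 have e: "fps_exp 1 - 1 = fps_X * ?B"
  by (rule fps_ext) (auto simp: fps_exp_def fact_reduce)
 have "?B * inverse ?B = 1" by (rule inverse_mult_eq_1') simp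
 then have "fps_X = fps_X * ?B * inverse ?B" by (simp only: mult.assoc mult_1_right)
 then have "fps_X * ?B dvd fps_X" by (rule dvdI)
 then have "todd_fps * (fps_X * ?B) = fps_X" unfolding todd_fps_def e by (rule dvd_div_mult_self)
 then have "fps_X * (?B * todd_fps) = fps_X * 1" by (simp only: mult_ac mult_1_right)
 then have "?B * todd_fps = 1" by (simp only: mult_cancel_left fps_X_neq_zero) simp
 then have "fps_nth (?B * todd_fps) n = (if n = 0 then 1 else 0)" by simp
 then show ?thesis by (simp add: fps_mult_nth atLeast0AtMost)
qed

lemma exp_inverse: "(\<Sum>i\<le>n. (- 1) ^ i / fact i * (1 / fact (n - i))) = (if n = 0 then 1 else (0::rat))"
proof -
 have "(\<Sum>i\<le>n. (- 1) ^ i / fact i * (1 / fact (n - i))) = (\<Sum>i\<le>n. of_nat (n choose i) * (- 1) ^ i) / (fact n :: rat)"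
  unfolding sum_divide_distrib by (rule sum.cong) (simp_all add: binomial_fact)
 also have "(\<Sum>i\<le>n. of_nat (n choose i) * (- 1) ^ i) = (- 1 + 1 :: rat) ^ n"
  unfolding binomial_ring by simp
 finally show ?thesis by (simp add: power_0_left)
qed

context strands begin

lemma op_lowers: "insertion K ==> positive x ==> lowers (Op K x)"
 unfolding lowers_def using Op_lincomb[of K x] Op_wts[of K x] by (auto simp: positive_def)

lemmas lser_lowers = op_lowers[OF _ lser_positive(1)]

lemma lser_cong: "(\<And>a. a \<in> S ==> m a = n a) ==> lser m = lser n"
 unfolding lser_def by (intro ext sum.cong refl) simp

lemma op_tbounded:
 assumes "insertion K" "W \<in> wts N" "D \<in> diagrams S"
 shows "tbounded N (%a p. W (K (plant a p) D))"
 using insertion_bounded[OF assms] plant_diagram by (fastforce simp: bounded_by_def)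

lemma lser_opI:
 assumes "tuple m" "W \<in> wts N" "insertion K" "\<And>D. D \<in> diagrams S ==> tpair m (%a p. W (K (plant a p) D)) = V D"
  "\<And>D. D \<notin> diagrams S ==> V D = 0"
 shows "Op K (lser m) W = V"
proof
 show "Op K (lser m) W D = V D" for D using assms(4,5) Op_lser[OF assms(1,2,3), of D] by (cases "D \<in> diagrams S") (simp_all add: Op_def)
qed

lemma op_ser:
 assumes K: "insertion K" and F: "raising F" and n: "tuple n" and W: "W \<in> wts N"
 shows "Op K (lser (ser c F n)) W = (%D. \<Sum>k\<le>N. c k * Op K (lser ((F ^^ k) n)) W D)"
proof -
 have t: "tuple ((F ^^ k) n)" for k using raising_pow[OF F n] by blast
 have "tpair (ser c F n) G = (\<Sum>k\<le>N. c k * tpair ((F ^^ k) n) G)" if "tbounded N G" for G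
  unfolding tpair_def sum_distrib_left using that
  by (subst sum.swap) (auto intro!: sum.cong simp: pairing_ser[OF F n])
 then show ?thesis
  by (intro lser_opI[OF tuple_ser[OF F n] W K]) (simp_all add: op_tbounded[OF K W] Op_lser[OF t W K], simp add: Op_def)
qed

lemma op_above:
 assumes K: "insertion K" and m: "above N m" "tuple m" and W: "W \<in> wts N"
 shows "Op K (lser m) W = (%_. 0)"
proof (rule lser_opI[OF m(2) W K])
 fix D assume D: "D \<in> diagrams S"
 have "m a p * W (K (plant a p) D) = 0" if "a \<in> S" for a p
 proof (rule ccontr)
  assume "m a p * W (K (plant a p) D) ~= 0"
  then have "m a p ~= 0" "W (K (plant a p) D) ~= 0" by auto
  then show False using m that op_tbounded[OF K W D] seriesD[of "m a" "trees S" leaves p] unfolding above_def bounded_by_def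
   by (meson leD)
 qed
 then show "tpair m (%a p. W (K (plant a p) D)) = 0" by (simp add: tpair_def pairing_def)
qed simp

lemma op_scale:
 assumes K: "insertion K" and m: "tuple m" and W: "W \<in> wts N"
 shows "Op K (lser (%a p. c * m a p)) W = (%D. c * Op K (lser m) W D)"
proof (rule lser_opI[OF _ W K])
 show "tuple (%a p. c * m a p)" using m by (simp add: series_scale)
 fix D assume D: "D \<in> diagrams S"
 show "tpair (%a p. c * m a p) (%a p. W (K (plant a p) D)) = c * Op K (lser m) W D"
  unfolding Op_lser[OF m W K D] tpair_def sum_distrib_left
  using m op_tbounded[OF K W D] by (intro sum.cong refl pairing_scale_left) auto
qed (simp add: Op_def)

lemma op_hom:
 fixes h :: "'r::comm_ring_1 => 'q::comm_ring_1"
 assumes K: "insertion K" and h: "\<And>x y. h (x + y) = h x + h y" "\<And>x y. h (x * y) = h x * h y" and m: "tuple m" and W: "W \<in> wts N"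
 shows "(%D. h (Op K (lser m) W D)) = Op K (lser (%a p. h (m a p))) (%D. h (W D))"
proof (rule lser_opI[symmetric, OF _ wts_hom[OF W h(1)] K])
 have h0: "h 0 = 0" using h(1)[of 0 0] by simp
 have hs: "h (sum g A) = (\<Sum>a\<in>A. h (g a))" for g and A :: "'a set"
  by (induction A rule: infinite_finite_induct) (auto simp: h0 h(1))
 show "tuple (%a p. h (m a p))" using m h0 by (auto intro: series_hom)
 fix D assume D: "D \<in> diagrams S"
 show "tpair (%a p. h (m a p)) (%a p. h (W (K (plant a p) D))) = h (Op K (lser m) W D)"
  unfolding Op_lser[OF m W K D] tpair_def hs
  using m op_tbounded[OF K W D] by (intro sum.cong refl pairing_hom[OF h, symmetric]) auto
qed (use h(1)[of 0 0] in \<open>simp add: Op_def\<close>)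

lemma op_pderiv:
 fixes m :: "('a, rat poly) tree_tuple"
 assumes K: "insertion K" and m: "tuple m" and W: "W \<in> wts N"
 shows "(%D. pderiv (Op K (lser m) W D)) = (%D. Op K (lser m) (%D. pderiv (W D)) D + Op K (lser (%a p. pderiv (m a p))) W D)"
proof
 fix D
 have t: "tuple (%a p. pderiv (m a p))" by (rule tuple_pderiv[OF m])
 have W': "(%D. pderiv (W D)) \<in> wts N" by (rule wts_hom[OF W pderiv_add])
 show "pderiv (Op K (lser m) W D) = Op K (lser m) (%D. pderiv (W D)) D + Op K (lser (%a p. pderiv (m a p))) W D"
 proof (cases "D \<in> diagrams S")
  case D: True
  show ?thesis unfolding Op_lser[OF m W K D] Op_lser[OF m W' K D] Op_lser[OF t W K D] tpair_def pderiv_sum sum.distrib[symmetric]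
   using m op_tbounded[OF K W D] by (intro sum.cong refl) (subst pairing_pderiv, auto)
 qed (simp add: Op_def)
qed

text \<open>On operators, \<^term>\<open>F\<close> acts as a commutator with \<^term>\<open>X\<close>; this replaces the linearity of \<^term>\<open>F\<close> on infinite sums.\<close>

lemma op_pow_ser:
 assumes K: "insertion K" and F: "raising F" and n: "tuple n" and X: "lowers X"
  and c: "\<And>n V. tuple n ==> V \<in> wts N ==> Op K (lser (F n)) V = (%D. e * (Op K (lser n) (X V) D - X (Op K (lser n) V) D))"
 shows "W \<in> wts N ==> Op K (lser ((F ^^ k) (ser d F n))) W = (%D. \<Sum>j\<le>N. d j * Op K (lser ((F ^^ (k + j)) n)) W D)"
proof (induction k arbitrary: W)
 case 0
 then show ?case by (simp add: op_ser[OF K F n])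
next
 case (Suc k)
 have t: "tuple ((F ^^ k) n)" "tuple ((F ^^ k) (ser d F n))" for k using raising_pow[OF F n] raising_pow[OF F tuple_ser[OF F n]] by blast+
 have XW: "X W \<in> wts N" by (rule lowersD(3)[OF X Suc.prems])
 have s: "X (%D. \<Sum>j\<le>N. d j * Op K (lser ((F ^^ (k + j)) n)) W D) = (%D. \<Sum>j\<le>N. d j * X (Op K (lser ((F ^^ (k + j)) n)) W) D)"
  by (rule lowers_sum[OF X]) (rule Op_lser_wts[OF K t(1) Suc.prems])
 have "Op K (lser ((F ^^ Suc k) (ser d F n))) W D = (\<Sum>j\<le>N. d j * Op K (lser ((F ^^ (Suc k + j)) n)) W D)" for D
  using c[OF t(2) Suc.prems, of k] c[OF t(1) Suc.prems, of "k + _"]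
  by (simp add: Suc.IH[OF Suc.prems] Suc.IH[OF XW] s sum_subtractf[symmetric] sum_distrib_left right_diff_distrib mult.left_commute)
 then show ?case by blast
qed

text \<open>If \<open>b\<close> and \<open>d\<close> are the coefficients of inverse power series,
  then applying \<open>b(F)\<close> undoes \<open>d(F)\<close>. On \<open>wts N\<close> all powers
  of \<open>F\<close> beyond \<open>N\<close> vanish, so the double sum is the full Cauchy
  product.\<close>

lemma op_ser_inverse:
 assumes K: "insertion K" and F: "raising F" and n: "tuple n" and X: "lowers X"
  and c: "\<And>n V. tuple n ==> V \<in> wts N ==> Op K (lser (F n)) V = (%D. e * (Op K (lser n) (X V) D - X (Op K (lser n) V) D))"
  and b: "\<And>n. (\<Sum>i\<le>n. b i * d (n - i)) = (if n = 0 then 1 else 0)" and W: "W \<in> wts N"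
 shows "(\<Sum>k\<le>N. b k * Op K (lser ((F ^^ k) (ser d F n))) W D) = Op K (lser n) W D"
proof -
 let ?T = "%k. Op K (lser ((F ^^ k) n)) W D"
 have z: "?T k = 0" if "N < k" for k
 proof -
  have "above k ((F ^^ k) n)" "tuple ((F ^^ k) n)" using raising_pow[OF F n, of k] by auto
  moreover from this(1) have "above N ((F ^^ k) n)" using that unfolding above_def by (meson order.strict_trans)
  ultimately show ?thesis using op_above[OF K _ _ W] by simp
 qed
 have "(\<Sum>k\<le>N. b k * Op K (lser ((F ^^ k) (ser d F n))) W D) = (\<Sum>k\<le>N. \<Sum>j\<le>N. b k * d j * ?T (k + j))"
  by (simp add: op_pow_ser[OF K F n X c W] sum_distrib_left mult.assoc)
 also have "... = (\<Sum>n\<le>2 * N. \<Sum>k\<le>n. b k * d (n - k) * ?T (k + (n - k)))"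
  by (subst sum_triangle_square) (auto simp: z intro: sum.swap)
 also have "... = (\<Sum>n\<le>2 * N. (\<Sum>k\<le>n. b k * d (n - k)) * ?T n)"
  by (simp add: sum_distrib_right)
 also have "... = ?T 0" unfolding b by (simp add: if_distrib[of "%x. x * _"] cong: if_cong)
 finally show ?thesis by simp
qed

end

section \<open>Comparison of the exponentials\<close>

lemma sum_pCons: "(\<Sum>i\<in>A. [:f i:]) = [:\<Sum>i\<in>A. f i:]"
 by (induction A rule: infinite_finite_induct) simp_all

context strands begin

interpretation p: exponential "wts :: nat => ('a diagram => rat poly) set" "%n. [:1 / fact n:]"
 by (intro exponential.intro filtered_wts exponential_axioms.intro) (simp add: of_nat_poly one_pCons)

interpretation q: exponential "wts :: nat => ('a diagram => rat) set" "%n. 1 / fact n"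
 by (intro exponential.intro filtered_wts exponential_axioms.intro) simp

abbreviation qexp where "qexp \<equiv> exponential.expo (%n. 1 / fact n :: rat)"

abbreviation dd :: "('a diagram => rat poly) => 'a diagram => rat poly" where "dd W \<equiv> %D. pderiv (W D)"

lemma dd_wts: "W \<in> wts N ==> dd W \<in> wts N"
 by (rule wts_hom[OF _ pderiv_add])

text \<open>Differentiation in t is itself regarded as an operator to be moved past the exponential:
  its commutator with \<open>X\<close> is \<open>M 0\<close>, the operator of the derivative, and
  further commutators follow. The shift of the index turns \<open>1 / k!\<close> into
  \<open>1 / (k + 1)!\<close>.\<close>

lemma dd_expo:
 assumes X: "lowers X" and W: "W \<in> wts N" and M: "\<And>k V. V \<in> wts N ==> M k V \<in> wts N"
  and M0: "\<And>V. V \<in> wts N ==> dd (X V) = (%D. X (dd V) D + M 0 V D)"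
  and MS: "\<And>k V. V \<in> wts N ==> M k (X V) = (%D. X (M k V) D + M (Suc k) V D)" and z: "\<And>k. N \<le> k ==> M k W = (%_. 0)"
 shows "dd (p.expo N X W) = p.expo N X (%D. pderiv (W D) + (\<Sum>k\<le>N. [:1 / fact (Suc k):] * M k W D))"
proof -
 let ?M = "%k. case k of 0 => dd | Suc j => M j"
 have "?M 0 (p.expo N X W) = p.expo N X (%D. \<Sum>k\<le>N. [:1 / fact k:] * ?M k W D)"
 proof (rule p.expo_conjugate[OF X W])
  show "?M k V \<in> wts N" if "V \<in> wts N" for k V using that M dd_wts by (cases k) auto
  show "?M k (X V) = (%D. X (?M k V) D + ?M (Suc k) V D)" if "V \<in> wts N" for k V
   using M0[OF that] MS[OF that] by (cases k) auto
  show "?M k W = (%_. 0)" if "N < k" for k using z[of "k - 1"] that by (cases k) auto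
 qed (auto simp: pderiv_sum pderiv_smult)
 also have "(%D. \<Sum>k\<le>N. [:1 / fact k:] * ?M k W D) = (%D. pderiv (W D) + (\<Sum>k\<le>N. [:1 / fact (Suc k):] * M k W D))"
 proof
  fix D
  have "(\<Sum>k\<le>N. [:1 / fact k:] * ?M k W D) = (\<Sum>k\<le>Suc N. [:1 / fact k:] * ?M k W D)" using z[of N] by simp
  then show "(\<Sum>k\<le>N. [:1 / fact k:] * ?M k W D) = pderiv (W D) + (\<Sum>k\<le>N. [:1 / fact (Suc k):] * M k W D)"
   unfolding sum.atMost_Suc_shift by simp
 qed
 finally show ?thesis by simp
qed

lemma expo_at_0:
 assumes X: "lowers X" and W: "W \<in> wts N" and 0: "\<And>V D. V \<in> wts N ==> poly (X V D) 0 = 0"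
 shows "poly (p.expo N X W D) 0 = poly (W D) 0"
proof -
 have "poly ((X ^^ n) W D) 0 = (if n = 0 then poly (W D) 0 else 0)" for n
  using 0[OF p.lowers_pow(2)[OF X W]] by (cases n) auto
 then show ?thesis unfolding p.expo_def poly_sum by (simp add: if_distrib[of "%x. _ * x"] cong: if_cong)
qed

lemma expo_at_1:
 assumes X: "lowers X" and W: "W \<in> wts N" and 1: "\<And>V. V \<in> wts N ==> (%D. poly (X V D) 1) = X' (%D. poly (V D) 1)"
 shows "poly (p.expo N X W D) 1 = qexp N X' (%D. poly (W D) 1) D"
proof -
 have "(%D. poly ((X ^^ n) W D) 1) = (X' ^^ n) (%D. poly (W D) 1)" for n
  by (induction n) (simp_all add: 1[OF p.lowers_pow(2)[OF X W]])
 then have "poly ((X ^^ n) W D) 1 = (X' ^^ n) (%D. poly (W D) 1) D" for n by (rule fun_cong)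
 then show ?thesis unfolding p.expo_def q.expo_def poly_sum by simp
qed

text \<open>Since \<^term>\<open>Y\<close> lowers the degree, the differential equation determines the functional by induction on the degree.\<close>

lemma functional_unique:
 assumes Y: "\<And>N W. W \<in> wts (Suc N) ==> Y W \<in> wts N"
  and u: "\<And>W. W \<in> wts L ==> pderiv (u W) = u (dd W) + u (Y W)" "\<And>W. W \<in> wts L ==> poly (u W) 0 = poly (W nil) 0" "u (%_. 0) = 0"
  and v: "\<And>W. W \<in> wts L ==> pderiv (v W) = v (dd W) + v (Y W)" "\<And>W. W \<in> wts L ==> poly (v W) 0 = poly (W nil) 0" "v (%_. 0) = 0"
 shows "W \<in> wts L ==> u W = v W"
proof -
 have "W \<in> wts N ==> u W = v W" if "N \<le> L" for N W
  using that
 proof (induction N arbitrary: W)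
  case 0
  then show ?case by (simp add: wts_0 u v)
 next
  case (Suc N)
  have "u W - v W = 0"
  proof (rule ode_zero[where P = "%W. W \<in> wts (Suc N)" and D = dd and de = "%W. u W - v W"])
   fix W :: "'a diagram => rat poly" assume W: "W \<in> wts (Suc N)"
   have WL: "W \<in> wts L" by (rule wts_mono[OF W Suc.prems(2)])
   show "dd W \<in> wts (Suc N) \<and> pderiv (u W - v W) = u (dd W) - v (dd W) \<and> poly (u W - v W) 0 = 0"
    using dd_wts[OF W] Suc.IH[OF Y[OF W]] Suc.prems(2) by (simp add: pderiv_diff u(1,2)[OF WL] v(1,2)[OF WL])
  qed (rule Suc.prems(1))
  then show ?case by simp
 qed
 then show "W \<in> wts L ==> u W = v W" by blast
qed

lemma expo_zero: "lowers X ==> p.expo N X (%_. 0) nil = 0"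
proof -
 assume X: "lowers X"
 have "(X ^^ n) (%_. 0) = (%_. 0)" for n by (induction n) (simp_all add: lowersD(4)[OF X])
 then show ?thesis by (simp add: p.expo_def)
qed

text \<open>The sign \<open>e\<close> tells whether \<open>F\<close> acts as the commutator with
  \<open>X\<close> or as its negative. Since \<open>e * e = 1\<close>, the iterated commutators are
  the operators of the powers of \<open>F\<close> with coefficient \<open>e ^ k\<close>.\<close>

lemma conj_ser:
 assumes K: "insertion K" and X: "lowers X" and F: "raising F" and n: "tuple n" and W: "W \<in> wts N" and e: "e * e = 1"
  and c: "\<And>n V. tuple n ==> V \<in> wts N ==> Op K (lser (F n)) V = (%D. e * (Op K (lser n) (X V) D - X (Op K (lser n) V) D))"
 shows "Op K (lser n) (p.expo N X W) = p.expo N X (%D. \<Sum>k\<le>N. [:1 / fact k:] * e ^ k * Op K (lser ((F ^^ k) n)) W D)"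
proof -
 have t: "tuple ((F ^^ k) n)" "above k ((F ^^ k) n)" for k using raising_pow[OF F n] by blast+
 note L = lser_lowers[OF K t(1)]
 let ?M = "%k V D. e ^ k * Op K (lser ((F ^^ k) n)) V D"
 have "?M 0 (p.expo N X W) = p.expo N X (%D. \<Sum>k\<le>N. [:1 / fact k:] * ?M k W D)"
 proof (rule p.expo_conjugate[OF X W])
  fix k and V :: "'a diagram => rat poly" assume V: "V \<in> wts N"
  show "?M k V \<in> wts N" by (rule p.A_scale[OF lowersD(3)[OF L V]])
  have "e ^ k * Op K (lser ((F ^^ k) n)) (X V) D = e ^ k * X (Op K (lser ((F ^^ k) n)) V) D + e ^ Suc k * Op K (lser (F ((F ^^ k) n))) V D" for D
  proof -
   have "e ^ Suc k * Op K (lser (F ((F ^^ k) n))) V D = (e * e) * (e ^ k * (Op K (lser ((F ^^ k) n)) (X V) D - X (Op K (lser ((F ^^ k) n)) V) D))"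
    unfolding c[OF t(1) V] by (simp add: mult_ac)
   then show ?thesis unfolding e by (simp add: algebra_simps)
  qed
  moreover have "X (?M k V) = (%D. e ^ k * X (Op K (lser ((F ^^ k) n)) V) D)"
   using lowersD(1)[OF X lowersD(3)[OF L V] lowersD(3)[OF L V], where c = "e ^ k" and e = 0] by simp
  ultimately show "?M k (X V) = (%D. X (?M k V) D + ?M (Suc k) V D)" by simp
 next
  fix k assume "N < k"
  then have "above N ((F ^^ k) n)" using t(2)[of k] unfolding above_def by (meson order.strict_trans)
  then show "?M k W = (%_. 0)" using op_above[OF K _ t(1) W] by simp
 next
  show "?M 0 (%_. 0) = (%_. 0)" using lowersD(4)[OF L[of 0]] by simp
  show "?M 0 (%D. \<Sum>n\<le>N. [:1 / fact n:] * w n D) = (%D. \<Sum>n\<le>N. [:1 / fact n:] * ?M 0 (w n) D)" if "\<And>n. w n \<in> wts N" for w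
   using lowers_sum[OF L[of 0], of "{..N}" w N "%n. [:1 / fact n:]"] that by simp
 qed
 then show ?thesis by (simp add: mult.assoc)
qed

text \<open>This is the reason for the Todd series in the defining equations: differentiating the
  exponential contributes \<open>(e^F - 1) / F\<close>, which cancels the factor
  \<open>F / (e^F - 1)\<close> in the derivative of \<open>m\<close> and leaves the operator of
  \<open>y\<close>.\<close>

lemma dd_expo_ser:
 assumes K: "insertion K" and m: "tuple m" and y: "tuple y" and F: "raising F" and W: "W \<in> wts N"
  and c: "\<And>n V D. tuple n ==> V \<in> wts N ==> Op K (lser n) (Op K (lser m) V) D - Op K (lser m) (Op K (lser n) V) D = Op K (lser (F n)) V D"
  and ode: "\<And>a p. a \<in> S ==> pderiv (m a p) = ser (poly_coeffs todd_fps) F y a p"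
 shows "dd (p.expo N (Op K (lser m)) W) = p.expo N (Op K (lser m)) (%D. pderiv (W D) + Op K (lser y) W D)"
proof -
 let ?s = "ser (poly_coeffs todd_fps) F y"
 have s: "tuple ((F ^^ k) ?s)" "above k ((F ^^ k) ?s)" for k using raising_pow[OF F tuple_ser[OF F y]] by blast+
 note X = lser_lowers[OF K m]
 have "lser (%a p. pderiv (m a p)) = lser ?s" by (rule lser_cong) (use ode in auto)
 then have "dd (p.expo N (Op K (lser m)) W) = p.expo N (Op K (lser m)) (%D. pderiv (W D) + (\<Sum>k\<le>N. [:1 / fact (Suc k):] * Op K (lser ((F ^^ k) ?s)) W D))"
 proof (intro dd_expo[OF X W])
  fix k and V :: "'a diagram => rat poly" assume V: "V \<in> wts N"
  show "Op K (lser ((F ^^ k) ?s)) V \<in> wts N" by (rule Op_lser_wts[OF K s(1) V])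
  show "Op K (lser ((F ^^ k) ?s)) (Op K (lser m) V) = (%D. Op K (lser m) (Op K (lser ((F ^^ k) ?s)) V) D + Op K (lser ((F ^^ Suc k) ?s)) V D)"
   using c[OF s(1) V, of k] by (auto simp: algebra_simps fun_eq_iff)
 next
  fix k assume "N \<le> k"
  then have "above N ((F ^^ k) ?s)" using s(2)[of k] unfolding above_def by (meson order.strict_trans1)
  then show "Op K (lser ((F ^^ k) ?s)) W = (%_. 0)" using op_above[OF K _ s(1) W] by simp
 qed (simp add: op_pderiv[OF K m])
 also have "(%D. \<Sum>k\<le>N. [:1 / fact (Suc k):] * Op K (lser ((F ^^ k) ?s)) W D) = Op K (lser y) W"
 proof (rule ext, rule op_ser_inverse[OF K F y X _ _ W, where e = 1])
  show "(\<Sum>i\<le>n. [:1 / fact (Suc i):] * poly_coeffs todd_fps (n - i)) = (if n = 0 then 1 else 0)" for n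
   using todd_inverse[of n] by (simp add: sum_pCons one_pCons mult.commute)
 qed (use c in auto)
 finally show ?thesis by (simp only:)
qed

text \<open>The exponent is t times a constant operator, so it commutes with its derivative and all
  higher commutators vanish.\<close>

lemma dd_expo_const:
 assumes K: "insertion K" and l: "tuple l" and W: "W \<in> wts N"
 defines "c \<equiv> %a p. [:l a p:]"
 defines "X \<equiv> %V D. [:0, 1:] * Op K (lser c) V D"
 shows "lowers X" "dd (p.expo N X W) = p.expo N X (%D. pderiv (W D) + Op K (lser c) W D)"
  "V \<in> wts N ==> Op K (lser c) (X V) = X (Op K (lser c) V)"
proof -
 have c: "tuple c" unfolding c_def by (rule tuple_const[OF l])
 note L = lser_lowers[OF K c]
 show X: "lowers X"
  unfolding lowers_def X_def
  by (intro conjI allI ballI p.A_scale lowersD(2)[OF L]) (simp_all add: lowersD(1)[OF L] distrib_left mult.left_commute del: mult_pCons_left)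
 have z: "Op K (lser (%a p. pderiv (c a p))) V = (%_. 0)" if "V \<in> wts N" for V
  using op_scale[OF K c that, of 0] by (simp add: c_def)
 show com: "Op K (lser c) (X V) = X (Op K (lser c) V)" if "V \<in> wts N" for V
  unfolding X_def using lowersD(1)[OF L lowersD(3)[OF L that] lowersD(3)[OF L that], where c = "[:0, 1:]" and e = 0] by simp
 let ?M = "%k V. if k = 0 then Op K (lser c) V else (%_. 0)"
 have "dd (p.expo N X W) = p.expo N X (%D. pderiv (W D) + (\<Sum>k\<le>N. [:1 / fact (Suc k):] * ?M k W D))"
 proof (rule dd_expo[OF X W])
  show "?M k V \<in> wts N" if "V \<in> wts N" for k V using that by (simp add: lowersD(3)[OF L] p.A_zero)
  show "dd (X V) = (%D. X (dd V) D + ?M 0 V D)" if "V \<in> wts N" for V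
   using fun_cong[OF op_pderiv[OF K c that]] by (simp add: X_def pderiv_mult pderiv_pCons z[OF that] add.commute)
  show "?M k (X V) = (%D. X (?M k V) D + ?M (Suc k) V D)" if "V \<in> wts N" for k V
   using com[OF that] by (simp add: lowersD(4)[OF X])
  show "?M k W = (%_. 0)" if "N \<le> k" for k
   using that W lowersD(4)[OF L] by (cases k) (simp_all add: wts_0)
 qed
 then show "dd (p.expo N X W) = p.expo N X (%D. pderiv (W D) + Op K (lser c) W D)"
  by (simp add: if_distrib[of "%f. f _"] if_distrib[of "%x. _ * x"] one_pCons[symmetric] cong: if_cong)
qed

lemma split_expo:
 assumes X: "lowers X" and W: "W \<in> wts N" and V: "V \<in> wts N"
 shows "p.expo N X (%D. pderiv (W D) + V D) D = p.expo N X (dd W) D + p.expo N X V D"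
 by (rule p.expo_add[OF X dd_wts[OF W] V])

lemma lser_nil:
 assumes n: "tuple n" and V: "V \<in> wts N"
 shows "Op stack (lser n) V nil = Op under (lser n) V nil" "Op wrap (lser n) V nil = Op under (lser n) V nil"
 using Op_nil[OF lser_series[OF n] wts_weight[OF V]] lser_positive[OF n] by simp_all

text \<open>The outermost stacking is evaluated at the empty diagram, where it may be replaced by
  stacking on the other side. That commutes with the remaining stackings and becomes the innermost
  operator, and the induction continues.\<close>

lemma stack_under_nil:
 assumes x: "positive x" and V: "V \<in> wts N"
 shows "(Op stack x ^^ k) V nil = (Op under x ^^ k) V nil"
 using V
proof (induction k arbitrary: V)
 case (Suc k)
 note VN = Suc.prems
 have xs: "x \<in> dser" using x by (simp add: positive_def)
 have c: "(Op stack x ^^ k) (Op under x V) = Op under x ((Op stack x ^^ k) V)"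
 proof (induction k)
  case (Suc k)
  have "Op stack x (Op under x ((Op stack x ^^ k) V)) = Op under x (Op stack x ((Op stack x ^^ k) V))"
   by (rule Op_stack_under[OF xs xs lowers_pow(2)[OF op_lowers[OF insertions(1) x] VN]])
  then show ?case by (simp only: funpow.simps comp_apply Suc)
 qed simp
 show ?case
  using Op_nil[OF xs wts_weight[OF lowers_pow(2)[OF op_lowers[OF insertions(1) x] VN, of k]]] Suc.IH[OF Op_wts_same[OF insertions(2) x VN]] c
  by (simp add: funpow_swap1)
qed simp

lemma const_wts: "W \<in> wts N ==> (%D. [:W D:]) \<in> wts N"
 by (rule wts_hom) simp_all

lemma op_hom_poly:
 assumes "insertion K" "tuple m" "V \<in> wts N"
 shows "(%D. poly (Op K (lser m) V D) x) = Op K (lser (%a p. poly (m a p) x)) (%D. poly (V D) x)"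
 by (rule op_hom[OF assms(1) _ _ assms(2,3)]) simp_all

text \<open>Both exponentials at the empty diagram are functionals of \<open>W\<close> depending on
  t. They have the same initial value and the same additional operator \<open>Y\<close> in their
  derivatives, so \<open>functional_unique\<close> identifies them; the claim is the case t =
  1.\<close>

lemma exponentials_agree:
 assumes K: "insertion K" "insertion K'" and r: "tuple r" and m: "tuple m" and m0: "\<And>a p. a \<in> S ==> poly (m a p) 0 = 0" and Y: "lowers Y"
 defines "X \<equiv> %V D. [:0, 1:] * Op K (lser (%a p. [:r a p:])) V D" and "V \<equiv> Op K' (lser m)"
 assumes u: "\<And>N W. W \<in> wts N ==> pderiv (p.expo N X W nil) = p.expo N X (dd W) nil + p.expo N X (Y W) nil"
  and v: "\<And>N W. W \<in> wts N ==> pderiv (p.expo N V W nil) = p.expo N V (dd W) nil + p.expo N V (Y W) nil" and W: "W \<in> wts N"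
 shows "qexp N (Op K (lser r)) W nil = qexp N (Op K' (lser (%a p. poly (m a p) 1))) W nil"
proof -
 have V: "lowers V" unfolding V_def by (rule lser_lowers[OF K(2) m])
 have X: "lowers X" unfolding X_def by (rule dd_expo_const(1)[OF K(1) r const_wts[OF W]])
 have "p.expo N X W nil = p.expo N V W nil" if W: "W \<in> wts N" for W
 proof (rule functional_unique[where Y = Y and L = N, OF lowersD(2)[OF Y] u _ _ v _ _ W])
  fix W :: "'a diagram => rat poly" assume W: "W \<in> wts N"
  show "poly (p.expo N X W nil) 0 = poly (W nil) 0" by (rule expo_at_0[OF X W]) (simp add: X_def)
  have "lser (%a p. poly (m a p) 0) = lser (%a p. 0 * poly (m a p) 0)" by (rule lser_cong) (simp add: m0)
  then have "poly (V W' D) 0 = 0" if "W' \<in> wts N" for W' D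
   using fun_cong[OF op_hom_poly[OF K(2) m that, of 0], of D] op_scale[OF K(2) tuple_poly[OF m] wts_hom[OF that, of "%q. poly q 0"], of 0] by (simp add: V_def)
  then show "poly (p.expo N V W nil) 0 = poly (W nil) 0" by (rule expo_at_0[OF V W])
 qed (use expo_zero[OF X] expo_zero[OF V] in simp_all)
 moreover have "poly (p.expo N X (%D. [:W D:]) nil) 1 = qexp N (Op K (lser r)) W nil"
  using expo_at_1[OF X const_wts[OF W], of "Op K (lser r)"] op_hom_poly[OF K(1) tuple_const[OF r], of _ _ 1] by (simp add: X_def)
 moreover have "poly (p.expo N V (%D. [:W D:]) nil) 1 = qexp N (Op K' (lser (%a p. poly (m a p) 1))) W nil"
  using expo_at_1[OF V const_wts[OF W], OF op_hom_poly[OF K(2) m, folded V_def]] by simp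
 ultimately show ?thesis using const_wts[OF W] by simp
qed

text \<open>The common operator is wrapping by \<open>y\<close>, the exponential of
  \<open>-t \<partial>\<close> applied to the constant tuple. For stacking on top, differentiation
  produces one factor for \<open>c\<close>; it is moved out of the exponential, traded at the empty
  diagram for a wrapping, and moved back in, where conjugation turns \<open>c\<close> into
  \<open>y\<close>. For wrapping, the Todd series leaves exactly the operator of
  \<open>y\<close>.\<close>

theorem Gamma_weights:
 assumes l: "lam \<in> FLS S"
 shows "\<exists>m. tuple m \<and> Gamma_map S lam = cl m \<and>
  (\<forall>N. \<forall>W\<in>wts N. qexp N (Op under (lser (reps lam))) W nil = qexp N (Op wrap (lser m)) W nil)"
proof -
 define c where "c = (%a p. [:reps lam a p:])"
 define F where "F = (%n a p. [:0, -1:] * der_op c n a p)"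
 define y where "y = ser (poly_coeffs (fps_exp 1)) F c"
 have rl: "tuple (reps lam)" by (rule FLS_cases(1)[OF l])
 have c: "tuple c" unfolding c_def by (rule tuple_const[OF rl])
 have F: "raising F" unfolding F_def by (rule raising_scale[OF raising_der[OF c]])
 have y: "tuple y" unfolding y_def by (rule tuple_ser[OF F c])
 obtain m where m: "tuple m" and m0: "\<And>a p. a \<in> S ==> poly (m a p) 0 = 0"
  and ode: "\<And>a p. a \<in> S ==> pderiv (m a p) = ser (poly_coeffs todd_fps) (ad_br m) y a p" and G: "Gamma_t S lam = cl m"
  using Gamma_solution[OF l] unfolding y_def F_def c_def by blast
 let ?X = "%V D. [:0, 1:] * Op under (lser c) V D" and ?V = "Op wrap (lser m)"
 note U = lser_lowers[OF insertions(2) c] and Y = lser_lowers[OF insertions(3) y] and V = lser_lowers[OF insertions(3) m]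
 note X = dd_expo_const[OF insertions(2) rl, folded c_def]
 have "qexp N (Op under (lser (reps lam))) W nil = qexp N (Op wrap (lser (%a p. poly (m a p) 1))) W nil" if W: "W \<in> wts N" for W N
 proof (rule exponentials_agree[OF insertions(2,3) rl m m0 Y _ _ W, folded c_def])
  fix N and W :: "'a diagram => rat poly" assume W: "W \<in> wts N"
  note YW = lowersD(3)[OF Y W] and XW = p.expo_wts[OF X(1) W]
  \<comment> \<open>By \<open>wrap_under\<close>, the commutator of wrapping with t times stacking
    on top is wrapping by \<open>-t\<close> times the derivation, that is by \<open>F\<close>; so
    the sign in \<open>conj_ser\<close> is 1.\<close>
  have conj: "Op wrap (lser c) (p.expo N ?X W) = p.expo N ?X (%D. \<Sum>k\<le>N. [:1 / fact k:] * 1 ^ k * Op wrap (lser ((F ^^ k) c)) W D)"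
  proof (rule conj_ser[OF insertions(3) X(1)[OF W] F c W])
   fix n :: "('a, rat poly) tree_tuple" and V :: "'a diagram => rat poly" assume n: "tuple n" and V: "V \<in> wts N"
   note L = lser_lowers[OF insertions(3) n] and UV = lowersD(3)[OF U V]
   have "Op wrap (lser n) (?X V) = (%D. [:0, 1:] * Op wrap (lser n) (Op under (lser c) V) D)"
    using lowersD(1)[OF L UV UV, where c = "[:0, 1:]" and e = 0] by simp
   moreover have "lser (F n) = lser (%a p. [:0, -1:] * der_op c n a p)" by (simp add: F_def)
   ultimately show "Op wrap (lser (F n)) V = (%D. 1 * (Op wrap (lser n) (?X V) D - ?X (Op wrap (lser n) V) D))"
    unfolding wrap_under[OF c n V] using op_scale[OF insertions(3) tuple_der[OF c n] V, of "[:0, -1:]"] by simp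
  qed simp
  have "p.expo N ?X (Op under (lser c) W) nil = Op under (lser c) (p.expo N ?X W) nil"
   using p.expo_commute[OF X(1) U W X(3)] W by simp
  also have "... = Op wrap (lser c) (p.expo N ?X W) nil" using lser_nil(2)[OF c XW] W by simp
  also have "... = p.expo N ?X (Op wrap (lser y) W) nil"
   unfolding conj y_def op_ser[OF insertions(3) F c W] by simp
  finally show "pderiv (p.expo N ?X W nil) = p.expo N ?X (dd W) nil + p.expo N ?X (Op wrap (lser y) W) nil"
   using fun_cong[OF X(2)[OF W], of nil] split_expo[OF X(1)[OF W] W lowersD(3)[OF U W]] by simp
  show "pderiv (p.expo N ?V W nil) = p.expo N ?V (dd W) nil + p.expo N ?V (Op wrap (lser y) W) nil"
   using fun_cong[where x = nil, OF dd_expo_ser[OF insertions(3) m y raising_Br[OF m] W wrap_commutator[OF m] ode]] split_expo[OF V W YW] by simp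
 qed
 moreover have "Gamma_map S lam = cl (%a p. poly (m a p) 1)" unfolding Gamma_map_def G by (rule fls_at_cl[OF m])
 ultimately show ?thesis using tuple_poly[OF m, of 1] by (intro exI[of _ "%a p. poly (m a p) 1"]) simp
qed

text \<open>The common operator is wrapping by the constant tuple. For stacking, differentiation
  produces stacking by \<open>y\<close>, the exponential of the derivation along \<open>m\<close>
  applied to this tuple. At the empty diagram the exponential is rewritten with stackings on top, so
  that \<open>y\<close> can be moved out and traded for a wrapping; moving it back applies the
  inverse exponential and leaves the constant tuple.\<close>

theorem Lambda_weights:
 assumes l: "lam \<in> FLS S"
 shows "\<exists>m. tuple m \<and> Lambda_map S lam = cl m \<and>
  (\<forall>N. \<forall>W\<in>wts N. qexp N (Op wrap (lser (reps lam))) W nil = qexp N (Op stack (lser m)) W nil)"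
proof -
 define c where "c = (%a p. [:reps lam a p:])"
 have rl: "tuple (reps lam)" by (rule FLS_cases(1)[OF l])
 have c: "tuple c" unfolding c_def by (rule tuple_const[OF rl])
 obtain m where m: "tuple m" and m0: "\<And>a p. a \<in> S ==> poly (m a p) 0 = 0"
  and ode: "\<And>a p. a \<in> S ==> pderiv (m a p) = ser (poly_coeffs todd_fps) (tbr m) (ser (poly_coeffs (fps_exp 1)) (der_op m) c) a p"
  and G: "Lambda_t S lam = cl m"
  using Lambda_solution[OF l] unfolding c_def by blast
 define y where "y = ser (poly_coeffs (fps_exp 1)) (der_op m) c"
 note D = raising_der[OF m]
 have y: "tuple y" unfolding y_def by (rule tuple_ser[OF D c])
 let ?X = "%V D. [:0, 1:] * Op wrap (lser c) V D" and ?V = "Op stack (lser m)" and ?U = "Op under (lser m)"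
 note C = lser_lowers[OF insertions(3) c] and Y = lser_lowers[OF insertions(1) y] and V = lser_lowers[OF insertions(1) m] and U = lser_lowers[OF insertions(2) m]
 note X = dd_expo_const[OF insertions(3) rl, folded c_def]
 have "qexp N (Op wrap (lser (reps lam))) W nil = qexp N (Op stack (lser (%a p. poly (m a p) 1))) W nil" if W: "W \<in> wts N" for W N
 proof (rule exponentials_agree[OF insertions(3,1) rl m m0 C _ _ W, folded c_def])
  fix N and W :: "'a diagram => rat poly" assume W: "W \<in> wts N"
  note YW = lowersD(3)[OF Y W] and CW = lowersD(3)[OF C W] and UW = p.expo_wts[OF U W]
  show "pderiv (p.expo N ?X W nil) = p.expo N ?X (dd W) nil + p.expo N ?X (Op wrap (lser c) W) nil"
   using fun_cong[where x = nil, OF X(2)[OF W]] split_expo[OF X(1)[OF W] W CW] by simp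
  have com: "Op wrap (lser (der_op m n)) V = (%D. - 1 * (Op wrap (lser n) (?U V) D - ?U (Op wrap (lser n) V) D))"
   if n: "tuple n" and V: "V \<in> wts N" for n and V :: "'a diagram => rat poly"
   unfolding wrap_under[OF m n V] by simp
  \<comment> \<open>The derivation is minus the commutator, so conjugation carries the signs
    \<open>(- 1) ^ i\<close>. They form the series of \<open>e^{-x}\<close>, inverse to the one in
    the definition of \<open>y\<close>.\<close>
  have inv: "(\<Sum>i\<le>n. [:1 / fact i:] * (- 1) ^ i * poly_coeffs (fps_exp 1) (n - i)) = (if n = 0 then 1 else 0)" for n
  proof -
   have "(- 1 :: rat poly) ^ i = [:(- 1) ^ i:]" for i by (induction i) (simp_all add: one_pCons)
   then show ?thesis using exp_inverse[of n] by (simp add: sum_pCons one_pCons fps_exp_def mult.commute)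
  qed
  have "p.expo N ?V (Op stack (lser y) W) nil = p.expo N ?U (Op stack (lser y) W) nil"
   unfolding p.expo_def stack_under_nil[OF lser_positive(1)[OF m] YW] ..
  also have "... = Op stack (lser y) (p.expo N ?U W) nil"
   using p.expo_commute[OF U Y W Op_stack_under[OF lser_series[OF y] lser_series[OF m]]] by simp
  also have "... = Op wrap (lser y) (p.expo N ?U W) nil" unfolding lser_nil[OF y UW] ..
  also have "Op wrap (lser y) (p.expo N ?U W) = p.expo N ?U (%D. \<Sum>k\<le>N. [:1 / fact k:] * (- 1) ^ k * Op wrap (lser ((der_op m ^^ k) y)) W D)"
   by (rule conj_ser[OF insertions(3) U D y W _ com]) simp_all
  also have "(%D. \<Sum>k\<le>N. [:1 / fact k:] * (- 1) ^ k * Op wrap (lser ((der_op m ^^ k) y)) W D) = Op wrap (lser c) W"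
   unfolding y_def by (rule ext, rule op_ser_inverse[OF insertions(3) D c U com inv W])
  also have "p.expo N ?U (Op wrap (lser c) W) nil = p.expo N ?V (Op wrap (lser c) W) nil"
   unfolding p.expo_def stack_under_nil[OF lser_positive(1)[OF m] CW] ..
  finally show "pderiv (p.expo N ?V W nil) = p.expo N ?V (dd W) nil + p.expo N ?V (Op wrap (lser c) W) nil"
   using fun_cong[where x = nil, OF dd_expo_ser[OF insertions(1) m y raising_tbr[OF m] W stack_commutator[OF m] ode[folded y_def]]]
    split_expo[OF V W YW] by simp
 qed
 moreover have "Lambda_map S lam = cl (%a p. poly (m a p) 1)" unfolding Lambda_map_def G by (rule fls_at_cl[OF m])
 ultimately show ?thesis using tuple_poly[OF m, of 1] by (intro exI[of _ "%a p. poly (m a p) 1"]) simp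
qed

end

section \<open>Wheels and the two presentations\<close>

text \<open>Connectedness is expressed through closed sets of edges because these are what the
  co-product distributes between its factors.\<close>

definition connected_diagram :: "'a diagram => bool" where
 "connected_diagram X \<longleftrightarrow> (\<exists>zs V. X = mk zs V \<and> (\<forall>E. closed_for V E --> E \<inter> word_names zs V = {} \<or> word_names zs V \<subseteq> E))"

definition wheel_verts :: "nat => verts" where
 "wheel_verts k = mset (map (%i. (i, k + Suc i mod k, k + i)) [0..<k])"

definition wheel_word :: "'a list => 'a letter list" where
 "wheel_word w = tword (map (%i. (w ! i, i)) [0..<length w])"

lemma wheel_mk: "wheel w = mk (wheel_word w) (wheel_verts (length w))"
proof -
 have "proj c (tword (map (%i. (w ! i, i)) js)) = map Tail (filter (%i. w ! i = c) js)" for c js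
  by (induction js) auto
 then show ?thesis by (simp add: wheel_def mk_def wheel_word_def wheel_verts_def Let_def)
qed

lemma wheel_closed:
 assumes "closed_for (wheel_verts k) E" "i < k"
 shows "i \<in> E \<longleftrightarrow> k + i \<in> E" "k + Suc i mod k \<in> E \<longleftrightarrow> k + i \<in> E"
 using assms unfolding closed_for_def wheel_verts_def by auto

lemma wheel_names: "word_names (wheel_word w) (wheel_verts (length w)) = {..<2 * length w}"
proof -
 let ?k = "length w"
 have "Suc i mod ?k < ?k" if "i < ?k" for i by (rule mod_less_divisor) (use that in linarith)
 then have "word_names (wheel_word w) (wheel_verts ?k) \<subseteq> {..<2 * ?k}"
  by (force simp: word_names_def wheel_word_def vert_names_def wheel_verts_def tword_def)
 moreover have "n \<in> word_names (wheel_word w) (wheel_verts ?k)" if "n < 2 * ?k" for n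
 proof (cases "n < ?k")
  case False
  then have "(n - ?k, ?k + Suc (n - ?k) mod ?k, n) \<in># wheel_verts ?k" using that by (auto simp: wheel_verts_def image_iff intro!: bexI[of _ "n - ?k"])
  then show ?thesis by (force simp: word_names_def vert_names_def)
 qed (force simp: word_names_def wheel_word_def tword_def)
 ultimately show ?thesis by blast
qed

lemma wheel_connected: "connected_diagram (wheel w)"
 unfolding connected_diagram_def
proof (intro exI conjI allI impI)
 let ?k = "length w"
 show "wheel w = mk (wheel_word w) (wheel_verts ?k)" by (rule wheel_mk)
 fix E assume E: "closed_for (wheel_verts ?k) E"
 have a: "k + j \<in> E \<longleftrightarrow> k + 0 \<in> E" if "j < k" "k = ?k" for j k
  using that
 proof (induction j)
  case (Suc j)
  then show ?case using wheel_closed(2)[OF E, of j] by simp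
 qed simp
 have "n \<in> E \<longleftrightarrow> ?k + 0 \<in> E" if "n < 2 * ?k" for n
  using a[of n ?k] a[of "n - ?k" ?k] wheel_closed(1)[OF E, of n] that by (cases "n < ?k") auto
 then show "E \<inter> word_names (wheel_word w) (wheel_verts ?k) = {} \<or> word_names (wheel_word w) (wheel_verts ?k) \<subseteq> E"
  unfolding wheel_names by blast
qed

context strands begin

lemma wf_wheel:
 assumes w: "w \<in> lists S"
 shows "wf_word S (wheel_word w) (wheel_verts (length w))"
 unfolding wf_word_def
proof (intro conjI allI impI)
 let ?k = "length w" and ?r = "[0..<length w]"
 have src: "word_src (wheel_word w) (wheel_verts ?k) = mset (map (%i. i) ?r) + mset (map ((+) ?k) ?r)"
  by (simp add: word_src_def wheel_word_def wheel_verts_def tword_def comp_def multiset.map_comp)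
 have s: "(\<Sum>v\<in>#image_mset g M. {#a v, b v#}) = image_mset (a \<circ> g) M + image_mset (b \<circ> g) M" for g M and a b :: "nat \<times> nat \<times> nat => nat"
  by (induction M) auto
 \<comment> \<open>The right inputs run through the cycle shifted by one step, so as a multiset they
   are again all edges of the cycle.\<close>
 have "map (%i. Suc i mod ?k) ?r = rotate1 ?r" 
 proof (rule nth_equalityI)
  fix i assume i: "i < length (map (%i. Suc i mod ?k) ?r)"
  then have "Suc i mod ?k < ?k" by (intro mod_less_divisor) auto
  then show "map (%i. Suc i mod ?k) ?r ! i = rotate1 ?r ! i" using i by (simp add: nth_rotate1)
 qed simp
 moreover have "mset (rotate1 xs) = mset xs" for xs :: "nat list" by (cases xs) auto
 ultimately have "image_mset (%i. Suc i mod ?k) (mset ?r) = mset ?r" by (metis mset_map)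
 then have "image_mset ((+) ?k) (image_mset (%i. Suc i mod ?k) (mset ?r)) = image_mset ((+) ?k) (mset ?r)" by simp
 then have "image_mset (%i. ?k + Suc i mod ?k) (mset ?r) = image_mset ((+) ?k) (mset ?r)" by (simp add: multiset.map_comp comp_def)
 then have "(\<Sum>(p, q, r)\<in>#wheel_verts ?k. {#p, q#}) = mset (map (%i. i) ?r) + mset (map ((+) ?k) ?r)"
  unfolding wheel_verts_def mset_map case_prod_beta s by (simp add: comp_def)
 then show "word_src (wheel_word w) (wheel_verts ?k) = word_tgt (wheel_word w) (wheel_verts ?k)"
  unfolding src by (simp add: word_tgt_def wheel_word_def tword_def comp_def)
 have d: "distinct (map (%i. i) ?r @ map ((+) ?k) ?r)" by (auto simp: distinct_map)
 show "count (word_src (wheel_word w) (wheel_verts ?k)) e \<le> 1" for e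
  using d unfolding src mset_append[symmetric] distinct_count_atmost_1 by simp
 show "fst ` set (wheel_word w) \<subseteq> S" using w by (auto simp: wheel_word_def tword_def)
 fix E assume E: "closed_for (wheel_verts ?k) E \<and> E \<inter> word_names (wheel_word w) (wheel_verts ?k) ~= {}"
 then obtain n where n: "n \<in> E" "n < 2 * ?k" unfolding wheel_names by blast
 have "n - ?k < ?k" "\<not> n < ?k ==> ?k + (n - ?k) = n" using n(2) by linarith+
 then obtain i where i: "i < ?k" "i \<in> E" using n wheel_closed(1)[of ?k E "n - ?k"] E by (cases "n < ?k") auto
 then show "\<exists>z\<in>set (wheel_word w). edge_of (snd z) \<in> E"
  by (intro bexI[of _ "(w ! i, Tail i)"]) (auto simp: wheel_word_def tword_def)
qed

lemma wheel_diagram: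
 assumes "w \<in> lists S"
 shows "wheel w \<in> diagrams S" "deg (wheel w) = length w"
 unfolding wheel_mk using wf_wheel[OF assms] by (simp_all add: mk_diagrams degree_wf) (simp add: wheel_word_def)

definition wser :: "('a list set => rat) => 'a diagram => rat" where
 "wser om = lin (%c D. - delta (wheel (rep c)) D) om"

lemma cyclic_rep:
 assumes "c \<in> cyclic_words S"
 shows "rep c \<in> lists S" "rep c ~= []" "\<exists>w\<in>lists S. length w = length (rep c) \<and> c = {rotate n w | n. True}"
proof -
 obtain w where w: "w \<in> lists S" "w ~= []" "c = {rotate n w | n. True}" using assms unfolding cyclic_words_def by blast
 then have "rotate 0 w \<in> c" by blast
 then have "rep c \<in> c" by (rule rep_in)
 then obtain m where m: "rep c = rotate m w" unfolding w(3) by blast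
 then show "rep c \<in> lists S" "rep c ~= []" "\<exists>w\<in>lists S. length w = length (rep c) \<and> c = {rotate n w | n. True}"
  using w by (auto intro!: bexI[of _ w])
qed

text \<open>Finiteness of \<open>S\<close> bounds the number of cyclic words up to each length, so
  \<open>om\<close> is a series for the grading by length, which is the degree of the wheel. Cyclic
  words are non-empty, whence the degrees are positive.\<close>

lemma wser:
 assumes w: "om \<in> CW S"
 shows "positive (wser om)" "tails_series (wser om)" "wser om D ~= 0 ==> connected_diagram D"
proof -
 let ?d = "%c. length (rep c :: 'a list)"
 have s: "om \<in> series (cyclic_words S) ?d"
 proof (rule seriesI)
  show "c \<in> cyclic_words S" if "om c ~= 0" for c using w that by (simp add: CW_def)
  fix N
  have "supp_upto ?d N om \<subseteq> (%w. {rotate n w | n. True}) ` {w. set w \<subseteq> S \<and> length w \<le> N}"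
  proof
   fix c assume "c \<in> supp_upto ?d N om"
   then have "c \<in> cyclic_words S" "?d c \<le> N" using w by (auto simp: supp_upto_def CW_def)
   then show "c \<in> (%w. {rotate n w | n. True}) ` {w. set w \<subseteq> S \<and> length w \<le> N}" using cyclic_rep(3)[of c] by (metis (mono_tags, lifting) imageI in_listsD mem_Collect_eq subsetI)
  qed
  then show "finite (supp_upto ?d N om)" using finite_lists_length_le[OF finite_S] finite_surj by blast
 qed
 have d: "(%D. - delta (wheel (rep c)) D) \<in> dser" if "c \<in> cyclic_words S" for c
  using series_scale[OF series_delta[OF wheel_diagram(1)[OF cyclic_rep(1)[OF that]]], of "-1"] by simp
 have "wser om \<in> dser"
  unfolding wser_def by (rule lin_series_pairing(1)[OF s d]) (auto simp: delta_def wheel_diagram cyclic_rep split: if_splits)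
 moreover have supp: "\<exists>c\<in>cyclic_words S. D = wheel (rep c)" if nz: "wser om D ~= 0" for D
 proof -
  obtain c where c: "om c * - delta (wheel (rep c)) D ~= 0" using nz unfolding wser_def lin_def by (meson Sum_any.not_neutral_obtains_not_neutral)
  then show ?thesis using w by (intro bexI[of _ c]) (auto simp: CW_def delta_def split: if_splits)
 qed
 ultimately show "positive (wser om)"
  unfolding positive_def using wheel_diagram(2)[OF cyclic_rep(1)] cyclic_rep(2) by fastforce
 show "tails_series (wser om)" unfolding tails_series_def tails_only_def using supp wheel_mk wheel_word_def by metis
 show "wser om D ~= 0 ==> connected_diagram D" using supp wheel_connected by metis
qed

lemma tails_sorted: "tails_series x ==> sorted_series x"
 unfolding tails_series_def tails_only_def sorted_series_def using sorted_diagram_mk[of "[]"] by fastforce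

lemma Op_class:
 assumes x: "x \<in> dser" and W: "W \<in> wts N"
 shows "Op stack (rep (aw_class S x)) W = Op stack x W"
proof
 fix D
 show "Op stack (rep (aw_class S x)) W D = Op stack x W D"
 proof (cases "D \<in> diagrams S")
  case D: True
  have W': "(%X. if X \<in> diagrams S then W (stack X D) else 0) \<in> wts N" by (rule insertion_wts[OF W insertions(2) D])
  have "pairing z (%X. W (stack X D)) = pairing z (%X. if X \<in> diagrams S then W (stack X D) else 0)" if "z \<in> dser" for z :: "'a diagram => rat"
   by (rule pairing_cong_series[OF that]) simp
  then show ?thesis using D aw_class_pairing[OF x W'] AW_rep(1)[OF aw_class_AW[OF x]] x by (simp add: Op_def)
 qed (simp add: Op_def)
qed

interpretation q: exponential "wts :: nat => ('a diagram => rat) set" "%n. 1 / fact n"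
 by (intro exponential.intro filtered_wts exponential_axioms.intro) simp

text \<open>Left multiplication by the class of \<open>x\<close> is dual to \<open>Op K x\<close>,
  so powers of the class pair like powers of the operator at the empty diagram. The term of index
  \<open>N\<close>, which \<open>exp_AW\<close> leaves out, vanishes on
  \<open>wts N\<close>.\<close>

lemma exp_pairing:
 assumes K: "insertion K" and x: "positive x"
  and m: "\<And>Y. Y \<in> AW S ==> m (aw_class S x) Y \<in> AW S"
   "\<And>Y N W. Y \<in> AW S ==> W \<in> wts N ==> pairing (rep (m (aw_class S x) Y)) W = pairing (rep Y) (Op K x W)"
 shows "aw_exp S m (aw_class S x) \<in> AW S"
  "W \<in> wts N ==> pairing (rep (aw_exp S m (aw_class S x))) W = qexp N (Op K x) W nil"
proof -
 let ?X = "aw_class S x"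
 note L = op_lowers[OF K x]
 have A: "(m ?X ^^ n) (aw_one S) \<in> AW S" for n by (induction n) (simp_all add: one_AW m(1))
 have P: "pairing (rep ((m ?X ^^ n) (aw_one S))) W = (Op K x ^^ n) W nil" if "W \<in> wts N" for n N W
  using that
 proof (induction n arbitrary: W)
  case (Suc n)
  then show ?case using m(2)[OF A Suc.prems, of n] lowersD(3)[OF L Suc.prems] by (simp add: funpow_swap1)
 qed (simp add: one_AW)
 have z: "pairing (rep ((m ?X ^^ n) (aw_one S))) W = 0" if "W \<in> wts n" for n W
  using P[OF that] lowers_pow(3)[OF L that] by simp
 show "aw_exp S m ?X \<in> AW S" by (rule exp_AW(1)[of m ?X, OF A]) (rule z)
 assume W: "W \<in> wts N"
 have "(\<Sum>n<N. (Op K x ^^ n) W nil / fact n) = (\<Sum>n\<le>N. (Op K x ^^ n) W nil / fact n)"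
  by (rule sum.mono_neutral_left) (use lowers_pow(3)[OF L W] in auto)
 moreover have "pairing (rep (aw_exp S m ?X)) W = (\<Sum>n<N. pairing (rep ((m ?X ^^ n) (aw_one S))) W / fact n)"
  by (rule exp_AW(2)[of m ?X, OF A _ W]) (rule z)
 ultimately show "pairing (rep (aw_exp S m ?X)) W = qexp N (Op K x) W nil"
  unfolding P[OF W] q.expo_def by simp
qed

lemma star_exp:
 assumes x: "positive x"
 shows "aw_exp S (aw_star S) (aw_class S x) \<in> AW S"
  "W \<in> wts N ==> pairing (rep (aw_exp S (aw_star S) (aw_class S x))) W = qexp N (Op stack x) W nil"
proof -
 have xs: "x \<in> dser" using x by (simp add: positive_def)
 note X = aw_class_AW[OF xs]
 have "pairing (rep (aw_star S (aw_class S x) Y)) W = pairing (rep Y) (Op stack x W)" if "Y \<in> AW S" "W \<in> wts N" for Y N W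
  using star_pairing[OF X that] Op_class[OF xs that(2)] by simp
 note e = exp_pairing[where m = "aw_star S", OF insertions(1) x star_AW(1)[OF X] this]
 show "aw_exp S (aw_star S) (aw_class S x) \<in> AW S" by (rule e(1))
 show "W \<in> wts N ==> pairing (rep (aw_exp S (aw_star S) (aw_class S x))) W = qexp N (Op stack x) W nil" by (rule e(2))
qed

text \<open>For a fixed lower diagram \<open>D\<close> the weight is pulled back along
  \<open>stack D\<close>. The stackings of the upper exponential, evaluated at the empty diagram,
  are traded for stackings on top; these commute with the pull-back and end up as stackings on top
  of \<open>D\<close>.\<close>

lemma star_exps:
 assumes x: "positive x" and w: "positive w" and W: "W \<in> wts N"
 defines "e \<equiv> aw_exp S (aw_star S)"
 shows "pairing (rep (aw_star S (e (aw_class S x)) (e (aw_class S w)))) W = qexp N (Op stack x) (qexp N (Op under w) W) nil"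
proof -
 note X = star_exp[OF x, folded e_def] and Z = star_exp[OF w, folded e_def]
 have ws: "w \<in> dser" using w by (simp add: positive_def)
 note U = op_lowers[OF insertions(2) w]
 have inner: "pairing (rep (e (aw_class S w))) (%D'. W (stack D D')) = qexp N (Op under w) W D" if D: "D \<in> diagrams S" for D
 proof -
  let ?L = "%W D'. if D' \<in> diagrams S then W (stack D D') else 0"
  have L: "?L V \<in> wts N" if "V \<in> wts N" for V by (rule insertion_wts[OF that insertions(1) D])
  have "Op under w (?L V) = ?L (Op under w V)" if V: "V \<in> wts N" for V
   using insertion_diagrams(1)[OF insertions(1)] D weight_stack_assoc[OF wts_weight[OF V] D]
   by (auto simp: Op_def fun_eq_iff intro!: pairing_cong_series[OF ws])
  then have p: "(Op under w ^^ n) (?L W) = ?L ((Op under w ^^ n) W)" for n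
   using lowers_pow(2)[OF U W] by (induction n) (simp_all cong: if_cong)
  have "pairing (rep (e (aw_class S w))) (%D'. W (stack D D')) = pairing (rep (e (aw_class S w))) (?L W)"
   by (rule pairing_cong_series[OF AW_rep(1)[OF Z(1)]]) simp
  also have "... = qexp N (Op under w) (?L W) nil"
   unfolding Z(2)[OF L[OF W]] q.expo_def stack_under_nil[OF w L[OF W]] ..
  also have "... = qexp N (Op under w) W D"
   unfolding q.expo_def p using nil_diagram weight_nil(1)[OF wts_weight[OF lowers_pow(2)[OF U W]] D] by simp
  finally show ?thesis .
 qed
 have "pairing (rep (aw_star S (e (aw_class S x)) (e (aw_class S w)))) W = pairing (rep (e (aw_class S x))) (qexp N (Op under w) W)"
  unfolding star_AW(2)[OF X(1) Z(1) W] by (rule pairing_cong_series[OF AW_rep(1)[OF X(1)] inner])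
 then show ?thesis using X(2)[OF q.expo_wts[OF U W]] by simp
qed

text \<open>For a series with tails only, wrapping is stacking on top, and by TC this commutes with
  the wrapping of \<open>x\<close>. So the exponential of the sum is a product of
  exponentials.\<close>

lemma sharp_exps:
 assumes x: "positive x" "sorted_series x" and w: "positive w" "tails_series w" and W: "W \<in> wts N"
 defines "z \<equiv> %D. x D + w D"
 shows "aw_exp S (aw_sharp S) (aw_class S z) \<in> AW S"
  "pairing (rep (aw_exp S (aw_sharp S) (aw_class S z))) W = qexp N (Op wrap x) (qexp N (Op under w) W) nil"
proof -
 have s: "x \<in> dser" "w \<in> dser" using x w by (auto simp: positive_def)
 have nz: "z D ~= 0 ==> x D ~= 0 \<or> w D ~= 0" for D by (auto simp: z_def)
 have zp: "positive z" "sorted_series z"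
  using x w(1) tails_sorted[OF w(2)] nz series_add[OF s] unfolding positive_def sorted_series_def z_def by blast+
 have zs: "z \<in> dser" using zp by (simp add: positive_def)
 have "pairing (rep (aw_sharp S (aw_class S z) Y)) W = pairing (rep Y) (Op wrap z W)" if "Y \<in> AW S" "W \<in> wts N" for Y N W
  by (rule sharp_pairing[OF zp that])
 note e = exp_pairing[where m = "aw_sharp S", OF insertions(3) zp(1) sharp_AW(1)[OF aw_class_AW[OF zs]] this]
 show "aw_exp S (aw_sharp S) (aw_class S z) \<in> AW S" by (rule e(1))
 have e2: "pairing (rep (aw_exp S (aw_sharp S) (aw_class S z))) W = qexp N (Op wrap z) W nil" by (rule e(2)) (assumption | rule W)+
 note Lx = op_lowers[OF insertions(3) x(1)] and Lw = op_lowers[OF insertions(2) w(1)]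
 let ?Z = "%W D. Op wrap x W D + Op under w W D"
 have Z: "Op wrap z V = ?Z V" if "V \<in> wts N" for V
  using Op_add_left[OF insertions(3) s that] Op_wrap_tails[OF w(2) wts_weight[OF that]] by (simp add: z_def)
 have "(Op wrap z ^^ n) W = (?Z ^^ n) W" for n
  by (induction n) (simp_all add: Z lowers_pow(2)[OF lowers_add[OF Lx Lw] W])
 then have "qexp N (Op wrap z) W nil = qexp N ?Z W nil" by (simp add: q.expo_def)
 then show "pairing (rep (aw_exp S (aw_sharp S) (aw_class S z))) W = qexp N (Op wrap x) (qexp N (Op under w) W) nil"
  using e2 q.expo_sum[OF Lx Lw W] Op_wrap_under[OF s(1) s(2) w(2)] by simp
qed

lemma l_map_lser: "l_map S lam = aw_class S (lser (reps lam))"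
 by (simp add: l_map_def lser_def[abs_def] reps_def)

text \<open>By \<open>graft_kills\<close> the weight of a planted tree is a Lie functional of the
  tree, so planting respects the relations of the free Lie algebra.\<close>

lemma l_map_cl:
 assumes m: "tuple m"
 shows "l_map S (cl m) = aw_class S (lser m)"
 unfolding l_map_lser
proof (rule aw_class_eqI[OF lser_series[OF reps_cl[OF m]] lser_series[OF m]])
 fix N and W :: "'a diagram => rat" assume W: "W \<in> wts N"
 obtain ph :: "bool list => nat" where ph: "inj ph" "range ph \<inter> word_names ([] :: 'a letter list) {#} = {}" using fresh_addr[of "{}"] by auto
 have g: "W (plant a p) = graft W [(a, Head (ph []))] {#} ph p" if "a \<in> S" "p \<in> trees S" for a p
  using under_plant[OF wts_weight[OF W] ph, of a p] weight_nil(2)[OF wts_weight[OF W] plant_diagram(1)[OF that]] by simp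
 have k: "lie_fun (lie_rels S) N (graft W [(a, Head (ph []))] {#} ph)" for a
  unfolding lie_fun_def kills_lie_rels using graft_kills[OF W] graft_bounded[OF W] ph(1) by (auto simp: graft_ok_def inj_eq)
 have "pairing (lser n) W = (\<Sum>a\<in>S. pairing (n a) (graft W [(a, Head (ph []))] {#} ph))" if "tuple n" for n :: "('a, rat) tree_tuple"
  unfolding pairing_lser[OF that wts_bounded[OF W]] using that g by (auto intro!: sum.cong pairing_cong_series)
 then show "pairing (lser (reps (cl m))) W = pairing (lser m) W"
  using m reps_cl[OF m] agreeD[OF agree_reps[OF m] _ k] by (auto intro!: sum.cong)
qed

theorem E_pairings:
 assumes lam: "l_map S lam = aw_class S (lser m)" and m: "tuple m" and om: "om \<in> CW S"
 shows "E_l S lam om \<in> AW S" "E_f S lam om \<in> AW S"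
  "W \<in> wts N ==> pairing (rep (E_l S lam om)) W = qexp N (Op stack (lser m)) (qexp N (Op under (wser om)) W) nil"
  "W \<in> wts N ==> pairing (rep (E_f S lam om)) W = qexp N (Op wrap (lser m)) (qexp N (Op under (wser om)) W) nil"
proof -
 note x = lser_positive[OF m] and w = wser(1,2)[OF om]
 have i: "iota S om = aw_class S (wser om)" by (simp add: iota_def wser_def)
 have s: "lser m \<in> dser" "wser om \<in> dser" using x w by (auto simp: positive_def)
 have "aw_add S (l_map S lam) (iota S om) = aw_class S (%D. lser m D + wser om D)"
  unfolding aw_add_def lam i
 proof (rule aw_class_eqI)
  note r = AW_rep(1)[OF aw_class_AW[OF s(1)]] AW_rep(1)[OF aw_class_AW[OF s(2)]]
  show "(%D. rep (aw_class S (lser m)) D + rep (aw_class S (wser om)) D) \<in> dser" "(%D. lser m D + wser om D) \<in> dser"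
   by (intro series_add r s)+
  fix N and W :: "'a diagram => rat" assume W: "W \<in> wts N"
  show "pairing (%D. rep (aw_class S (lser m)) D + rep (aw_class S (wser om)) D) W = pairing (%D. lser m D + wser om D) W"
   unfolding pairing_add_left[OF r wts_bounded[OF W]] pairing_add_left[OF s wts_bounded[OF W]] aw_class_pairing[OF s(1) W] aw_class_pairing[OF s(2) W] ..
 qed
 then have f: "E_f S lam om = aw_exp S (aw_sharp S) (aw_class S (%D. lser m D + wser om D))" by (simp add: E_f_def)
 have l: "E_l S lam om = aw_star S (aw_exp S (aw_star S) (aw_class S (lser m))) (aw_exp S (aw_star S) (aw_class S (wser om)))"
  by (simp add: E_l_def lam i)
 show "E_l S lam om \<in> AW S" unfolding l by (intro star_AW(1) star_exp(1) x w)
 show "E_f S lam om \<in> AW S" unfolding f by (rule sharp_exps(1)[OF x w, of "%_. 0" 0]) (simp add: wts_0)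
 show "W \<in> wts N ==> pairing (rep (E_l S lam om)) W = qexp N (Op stack (lser m)) (qexp N (Op under (wser om)) W) nil"
  unfolding l by (rule star_exps[OF x(1) w(1)])
 show "W \<in> wts N ==> pairing (rep (E_f S lam om)) W = qexp N (Op wrap (lser m)) (qexp N (Op under (wser om)) W) nil"
  unfolding f by (rule sharp_exps(2)[OF x w])
qed

end

section \<open>The co-product and group-like elements\<close>

definition word_in :: "nat set => 'a letter list => 'a letter list" where
 "word_in E = filter (%z. edge_of (snd z) \<in> E)"

definition verts_in :: "nat set => verts => verts" where
 "verts_in E = filter_mset (%(p, q, r). r \<in> E)"

text \<open>A cut is the set of edges assigned to the left factor; closedness says that no component
  is divided. For the right factor the full complement \<open>- E\<close> may be taken, as only the
  names that occur matter.\<close>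

definition cuts :: "'a letter list => verts => nat set set" where
 "cuts zs V = {E. E \<subseteq> word_names zs V \<and> closed_for V E}"

definition cut_sum :: "('a diagram \<times> 'a diagram => 'r::comm_ring_1) => 'a letter list => verts => 'r" where
 "cut_sum W zs V = (\<Sum>E\<in>cuts zs V. W (mk (word_in E zs) (verts_in E V), mk (word_in (- E) zs) (verts_in (- E) V)))"

lemma word_in_simps [simp]: "word_in E [] = []" "word_in E (xs @ ys) = word_in E xs @ word_in E ys"
 "word_in E (z # zs) = (if edge_of (snd z) \<in> E then z # word_in E zs else word_in E zs)"
 by (auto simp: word_in_def)

lemma verts_in_simps [simp]: "verts_in E {#} = {#}" "verts_in E (V + V') = verts_in E V + verts_in E V'"
 "verts_in E (add_mset (p, q, r) V) = (if r \<in> E then add_mset (p, q, r) (verts_in E V) else verts_in E V)"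
 by (auto simp: verts_in_def)

lemma in_cong:
 assumes "\<And>n. n \<in> word_names zs V ==> n \<in> E \<longleftrightarrow> n \<in> F"
 shows "word_in E zs = word_in F zs" "verts_in E V = verts_in F V"
proof -
 have "r \<in> word_names zs V" if "(p, q, r) \<in># V" for p q r using that by (force simp: word_names_def vert_names_def)
 then show "verts_in E V = verts_in F V" unfolding verts_in_def by (intro filter_mset_cong) (use assms in auto)
 show "word_in E zs = word_in F zs" unfolding word_in_def using assms by (intro filter_cong) (auto simp: word_names_def)
qed

lemma in_ren: "word_in E (ren_word f zs) = ren_word f (word_in (f -` E) zs)" "verts_in E (ren_verts f V) = ren_verts f (verts_in (f -` E) V)"
proof -
 show "word_in E (ren_word f zs) = ren_word f (word_in (f -` E) zs)" by (induction zs) auto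
 show "verts_in E (ren_verts f V) = ren_verts f (verts_in (f -` E) V)" by (induction V) auto
qed

lemma names_in: "word_names (word_in E zs) (verts_in E V) \<subseteq> word_names zs V"
 by (auto simp: word_names_def vert_names_def word_in_def verts_in_def)

lemma finite_cuts [simp]: "finite (cuts zs V)"
 by (rule finite_subset[of _ "Pow (word_names zs V)"]) (auto simp: cuts_def)

lemma restrict_mk: "restrict_diagram (mk zs V) E = mk (word_in E zs) (verts_in E V)"
proof -
 have "filter (%x. edge_of x \<in> E) (proj a zs) = proj a (word_in E zs)" for a by (induction zs) auto
 then show ?thesis by (simp add: restrict_diagram_def mk_def verts_in_def)
qed

lemma wf_in:
 assumes wf: "wf_word S zs V" and E: "closed_for V E"
 shows "wf_word S (word_in E zs) (verts_in E V)"
 unfolding wf_word_def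
proof (intro conjI allI impI)
 have s: "word_src (word_in E zs) (verts_in E V) = filter_mset (%n. n \<in> E) (word_src zs V)" for zs :: "'a letter list"
  using E
 proof (induction V)
  case empty
  show ?case
  proof (induction zs)
   case (Cons z zs) then show ?case by (cases z; cases "snd z") auto
  qed simp
 next
  case (add v V) then show ?case by (cases v) auto
 qed
 have t: "word_tgt (word_in E zs) (verts_in E V) = filter_mset (%n. n \<in> E) (word_tgt zs V)" for zs :: "'a letter list"
  using E
 proof (induction V)
  case empty
  show ?case
  proof (induction zs)
   case (Cons z zs) then show ?case by (cases z; cases "snd z") auto
  qed simp
 next
  case (add v V) then show ?case by (cases v) auto
 qed
 show "word_src (word_in E zs) (verts_in E V) = word_tgt (word_in E zs) (verts_in E V)" unfolding s t wf_wordD(2)[OF wf] ..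
 show "count (word_src (word_in E zs) (verts_in E V)) e \<le> 1" for e unfolding s using wf_wordD(3)[OF wf, of e] by simp
 show "fst ` set (word_in E zs) \<subseteq> S" using wf_wordD(1)[OF wf] by (auto simp: word_in_def)
 fix F assume F: "closed_for (verts_in E V) F \<and> F \<inter> word_names (word_in E zs) (verts_in E V) ~= {}"
 have "closed_for V (F \<inter> E)" using E conjunct1[OF F] by (induction V) auto
 moreover have "word_names (word_in E zs) (verts_in E V) \<subseteq> E \<inter> word_names zs V"
  using E by (auto simp: word_names_def vert_names_def word_in_def verts_in_def closed_for_def)
 then obtain n where "n \<in> F \<inter> E" "n \<in> word_names zs V" using F by blast
 ultimately show "\<exists>z\<in>set (word_in E zs). edge_of (snd z) \<in> F" using wf_touch[OF wf] by (force simp: word_in_def)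
qed

context strands begin

text \<open>Functionals on pairs that are weights in each argument separately. Every homogeneous
  functional killing the relations of the tensor square is of this kind
  (\<open>kills_aw2\<close>).\<close>

definition wts2 :: "nat => ('a diagram \<times> 'a diagram => rat) set" where
 "wts2 N = {W. (\<forall>A B. W (A, B) ~= 0 --> A \<in> diagrams S \<and> B \<in> diagrams S \<and> deg A + deg B < N) \<and>
   (\<forall>D. weight (%X. W (X, D)) \<and> weight (%X. W (D, X)))}"

lemma wts2D:
 assumes "W \<in> wts2 N"
 shows "W (A, B) ~= 0 ==> A \<in> diagrams S \<and> B \<in> diagrams S \<and> deg A + deg B < N" "weight (%X. W (X, D))" "weight (%X. W (D, X))"
  "(%X. W (X, D)) \<in> wts N" "(%X. W (D, X)) \<in> wts N"
 using assms unfolding wts2_def wts_def by (auto simp: add_lessD1) (metis add.commute add_lessD1)+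

lemma wts2_swap: "W \<in> wts2 N ==> W \<circ> prod.swap \<in> wts2 N"
 unfolding wts2_def by (simp add: comp_def) (metis add.commute)

lemma cut_sum_ren:
 assumes W: "W \<in> wts2 N" and f: "inj_on f (word_names zs V)"
 shows "cut_sum W (ren_word f zs) (ren_verts f V) = cut_sum W zs V"
proof -
 let ?N = "word_names zs V"
 have v: "f -` (f ` E) \<inter> ?N = E" if "E \<subseteq> ?N" for E using that f by (auto dest: inj_onD)
 have mem: "n \<in> f -` (f ` E) \<longleftrightarrow> n \<in> E" if "n \<in> ?N" "E \<subseteq> ?N" for n E using v[OF that(2)] that by blast
 have i: "inj_on (image f) (cuts zs V)" using inj_on_image_Pow[OF f] by (rule inj_on_subset) (auto simp: cuts_def)
 have c: "cuts (ren_word f zs) (ren_verts f V) = image f ` cuts zs V"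
 proof (intro equalityI subsetI)
  fix E assume "E \<in> cuts (ren_word f zs) (ren_verts f V)"
  then have E: "E \<subseteq> f ` ?N" "closed_for V (f -` E)" by (simp_all add: cuts_def word_names_ren closed_for_ren)
  have "closed_for V (f -` E \<inter> ?N)" using E(2) closed_for_cong[of V "f -` E" "f -` E \<inter> ?N"] by (auto simp: word_names_def)
  moreover have "E = f ` (f -` E \<inter> ?N)" using E(1) by blast
  ultimately show "E \<in> image f ` cuts zs V" by (auto simp: cuts_def)
 next
  fix E assume "E \<in> image f ` cuts zs V"
  then obtain F where F: "F \<subseteq> ?N" "closed_for V F" "E = f ` F" by (auto simp: cuts_def)
  have "closed_for V (f -` E)" using F(2) closed_for_cong[of V F "f -` E"] mem[OF _ F(1)] by (auto simp: F(3) word_names_def)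
  then show "E \<in> cuts (ren_word f zs) (ren_verts f V)" using F by (auto simp: cuts_def word_names_ren closed_for_ren)
 qed
 show ?thesis
  unfolding cut_sum_def c sum.reindex[OF i] comp_def
 proof (rule sum.cong[OF refl])
  fix E assume "E \<in> cuts zs V"
  then have E: "E \<subseteq> ?N" by (simp add: cuts_def)
  have e: "word_in (f -` (f ` E)) zs = word_in E zs" "verts_in (f -` (f ` E)) V = verts_in E V"
   "word_in (f -` (- f ` E)) zs = word_in (- E) zs" "verts_in (f -` (- f ` E)) V = verts_in (- E) V"
   using in_cong[of zs V "f -` (f ` E)" E] in_cong[of zs V "f -` (- f ` E)" "- E"] mem[OF _ E] by auto
  have j: "inj_on f (word_names (word_in F zs) (verts_in F V))" for F by (rule inj_on_subset[OF f names_in])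
  show "W (mk (word_in (f ` E) (ren_word f zs)) (verts_in (f ` E) (ren_verts f V)), mk (word_in (- f ` E) (ren_word f zs)) (verts_in (- f ` E) (ren_verts f V))) =
    W (mk (word_in E zs) (verts_in E V), mk (word_in (- E) zs) (verts_in (- E) V))"
   unfolding in_ren e weight_ren[OF wts2D(2)[OF W] j] weight_ren[OF wts2D(3)[OF W] j] ..
 qed
qed

text \<open>If a cut sends the two ends to different factors, their order is invisible and the terms
  cancel. If it sends them to the same factor, the relation holds in that factor; such cuts
  correspond to those of the diagram with the new vertex, where the new edge follows its neighbours.
  The parameters \<open>m\<close> and \<open>v\<close> cover both forms of STU.\<close>

lemma cut_sum_STU:
 assumes W: "W \<in> wts2 N" and n: "n \<notin> word_names (xs @ [h, k] @ ys) V"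
  and m: "edge_of (snd m) = n" and v: "v = (v1, v2, v3)" "{v1, v2, v3} = {edge_of (snd h), edge_of (snd k), n}"
  and rel: "\<And>W' xs ys V. weight W' ==> n \<notin> word_names (xs @ [h, k] @ ys) V ==>
   (W' (mk (xs @ [h, k] @ ys) V) :: rat) - W' (mk (xs @ [k, h] @ ys) V) = W' (mk (xs @ [m] @ ys) (V + {#v#}))"
 shows "cut_sum W (xs @ [h, k] @ ys) V - cut_sum W (xs @ [k, h] @ ys) V = cut_sum W (xs @ [m] @ ys) (V + {#v#})"
proof -
 let ?p = "edge_of (snd h)" and ?q = "edge_of (snd k)" and ?N = "word_names (xs @ [h, k] @ ys) V"
 let ?C = "cuts (xs @ [h, k] @ ys) V" and ?D = "{E \<in> cuts (xs @ [h, k] @ ys) V. ?p \<in> E \<longleftrightarrow> ?q \<in> E}"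
 let ?T = "%zs V E. W (mk (word_in E zs) (verts_in E V), mk (word_in (- E) zs) (verts_in (- E) V))"
 let ?g = "%E. if ?p \<in> E then insert n E else E"
 have wn: "word_names (z # zs) U = insert (edge_of (snd z)) (word_names zs U)" for z :: "'a letter" and zs U by (cases z) simp
 have N: "?N = insert ?p (insert ?q (word_names (xs @ ys) V))" by (auto simp: wn)
 have nn: "n ~= ?p" "n ~= ?q" "n \<notin> word_names (xs @ ys) V" using n unfolding N by auto
 have N3: "word_names (xs @ [m] @ ys) (V + {#v#}) = insert n ?N" unfolding N v using m v(2) by (auto simp: wn)
 have clv: "closed_for (add_mset v V) E \<longleftrightarrow> closed_for V E \<and> (?p \<in> E \<longleftrightarrow> ?q \<in> E) \<and> (n \<in> E \<longleftrightarrow> ?p \<in> E)" for E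
 proof -
  have "closed_for (add_mset v V) E \<longleftrightarrow> closed_for V E \<and> (\<forall>x\<in>{v1, v2, v3}. \<forall>y\<in>{v1, v2, v3}. x \<in> E \<longleftrightarrow> y \<in> E)" unfolding v(1) by auto
  then show ?thesis unfolding v(2) by auto
 qed
 have gV: "closed_for V (?g E) \<longleftrightarrow> closed_for V E" for E
  by (rule closed_for_cong) (use nn(3) in \<open>auto simp: word_names_def\<close>)
 have c: "cuts (xs @ [m] @ ys) (V + {#v#}) = ?g ` ?D"
 proof (intro equalityI subsetI)
  fix E assume "E \<in> cuts (xs @ [m] @ ys) (V + {#v#})"
  then have E: "E \<subseteq> insert n ?N" "closed_for V E" "?p \<in> E \<longleftrightarrow> ?q \<in> E" "n \<in> E \<longleftrightarrow> ?p \<in> E"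
   unfolding cuts_def N3 by (simp_all add: clv)
  have "closed_for V (E - {n})" using E(2) closed_for_cong[of V E "E - {n}"] nn(3) by (auto simp: word_names_def)
  moreover have "E - {n} \<subseteq> ?N" using E(1) by blast
  ultimately have "E - {n} \<in> ?D" using E(3) nn(1,2) unfolding cuts_def by simp
  moreover have "E = ?g (E - {n})" using E(4) nn by auto
  ultimately show "E \<in> ?g ` ?D" by blast
 next
  fix E assume "E \<in> ?g ` ?D"
  then obtain F where F: "F \<subseteq> ?N" "closed_for V F" "?p \<in> F \<longleftrightarrow> ?q \<in> F" and E: "E = ?g F" by (auto simp: cuts_def)
  have "n \<notin> F" using F(1) n by blast
  then show "E \<in> cuts (xs @ [m] @ ys) (V + {#v#})"
   unfolding cuts_def N3 E using F nn gV[of F] by (auto simp: clv)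
 qed
 have i: "inj_on ?g ?D"
 proof (rule inj_on_inverseI)
  show "?g E - {n} = E" if "E \<in> ?D" for E using that n by (auto simp: cuts_def)
 qed
 have C: "cuts (xs @ [k, h] @ ys) V = ?C" unfolding cuts_def by (simp add: wn insert_commute)
 have d: "?T (xs @ [h, k] @ ys) V E - ?T (xs @ [k, h] @ ys) V E = (if ?p \<in> E \<longleftrightarrow> ?q \<in> E then ?T (xs @ [m] @ ys) (V + {#v#}) (?g E) else 0)"
  if "E \<in> ?C" for E
 proof -
  have nE: "n \<notin> E" using that n by (auto simp: cuts_def)
  have in3: "v3 \<in> {?p, ?q, n}" using v(2) by blast
  have r: "n \<notin> word_names (word_in F xs @ [h, k] @ word_in F ys) (verts_in F V)" for F
   using nn names_in[of F "xs @ ys" V] by (auto simp: wn)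
  have ins: "word_in (insert n E) xs = word_in E xs" "word_in (insert n E) ys = word_in E ys" "verts_in (insert n E) V = verts_in E V"
   "word_in (- insert n E) xs = word_in (- E) xs" "word_in (- insert n E) ys = word_in (- E) ys" "verts_in (- insert n E) V = verts_in (- E) V"
   using nn(3) by (auto intro!: in_cong)
  consider (both) "?p \<in> E" "?q \<in> E" | (none) "?p \<notin> E" "?q \<notin> E" | (neq) "?p \<in> E \<longleftrightarrow> ?q \<notin> E" by blast
  then show ?thesis
  proof cases
   case both
   have "v3 \<in> insert n E" using both in3 by blast
   then show ?thesis using both nn m rel[OF wts2D(2)[OF W] r, of E] by (simp add: ins v(1))
  next
   case none
   have "v3 \<notin> E" using none in3 nE by blast
   then show ?thesis using none m nE rel[OF wts2D(3)[OF W] r, of _ "- E"] by (simp add: v(1))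
  next
   case neq
   then show ?thesis by (cases "?p \<in> E") simp_all
  qed
 qed
 have "cut_sum W (xs @ [h, k] @ ys) V - cut_sum W (xs @ [k, h] @ ys) V =
   (\<Sum>E\<in>?C. if ?p \<in> E \<longleftrightarrow> ?q \<in> E then ?T (xs @ [m] @ ys) (V + {#v#}) (?g E) else 0)"
  unfolding cut_sum_def C sum_subtractf[symmetric] by (rule sum.cong[OF refl d])
 also have "... = cut_sum W (xs @ [m] @ ys) (V + {#v#})"
  unfolding cut_sum_def c sum.reindex[OF i] comp_def by (rule sum.inter_filter[symmetric]) simp
 finally show ?thesis .
qed

lemma cut_sum_rel:
 assumes W: "W \<in> wts2 N" and "rel c"
 shows "cval (cut_sum W) c = 0"
 using assms(2)
proof cases
 case (AS zs V p q r)
 have C: "cuts zs (V + {#(q, p, r)#}) = cuts zs (V + {#(p, q, r)#})" by (auto simp: cuts_def)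
 show ?thesis unfolding AS(1) cval_simps cut_sum_def C
  using weight_AS[OF wts2D(2)[OF W]] weight_AS[OF wts2D(3)[OF W]]
  by (simp flip: sum.distrib) (intro sum.neutral ballI, auto)
next
 case (IHX zs V p q i r e)
 let ?V = "V + {#(p, q, i), (i, r, e)#}"
 have C: "cuts zs (V + {#(q, r, i), (i, p, e)#}) = cuts zs ?V" "cuts zs (V + {#(r, p, i), (i, q, e)#}) = cuts zs ?V" by (auto simp: cuts_def)
 let ?T = "%U E. W (mk (word_in E zs) (verts_in E U), mk (word_in (- E) zs) (verts_in (- E) U))"
 have "?T ?V E + (?T (V + {#(q, r, i), (i, p, e)#}) E + ?T (V + {#(r, p, i), (i, q, e)#}) E) = 0" if "E \<in> cuts zs ?V" for E
 proof -
  have "i \<in> E \<longleftrightarrow> e \<in> E" using that by (auto simp: cuts_def)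
  then show ?thesis
   using weight_IHX[OF wts2D(2)[OF W], of _ "verts_in E V" p q i r e] weight_IHX[OF wts2D(3)[OF W], of _ _ "verts_in (- E) V" p q i r e]
   by (cases "i \<in> E") (simp_all add: add.assoc)
 qed
 then have "(\<Sum>E\<in>cuts zs ?V. ?T ?V E + (?T (V + {#(q, r, i), (i, p, e)#}) E + ?T (V + {#(r, p, i), (i, q, e)#}) E)) = 0" by (intro sum.neutral) blast
 then show ?thesis unfolding IHX(1) cval_simps cut_sum_def C sum.distrib by simp
next
 case (STU n xs a p x ys V)
 obtain v1 v2 v3 where v: "stu_vertex p x n = (v1, v2, v3)" "{v1, v2, v3} = {p, edge_of x, n}" by (cases x) auto
 show ?thesis unfolding STU(1)
  using cut_sum_STU[where m = "(a, set_edge n x)", OF W STU(2) _ v(1) _ weight_STU] v(2) by (simp add: algebra_simps)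
next
 case (TC xs a e f ys V)
 have C: "cuts (xs @ [(a, Tail f), (a, Tail e)] @ ys) V = cuts (xs @ [(a, Tail e), (a, Tail f)] @ ys) V" by (auto simp: cuts_def)
 show ?thesis unfolding TC(1) cval_simps cut_sum_def C
  using weight_TC[OF wts2D(2)[OF W]] weight_TC[OF wts2D(3)[OF W]]
  by (simp flip: sum_subtractf) (intro sum.neutral ballI, auto)
qed

definition box_dual :: "('a diagram \<times> 'a diagram => rat) => 'a diagram => rat" where
 "box_dual W D = (if D \<in> diagrams S then
   \<Sum>E | E \<subseteq> edges S D \<and> component_closed D E. W (restrict_diagram D E, restrict_diagram D (edges S D - E)) else 0)"

lemma box_dual_mk:
 assumes wf: "wf_word S zs V"
 shows "box_dual W (mk zs V) = cut_sum W zs V"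
proof -
 have "word_in (word_names zs V - E) zs = word_in (- E) zs" "verts_in (word_names zs V - E) V = verts_in (- E) V" for E
  using in_cong[of zs V "word_names zs V - E" "- E"] by auto
 moreover have "component_closed (mk zs V) E \<longleftrightarrow> closed_for V E" for E by (simp add: component_closed_def closed_for_def)
 ultimately show ?thesis using wf by (simp add: box_dual_def mk_diagrams edges_mk restrict_mk cut_sum_def cuts_def)
qed

text \<open>The dual form of the fact that the co-product descends to the quotient: the transpose of
  \<open>box\<close> carries weights of pairs to weights.\<close>

lemma box_dual_wts:
 assumes W: "W \<in> wts2 N"
 shows "box_dual W \<in> wts N"
 unfolding wts_def weight_def mem_Collect_eq
proof (intro conjI allI impI)
 fix zs :: "'a letter list" and V and f :: "nat => nat" assume "wf_word S zs V" "inj_on f (word_names zs V)"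
 then show "box_dual W (mk (ren_word f zs) (ren_verts f V)) = box_dual W (mk zs V)"
  by (simp add: box_dual_mk wf_ren cut_sum_ren[OF W])
next
 fix c assume c: "rel c" "\<forall>(k, zs, V)\<in>set c. wf_word S zs V"
 have "cval (%zs V. box_dual W (mk zs V)) c = cval (cut_sum W) c" by (rule cval_cong) (use c(2) box_dual_mk in fastforce)
 then show "cval (%zs V. box_dual W (mk zs V)) c = 0" using cut_sum_rel[OF W c(1)] by simp
next
 fix D assume nz: "box_dual W D ~= 0"
 show D: "D \<in> diagrams S" using nz by (auto simp: box_dual_def split: if_splits)
 then obtain zs V where d: "D = mk zs V" "wf_word S zs V" using diagram_cases by metis
 obtain E where E: "E \<in> cuts zs V" "W (mk (word_in E zs) (verts_in E V), mk (word_in (- E) zs) (verts_in (- E) V)) ~= 0"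
  using nz unfolding d(1) box_dual_mk[OF d(2)] cut_sum_def by (rule sum.not_neutral_contains_not_neutral)
 have c: "closed_for V E" "closed_for V (- E)" using E(1) by (auto simp: cuts_def closed_for_def)
 have "tail_count zs = tail_count (word_in E zs) + tail_count (word_in (- E) zs)" by (induction zs) auto
 then show "deg D < N"
  using wts2D(1)[OF W E(2)] by (simp add: d(1) degree_wf[OF d(2)] degree_wf[OF wf_in[OF d(2) c(1)]] degree_wf[OF wf_in[OF d(2) c(2)]])
qed

lemma wts2_lincomb:
 assumes "W \<in> wts2 N" "V \<in> wts2 N"
 shows "(%P. c * W P + e * V P) \<in> wts2 N"
 unfolding wts2_def mem_Collect_eq
proof (intro conjI allI impI weight_lincomb wts2D(2,3)[OF assms(1)] wts2D(2,3)[OF assms(2)])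
 fix A B assume "c * W (A, B) + e * V (A, B) ~= 0"
 then have "W (A, B) ~= 0 \<or> V (A, B) ~= 0" by auto
 then show "A \<in> diagrams S" "B \<in> diagrams S" "deg A + deg B < N" using wts2D(1)[OF assms(1)] wts2D(1)[OF assms(2)] by blast+
qed

lemma filtered_wts2: "filtered wts2"
proof
 show "W \<in> wts2 0 \<longleftrightarrow> W = (%_. 0)" for W by (auto simp: wts2_def weight_zero fun_eq_iff)
 show "W \<in> wts2 N ==> N \<le> M ==> W \<in> wts2 M" for W N M by (force simp: wts2_def)
qed (rule wts2_lincomb)

interpretation b: exponential wts2 "%n. 1 / fact n"
 by (intro exponential.intro filtered_wts2 exponential_axioms.intro) simp

interpretation q: exponential "wts :: nat => ('a diagram => rat) set" "%n. 1 / fact n"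
 by (intro exponential.intro filtered_wts exponential_axioms.intro) simp

definition opl where "opl K x W = (%(A, B). Op K x (%X. W (X, B)) A)"

definition opr where "opr K x W = (%(A, B). Op K x (%X. W (A, X)) B)"

lemma opr_swap: "opr K x W = opl K x (W \<circ> prod.swap) \<circ> prod.swap"
 by (auto simp: opl_def opr_def)

lemma opl_lowering:
 assumes K: "insertion K" and x: "positive x"
 shows "b.lowering (opl K x)"
 unfolding b.lowering_def
proof (intro conjI allI ballI)
 have xs: "x \<in> dser" using x by (simp add: positive_def)
 show "opl K x (%D. c * W D + e * V D) = (%D. c * opl K x W D + e * opl K x V D)" if "W \<in> wts2 N" "V \<in> wts2 N" for N W V c e
  using Op_lincomb[OF K xs wts2D(4)[OF that(1)] wts2D(4)[OF that(2)]] by (auto simp: opl_def)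
 fix N and W :: "'a diagram \<times> 'a diagram => rat" assume W: "W \<in> wts2 (Suc N)"
 show "opl K x W \<in> wts2 N"
  unfolding wts2_def mem_Collect_eq
 proof (intro conjI allI impI)
  fix A B assume nz: "opl K x W (A, B) ~= 0"
  then have "Op K x (%X. W (X, B)) A ~= Op K x (%_. 0) A" by (auto simp: opl_def Op_def split: if_splits)
  then have "(%X. W (X, B)) ~= (%_. 0)" by metis
  then obtain X where "W (X, B) ~= 0" by auto
  then have B: "B \<in> diagrams S" "deg B \<le> N" using wts2D(1)[OF W] by force+
  have "(%X. W (X, B)) \<in> wts (Suc (N - deg B))"
   using wts2D[OF W] B(2) by (fastforce simp: wts_def)
  then have "Op K x (%X. W (X, B)) \<in> wts (N - deg B)" by (rule Op_wts[OF K x])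
  moreover have "A \<in> diagrams S" using nz by (auto simp: opl_def Op_def split: if_splits)
  ultimately show "A \<in> diagrams S" "B \<in> diagrams S" "deg A + deg B < N" using nz B by (auto simp: opl_def wts_def less_diff_conv)
 next
  fix D
  show "weight (%X. opl K x W (X, D))" using Op_wts[OF K x wts2D(4)[OF W, of D]] by (simp add: opl_def wts_weight)
  show "weight (%X. opl K x W (D, X))"
  proof (cases "D \<in> diagrams S")
   case True
   have "opl K x W (D, X) = (\<Sum>Y\<in>supp_upto deg (Suc N) x. x Y * W (K Y D, X))" for X
    using True pairing_series[OF xs insertion_bounded[OF K wts2D(4)[OF W] True]] by (simp add: opl_def Op_def)
   then show ?thesis using weight_sum[of "supp_upto deg (Suc N) x" "%Y X. W (K Y D, X)" x] wts2D(3)[OF W] by simp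
  qed (simp add: opl_def Op_def weight_zero)
 qed
qed

lemma opr_lowering:
 assumes K: "insertion K" and x: "positive x"
 shows "b.lowering (opr K x)"
 unfolding b.lowering_def
proof (intro conjI allI ballI)
 have xs: "x \<in> dser" using x by (simp add: positive_def)
 show "opr K x (%D. c * W D + e * V D) = (%D. c * opr K x W D + e * opr K x V D)" if "W \<in> wts2 N" "V \<in> wts2 N" for N W V c e
  using Op_lincomb[OF K xs wts2D(5)[OF that(1)] wts2D(5)[OF that(2)]] by (auto simp: opr_def)
 show "opr K x W \<in> wts2 N" if "W \<in> wts2 (Suc N)" for N W
  unfolding opr_swap by (rule wts2_swap[OF b.lowersD(2)[OF opl_lowering[OF K x] wts2_swap[OF that]]])
qed

lemma opl_opr:
 assumes "insertion K" "insertion K'" "positive x" "positive y" and W: "W \<in> wts2 N"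
 shows "opl K x (opr K' y W) = opr K' y (opl K x W)"
proof -
 have s: "x \<in> dser" "y \<in> dser" using assms by (auto simp: positive_def)
 have "pairing x (%X. pairing y (%Y. W (K X A, K' Y B))) = pairing y (%Y. pairing x (%X. W (K X A, K' Y B)))"
  if "A \<in> diagrams S" "B \<in> diagrams S" for A B
  by (rule pairing_swap[OF s, where N = N])
   (use wts2D(1)[OF W] insertion_diagrams(2)[OF assms(1) _ that(1)] insertion_diagrams(2)[OF assms(2) _ that(2)] in fastforce)
 then show ?thesis by (auto simp: opl_def opr_def Op_def fun_eq_iff)
qed

lemma box_dual_nil: "box_dual W nil = W (nil, nil)"
proof -
 have "cuts ([] :: 'a letter list) {#} = {{}}" by (auto simp: cuts_def)
 then show ?thesis using nil_diagram by (simp add: box_dual_mk mk_diagrams cut_sum_def)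
qed

lemma box_dual_sum: "box_dual (%P. \<Sum>i\<in>I. c i * W i P) D = (\<Sum>i\<in>I. c i * box_dual (W i) D)"
 unfolding box_dual_def by (auto simp: sum_distrib_left intro: sum.swap)

text \<open>A connected diagram goes to one of the two factors as a whole.\<close>

lemma box_dual_insertion:
 assumes K: "insertion K" and X: "X \<in> diagrams S" "connected_diagram X" "0 < deg X" and D: "D \<in> diagrams S" and W: "W \<in> wts2 N"
 shows "box_dual W (K X D) = box_dual (%(A, B). W (K X A, B) + W (A, K X B)) D"
proof -
 obtain f g L R where k: "inj f" "inj g" "range f \<inter> range g = {}" "\<And>zs. mset (L zs @ R zs) = mset (ren_word f zs)"
  "\<And>zs V zs' V'. K (mk zs V) (mk zs' V') = mk (L zs @ ren_word g zs' @ R zs) (ren_verts f V + ren_verts g V')"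
  by (rule insertionE[OF K]) (rule that)
 obtain xs U where X': "X = mk xs U" "\<And>E. closed_for U E ==> E \<inter> word_names xs U = {} \<or> word_names xs U \<subseteq> E"
  using X(2) unfolding connected_diagram_def by blast
 obtain zs V where D': "D = mk zs V" "wf_word S zs V" using diagram_cases[OF D] .
 let ?zs = "L xs @ ren_word g zs @ R xs" and ?V = "ren_verts f U + ren_verts g V" and ?M = "f ` word_names xs U" and ?N = "word_names zs V"
 let ?T = "%E. W (mk (word_in E ?zs) (verts_in E ?V), mk (word_in (- E) ?zs) (verts_in (- E) ?V))"
 have wfX: "wf_word S xs U" using X(1) by (simp add: X'(1) mk_diagrams)
 \<comment> \<open>Positive degree makes the set of names of \<open>X\<close> non-empty. Therefore
   the cuts with \<open>X\<close> on the left are different from those with \<open>X\<close> on the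
   right, and none is counted twice.\<close>
 have "tail_count xs ~= 0" using X(3) degree_wf[OF wfX] by (simp add: X'(1))
 then have "xs ~= []" by auto
 then have ne: "?M ~= {}" by (cases xs) auto
 have ls: "set (L xs) \<union> set (R xs) = set (ren_word f xs)" using k(4)[of xs] by (metis set_append set_mset_mset)
 have lr: "word_names (L xs @ R xs) (ren_verts f U) = ?M" using ls unfolding word_names_ren[symmetric] by (simp add: word_names_def)
 have "word_names ?zs ?V = word_names (L xs @ R xs) (ren_verts f U) \<union> word_names (ren_word g zs) (ren_verts g V)"
  by (auto simp: word_names_def)
 then have names: "word_names ?zs ?V = ?M \<union> g ` ?N" by (simp only: word_names_ren lr)
 have LM: "edge_of (snd z) \<in> ?M" if "z \<in> set (L xs) \<union> set (R xs)" for z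
  using that unfolding lr[symmetric] by (auto simp: word_names_def)
 have nm: "g n \<notin> ?M" "f m \<notin> g ` F" for n m F using k(3) by blast+
 have all: "word_in E (L xs) = L xs \<and> word_in E (R xs) = R xs \<and> verts_in E (ren_verts f U) = ren_verts f U" if "?M \<subseteq> E" for E
 proof -
  have "word_in (f -` E) xs = word_in UNIV xs \<and> verts_in (f -` E) U = verts_in UNIV U" using that in_cong[of xs U "f -` E" UNIV] by auto
  moreover have "verts_in UNIV U = U" by (simp add: verts_in_def filter_mset_eq_conv)
  ultimately have "verts_in E (ren_verts f U) = ren_verts f U" unfolding in_ren by simp
  moreover have "edge_of (snd z) \<in> E" if "z \<in> set (L xs) \<union> set (R xs)" for z using LM[OF that] \<open>?M \<subseteq> E\<close> by blast
  ultimately show ?thesis by (simp add: word_in_def filter_id_conv)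
 qed
 have none: "word_in E (L xs) = [] \<and> word_in E (R xs) = [] \<and> verts_in E (ren_verts f U) = {#}" if "?M \<inter> E = {}" for E
 proof -
  have "verts_in (f -` E) U = verts_in {} U" using that in_cong(2)[of xs U "f -` E" "{}"] by auto
  moreover have "verts_in {} U = {#}" by (simp add: verts_in_def filter_mset_eq_conv case_prod_beta)
  ultimately have "verts_in E (ren_verts f U) = {#}" unfolding in_ren by simp
  moreover have "word_in E (L xs) = []" "word_in E (R xs) = []" using LM that unfolding word_in_def filter_empty_conv by blast+
  ultimately show ?thesis by simp
 qed
 have g0: "g -` (g ` E) = E" "g -` (?M \<union> g ` E) = E" "g -` (- g ` E) = - E" "g -` (- (?M \<union> g ` E)) = - E" for E
  using inj_vimage_image_eq[OF k(2)] nm(1) by (auto simp: inj_eq[OF k(2)])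
 have cl: "closed_for ?V E \<longleftrightarrow> closed_for U (f -` E) \<and> closed_for V (g -` E)" for E by (simp add: closed_for_ren)
 \<comment> \<open>Connectedness of \<open>X\<close> enters here: a closed set contains all of
   \<open>?M\<close> or nothing of it, so a cut of the composite is a cut of \<open>D\<close> with
   or without \<open>?M\<close>.\<close>
 have c: "cuts ?zs ?V = image g ` cuts zs V \<union> (%E. ?M \<union> g ` E) ` cuts zs V"
 proof (intro equalityI subsetI)
  fix E assume "E \<in> cuts ?zs ?V"
  then have E: "E \<subseteq> ?M \<union> g ` ?N" "closed_for U (f -` E)" "closed_for V (g -` E)" by (simp_all only: cuts_def mem_Collect_eq names cl)
  have "g -` E \<subseteq> ?N" using E(1) nm by (auto simp: inj_eq[OF k(2)] dest!: subsetD)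
  then have F: "g -` E \<in> cuts zs V" using E(3) by (simp add: cuts_def)
  from X'(2)[OF E(2)] have "E = g ` (g -` E) \<or> E = ?M \<union> g ` (g -` E)" using E(1) by blast
  then show "E \<in> image g ` cuts zs V \<union> (%E. ?M \<union> g ` E) ` cuts zs V" using F by blast
 next
  fix E assume "E \<in> image g ` cuts zs V \<union> (%E. ?M \<union> g ` E) ` cuts zs V"
  then obtain F where F: "F \<in> cuts zs V" "E = g ` F \<or> E = ?M \<union> g ` F" by blast
  have "f -` E = {} \<or> f -` E = word_names xs U" using F(2) nm(2) by (auto simp: inj_eq[OF k(1)])
  moreover have "closed_for U {} \<and> closed_for U (word_names xs U)"
   by (auto simp: closed_for_def word_names_def vert_names_def)
  ultimately have "closed_for U (f -` E)" by metis
  moreover have "g -` E = F" using F(2) g0(1,2)[of F] by metis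
  moreover have "F \<subseteq> ?N" "closed_for V F" using F(1) by (simp_all add: cuts_def)
  moreover from this(1) have "E \<subseteq> ?M \<union> g ` ?N" using F(2) by blast
  ultimately show "E \<in> cuts ?zs ?V" unfolding cuts_def names cl mem_Collect_eq by simp
 qed
 have i: "inj_on (image g) C" "inj_on (%E. ?M \<union> g ` E) C" for C
  by (rule inj_on_inverseI[where g = "vimage g"], rule g0)+
 have dis: "image g ` cuts zs V \<inter> (%E. ?M \<union> g ` E) ` cuts zs V = {}" using ne k(3) by blast
 have rg: "W (mk (ren_word g ys) (ren_verts g Y), B) = W (mk ys Y, B)" "W (B, mk (ren_word g ys) (ren_verts g Y)) = W (B, mk ys Y)" for ys Y B
  using weight_ren[OF wts2D(2)[OF W] inj_on_subset[OF k(2)]] weight_ren[OF wts2D(3)[OF W] inj_on_subset[OF k(2)]] by blast+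
 have T: "?T (g ` E) = W (mk (word_in E zs) (verts_in E V), K X (mk (word_in (- E) zs) (verts_in (- E) V)))"
  "?T (?M \<union> g ` E) = W (K X (mk (word_in E zs) (verts_in E V)), mk (word_in (- E) zs) (verts_in (- E) V))" for E
 proof -
  have "?M \<inter> g ` E = {}" "?M \<subseteq> - g ` E" "?M \<subseteq> ?M \<union> g ` E" "?M \<inter> - (?M \<union> g ` E) = {}" using k(3) by blast+
  note t = none[OF this(1)] all[OF this(2)] all[OF this(3)] none[OF this(4)]
  show "?T (g ` E) = W (mk (word_in E zs) (verts_in E V), K X (mk (word_in (- E) zs) (verts_in (- E) V)))"
   unfolding X'(1) k(5) by (simp only: word_in_simps verts_in_simps t in_ren[where f = g] g0 append_Nil append_Nil2 add_0 rg)
  show "?T (?M \<union> g ` E) = W (K X (mk (word_in E zs) (verts_in E V)), mk (word_in (- E) zs) (verts_in (- E) V))"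
   unfolding X'(1) k(5) by (simp only: word_in_simps verts_in_simps t in_ren[where f = g] g0 append_Nil append_Nil2 add_0 rg)
 qed
 have wf: "wf_word S ?zs ?V" using insertion_diagrams(1)[OF K X(1) D] unfolding X'(1) D'(1) k(5) by (simp add: mk_diagrams)
 have "box_dual W (K X D) = cut_sum W ?zs ?V" unfolding X'(1) D'(1) k(5) by (rule box_dual_mk[OF wf])
 also have "... = (\<Sum>E\<in>cuts zs V. ?T (g ` E)) + (\<Sum>E\<in>cuts zs V. ?T (?M \<union> g ` E))"
  unfolding cut_sum_def c by (subst sum.union_disjoint[OF _ _ dis]) (simp_all add: sum.reindex[OF i(1)] sum.reindex[OF i(2)])
 also have "... = box_dual (%(A, B). W (K X A, B) + W (A, K X B)) D"
  unfolding D'(1) box_dual_mk[OF D'(2)] cut_sum_def T by (simp add: sum.distrib add.commute)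
 finally show ?thesis .
qed

text \<open>Connected diagrams are primitive. Dually, an insertion before the co-product becomes the
  sum of an insertion into the left and one into the right argument.\<close>

lemma Op_box_dual:
 assumes K: "insertion K" and x: "positive x" "\<And>X. x X ~= 0 ==> connected_diagram X" and W: "W \<in> wts2 N"
 shows "Op K x (box_dual W) = box_dual (%P. opl K x W P + opr K x W P)"
proof
 fix D
 have xs: "x \<in> dser" using x by (simp add: positive_def)
 show "Op K x (box_dual W) D = box_dual (%P. opl K x W P + opr K x W P) D"
 proof (cases "D \<in> diagrams S")
  case True
  then obtain zs V where D: "D = mk zs V" "wf_word S zs V" using diagram_cases by metis
  let ?A = "%E. mk (word_in E zs) (verts_in E V)"
  have d: "?A E \<in> diagrams S" "?A (- E) \<in> diagrams S" if "E \<in> cuts zs V" for E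
   using that wf_in[OF D(2)] by (auto simp: mk_diagrams cuts_def closed_for_def)
  have l: "bounded_by (diagrams S) deg N (%X. W (K X (?A E), ?A (- E)))" "bounded_by (diagrams S) deg N (%X. W (?A E, K X (?A (- E))))"
   if "E \<in> cuts zs V" for E
   using insertion_bounded[OF K wts2D(4)[OF W] d(1)[OF that]] insertion_bounded[OF K wts2D(5)[OF W] d(2)[OF that]] by blast+
  have "Op K x (box_dual W) D = pairing x (%X. \<Sum>E\<in>cuts zs V. W (K X (?A E), ?A (- E)) + W (?A E, K X (?A (- E))))"
   unfolding Op_def using True
  proof (simp, intro pairing_cong)
   fix X assume X: "x X ~= 0"
   have "box_dual W (K X D) = box_dual (%(A, B). W (K X A, B) + W (A, K X B)) D"
    by (rule box_dual_insertion[OF K seriesD[OF xs X] x(2)[OF X] _ True W]) (use x(1) X in \<open>simp add: positive_def\<close>)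
   then show "box_dual W (K X D) = (\<Sum>E\<in>cuts zs V. W (K X (?A E), ?A (- E)) + W (?A E, K X (?A (- E))))"
    unfolding D(1) box_dual_mk[OF D(2)] cut_sum_def by simp
  qed
  also have "... = (\<Sum>E\<in>cuts zs V. pairing x (%X. W (K X (?A E), ?A (- E))) + pairing x (%X. W (?A E, K X (?A (- E)))))"
   by (subst pairing_sum_right[OF xs, where N = N]) (auto intro!: bounded_by_add l sum.cong simp: pairing_add_right[OF xs l])
  also have "... = box_dual (%P. opl K x W P + opr K x W P) D"
   unfolding D(1) box_dual_mk[OF D(2)] cut_sum_def by (rule sum.cong) (simp_all add: opl_def opr_def Op_def d)
  finally show ?thesis .
 qed (simp add: Op_def box_dual_def)
qed

text \<open>The exponential of a primitive element is group-like: the operators on the two arguments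
  commute, so the exponential of their sum is a product.\<close>

lemma expo_box_dual:
 assumes K: "insertion K" and x: "positive x" "\<And>X. x X ~= 0 ==> connected_diagram X" and W: "W \<in> wts2 N"
 shows "qexp N (Op K x) (box_dual W) = box_dual (qexp N (opl K x) (qexp N (opr K x) W))"
proof -
 note l = opl_lowering[OF K x(1)] and r = opr_lowering[OF K x(1)]
 let ?Z = "%W P. opl K x W P + opr K x W P"
 have p: "(Op K x ^^ n) (box_dual W) = box_dual ((?Z ^^ n) W)" for n
  by (induction n) (simp_all add: Op_box_dual[OF K x b.lowers_pow(2)[OF b.lowers_add[OF l r] W]])
 have "qexp N (Op K x) (box_dual W) = box_dual (qexp N ?Z W)"
  unfolding q.expo_def[abs_def] b.expo_def[abs_def] p box_dual_sum ..
 also have "qexp N ?Z W = qexp N (opl K x) (qexp N (opr K x) W)"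
  by (rule b.expo_sum[OF l r W opl_opr[OF K K x(1) x(1), symmetric]])
 finally show ?thesis .
qed

lemma opl_section: "(Op K x ^^ n) (%X. W (X, B)) = (%A. (opl K x ^^ n) W (A, B))" "(Op K x ^^ n) (%X. W (A, X)) = (%B. (opr K x ^^ n) W (A, B))"
 by (induction n) (simp_all add: opl_def opr_def)

text \<open>Both exponentials split over the two arguments. Operators on different arguments
  commute, so those of each argument can be collected; evaluation of both arguments at the empty
  diagram then gives the iterated pairing.\<close>

theorem group_like_pairing:
 assumes x: "positive x" "\<And>X. x X ~= 0 ==> connected_diagram X" and w: "positive w" "\<And>X. w X ~= 0 ==> connected_diagram X"
  and e: "e \<in> dser" "\<And>N W. W \<in> wts N ==> pairing e W = qexp N (Op stack x) (qexp N (Op under w) W) nil" and W: "W \<in> wts2 N"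
 shows "pairing e (box_dual W) = pairing e (%A. pairing e (%B. W (A, B)))"
proof -
 let ?L = "qexp N (opl stack x)" and ?R = "qexp N (opr stack x)" and ?l = "qexp N (opl under w)" and ?r = "qexp N (opr under w)"
 note ol = opl_lowering[OF insertions(1) x(1)] opl_lowering[OF insertions(2) w(1)] opr_lowering[OF insertions(1) x(1)] opr_lowering[OF insertions(2) w(1)]
 have ex: "?L V \<in> wts2 N" "?l V \<in> wts2 N" "?R V \<in> wts2 N" "?r V \<in> wts2 N" if "V \<in> wts2 N" for V
  using ol[THEN b.expo_wts, OF that] by blast+
 have sec: "qexp N (Op K y) (%X. V (X, B)) = (%A. qexp N (opl K y) V (A, B))" "qexp N (Op K y) (%X. V (A, X)) = (%B. qexp N (opr K y) V (A, B))"
  for K y V A B unfolding q.expo_def[abs_def] b.expo_def[abs_def] opl_section by simp_all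
 have "pairing e (box_dual W) = qexp N (Op stack x) (qexp N (Op under w) (box_dual W)) nil" by (rule e(2)[OF box_dual_wts[OF W]])
 also have "qexp N (Op under w) (box_dual W) = box_dual (?l (?r W))" by (rule expo_box_dual[OF insertions(2) w W])
 also have "qexp N (Op stack x) (box_dual (?l (?r W))) = box_dual (?L (?R (?l (?r W))))"
  by (rule expo_box_dual[OF insertions(1) x ex(2)[OF ex(4)[OF W]]])
 also note box_dual_nil
 also have "?R (?l (?r W)) = ?l (?R (?r W))"
  by (rule b.expo_expo[OF ol(2) ol(3) ex(4)[OF W] opl_opr[OF insertions(2,1) w(1) x(1), symmetric]])
 also have "?L (?l (?R (?r W))) (nil, nil) = pairing e (%A. ?R (?r W) (A, nil))"
  unfolding e(2)[OF wts2D(4)[OF ex(3)[OF ex(4)[OF W]]]] sec ..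
 also have "... = pairing e (%A. pairing e (%B. W (A, B)))"
  unfolding e(2)[OF wts2D(5)[OF W]] sec ..
 finally show ?thesis .
qed

end

section \<open>The tensor square, group-like elements and the two identities\<close>

lemma bilin_Pair: "bilin Pair x y (A, B) = x A * y B"
 unfolding bilin_def lin_def by (subst Sum_any.expand_superset[of "{(A, B)}"]) (auto simp: delta_def split: if_splits)

context strands begin

abbreviation pairs where "pairs \<equiv> diagrams S \<times> diagrams S"

abbreviation deg2 where "deg2 \<equiv> %(A, B). deg A + deg B"

lemma aw_rels_series:
 assumes "x \<in> aw_rels S"
 shows "x \<in> dser"
proof (rule seriesI)
 have h: "finite {D. x D ~= 0}" "\<And>D. x D ~= 0 ==> D \<in> diagrams S"
  using homogeneous_aw_rels assms unfolding homogeneous_rels_def by blast+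
 show "D \<in> diagrams S" if "x D ~= 0" for D by (rule h(2)[OF that])
 show "finite (supp_upto deg N x)" for N by (rule finite_subset[OF _ h(1)]) (auto simp: supp_upto_def)
qed

lemma homogeneous_aw2_rels: "homogeneous_rels pairs deg2 (aw2_rels S)"
 unfolding homogeneous_rels_def
proof
 fix z assume "z \<in> aw2_rels S"
 then obtain x D where xD: "x \<in> aw_rels S" "D \<in> diagrams S" and z: "z = bilin Pair x (delta D) \<or> z = bilin Pair (delta D) x"
  unfolding aw2_rels_def by blast
 obtain n where h: "finite {A. x A ~= 0}" "\<And>A. x A ~= 0 ==> A \<in> diagrams S \<and> deg A = n"
  using homogeneous_aw_rels xD(1) unfolding homogeneous_rels_def by blast
 have s: "x A ~= 0 \<and> P = (A, D) \<or> x A ~= 0 \<and> P = (D, A)" if "z P ~= 0" "A = (if fst P = D \<and> x (snd P) ~= 0 \<and> z = bilin Pair (delta D) x then snd P else fst P)" for P A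
  using z that by (cases P) (auto simp: bilin_Pair delta_def split: if_splits)
 have "{P. z P ~= 0} \<subseteq> (%A. (A, D)) ` {A. x A ~= 0} \<union> Pair D ` {A. x A ~= 0}" using s by blast
 then have "finite {P. z P ~= 0}" by (rule finite_subset) (use h(1) in simp)
 moreover have "P \<in> pairs \<and> deg2 P = n + deg D" if "z P ~= 0" for P using s[OF that] h(2) xD(2) by fastforce
 ultimately show "finite {P. z P ~= 0} \<and> (\<exists>n. \<forall>P. z P ~= 0 --> P \<in> pairs \<and> deg2 P = n)" by blast
qed

text \<open>A relation paired with a single diagram is a relation of the tensor square, so fixing
  one argument of \<open>W\<close> leaves a functional that kills the relations in the
  other.\<close>

lemma kills_aw2:
 assumes W: "\<And>P. W P ~= 0 ==> P \<in> pairs \<and> deg2 P = n" and k: "kills (aw2_rels S) W"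
 shows "W \<in> wts2 (Suc n)"
proof -
 have b: "bounded_by pairs deg2 n W" using W by (auto simp: bounded_by_def)
 have "weight (%X. W (X, D)) \<and> weight (%X. W (D, X))" for D
 proof (cases "D \<in> diagrams S")
  case D: True
  have d: "delta D \<in> dser" by (rule series_delta[OF D])
  have "pairing x (%X. W (X, D)) = 0 \<and> pairing x (%X. W (D, X)) = 0" if x: "x \<in> aw_rels S" for x
  proof -
   note xs = aw_rels_series[OF x]
   have "bilin Pair x (delta D) \<in> aw2_rels S" "bilin Pair (delta D) x \<in> aw2_rels S" using x D unfolding aw2_rels_def by blast+
   then have "pairing (bilin Pair x (delta D)) W = 0" "pairing (bilin Pair (delta D) x) W = 0" using k by (simp_all add: kills_def)
   then show ?thesis
    using bilin_series_pairing(2)[where m = Pair and g = deg2, OF xs d _ b] bilin_series_pairing(2)[where m = Pair and g = deg2, OF d xs _ b] by simp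
  qed
  then show ?thesis using W by (auto simp: kills_def kills_iff_weight[symmetric])
 next
  case False
  then have "W (X, D) = 0 \<and> W (D, X) = 0" for X using W by blast
  then show ?thesis by (simp add: weight_zero)
 qed
 then show ?thesis using W unfolding wts2_def by (fastforce simp: less_Suc_eq_le)
qed

lemma box_series:
 assumes D: "D \<in> diagrams S"
 shows "box S D \<in> series pairs deg2" "box S D P ~= 0 ==> deg D \<le> deg2 P" "pairing (box S D) W = box_dual W D"
proof -
 obtain zs V where d: "D = mk zs V" "wf_word S zs V" using diagram_cases[OF D] .
 let ?I = "{E. E \<subseteq> edges S D \<and> component_closed D E}" and ?P = "%E. (restrict_diagram D E, restrict_diagram D (edges S D - E))"
 have I: "?I = cuts zs V" by (simp add: d(1) edges_mk[OF d(2)] cuts_def component_closed_def closed_for_def)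
 have fin: "finite ?I" unfolding I by simp
 have P: "?P E \<in> pairs \<and> deg2 (?P E) = deg D" if "E \<in> ?I" for E
 proof -
  have "word_in (word_names zs V - E) zs = word_in (- E) zs" "verts_in (word_names zs V - E) V = verts_in (- E) V"
   using in_cong[of zs V "word_names zs V - E" "- E"] by auto
  then have e: "?P E = (mk (word_in E zs) (verts_in E V), mk (word_in (- E) zs) (verts_in (- E) V))"
   by (simp add: d(1) edges_mk[OF d(2)] restrict_mk)
  have c: "closed_for V E" "closed_for V (- E)" using that unfolding I by (auto simp: cuts_def closed_for_def)
  note w = wf_in[OF d(2) c(1)] wf_in[OF d(2) c(2)]
  have "tail_count zs = tail_count (word_in E zs) + tail_count (word_in (- E) zs)" by (induction zs) auto
  then show ?thesis unfolding e using w by (simp add: d(1) mk_diagrams degree_wf[OF d(2)] degree_wf)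
 qed
 have del: "delta (?P E) \<in> series pairs deg2" if "E \<in> ?I" for E by (rule series_delta) (use P[OF that] in blast)
 show "box S D \<in> series pairs deg2" unfolding box_def by (rule series_sum[OF fin del])
 show "deg D \<le> deg2 P" if nz: "box S D P ~= 0"
 proof -
  obtain E where "E \<in> ?I" "delta (?P E) P ~= (0::rat)" using nz unfolding box_def by (rule sum.not_neutral_contains_not_neutral)
  then show ?thesis using P[of E] by (auto simp: delta_def split: if_splits)
 qed
 have u: "delta Q \<in> series UNIV (%_. 0::nat)" for Q :: "'a diagram \<times> 'a diagram" by (rule series_delta) simp
 have "pairing (box S D) W = (\<Sum>E\<in>?I. pairing (delta (?P E)) W)"
  unfolding box_def by (rule pairing_sum_left[OF fin u]) (simp add: bounded_by_def)
 then show "pairing (box S D) W = box_dual W D" using D by (simp add: box_dual_def)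
qed

text \<open>Equality in the tensor square is tested on functionals, where the co-product turns into
  its transpose \<open>box_dual\<close> and the tensor product into an iterated pairing.\<close>

lemma group_likeI:
 assumes Z: "Z \<in> AW S" and eq: "\<And>N W. W \<in> wts2 N ==> pairing (rep Z) (box_dual W) = pairing (rep Z) (%A. pairing (rep Z) (%B. W (A, B)))"
 shows "Z \<in> AW_exp S"
proof -
 note z = AW_rep(1)[OF Z]
 have l1: "lin (box S) (rep Z) \<in> series pairs deg2" by (rule lin_series_pairing(1)[OF z box_series(1,2)])
 have t1: "bilin Pair (rep Z) (rep Z) \<in> series pairs deg2" by (rule bilin_series_pairing(1)[where m = Pair, OF z z]) simp
 have "aw2_class S (lin (box S) (rep Z)) = aw2_class S (bilin Pair (rep Z) (rep Z))"
  unfolding aw2_class_def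
 proof (rule qclass_eqI, rule null_seriesI[OF homogeneous_aw2_rels series_diff[OF l1 t1]])
  fix n W assume W: "\<And>P. W P ~= 0 ==> P \<in> pairs \<and> deg2 P = n" and k: "kills (aw2_rels S) W"
  have b: "bounded_by pairs deg2 n W" using W by (auto simp: bounded_by_def)
  have "pairing (lin (box S) (rep Z)) W = pairing (rep Z) (box_dual W)"
   by (subst lin_series_pairing(2)[OF z box_series(1,2) b], assumption+) (rule pairing_cong_series[OF z], rule box_series(3))
  also have "... = pairing (bilin Pair (rep Z) (rep Z)) W"
   by (subst bilin_series_pairing(2)[where m = Pair and g = deg2, OF z z _ b]) (simp, rule eq[OF kills_aw2[OF W k]])
  finally show "pairing (%P. lin (box S) (rep Z) P - bilin Pair (rep Z) (rep Z) P) W = 0"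
   unfolding pairing_diff_left[OF l1 t1 b] by simp
 qed
 then show ?thesis using Z by (simp add: AW_exp_def aw_coproduct_def aw_tensor_def)
qed

lemma plant_connected: "connected_diagram (plant a p)"
 unfolding connected_diagram_def plant_mk
proof (intro exI conjI allI impI refl)
 fix E assume E: "closed_for (hverts (addr 1) p) E"
 have "word_names (hword [(a, addr 1 [])] @ tword (htails (addr 1) p)) (hverts (addr 1) p) = tree_names (addr 1) p"
  using tree_names_root[of "addr 1" p] by (auto simp: tree_names_def)
 then show "E \<inter> word_names (hword [(a, addr 1 [])] @ tword (htails (addr 1) p)) (hverts (addr 1) p) = {} \<or>
   word_names (hword [(a, addr 1 [])] @ tword (htails (addr 1) p)) (hverts (addr 1) p) \<subseteq> E"
  using tree_closed[OF E] by blast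
qed (rule refl)

lemma E_l_group_like:
 assumes lam: "l_map S lam = aw_class S (lser m)" and m: "tuple m" and w: "om \<in> CW S"
 shows "E_l S lam om \<in> AW_exp S"
proof (rule group_likeI[OF E_pairings(1)[OF lam m w]])
 note e = AW_rep(1)[OF E_pairings(1)[OF lam m w]]
 have c: "connected_diagram X" if "lser m X ~= 0" for X using lser_support[OF m that] plant_connected by metis
 show "pairing (rep (E_l S lam om)) (box_dual W) = pairing (rep (E_l S lam om)) (%A. pairing (rep (E_l S lam om)) (%B. W (A, B)))"
  if "W \<in> wts2 N" for N W
  by (rule group_like_pairing[OF lser_positive(1)[OF m] c wser(1)[OF w] wser(3)[OF w] e E_pairings(3)[OF lam m w] that])
qed

interpretation q: exponential "wts :: nat => ('a diagram => rat) set" "%n. 1 / fact n"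
 by (intro exponential.intro filtered_wts exponential_axioms.intro) simp

text \<open>The exponential of the wheels acts in the same way on both sides and is absorbed into
  the weight; the identity for trees is then applied to the new weight.\<close>

theorem E_l_eq_E_f_Gamma:
 assumes l: "lam \<in> FLS S" and w: "om \<in> CW S"
 shows "E_l S lam om = E_f S (Gamma_map S lam) om"
proof -
 obtain m where m: "tuple m" "Gamma_map S lam = cl m"
  "\<And>N W. W \<in> wts N ==> qexp N (Op under (lser (reps lam))) W nil = qexp N (Op wrap (lser m)) W nil"
  using Gamma_weights[OF l] by blast
 note r = FLS_cases(1)[OF l] and g = l_map_cl[OF m(1), folded m(2)]
 show ?thesis
 proof (rule AW_eqI[OF E_pairings(1)[OF l_map_lser r w] E_pairings(2)[OF g m(1) w]])
  fix N and W :: "'a diagram => rat" assume W: "W \<in> wts N"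
  have V: "qexp N (Op under (wser om)) W \<in> wts N" by (rule q.expo_wts[OF op_lowers[OF insertions(2) wser(1)[OF w]] W])
  show "pairing (rep (E_l S lam om)) W = pairing (rep (E_f S (Gamma_map S lam) om)) W"
   unfolding E_pairings(3)[OF l_map_lser r w W] E_pairings(4)[OF g m(1) w W] m(3)[OF V, symmetric]
   by (simp add: q.expo_def[of N "Op stack _"] q.expo_def[of N "Op under (lser _)"] stack_under_nil[OF lser_positive(1)[OF r] V])
 qed
qed

text \<open>Group-likeness of \<open>E_f\<close> is inherited from the \<open>E_l\<close> it equals,
  where trees and wheels appear as two separate exponentials for stacking.\<close>

theorem E_f_eq_E_l_Lambda:
 assumes l: "lam \<in> FLS S" and w: "om \<in> CW S"
 shows "E_f S lam om = E_l S (Lambda_map S lam) om" "E_f S lam om \<in> AW_exp S"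
proof -
 obtain m where m: "tuple m" "Lambda_map S lam = cl m"
  "\<And>N W. W \<in> wts N ==> qexp N (Op wrap (lser (reps lam))) W nil = qexp N (Op stack (lser m)) W nil"
  using Lambda_weights[OF l] by blast
 note r = FLS_cases(1)[OF l] and g = l_map_cl[OF m(1), folded m(2)]
 show "E_f S lam om = E_l S (Lambda_map S lam) om"
 proof (rule AW_eqI[OF E_pairings(2)[OF l_map_lser r w] E_pairings(1)[OF g m(1) w]])
  fix N and W :: "'a diagram => rat" assume W: "W \<in> wts N"
  have V: "qexp N (Op under (wser om)) W \<in> wts N" by (rule q.expo_wts[OF op_lowers[OF insertions(2) wser(1)[OF w]] W])
  show "pairing (rep (E_f S lam om)) W = pairing (rep (E_l S (Lambda_map S lam) om)) W"
   unfolding E_pairings(4)[OF l_map_lser r w W] E_pairings(3)[OF g m(1) w W] m(3)[OF V] ..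
 qed
 then show "E_f S lam om \<in> AW_exp S" using E_l_group_like[OF g m(1) w] by simp
qed

end

theorem theorem2p31:
  fixes S :: "'a set"
    and lam :: "('a, rat) fl_tuple"
    and \<omega> :: "'a list set \<Rightarrow> rat"
  assumes "finite S"
    and "lam \<in> FLS S"
    and "\<omega> \<in> CW S"
  shows "E_l S lam \<omega> \<in> AW_exp S \<and> E_f S lam \<omega> \<in> AW_exp S \<and>
    E_l S lam \<omega> = E_f S (Gamma_map S lam) \<omega> \<and>
    E_f S lam \<omega> = E_l S (Lambda_map S lam) \<omega>"
proof -
  interpret strands S by unfold_locales (rule assms(1))
  show ?thesis
    using E_l_group_like[OF l_map_lser FLS_cases(1)[OF assms(2)] assms(3)] E_l_eq_E_f_Gamma[OF assms(2,3)] E_f_eq_E_l_Lambda[OF assms(2,3)] by simp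
qed

end
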